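(* Let $N$ be a simply connected non-singular $2$-step nilpotent Lie group, let $\Gamma$ be a lattice of $N$, let $S\subset\Gamma$ be a finite symmetric generating set of $\Gamma$, and let $\rho_S$ be the associated word metric on $\Gamma$. Then there is $C>0$ such that $(\Gamma,\rho_S)$ is $(1,C)$-quasi isometric to its asymptotic cone.
   Context: Commutators: $[x,y]=x^{-1}y^{-1}xy$ for $x,y$ in a group, and $[N,N]$ is the commutator subgroup of $N$. Non-singular: a simply connected $2$-step nilpotent Lie group $N$ is called non-singular if for all $z\in[N,N]$ and all $x\in N\setminus[N,N]$ there is $y\in N$ such that $[x,y]=z$. Asymptotic cone: for a pointed proper metric space $(X,d,p)$, if the sequence $\{(X,\frac1n d,p)\}_{n\in\mathbb{N}}$ converges to a pointed metric space $(X_\infty,d_\infty,p_\infty)$ in the pointed Gromov-Hausdorff topology (i.e. for every $R>0$ the balls of radius $R$ around the base points converge in the Gromov-Hausdorff distance of compact metric spaces to the ball $B_{d_\infty}(p_\infty,R)$), then $(X_\infty,d_\infty,p_\infty)$ is called the asymptotic cone of $(X,d,p)$. For $(\Gamma,\rho_S,id)$ with $\Gamma$ a finitely generated torsion free nilpotent group, it is known (Pansu) that this limit exists and is unique up to isometry. $(1,C)$-quasi isometric: metric spaces $(X,d_X)$ and $(Y,d_Y)$ are $(1,C)$-quasi isometric if there is a map $f:X\to Y$ such that $|d_Y(f(x),f(x'))-d_X(x,x')|\le C$ for all $x,x'\in X$ and every point of $Y$ is within distance $C$ of $f(X)$. *)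

theory Defs
  imports "HOL-Analysis.Analysis" "HOL-Algebra.Generated_Groups" "HOL-Algebra.Left_Coset"
begin

section \<open>Lie groups\<close>

text \<open>\<open>Ck_on k f S\<close> is only meant for open \<open>S\<close>: \<open>f\<close> is of class \<open>C\<^sup>k\<close> there.\<close>

primrec Ck_on ::
  "nat \<Rightarrow> ('x::real_normed_vector \<Rightarrow> 'y::real_normed_vector) \<Rightarrow> 'x set \<Rightarrow> bool" where
  "Ck_on 0 f S \<longleftrightarrow> continuous_on S f"
| "Ck_on (Suc k) f S \<longleftrightarrow> (\<forall>x\<in>S. f differentiable (at x)) \<and>
     (\<forall>v. Ck_on k (\<lambda>x. frechet_derivative f (at x) v) S)"

definition smooth_on ::
  "('x::real_normed_vector \<Rightarrow> 'y::real_normed_vector) \<Rightarrow> 'x set \<Rightarrow> bool" where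
  "smooth_on f S \<longleftrightarrow> (\<forall>k. Ck_on k f S)"

definition is_chart :: "'a::topological_space set \<Rightarrow> ('a \<Rightarrow> 'e::euclidean_space) \<Rightarrow> bool" where
  "is_chart U \<phi> \<longleftrightarrow> open U \<and> open (\<phi> ` U) \<and> homeomorphism U (\<phi> ` U) \<phi> (inv_into U \<phi>)"

text \<open>
  The underlying manifold is a whole Hausdorff second countable type, modelled on the Euclidean
  space \<open>'e\<close>. The atlas need not be maximal: it determines the smooth structure it generates, and
  smoothness of the group operations may be tested in any atlas.
\<close>

locale lie_group = group G
  for G :: "('a::{t2_space,second_countable_topology}, 'm) monoid_scheme" (structure) +
  fixes atlas :: "('a set \<times> ('a \<Rightarrow> 'e::euclidean_space)) set"
  assumes carrier_UNIV: "carrier G = UNIV"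
    and charts: "\<And>U \<phi>. (U, \<phi>) \<in> atlas \<Longrightarrow> is_chart U \<phi>"
    and charts_cover: "(\<Union>(U, \<phi>)\<in>atlas. U) = UNIV"
    and transition_smooth: "\<And>U \<phi> V \<psi>. (U, \<phi>) \<in> atlas \<Longrightarrow> (V, \<psi>) \<in> atlas \<Longrightarrow>
          smooth_on (\<lambda>a. \<psi> (inv_into U \<phi> a)) (\<phi> ` (U \<inter> V))"
    and mult_continuous: "continuous_on UNIV (\<lambda>(x, y). x \<otimes> y)"
    and mult_smooth: "\<And>U \<phi> V \<psi> W \<theta>.
          (U, \<phi>) \<in> atlas \<Longrightarrow> (V, \<psi>) \<in> atlas \<Longrightarrow> (W, \<theta>) \<in> atlas \<Longrightarrow>
          smooth_on (\<lambda>(a, b). \<theta> (inv_into U \<phi> a \<otimes> inv_into V \<psi> b))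
            {(a, b). a \<in> \<phi> ` U \<and> b \<in> \<psi> ` V \<and> inv_into U \<phi> a \<otimes> inv_into V \<psi> b \<in> W}"
    and inv_continuous: "continuous_on UNIV (\<lambda>x. inv x)"
    and inv_smooth: "\<And>U \<phi> V \<psi>. (U, \<phi>) \<in> atlas \<Longrightarrow> (V, \<psi>) \<in> atlas \<Longrightarrow>
          smooth_on (\<lambda>a. \<psi> (inv (inv_into U \<phi> a))) {a \<in> \<phi> ` U. inv (inv_into U \<phi> a) \<in> V}"


section \<open>Non-singular 2-step nilpotent groups\<close>

definition comm :: "('a, 'm) monoid_scheme \<Rightarrow> 'a \<Rightarrow> 'a \<Rightarrow> 'a" where
  "comm G x y = inv\<^bsub>G\<^esub> x \<otimes>\<^bsub>G\<^esub> inv\<^bsub>G\<^esub> y \<otimes>\<^bsub>G\<^esub> x \<otimes>\<^bsub>G\<^esub> y"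

text \<open>
  The library's \<^const>\<open>derived\<close> is built from the elements \<open>x y x\<^sup>-\<^sup>1 y\<^sup>-\<^sup>1\<close>;
  replacing \<open>x\<close>, \<open>y\<close> by their inverses shows that it is the subgroup generated by the
  \<open>comm G x y\<close>.
\<close>

abbreviation commutator_subgroup :: "('a, 'm) monoid_scheme \<Rightarrow> 'a set" where
  "commutator_subgroup G \<equiv> derived G (carrier G)"

text \<open>Nilpotency class exactly 2: \<open>[G,G] \<noteq> 1\<close> and \<open>[G,[G,G]] = 1\<close>.\<close>

definition two_step_nilpotent :: "('a, 'm) monoid_scheme \<Rightarrow> bool" where
  "two_step_nilpotent G \<longleftrightarrow> commutator_subgroup G \<noteq> {\<one>\<^bsub>G\<^esub>} \<and>
     (\<forall>x\<in>carrier G. \<forall>z\<in>commutator_subgroup G. comm G x z = \<one>\<^bsub>G\<^esub>)"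

definition non_singular :: "('a, 'm) monoid_scheme \<Rightarrow> bool" where
  "non_singular G \<longleftrightarrow>
     (\<forall>z\<in>commutator_subgroup G. \<forall>x\<in>carrier G - commutator_subgroup G.
        \<exists>y\<in>carrier G. comm G x y = z)"


section \<open>Lattices\<close>

text \<open>
  Borel sets of the coset space \<open>G/\<Gamma>\<close>: a set of cosets is open in the quotient topology iff its
  preimage in \<open>G\<close>, i.e. its union, is open.
\<close>

definition coset_borel :: "('a::topological_space, 'm) monoid_scheme \<Rightarrow> 'a set \<Rightarrow> 'a set measure" where
  "coset_borel G \<Gamma> = sigma (lcosets\<^bsub>G\<^esub> \<Gamma>) {\<U>. \<U> \<subseteq> lcosets\<^bsub>G\<^esub> \<Gamma> \<and> open (\<Union>\<U>)}"

text \<open>Discrete subgroups \<open>\<Gamma>\<close> for which \<open>G/\<Gamma>\<close> carries a non-zero finite \<open>G\<close>-invariant Borel measure.\<close>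

definition lattice_subgroup :: "('a::topological_space, 'm) monoid_scheme \<Rightarrow> 'a set \<Rightarrow> bool" where
  "lattice_subgroup G \<Gamma> \<longleftrightarrow> subgroup \<Gamma> G \<and> discrete \<Gamma> \<and>
     (\<exists>\<mu>. sets \<mu> = sets (coset_borel G \<Gamma>) \<and> finite_measure \<mu> \<and> emeasure \<mu> (space \<mu>) \<noteq> 0 \<and>
        (\<forall>g\<in>carrier G. \<forall>E\<in>sets \<mu>. emeasure \<mu> ((\<lambda>c. g <#\<^bsub>G\<^esub> c) ` E) = emeasure \<mu> E))"


section \<open>Word metrics\<close>

text \<open>For symmetric \<open>S\<close>, words in \<open>S\<close> need no formal inverses. The metric is the left-invariant one.\<close>

definition word_length :: "('a, 'm) monoid_scheme \<Rightarrow> 'a set \<Rightarrow> 'a \<Rightarrow> nat" where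
  "word_length G S g =
     (LEAST n. \<exists>w. length w = n \<and> set w \<subseteq> S \<and> foldr (\<lambda>s h. s \<otimes>\<^bsub>G\<^esub> h) w \<one>\<^bsub>G\<^esub> = g)"

definition word_metric :: "('a, 'm) monoid_scheme \<Rightarrow> 'a set \<Rightarrow> 'a \<Rightarrow> 'a \<Rightarrow> real" where
  "word_metric G S x y = real (word_length G S (inv\<^bsub>G\<^esub> x \<otimes>\<^bsub>G\<^esub> y))"


section \<open>Gromov-Hausdorff convergence and asymptotic cones\<close>

definition hausdorff_distance :: "('z \<Rightarrow> 'z \<Rightarrow> real) \<Rightarrow> 'z set \<Rightarrow> 'z set \<Rightarrow> real" where
  "hausdorff_distance d A B =
     Inf {r. 0 \<le> r \<and> (\<forall>a\<in>A. \<exists>b\<in>B. d a b \<le> r) \<and> (\<forall>b\<in>B. \<exists>a\<in>A. d a b \<le> r)}"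

definition isometric_embedding ::
  "'x set \<Rightarrow> ('x \<Rightarrow> 'x \<Rightarrow> real) \<Rightarrow> 'z set \<Rightarrow> ('z \<Rightarrow> 'z \<Rightarrow> real) \<Rightarrow> ('x \<Rightarrow> 'z) \<Rightarrow> bool" where
  "isometric_embedding X dX Z dZ f \<longleftrightarrow>
     f ` X \<subseteq> Z \<and> (\<forall>x\<in>X. \<forall>x'\<in>X. dZ (f x) (f x') = dX x x')"

text \<open>
  Infimum of the Hausdorff distances over all isometric embeddings into a common metric space \<open>Z\<close>.
  Only the two images in \<open>Z\<close> matter, and their union injects into \<open>'x + 'y\<close>; hence nothing is lost
  by letting \<open>Z\<close> range over the metric spaces with points in that type.
\<close>

definition GH_distance ::
  "'x set \<Rightarrow> ('x \<Rightarrow> 'x \<Rightarrow> real) \<Rightarrow> 'y set \<Rightarrow> ('y \<Rightarrow> 'y \<Rightarrow> real) \<Rightarrow> real" where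
  "GH_distance X dX Y dY =
     Inf {hausdorff_distance dZ (f ` X) (g ` Y) |(Z :: ('x + 'y) set) dZ f g.
            Metric_space Z dZ \<and> isometric_embedding X dX Z dZ f \<and> isometric_embedding Y dY Z dZ g}"

definition proper_metric :: "'x set \<Rightarrow> ('x \<Rightarrow> 'x \<Rightarrow> real) \<Rightarrow> bool" where
  "proper_metric X d \<longleftrightarrow> Metric_space X d \<and>
     (\<forall>x\<in>X. \<forall>R. compactin (Metric_space.mtopology X d) (Metric_space.mcball X d x R))"

text \<open>
  Balls are closed, so that they are compact in a proper space. The term \<open>n = 0\<close> of the sequence
  of rescaled metrics is junk and irrelevant for the limit.
\<close>

definition pointed_GH_limit ::
  "(nat \<Rightarrow> 'x set) \<Rightarrow> (nat \<Rightarrow> 'x \<Rightarrow> 'x \<Rightarrow> real) \<Rightarrow> (nat \<Rightarrow> 'x) \<Rightarrow>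
   'y set \<Rightarrow> ('y \<Rightarrow> 'y \<Rightarrow> real) \<Rightarrow> 'y \<Rightarrow> bool" where
  "pointed_GH_limit X dX p Y dY q \<longleftrightarrow>
     (\<forall>R>0. (\<lambda>n. GH_distance (Metric_space.mcball (X n) (dX n) (p n) R) (dX n)
                             (Metric_space.mcball Y dY q R) dY) \<longlonglongrightarrow> 0)"

definition asymptotic_cone ::
  "'x set \<Rightarrow> ('x \<Rightarrow> 'x \<Rightarrow> real) \<Rightarrow> 'x \<Rightarrow> 'y set \<Rightarrow> ('y \<Rightarrow> 'y \<Rightarrow> real) \<Rightarrow> 'y \<Rightarrow> bool" where
  "asymptotic_cone X d p Y dY q \<longleftrightarrow>
     proper_metric X d \<and> p \<in> X \<and> proper_metric Y dY \<and> q \<in> Y \<and>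
     pointed_GH_limit (\<lambda>n. X) (\<lambda>n x x'. 1 / real n * d x x') (\<lambda>n. p) Y dY q"

definition one_quasi_isometric ::
  "real \<Rightarrow> 'x set \<Rightarrow> ('x \<Rightarrow> 'x \<Rightarrow> real) \<Rightarrow> 'y set \<Rightarrow> ('y \<Rightarrow> 'y \<Rightarrow> real) \<Rightarrow> bool" where
  "one_quasi_isometric C X dX Y dY \<longleftrightarrow>
     (\<exists>f. f ` X \<subseteq> Y \<and> (\<forall>x\<in>X. \<forall>x'\<in>X. \<bar>dY (f x) (f x') - dX x x'\<bar> \<le> C) \<and>
          (\<forall>y\<in>Y. \<exists>x\<in>X. dY y (f x) \<le> C))"

end

theory Submission imports Defs "HOL-Library.Diagonal_Subsequence"
begin

text \<open>
  The derivative at \<open>1\<close> of \<open>x \<mapsto> [x, g]\<close> defines a homomorphism \<open>\<Phi>\<close> of \<open>N\<close> into a vector space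
  with kernel \<open>[N, N]\<close>, which is the centre because \<open>N\<close> is non-singular. A map \<open>\<kappa>\<close> linearises the
  centre modulo a compact part, the commutator becomes a bilinear form \<open>B\<close>, and \<open>\<kappa>\<close> extends from
  \<open>\<Gamma> \<inter> [N, N]\<close> to \<open>\<zeta>\<close> on \<open>\<Gamma>\<close> with \<open>\<zeta>(gh) = \<zeta>(g) + \<zeta>(h) + B(\<Phi> g, \<Phi> h) / 2\<close>. Thus \<open>(\<Phi>, \<zeta>)\<close> are
  coordinates on \<open>\<Gamma>\<close> up to bounded error. No classification of Lie groups is involved: the
  finite invariant measure on \<open>N / \<Gamma>\<close> only serves to show that a continuous homomorphism to the
  reals that vanishes on \<open>\<Gamma>\<close> is zero, so that non-singularity passes to the generators \<open>S\<close>.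

  The key estimate is \<open>\<bar>\<ell>(g') - n \<ell>(g)\<bar> \<le> c n\<close> for the word length \<open>\<ell>\<close> whenever \<open>g'\<close> is close to
  the image of \<open>g\<close> under the dilation by \<open>n\<close>. One replaces each letter \<open>s\<close> of a geodesic word by
  \<open>s\<^sup>n\<close>, respectively keeps every \<open>n\<close>-th occurrence of each letter. This reaches the right
  \<open>\<Phi>\<close>-coordinate, and an error in \<open>\<zeta>\<close> that is of order \<open>n\<close> times the length is corrected at
  cost \<open>O(n)\<close>: by non-singularity, conjugating suitable elements along a word that travels far
  moves \<open>\<zeta>\<close> in every direction. Hence \<open>\<ell>(g\<^sub>n\<^sup>-\<^sup>1 h\<^sub>n) / n\<close> is Cauchy with error \<open>O(1/n)\<close> for
  dilated points \<open>g\<^sub>n, h\<^sub>n\<close>; its limit is the metric of the cone, and \<open>n = 1\<close> gives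
  the \<open>(1, C)\<close>-quasi isometry. Any other asymptotic cone is isometric to this one by compactness.
\<close>

text \<open>The obstacle is that the additive error has to stay bounded, not merely sublinear. A
  dilated word of length K carries an error of order n K in \<open>\<zeta>\<close>. Correcting it by
  central elements alone costs about sqrt(n K), which exceeds every multiple of n for large K. The
  way out is a dichotomy. If the path of the word goes a distance comparable to K from the origin, a
  generator commuted with a long prefix moves \<open>\<zeta>\<close> by an amount of order K, in
  every direction by non-singularity, so O(n) such moves suffice. If the path stays near the origin,
  the word is so wasteful that the general upper bound for word lengths already wins. The second
  obstacle is integrality: plain rounding of the exponents would leave an error of order K. Rounding
  is therefore done along curves: a fractional multiple of a vector is replaced by a point of a
  curve that the group can follow, and Brouwer's theorem solves the resulting nonlinear equation.
  The same principle shows that the image of \<open>\<Phi>\<close> is a linear space.\<close>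

section \<open>Lattice curves in Euclidean space\<close>

text \<open>If \<open>f\<close> had no zero, the map \<open>h\<close> that normalises
  \<open>- f\<close> to length \<open>r\<close> would have a fixed point on the sphere, and there
  \<open>f\<close> would point strictly inwards.\<close>

lemma brouwer_zero:
  fixes f :: "'z::euclidean_space \<Rightarrow> 'z"
  assumes Z: "subspace Z" and r: "0 < r"
    and f: "continuous_on (Z \<inter> cball 0 r) f" "\<And>u. u \<in> Z \<Longrightarrow> norm u \<le> r \<Longrightarrow> f u \<in> Z"
    and sphere: "\<And>u. u \<in> Z \<Longrightarrow> norm u = r \<Longrightarrow> 0 \<le> f u \<bullet> u"
  shows "\<exists>u\<in>Z. norm u \<le> r \<and> f u = 0"
proof (rule ccontr)
  assume "\<not> ?thesis"
  then have nz: "\<And>u. u \<in> Z \<Longrightarrow> norm u \<le> r \<Longrightarrow> f u \<noteq> 0" by blast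
  let ?K = "Z \<inter> cball 0 r"
  define h where "h = (\<lambda>u. - (r / norm (f u)) *\<^sub>R f u)"
  have "compact ?K" using Z by (simp add: closed_Int_compact closed_subspace)
  moreover have "convex ?K" using Z by (simp add: convex_Int subspace_imp_convex)
  moreover have "?K \<noteq> {}" using Z r subspace_0 by fastforce
  moreover have "continuous_on ?K h" unfolding h_def
    by (intro continuous_intros f) (auto simp: nz)
  moreover have "h \<in> ?K \<rightarrow> ?K"
    using Z r nz f(2) by (auto simp: h_def subspace_scale subspace_neg)
  ultimately obtain u where u: "u \<in> ?K" "h u = u" by (rule brouwer)
  have fu: "f u \<noteq> 0" using nz u by auto
  have "norm (h u) = r" using fu r by (simp add: h_def)
  then have nu: "norm u = r" using u by simp
  have "f u \<bullet> u = f u \<bullet> h u" using u by simp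
  also have "\<dots> = - (r * norm (f u))"
    using fu by (simp add: h_def power2_norm_eq_inner[symmetric] power2_eq_square)
  finally have "f u \<bullet> u = - (r * norm (f u))" .
  moreover have "0 < r * norm (f u)" using r fu by simp
  ultimately show False using sphere[of u] u nu by auto
qed

text \<open>Rounding along curves: the segment from 0 to \<open>b i\<close> is replaced by a curve
  with the same ends, and fractional parts are taken on the curve. The periodic extension of its
  deviation from the segment is a bounded continuous perturbation of the coercive map that sends
  \<open>u\<close> to the sum of all \<open>(b i \<bullet> u) *\<^sub>R b i\<close>, so the equation
  has a solution in a ball, whose radius bounds the integers.\<close>

lemma lattice_curves_surj:
  fixes b :: "'i \<Rightarrow> 'z::euclidean_space" and \<gamma> :: "'i \<Rightarrow> real \<Rightarrow> 'z" and E :: real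
  assumes I: "finite I" and Z: "subspace Z" and b: "\<And>i. i \<in> I \<Longrightarrow> b i \<in> Z"
    and cont: "\<And>i. i \<in> I \<Longrightarrow> continuous_on {0..1} (\<gamma> i)"
    and inZ: "\<And>i t. i \<in> I \<Longrightarrow> t \<in> {0..1} \<Longrightarrow> \<gamma> i t \<in> Z"
    and ends: "\<And>i. i \<in> I \<Longrightarrow> \<gamma> i 0 = 0" "\<And>i. i \<in> I \<Longrightarrow> \<gamma> i 1 = b i"
    and close: "\<And>i t. i \<in> I \<Longrightarrow> t \<in> {0..1} \<Longrightarrow> norm (\<gamma> i t - t *\<^sub>R b i) \<le> E"
    and E: "0 \<le> E" and lam: "0 < \<mu>"
    and coercive: "\<And>u. u \<in> Z \<Longrightarrow> \<mu> * (norm u)\<^sup>2 \<le> (\<Sum>i\<in>I. (b i \<bullet> u)\<^sup>2)"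
    and z: "z \<in> Z"
  shows "\<exists>n :: 'i \<Rightarrow> int. \<exists>t. (\<Sum>i\<in>I. of_int (n i) *\<^sub>R b i + \<gamma> i (t i)) = z \<and>
    (\<forall>i\<in>I. t i \<in> {0..1} \<and> \<bar>of_int (n i)\<bar> \<le> norm (b i) * ((norm z + real (card I) * E) / \<mu>) + 1)"
proof -
  \<comment> \<open>On the sphere of this radius the coercive term \<open>\<mu> * r\<^sup>2\<close>
    equals the most that \<open>z\<close> and the \<open>card I\<close> perturbations of size
    \<open>E\<close> can contribute.\<close>
  define r where "r = (norm z + real (card I) * E) / \<mu>"
  have r0: "0 \<le> r" using E lam by (simp add: r_def)
  show ?thesis
  proof (cases "r = 0")
    case True
    then have "norm z + real (card I) * E = 0" using lam by (simp add: r_def)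
    then have "z = 0" using E by (smt (verit) mult_nonneg_nonneg norm_eq_zero norm_ge_zero of_nat_0_le_iff)
    then show ?thesis
      using ends r0 unfolding r_def[symmetric]
      by (intro exI[of _ "\<lambda>_. 0"]) auto
  next
    case False
    with r0 have r: "0 < r" by simp
    \<comment> \<open>Deviation of the curve from its chord. The clamping makes it vanish outside
      the unit interval, so that integer translates can be added up.\<close>
    define e where "e i x = \<gamma> i (max 0 (min 1 x)) - max 0 (min 1 x) *\<^sub>R b i" for i x
    have e0: "e i x = 0" if "i \<in> I" "x \<le> 0 \<or> 1 \<le> x" for i x
      using that ends by (auto simp: e_def)
    have eE: "norm (e i x) \<le> E" if "i \<in> I" for i x
      using close[of i "max 0 (min 1 x)"] that by (auto simp: e_def)
    have eZ: "e i x \<in> Z" if "i \<in> I" for i x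
      using that Z b inZ[of i "max 0 (min 1 x)"] by (auto simp: e_def intro!: subspace_diff subspace_scale)
    have econt: "continuous_on UNIV (e i)" if "i \<in> I" for i
    proof -
      have "continuous_on UNIV (\<lambda>x. \<gamma> i (max 0 (min 1 x)))"
        by (rule continuous_on_compose2[OF cont[OF that]]) (auto intro!: continuous_intros)
      then show ?thesis unfolding e_def by (intro continuous_intros) auto
    qed
    define M where "M = (\<Sum>i\<in>I. \<lceil>norm (b i) * r\<rceil>) + 1"
    have M: "norm (b i) * r \<le> of_int (M - 1)" if "i \<in> I" for i
    proof -
      have "\<lceil>norm (b i) * r\<rceil> \<le> (\<Sum>i\<in>I. \<lceil>norm (b i) * r\<rceil>)"
        using that I r by (intro member_le_sum) (auto simp: le_ceiling_iff intro: less_le_trans[of _ 0])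
      then show ?thesis unfolding M_def by linarith
    qed
    \<comment> \<open>On \<open>\<bar>x\<bar> \<le> M\<close> this finite sum is the \<open>1\<close>-periodic extension of \<open>e i\<close>.\<close>
    define p where "p i x = (\<Sum>j\<in>{-M..M}. e i (x - of_int j))" for i x
    have p: "p i x = e i (frac x)" if "i \<in> I" "\<bar>x\<bar> \<le> norm (b i) * r" for i x
    proof -
      have "\<bar>x\<bar> \<le> of_int (M - 1)" using M that by fastforce
      then have "\<lfloor>x\<rfloor> \<in> {-M..M}" by (simp add: floor_le_iff le_floor_iff abs_le_iff)
      moreover have "e i (x - of_int j) = 0" if "j \<noteq> \<lfloor>x\<rfloor>" for j
      proof (rule e0[OF \<open>i \<in> I\<close>])
        show "x - of_int j \<le> 0 \<or> 1 \<le> x - of_int j"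
          using that by (smt (verit) floor_unique of_int_1_le_iff)
      qed
      ultimately have "p i x = e i (x - of_int \<lfloor>x\<rfloor>)"
        unfolding p_def by (subst sum.remove[of _ "\<lfloor>x\<rfloor>"]) auto
      then show ?thesis by (simp add: frac_def)
    qed
    define f where "f u = (\<Sum>i\<in>I. (b i \<bullet> u) *\<^sub>R b i + p i (b i \<bullet> u)) - z" for u
    have bu: "\<bar>b i \<bullet> u\<bar> \<le> norm (b i) * r" if "norm u \<le> r" for i u
      using that by (meson Cauchy_Schwarz_ineq2 mult_left_mono norm_ge_zero order_trans)
    have "\<exists>u\<in>Z. norm u \<le> r \<and> f u = 0"
    proof (rule brouwer_zero[OF Z r])
      show "continuous_on (Z \<inter> cball 0 r) f"
        unfolding f_def p_def
        by (intro continuous_intros continuous_on_compose2[OF econt]) auto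
      show "f u \<in> Z" if "u \<in> Z" "norm u \<le> r" for u
        using Z b z eZ unfolding f_def p_def
        by (intro subspace_diff subspace_sum subspace_add subspace_scale) auto
    next
      fix u assume u: "u \<in> Z" "norm u = r"
      have pe: "- (E * r) \<le> p i (b i \<bullet> u) \<bullet> u" if "i \<in> I" for i
      proof -
        have "norm (p i (b i \<bullet> u)) \<le> E" using p[OF that bu] eE[OF that] u by simp
        then have "\<bar>p i (b i \<bullet> u) \<bullet> u\<bar> \<le> E * r"
          using Cauchy_Schwarz_ineq2[of "p i (b i \<bullet> u)" u] u
          by (smt (verit) mult_right_mono norm_ge_zero)
        then show ?thesis by linarith
      qed
      have "f u \<bullet> u = (\<Sum>i\<in>I. (b i \<bullet> u)\<^sup>2) + (\<Sum>i\<in>I. p i (b i \<bullet> u) \<bullet> u) - z \<bullet> u"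
        by (simp add: f_def inner_diff_left inner_sum_left inner_add_left power2_eq_square sum.distrib)
      moreover have "(\<Sum>i\<in>I. - (E * r)) \<le> (\<Sum>i\<in>I. p i (b i \<bullet> u) \<bullet> u)"
        by (intro sum_mono pe)
      moreover have "z \<bullet> u \<le> norm z * r" using norm_cauchy_schwarz u by metis
      moreover have "\<mu> * r\<^sup>2 = (norm z + real (card I) * E) * r"
        using lam by (simp add: r_def power2_eq_square)
      ultimately show "0 \<le> f u \<bullet> u" using coercive[of u] u by (simp add: algebra_simps)
    qed
    then obtain u where u: "u \<in> Z" "norm u \<le> r" "f u = 0" by blast
    \<comment> \<open>At the zero, the integer part of \<open>b i \<bullet> u\<close> is the
      multiplicity of \<open>b i\<close> and the fractional part is the parameter on the
      curve.\<close>
    have "(\<Sum>i\<in>I. of_int \<lfloor>b i \<bullet> u\<rfloor> *\<^sub>R b i + \<gamma> i (frac (b i \<bullet> u))) = (\<Sum>i\<in>I. (b i \<bullet> u) *\<^sub>R b i + p i (b i \<bullet> u))"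
    proof (intro sum.cong refl)
      fix i assume i: "i \<in> I"
      have "max 0 (min 1 (frac (b i \<bullet> u))) = frac (b i \<bullet> u)"
        by (simp add: frac_lt_1 less_imp_le)
      then show "of_int \<lfloor>b i \<bullet> u\<rfloor> *\<^sub>R b i + \<gamma> i (frac (b i \<bullet> u)) = (b i \<bullet> u) *\<^sub>R b i + p i (b i \<bullet> u)"
        using p[OF i bu[OF u(2)]] by (simp add: e_def frac_def algebra_simps)
    qed
    also have "\<dots> = z" using u by (simp add: f_def)
    finally have "(\<Sum>i\<in>I. of_int \<lfloor>b i \<bullet> u\<rfloor> *\<^sub>R b i + \<gamma> i (frac (b i \<bullet> u))) = z" .
    moreover have "frac (b i \<bullet> u) \<in> {0..1} \<and> \<bar>of_int \<lfloor>b i \<bullet> u\<rfloor>\<bar> \<le> norm (b i) * r + 1" for i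
      using bu[OF u(2), of i] by (auto simp: frac_lt_1 less_imp_le) linarith
    ultimately show ?thesis unfolding r_def[symmetric]
      by (intro exI[of _ "\<lambda>i. \<lfloor>b i \<bullet> u\<rfloor>"] exI[of _ "\<lambda>i. frac (b i \<bullet> u)"]) auto
  qed
qed

text \<open>The quadratic form is continuous and positive on the compact unit sphere of
  \<open>Z\<close>, so it has a positive minimum there, and homogeneity does the rest. An empty
  sphere means that \<open>Z\<close> is trivial.\<close>

lemma coercive_family:
  fixes b :: "'i \<Rightarrow> 'z::euclidean_space"
  assumes I: "finite I" and Z: "subspace Z"
    and nd: "\<And>u. u \<in> Z \<Longrightarrow> u \<noteq> 0 \<Longrightarrow> \<exists>i\<in>I. b i \<bullet> u \<noteq> 0"
  shows "\<exists>\<mu>>0. \<forall>u\<in>Z. \<mu> * (norm u)\<^sup>2 \<le> (\<Sum>i\<in>I. (b i \<bullet> u)\<^sup>2)"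
proof -
  let ?K = "Z \<inter> sphere 0 1" and ?q = "\<lambda>u. \<Sum>i\<in>I. (b i \<bullet> u)\<^sup>2"
  have K: "compact ?K" using Z by (simp add: closed_Int_compact closed_subspace)
  show ?thesis
  proof (cases "?K = {}")
    case True
    have z0: "u = 0" if "u \<in> Z" for u
    proof (rule ccontr)
      assume "u \<noteq> 0"
      then have "(1 / norm u) *\<^sub>R u \<in> ?K" using that Z by (simp add: subspace_scale)
      then show False using True by blast
    qed
    have "1 * (norm u)\<^sup>2 \<le> ?q u" if "u \<in> Z" for u
      by (simp add: z0[OF that] sum_nonneg)
    then show ?thesis by (intro exI[of _ 1]) simp
  next
    case False
    have "continuous_on ?K ?q" by (intro continuous_intros)
    then obtain w where w: "w \<in> ?K" "\<And>u. u \<in> ?K \<Longrightarrow> ?q w \<le> ?q u"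
      using continuous_attains_inf[OF K False] by blast
    have "w \<noteq> 0" using w(1) by auto
    then obtain i where "i \<in> I" "b i \<bullet> w \<noteq> 0" using nd w(1) by blast
    then have pos: "0 < ?q w" using I by (intro sum_pos2[of _ i]) auto
    have "?q w * (norm u)\<^sup>2 \<le> ?q u" if "u \<in> Z" for u
    proof (cases "u = 0")
      case False
      have "?q w \<le> ?q ((1 / norm u) *\<^sub>R u)"
        using that Z False by (intro w) (simp add: subspace_scale)
      also have "\<dots> = ?q u / (norm u)\<^sup>2"
        by (simp add: power_divide sum_divide_distrib)
      finally show ?thesis using False by (simp add: field_simps)
    qed auto
    then show ?thesis using pos by blast
  qed
qed

section \<open>Word length\<close>

locale gen_group = group G for G (structure) +
  fixes S
  assumes finS: "finite S" and S_carrier: "S \<subseteq> carrier G"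
    and S_inv: "\<And>s. s \<in> S \<Longrightarrow> inv s \<in> S" and gen: "generate G S = carrier G"
begin

definition ev :: "'a list \<Rightarrow> 'a" where "ev w = foldr (\<lambda>s h. s \<otimes> h) w \<one>"

abbreviation wl :: "'a \<Rightarrow> nat" where "wl \<equiv> word_length G S"

lemma ev_Nil [simp]: "ev [] = \<one>" and ev_Cons [simp]: "ev (s # w) = s \<otimes> ev w"
  by (simp_all add: ev_def)

lemma S_closed: "s \<in> S \<Longrightarrow> s \<in> carrier G" using S_carrier by blast

lemma ev_closed [simp]: "set w \<subseteq> S \<Longrightarrow> ev w \<in> carrier G"
  by (induction w) (auto simp: S_closed)

lemma ev_append: "set v \<subseteq> S \<Longrightarrow> set w \<subseteq> S \<Longrightarrow> ev (v @ w) = ev v \<otimes> ev w"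
  by (induction v) (auto simp: S_closed m_assoc)

lemma ev_rev: "set w \<subseteq> S \<Longrightarrow> inv (ev w) = ev (rev (map (\<lambda>s. inv s) w))"
proof (induction w)
  case (Cons s w)
  have "set (rev (map (\<lambda>s. inv s) w)) \<subseteq> S" using Cons.prems S_inv by auto
  then show ?case using Cons by (simp add: inv_mult_group S_closed S_inv ev_append)
qed simp

lemma ev_surj: "g \<in> carrier G \<Longrightarrow> \<exists>w. set w \<subseteq> S \<and> ev w = g"
proof -
  assume "g \<in> carrier G"
  then have "g \<in> generate G S" by (simp add: gen)
  then show ?thesis
  proof induction
    case one then show ?case by (intro exI[of _ "[]"]) simp
  next
    case (incl h) then show ?case by (intro exI[of _ "[h]"]) (simp add: S_closed)
  next
    case (inv h) then show ?case by (intro exI[of _ "[inv h]"]) (simp add: S_closed S_inv)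
  next
    case (eng h1 h2)
    then obtain v w where "set v \<subseteq> S" "ev v = h1" "set w \<subseteq> S" "ev w = h2" by blast
    then show ?case by (intro exI[of _ "v @ w"]) (simp add: ev_append)
  qed
qed

lemma wl_word: "g \<in> carrier G \<Longrightarrow> \<exists>w. length w = wl g \<and> set w \<subseteq> S \<and> ev w = g"
  using ev_surj[of g] unfolding word_length_def ev_def
  by (intro LeastI_ex[where P = "\<lambda>n. \<exists>w. length w = n \<and> set w \<subseteq> S \<and> foldr (\<lambda>s h. s \<otimes> h) w \<one> = g"]) auto

lemma wl_ev: "set w \<subseteq> S \<Longrightarrow> wl (ev w) \<le> length w"
  unfolding word_length_def ev_def by (rule Least_le) auto

lemma wl_one [simp]: "wl \<one> = 0"
  using wl_ev[of "[]"] by simp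

lemma wl_eq_0: "g \<in> carrier G \<Longrightarrow> wl g = 0 \<longleftrightarrow> g = \<one>"
  using wl_word[of g] by auto

lemma wl_gen: "s \<in> S \<Longrightarrow> wl s \<le> 1"
  using wl_ev[of "[s]"] by (simp add: S_closed)

lemma wl_mult: "g \<in> carrier G \<Longrightarrow> h \<in> carrier G \<Longrightarrow> wl (g \<otimes> h) \<le> wl g + wl h"
proof -
  assume "g \<in> carrier G" "h \<in> carrier G"
  then obtain v w where "length v = wl g" "set v \<subseteq> S" "ev v = g" "length w = wl h" "set w \<subseteq> S" "ev w = h"
    using wl_word by metis
  then show ?thesis using wl_ev[of "v @ w"] by (simp add: ev_append)
qed

lemma wl_inv [simp]: "g \<in> carrier G \<Longrightarrow> wl (inv g) = wl g"
proof -
  have le: "wl (inv g) \<le> wl g" if "g \<in> carrier G" for g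
  proof -
    obtain w where w: "length w = wl g" "set w \<subseteq> S" "ev w = g" using wl_word \<open>g \<in> carrier G\<close> by metis
    have "set (rev (map (\<lambda>s. inv s) w)) \<subseteq> S" using w S_inv by auto
    from wl_ev[OF this] show ?thesis using w ev_rev[of w] by simp
  qed
  assume g: "g \<in> carrier G"
  show ?thesis using le[OF g] le[of "inv g"] g by simp
qed

text \<open>A shortest word is cut in two. This stands in for geodesics when balls are compared
  later.\<close>

lemma wl_split:
  assumes "g \<in> carrier G" "i \<le> wl g"
  shows "\<exists>a\<in>carrier G. \<exists>b\<in>carrier G. a \<otimes> b = g \<and> wl a \<le> i \<and> wl b \<le> wl g - i"
proof -
  obtain w where w: "length w = wl g" "set w \<subseteq> S" "ev w = g" using wl_word assms by metis
  have s: "set (take i w) \<subseteq> S" "set (drop i w) \<subseteq> S" using w by (auto dest: in_set_takeD in_set_dropD)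
  have e: "ev (take i w) \<otimes> ev (drop i w) = g"
    by (metis ev_append[OF s] append_take_drop_id w(3))
  have "wl (ev (take i w)) \<le> i" "wl (ev (drop i w)) \<le> wl g - i"
    using wl_ev[OF s(1)] wl_ev[OF s(2)] by (simp_all add: w(1))
  then show ?thesis using e ev_closed[OF s(1)] ev_closed[OF s(2)] by blast
qed

lemma finite_wl_ball: "finite {g \<in> carrier G. wl g \<le> k}"
proof (rule finite_subset)
  show "finite (ev ` {w. set w \<subseteq> S \<and> length w \<le> k})"
    using finS by (simp add: finite_lists_length_le)
  show "{g \<in> carrier G. wl g \<le> k} \<subseteq> ev ` {w. set w \<subseteq> S \<and> length w \<le> k}"
    using wl_word by fastforce
qed

lemma wl_pow: "g \<in> carrier G \<Longrightarrow> wl (g [^] (n::nat)) \<le> n * wl g"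
proof (induction n)
  case (Suc n) then show ?case using wl_mult[of "g [^] n" g] by (simp add: algebra_simps)
qed simp

lemma wl_int_pow:
  assumes g: "g \<in> carrier G"
  shows "wl (g [^] (n::int)) \<le> nat \<bar>n\<bar> * wl g"
proof (cases n rule: int_cases2)
  case (nonneg m)
  then show ?thesis using wl_pow[OF g, of m] by (simp add: int_pow_int)
next
  case (nonpos m)
  then show ?thesis using wl_pow[OF g, of m] g by (simp add: int_pow_neg_int)
qed

end

section \<open>Coordinates on finitely generated nilpotent groups\<close>

text \<open>The group law in exponential coordinates of a 2-step nilpotent group.
  \<open>nondeg\<close> is non-singularity tested on generators only. By \<open>fin\<close> the
  coordinates have finite fibres and are proper, which is as good as injectivity up to a bounded
  error.\<close>

locale nilpotent_coords = gen_group G S for G (structure) and S +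
  fixes \<pi> :: "'a \<Rightarrow> 'v::euclidean_space" and \<zeta> :: "'a \<Rightarrow> 'z::euclidean_space"
    and B :: "'v \<Rightarrow> 'v \<Rightarrow> 'z" and V :: "'v set" and Z :: "'z set"
  assumes bilB: "bounded_bilinear B" and B_alt [simp]: "\<And>v. B v v = 0"
    and subV: "subspace V" and subZ: "subspace Z"
    and BZ: "\<And>v w. v \<in> V \<Longrightarrow> w \<in> V \<Longrightarrow> B v w \<in> Z"
    and piV: "\<And>g. g \<in> carrier G \<Longrightarrow> \<pi> g \<in> V" and zetaZ: "\<And>g. g \<in> carrier G \<Longrightarrow> \<zeta> g \<in> Z"
    and pi_mult: "\<And>g h. g \<in> carrier G \<Longrightarrow> h \<in> carrier G \<Longrightarrow> \<pi> (g \<otimes> h) = \<pi> g + \<pi> h"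
    and zeta_mult: "\<And>g h. g \<in> carrier G \<Longrightarrow> h \<in> carrier G \<Longrightarrow>
          \<zeta> (g \<otimes> h) = \<zeta> g + \<zeta> h + (1/2) *\<^sub>R B (\<pi> g) (\<pi> h)"
    and spanV: "span (\<pi> ` S) = V"
    and nondeg: "\<And>v z. v \<in> V \<Longrightarrow> v \<noteq> 0 \<Longrightarrow> z \<in> Z \<Longrightarrow> z \<noteq> 0 \<Longrightarrow> \<exists>s\<in>S. B v (\<pi> s) \<bullet> z \<noteq> 0"
    and V_nz: "\<exists>v\<in>V. v \<noteq> 0"
    and fin: "\<And>R. finite {g \<in> carrier G. norm (\<pi> g) \<le> R \<and> norm (\<zeta> g) \<le> R}"
begin

sublocale B: bounded_bilinear B by (rule bilB)

lemma B_skew: "B w v = - B v w"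
proof -
  have "B (v + w) (v + w) = B w v + B v w" unfolding B.add_left B.add_right by simp
  then have "B w v + B v w = 0" by simp
  then show ?thesis by (simp add: eq_neg_iff_add_eq_0)
qed

lemma pi_one [simp]: "\<pi> \<one> = 0"
  using pi_mult[of \<one> \<one>] by simp

lemma zeta_one [simp]: "\<zeta> \<one> = 0"
  using zeta_mult[of \<one> \<one>] by simp

lemma pi_inv: "g \<in> carrier G \<Longrightarrow> \<pi> (inv g) = - \<pi> g"
  using pi_mult[of g "inv g"] by (simp add: eq_neg_iff_add_eq_0 add.commute)

lemma zeta_inv: "g \<in> carrier G \<Longrightarrow> \<zeta> (inv g) = - \<zeta> g"
  using zeta_mult[of g "inv g"] by (simp add: pi_inv B.minus_right eq_neg_iff_add_eq_0 add.commute)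

lemma zeta_inv_mult: "g \<in> carrier G \<Longrightarrow> h \<in> carrier G \<Longrightarrow>
    \<zeta> (inv g \<otimes> h) = \<zeta> h - \<zeta> g - (1/2) *\<^sub>R B (\<pi> g) (\<pi> h)"
  by (simp add: zeta_mult zeta_inv pi_inv B.minus_left)

lemma pi_inv_mult: "g \<in> carrier G \<Longrightarrow> h \<in> carrier G \<Longrightarrow> \<pi> (inv g \<otimes> h) = \<pi> h - \<pi> g"
  by (simp add: pi_mult pi_inv)

lemma pi_pow: "g \<in> carrier G \<Longrightarrow> \<pi> (g [^] (n::nat)) = real n *\<^sub>R \<pi> g"
  by (induction n) (simp_all add: pi_mult algebra_simps)

lemma zeta_pow: "g \<in> carrier G \<Longrightarrow> \<zeta> (g [^] (n::nat)) = real n *\<^sub>R \<zeta> g"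
  by (induction n) (simp_all add: zeta_mult pi_pow B.scaleR_left algebra_simps)

lemma pi_int_pow: "g \<in> carrier G \<Longrightarrow> \<pi> (g [^] (n::int)) = of_int n *\<^sub>R \<pi> g"
  by (cases n rule: int_cases2) (simp_all add: int_pow_int int_pow_neg_int pi_pow pi_inv)

lemma comm_closed [simp]: "g \<in> carrier G \<Longrightarrow> h \<in> carrier G \<Longrightarrow> comm G g h \<in> carrier G"
  by (simp add: comm_def)

lemma pi_comm: "g \<in> carrier G \<Longrightarrow> h \<in> carrier G \<Longrightarrow> \<pi> (comm G g h) = 0"
  by (simp add: comm_def pi_mult pi_inv)

lemma zeta_comm: "g \<in> carrier G \<Longrightarrow> h \<in> carrier G \<Longrightarrow> \<zeta> (comm G g h) = B (\<pi> g) (\<pi> h)"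
proof -
  assume gh: "g \<in> carrier G" "h \<in> carrier G"
  have half: "(1/2) *\<^sub>R x + (1/2) *\<^sub>R x = x" for x :: 'z by (simp flip: scaleR_left_distrib)
  have "\<zeta> (comm G g h) = - ((1/2) *\<^sub>R B (\<pi> h) (\<pi> g) + (1/2) *\<^sub>R B (\<pi> h) (\<pi> g))"
    using gh B_skew[of "\<pi> g" "\<pi> h"]
    by (simp add: comm_def pi_mult pi_inv zeta_mult zeta_inv B.add_left B.minus_left B.minus_right B.diff_left)
  then show ?thesis using B_skew[of "\<pi> g" "\<pi> h"] by (simp only: half)
qed

lemma wl_comm: "g \<in> carrier G \<Longrightarrow> h \<in> carrier G \<Longrightarrow> wl (comm G g h) \<le> 2 * wl g + 2 * wl h"
proof -
  assume gh: "g \<in> carrier G" "h \<in> carrier G"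
  have "wl (comm G g h) \<le> wl (inv g \<otimes> inv h \<otimes> g) + wl h" unfolding comm_def using gh by (intro wl_mult) auto
  also have "\<dots> \<le> wl (inv g \<otimes> inv h) + wl g + wl h" using gh wl_mult[of "inv g \<otimes> inv h" g] by simp
  also have "\<dots> \<le> wl g + wl h + wl g + wl h" using gh wl_mult[of "inv g" "inv h"] by simp
  finally show ?thesis by simp
qed

lemma c0_ex: "\<exists>c\<ge>1. (\<forall>s\<in>S. norm (\<pi> s) \<le> c \<and> norm (\<zeta> s) \<le> c) \<and> (\<forall>v w. norm (B v w) \<le> c * norm v * norm w)"
proof -
  obtain K where K: "\<And>v w. norm (B v w) \<le> norm v * norm w * K" using B.nonneg_bounded by blast
  define c where "c = 1 + \<bar>K\<bar> + (\<Sum>s\<in>S. norm (\<pi> s) + norm (\<zeta> s))"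
  have sm: "norm (\<pi> s) + norm (\<zeta> s) \<le> (\<Sum>s\<in>S. norm (\<pi> s) + norm (\<zeta> s))" if "s \<in> S" for s
    using that finS by (intro member_le_sum) auto
  have pos: "0 \<le> (\<Sum>s\<in>S. norm (\<pi> s) + norm (\<zeta> s))" by (simp add: sum_nonneg)
  have "norm (B v w) \<le> c * norm v * norm w" for v w
  proof -
    have "norm v * norm w * K \<le> norm v * norm w * c"
      using pos by (intro mult_left_mono) (auto simp: c_def)
    then show ?thesis using K[of v w] by (simp add: algebra_simps)
  qed
  moreover have "norm (\<pi> s) \<le> c \<and> norm (\<zeta> s) \<le> c" if "s \<in> S" for s
    using sm[OF that] norm_ge_zero[of "\<pi> s"] norm_ge_zero[of "\<zeta> s"] unfolding c_def by linarith
  moreover have "c \<ge> 1" using pos by (simp add: c_def)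
  ultimately show ?thesis by blast
qed

text \<open>One bound for the coordinates of the generators and for \<open>B\<close>. Being at least
  1, it may be raised to a higher power whenever terms are merged.\<close>

definition c0 :: real where
  "c0 = (SOME c. c\<ge>1 \<and> (\<forall>s\<in>S. norm (\<pi> s) \<le> c \<and> norm (\<zeta> s) \<le> c) \<and> (\<forall>v w. norm (B v w) \<le> c * norm v * norm w))"

lemma c0: "1 \<le> c0" "\<And>s. s \<in> S \<Longrightarrow> norm (\<pi> s) \<le> c0" "\<And>s. s \<in> S \<Longrightarrow> norm (\<zeta> s) \<le> c0"
    and B_le: "\<And>v w. norm (B v w) \<le> c0 * norm v * norm w"
  using someI_ex[OF c0_ex] unfolding c0_def[symmetric] by auto

lemma B_le': "norm v \<le> a \<Longrightarrow> norm w \<le> b \<Longrightarrow> norm (B v w) \<le> c0 * a * b"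
proof -
  assume "norm v \<le> a" "norm w \<le> b"
  then have "norm v * norm w \<le> a * b"
    by (meson mult_mono norm_ge_zero order_trans)
  then have "c0 * (norm v * norm w) \<le> c0 * (a * b)" using c0 by (intro mult_left_mono) auto
  then show ?thesis using B_le[of v w] by (simp add: mult.assoc)
qed

lemma pi_ev: "set w \<subseteq> S \<Longrightarrow> norm (\<pi> (ev w)) \<le> c0 * length w"
proof (induction w)
  case (Cons s w)
  then have "norm (\<pi> (ev (s # w))) \<le> norm (\<pi> s) + norm (\<pi> (ev w))"
    by (simp add: pi_mult S_closed norm_triangle_ineq)
  also have "\<dots> \<le> c0 + c0 * length w" using Cons c0 by (intro add_mono) auto
  finally show ?case by (simp add: algebra_simps)
qed simp

text \<open>The quadratic term of \<open>\<zeta>\<close> is governed by how far the path described by the word strays.\<close>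

lemma zeta_ev:
  assumes "set w \<subseteq> S" "\<And>i. i \<le> length w \<Longrightarrow> norm (\<pi> (ev (take i w))) \<le> D"
  shows "norm (\<zeta> (ev w)) \<le> c0 * length w + c0 * D * (c0 * length w)"
  using assms
proof (induction w rule: rev_induct)
  case (snoc s w)
  have s: "set w \<subseteq> S" "s \<in> S" using snoc.prems by auto
  have D: "norm (\<pi> (ev w)) \<le> D" using snoc.prems(2)[of "length w"] by simp
  then have D0: "0 \<le> D" using norm_ge_zero order_trans by blast
  have IH: "norm (\<zeta> (ev w)) \<le> c0 * length w + c0 * D * (c0 * length w)"
  proof (rule snoc.IH[OF s(1)])
    fix i assume "i \<le> length w" then show "norm (\<pi> (ev (take i w))) \<le> D" using snoc.prems(2)[of i] by simp
  qed
  have "\<zeta> (ev (w @ [s])) = \<zeta> (ev w) + \<zeta> s + (1/2) *\<^sub>R B (\<pi> (ev w)) (\<pi> s)"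
    using s by (simp add: ev_append S_closed zeta_mult)
  then have "norm (\<zeta> (ev (w @ [s]))) \<le> norm (\<zeta> (ev w)) + norm (\<zeta> s) + (1/2) * norm (B (\<pi> (ev w)) (\<pi> s))"
    using norm_triangle_ineq[of "\<zeta> (ev w) + \<zeta> s" "(1/2) *\<^sub>R B (\<pi> (ev w)) (\<pi> s)"]
      norm_triangle_ineq[of "\<zeta> (ev w)" "\<zeta> s"] by simp
  moreover have "norm (B (\<pi> (ev w)) (\<pi> s)) \<le> c0 * D * c0" using D c0 s by (intro B_le') auto
  moreover have "0 \<le> c0 * D * c0" using c0 D0 by simp
  ultimately show ?case using IH c0(3)[OF s(2)] by (simp add: algebra_simps)
qed simp

lemma pi_bound: "g \<in> carrier G \<Longrightarrow> norm (\<pi> g) \<le> c0 * wl g"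
  using wl_word[of g] pi_ev by metis

lemma zeta_bound:
  assumes "g \<in> carrier G" shows "norm (\<zeta> g) \<le> 2 * c0 ^ 3 * (real (wl g))\<^sup>2"
proof -
  obtain w where w: "length w = wl g" "set w \<subseteq> S" "ev w = g" using wl_word assms by metis
  let ?k = "real (wl g)"
  have "norm (\<zeta> (ev w)) \<le> c0 * length w + c0 * (c0 * length w) * (c0 * length w)"
  proof (rule zeta_ev[OF w(2)])
    fix i assume i: "i \<le> length w"
    have "norm (\<pi> (ev (take i w))) \<le> c0 * length (take i w)"
      using w by (intro pi_ev) (auto dest: in_set_takeD)
    also have "\<dots> \<le> c0 * length w" using i c0 by (intro mult_left_mono) auto
    finally show "norm (\<pi> (ev (take i w))) \<le> c0 * length w" .
  qed
  then have "norm (\<zeta> g) \<le> c0 * ?k + c0 ^ 3 * ?k\<^sup>2" using w by (simp add: power2_eq_square power3_eq_cube algebra_simps)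
  moreover have "c0 * ?k \<le> c0 ^ 3 * ?k\<^sup>2"
  proof (rule mult_mono)
    show "c0 \<le> c0 ^ 3" using c0(1) self_le_power[of c0 3] by simp
    show "?k \<le> ?k\<^sup>2" by (simp add: power2_eq_square flip: of_nat_mult)
  qed (use c0 in auto)
  ultimately show ?thesis by simp
qed

section \<open>Group elements with prescribed coordinates\<close>

definition gens :: "'a list" where "gens = (SOME l. set l = S \<and> distinct l)"

lemma gens: "set gens = S" "distinct gens"
  using someI_ex[OF finite_distinct_list[OF finS]] unfolding gens_def by auto

text \<open>The order of the factors is an arbitrary choice and influences only
  \<open>\<zeta>\<close>. Under \<open>\<pi>\<close> the product realises an integer combination of
  the generators.\<close>

definition pw :: "('a \<Rightarrow> int) \<Rightarrow> 'a" where "pw e = foldr (\<lambda>s g. s [^] e s \<otimes> g) gens \<one>"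

lemma pw_aux:
  assumes "set l \<subseteq> S" "distinct l"
  shows "foldr (\<lambda>s g. s [^] (e s :: int) \<otimes> g) l \<one> \<in> carrier G"
    "\<pi> (foldr (\<lambda>s g. s [^] e s \<otimes> g) l \<one>) = (\<Sum>s\<in>set l. of_int (e s) *\<^sub>R \<pi> s)"
    "wl (foldr (\<lambda>s g. s [^] e s \<otimes> g) l \<one>) \<le> (\<Sum>s\<in>set l. nat \<bar>e s\<bar>)"
proof -
  have "foldr (\<lambda>s g. s [^] (e s :: int) \<otimes> g) l \<one> \<in> carrier G \<and>
    \<pi> (foldr (\<lambda>s g. s [^] e s \<otimes> g) l \<one>) = (\<Sum>s\<in>set l. of_int (e s) *\<^sub>R \<pi> s) \<and>
    wl (foldr (\<lambda>s g. s [^] e s \<otimes> g) l \<one>) \<le> (\<Sum>s\<in>set l. nat \<bar>e s\<bar>)" using assms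
  proof (induction l)
    case (Cons s l)
    let ?g = "foldr (\<lambda>s g. s [^] e s \<otimes> g) l \<one>"
    have s: "s \<in> S" "s \<in> carrier G" using Cons.prems S_closed by auto
    have IH: "?g \<in> carrier G" "\<pi> ?g = (\<Sum>s\<in>set l. of_int (e s) *\<^sub>R \<pi> s)" "wl ?g \<le> (\<Sum>s\<in>set l. nat \<bar>e s\<bar>)"
      using Cons by auto
    have "wl (s [^] e s \<otimes> ?g) \<le> wl (s [^] e s) + wl ?g" using s IH by (intro wl_mult) auto
    moreover have "wl (s [^] e s) \<le> nat \<bar>e s\<bar>"
      using wl_int_pow[OF s(2), of "e s"] wl_gen[OF s(1)]
      by (metis mult.right_neutral mult_le_mono2 order_trans)
    ultimately show ?case using Cons.prems s IH by (simp add: pi_mult pi_int_pow)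
  qed simp
  then show "foldr (\<lambda>s g. s [^] (e s :: int) \<otimes> g) l \<one> \<in> carrier G"
    "\<pi> (foldr (\<lambda>s g. s [^] e s \<otimes> g) l \<one>) = (\<Sum>s\<in>set l. of_int (e s) *\<^sub>R \<pi> s)"
    "wl (foldr (\<lambda>s g. s [^] e s \<otimes> g) l \<one>) \<le> (\<Sum>s\<in>set l. nat \<bar>e s\<bar>)" by auto
qed

lemma pw_closed [simp]: "pw e \<in> carrier G"
  and pi_pw: "\<pi> (pw e) = (\<Sum>s\<in>S. of_int (e s) *\<^sub>R \<pi> s)"
  and wl_pw: "wl (pw e) \<le> (\<Sum>s\<in>S. nat \<bar>e s\<bar>)"
  using pw_aux[of gens e] gens unfolding pw_def by auto

text \<open>Rounding with straight segments as curves: the images of the generators span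
  \<open>V\<close>, and only a combination with coefficients in the unit interval is lost.\<close>

lemma approx_pi: "\<exists>c\<ge>0. \<forall>v\<in>V. \<exists>g\<in>carrier G. norm (\<pi> g - v) \<le> c \<and> wl g \<le> c * (norm v + 1)"
proof -
  have "\<exists>s\<in>S. \<pi> s \<bullet> u \<noteq> 0" if "u \<in> V" "u \<noteq> 0" for u
  proof (rule ccontr)
    assume "\<not> ?thesis"
    then have "\<And>x. x \<in> \<pi> ` S \<Longrightarrow> orthogonal u x" by (auto simp: orthogonal_def inner_commute)
    then have "orthogonal u u" using that spanV orthogonal_to_span by blast
    then show False using that by (simp add: orthogonal_def)
  qed
  then obtain \<mu> where \<mu>: "\<mu> > 0" "\<And>u. u \<in> V \<Longrightarrow> \<mu> * (norm u)\<^sup>2 \<le> (\<Sum>s\<in>S. (\<pi> s \<bullet> u)\<^sup>2)"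
    using coercive_family[OF finS subV, of \<pi>] by blast
  define c where "c = card S * (c0 / \<mu> + 1) + card S * c0"
  have c: "0 \<le> c" using c0 \<mu> by (simp add: c_def)
  have "\<exists>g\<in>carrier G. norm (\<pi> g - v) \<le> c \<and> wl g \<le> c * (norm v + 1)" if v: "v \<in> V" for v
  proof -
    have "\<exists>n :: 'a \<Rightarrow> int. \<exists>t. (\<Sum>i\<in>S. of_int (n i) *\<^sub>R \<pi> i + t i *\<^sub>R \<pi> i) = v \<and>
       (\<forall>i\<in>S. t i \<in> {0..1} \<and> \<bar>of_int (n i)\<bar> \<le> norm (\<pi> i) * ((norm v + real (card S) * 0) / \<mu>) + 1)"
      by (rule lattice_curves_surj[OF finS subV _ _ _ _ _ _ _ \<mu>(1) \<mu>(2) v, where \<gamma> = "\<lambda>i t. t *\<^sub>R \<pi> i" and E = 0])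
         (auto intro!: piV S_closed continuous_intros subspace_scale[OF subV])
    then obtain n t where nt: "(\<Sum>i\<in>S. of_int (n i) *\<^sub>R \<pi> i + t i *\<^sub>R \<pi> i) = v"
      and t: "\<And>i. i \<in> S \<Longrightarrow> t i \<in> {0..1}" and n: "\<And>i. i \<in> S \<Longrightarrow> \<bar>of_int (n i)\<bar> \<le> norm (\<pi> i) * (norm v / \<mu>) + 1"
      by auto
    have "v - \<pi> (pw n) = (\<Sum>i\<in>S. t i *\<^sub>R \<pi> i)" by (simp add: pi_pw nt[symmetric] sum.distrib)
    moreover have "norm (\<Sum>i\<in>S. t i *\<^sub>R \<pi> i) \<le> card S * c0"
    proof (rule sum_norm_bound)
      fix i assume i: "i \<in> S"
      have "norm (t i *\<^sub>R \<pi> i) \<le> 1 * c0" unfolding norm_scaleR using t[OF i] c0 i by (intro mult_mono) auto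
      then show "norm (t i *\<^sub>R \<pi> i) \<le> c0" by simp
    qed
    ultimately have 1: "norm (\<pi> (pw n) - v) \<le> card S * c0" by (simp add: norm_minus_commute)
    have "real (wl (pw n)) \<le> (\<Sum>i\<in>S. \<bar>of_int (n i)\<bar>)"
      using of_nat_mono[OF wl_pw[of n], where 'a = real] by simp
    also have "\<dots> \<le> (\<Sum>i\<in>S. (c0 / \<mu> + 1) * (norm v + 1))"
    proof (rule sum_mono)
      fix i assume i: "i \<in> S"
      have "norm (\<pi> i) * (norm v / \<mu>) \<le> c0 * (norm v / \<mu>)" using c0(2)[OF i] \<mu> by (intro mult_right_mono) auto
      then have "\<bar>of_int (n i)\<bar> \<le> c0 / \<mu> * norm v + 1" using n[OF i] by simp
      also have "\<dots> \<le> (c0 / \<mu> + 1) * (norm v + 1)"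
        using divide_nonneg_pos[of c0 \<mu>] c0(1) \<mu>(1) unfolding ring_distribs by simp
      finally show "\<bar>of_int (n i)\<bar> \<le> (c0 / \<mu> + 1) * (norm v + 1)" .
    qed
    also have "\<dots> \<le> c * (norm v + 1)"
      using c0 unfolding c_def by (simp add: algebra_simps)
    finally have 2: "real (wl (pw n)) \<le> c * (norm v + 1)" .
    have "card S * c0 \<le> c" using c0 \<mu> by (simp add: c_def)
    then show ?thesis using 1 2 by (intro bexI[of _ "pw n"]) auto
  qed
  then show ?thesis using c by blast
qed

text \<open>The centre is quadratically distorted. Write \<open>m = a * a + b\<close> with
  \<open>b \<le> 2 * a\<close>: a commutator of two \<open>a\<close>-th powers yields the square and
  a commutator with a \<open>b\<close>-th power the rest, both with words of length of order
  \<open>sqrt m\<close>.\<close>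

lemma comm_power_nat:
  assumes "g \<in> carrier G" "h \<in> carrier G" "wl g \<le> 1" "wl h \<le> 1"
  shows "\<exists>x\<in>carrier G. \<pi> x = 0 \<and> \<zeta> x = real m *\<^sub>R B (\<pi> g) (\<pi> h) \<and> wl x \<le> 8 * sqrt m + 2"
proof -
  define a where "a = nat \<lfloor>sqrt m\<rfloor>"
  define b where "b = m - a * a"
  have a: "real a \<le> sqrt m" "sqrt m < real a + 1" by (auto simp: a_def)
  then have "real a * real a \<le> sqrt m * sqrt m" by (intro mult_mono) auto
  then have "real (a * a) \<le> real m" by simp
  then have aa: "a * a \<le> m" using of_nat_le_iff by blast
  have "sqrt m * sqrt m < (real a + 1) * (real a + 1)" using a by (intro mult_strict_mono) auto
  then have "real m < real (a * a + 2 * a + 1)" by (simp add: algebra_simps)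
  then have "m < a * a + 2 * a + 1" using of_nat_less_iff by blast
  then have b: "b \<le> 2 * a" by (simp add: b_def)
  have m: "real m = real a * real a + real b" using aa by (simp add: b_def flip: of_nat_mult of_nat_add)
  let ?x = "comm G (g [^] a) (h [^] a) \<otimes> comm G (g [^] b) h"
  have "wl ?x \<le> wl (comm G (g [^] a) (h [^] a)) + wl (comm G (g [^] b) h)" using assms by (intro wl_mult) auto
  also have "\<dots> \<le> (2 * wl (g [^] a) + 2 * wl (h [^] a)) + (2 * wl (g [^] b) + 2 * wl h)"
    using assms by (intro add_mono wl_comm) auto
  also have "\<dots> \<le> (2 * a + 2 * a) + (2 * b + 2 * 1)"
  proof -
    have le: "wl (x [^] k) \<le> k" if "x \<in> carrier G" "wl x \<le> 1" for x and k :: nat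
      using wl_pow[OF that(1), of k] that(2) by (metis mult.right_neutral mult_le_mono2 order_trans)
    show ?thesis using le assms by (intro add_mono mult_le_mono2) auto
  qed
  also have "\<dots> \<le> 8 * a + 2" using b by simp
  finally have "real (wl ?x) \<le> real (8 * a + 2)" using of_nat_le_iff by blast
  then have "wl ?x \<le> 8 * sqrt m + 2" using a by simp
  moreover have "\<pi> ?x = 0" using assms by (simp add: pi_mult pi_comm)
  moreover have "\<zeta> ?x = real m *\<^sub>R B (\<pi> g) (\<pi> h)"
    using assms by (simp add: zeta_mult pi_comm zeta_comm pi_pow B.scaleR_left B.scaleR_right m algebra_simps)
  ultimately show ?thesis using assms by (intro bexI[of _ ?x]) auto
qed

lemma comm_power:
  assumes "g \<in> carrier G" "h \<in> carrier G" "wl g \<le> 1" "wl h \<le> 1"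
  shows "\<exists>x\<in>carrier G. \<pi> x = 0 \<and> \<zeta> x = of_int m *\<^sub>R B (\<pi> g) (\<pi> h) \<and> wl x \<le> 8 * sqrt \<bar>of_int m\<bar> + 2"
proof (cases m rule: int_cases2)
  case (nonneg n)
  then show ?thesis using comm_power_nat[OF assms, of n] by simp
next
  case (nonpos n)
  obtain x where x: "x \<in> carrier G" "\<pi> x = 0" "\<zeta> x = real n *\<^sub>R B (\<pi> g) (\<pi> h)" "wl x \<le> 8 * sqrt n + 2"
    using comm_power_nat[OF assms, of n] by blast
  then show ?thesis using nonpos by (intro bexI[of _ "inv x"]) (auto simp: pi_inv zeta_inv)
qed

lemma central_prod:
  assumes "finite I" "\<And>i. i \<in> I \<Longrightarrow> f i \<in> carrier G" "\<And>i. i \<in> I \<Longrightarrow> \<pi> (f i) = 0"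
  shows "\<exists>x\<in>carrier G. \<pi> x = 0 \<and> \<zeta> x = (\<Sum>i\<in>I. \<zeta> (f i)) \<and> wl x \<le> (\<Sum>i\<in>I. wl (f i))"
  using assms
proof (induction I)
  case empty
  show ?case by (intro bexI[of _ \<one>]) auto
next
  case (insert i I)
  then obtain x where x: "x \<in> carrier G" "\<pi> x = 0" "\<zeta> x = (\<Sum>i\<in>I. \<zeta> (f i))" "wl x \<le> (\<Sum>i\<in>I. wl (f i))" by auto
  then show ?case using insert wl_mult[of "f i" x]
    by (intro bexI[of _ "f i \<otimes> x"]) (auto simp: pi_mult zeta_mult)
qed

text \<open>The commutators of pairs of generators span \<open>Z\<close>: a vector orthogonal to all
  of them would by linearity be orthogonal to every \<open>B v (\<pi> t)\<close>, against
  \<open>nondeg\<close>. So rounding applies again, and each power costs only the square root of its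
  exponent.\<close>

lemma approx_zeta: "\<exists>c\<ge>0. \<forall>z\<in>Z. \<exists>g\<in>carrier G. \<pi> g = 0 \<and> norm (\<zeta> g - z) \<le> c \<and> wl g \<le> c * (sqrt (norm z) + 1)"
proof -
  let ?I = "S \<times> S"
  define b where "b = (\<lambda>(s,t). B (\<pi> s) (\<pi> t))"
  have I: "finite ?I" using finS by simp
  have "\<exists>i\<in>?I. b i \<bullet> u \<noteq> 0" if u: "u \<in> Z" "u \<noteq> 0" for u
  proof (rule ccontr)
    assume "\<not> ?thesis"
    then have 0: "B (\<pi> s) (\<pi> t) \<bullet> u = 0" if "s \<in> S" "t \<in> S" for s t using that by (auto simp: b_def)
    obtain v where v: "v \<in> V" "v \<noteq> 0" using V_nz by blast
    obtain t where t: "t \<in> S" "B v (\<pi> t) \<bullet> u \<noteq> 0" using nondeg[OF v u] by blast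
    have "linear (\<lambda>v. B v (\<pi> t) \<bullet> u)"
      by (intro linearI) (auto simp: B.add_left B.scaleR_left inner_add_left)
    then have "B v (\<pi> t) \<bullet> u = 0"
      using linear_eq_0_on_span[of "\<lambda>v. B v (\<pi> t) \<bullet> u" "\<pi> ` S" v] 0 t v spanV by auto
    then show False using t by simp
  qed
  then obtain \<mu> where \<mu>: "\<mu> > 0" "\<And>u. u \<in> Z \<Longrightarrow> \<mu> * (norm u)\<^sup>2 \<le> (\<Sum>i\<in>?I. (b i \<bullet> u)\<^sup>2)"
    using coercive_family[OF I subZ, of b] by blast
  have bn: "norm (b i) \<le> c0 ^ 3" if "i \<in> ?I" for i
    using that B_le'[OF c0(2) c0(2)] by (auto simp: b_def power3_eq_cube mult.assoc)
  have bZ: "b i \<in> Z" if "i \<in> ?I" for i using that by (auto simp: b_def intro!: BZ piV S_closed)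
  define C where "C = c0 ^ 3 / \<mu>"
  have C: "0 \<le> C" using c0 \<mu> by (simp add: C_def)
  define c where "c = card ?I * c0 ^ 3 + card ?I * (8 * sqrt C + 10)"
  have c: "0 \<le> c" using c0 C by (simp add: c_def)
  have "\<exists>g\<in>carrier G. \<pi> g = 0 \<and> norm (\<zeta> g - z) \<le> c \<and> wl g \<le> c * (sqrt (norm z) + 1)" if z: "z \<in> Z" for z
  proof -
    have "\<exists>n :: 'a \<times> 'a \<Rightarrow> int. \<exists>t. (\<Sum>i\<in>?I. of_int (n i) *\<^sub>R b i + t i *\<^sub>R b i) = z \<and>
       (\<forall>i\<in>?I. t i \<in> {0..1} \<and> \<bar>of_int (n i)\<bar> \<le> norm (b i) * ((norm z + real (card ?I) * 0) / \<mu>) + 1)"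
      by (rule lattice_curves_surj[OF I subZ _ _ _ _ _ _ _ \<mu>(1) \<mu>(2) z, where \<gamma> = "\<lambda>i t. t *\<^sub>R b i" and E = 0])
         (auto intro!: bZ continuous_intros subspace_scale[OF subZ])
    then obtain n t where nt: "(\<Sum>i\<in>?I. of_int (n i) *\<^sub>R b i + t i *\<^sub>R b i) = z"
      and t: "\<And>i. i \<in> ?I \<Longrightarrow> t i \<in> {0..1}" and n: "\<And>i. i \<in> ?I \<Longrightarrow> \<bar>of_int (n i)\<bar> \<le> norm (b i) * (norm z / \<mu>) + 1"
      by auto
    have "\<forall>i\<in>?I. \<exists>x. x \<in> carrier G \<and> \<pi> x = 0 \<and> \<zeta> x = of_int (n i) *\<^sub>R b i \<and> wl x \<le> 8 * sqrt \<bar>of_int (n i)\<bar> + 2"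
    proof
      fix i assume "i \<in> ?I"
      then show "\<exists>x. x \<in> carrier G \<and> \<pi> x = 0 \<and> \<zeta> x = of_int (n i) *\<^sub>R b i \<and> wl x \<le> 8 * sqrt \<bar>of_int (n i)\<bar> + 2"
        using comm_power[OF S_closed S_closed wl_gen wl_gen, of "fst i" "snd i" "n i"] by (auto simp: b_def)
    qed
    from bchoice[OF this] obtain f where f0: "\<forall>i\<in>?I. f i \<in> carrier G \<and> \<pi> (f i) = 0 \<and>
        \<zeta> (f i) = of_int (n i) *\<^sub>R b i \<and> wl (f i) \<le> 8 * sqrt \<bar>of_int (n i)\<bar> + 2" by (elim exE)
    have f: "\<And>i. i \<in> ?I \<Longrightarrow> f i \<in> carrier G" "\<And>i. i \<in> ?I \<Longrightarrow> \<pi> (f i) = 0"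
      "\<And>i. i \<in> ?I \<Longrightarrow> \<zeta> (f i) = of_int (n i) *\<^sub>R b i" "\<And>i. i \<in> ?I \<Longrightarrow> wl (f i) \<le> 8 * sqrt \<bar>of_int (n i)\<bar> + 2"
      by (drule bspec[OF f0], elim conjE, assumption)+
    have "\<exists>x\<in>carrier G. \<pi> x = 0 \<and> \<zeta> x = (\<Sum>i\<in>?I. \<zeta> (f i)) \<and> wl x \<le> (\<Sum>i\<in>?I. wl (f i))"
      by (rule central_prod[OF I]) (erule f(1,2))+
    then obtain x where x: "x \<in> carrier G" "\<pi> x = 0" "\<zeta> x = (\<Sum>i\<in>?I. \<zeta> (f i))" "wl x \<le> (\<Sum>i\<in>?I. wl (f i))"
      by (elim bexE conjE) (rule that)
    have "z - \<zeta> x = (\<Sum>i\<in>?I. t i *\<^sub>R b i)" using x(3) f(3) by (simp add: nt[symmetric] sum.distrib)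
    moreover have "norm (\<Sum>i\<in>?I. t i *\<^sub>R b i) \<le> card ?I * c0 ^ 3"
    proof (rule sum_norm_bound)
      fix i assume i: "i \<in> ?I"
      have "norm (t i *\<^sub>R b i) \<le> 1 * c0 ^ 3" unfolding norm_scaleR using t[OF i] bn[OF i] by (intro mult_mono) auto
      then show "norm (t i *\<^sub>R b i) \<le> c0 ^ 3" by simp
    qed
    ultimately have 1: "norm (\<zeta> x - z) \<le> card ?I * c0 ^ 3" by (simp add: norm_minus_commute)
    have "real (wl x) \<le> (\<Sum>i\<in>?I. real (wl (f i)))" using x(4) by (metis of_nat_le_iff of_nat_sum)
    also have "\<dots> \<le> (\<Sum>i\<in>?I. (8 * sqrt C + 10) * (sqrt (norm z) + 1))"
    proof (rule sum_mono)
      fix i assume i: "i \<in> ?I"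
      have "norm (b i) * (norm z / \<mu>) \<le> c0 ^ 3 * (norm z / \<mu>)" using bn[OF i] \<mu> by (intro mult_right_mono) auto
      then have "\<bar>of_int (n i)\<bar> \<le> C * norm z + 1" using n[OF i] by (simp add: C_def)
      then have "sqrt \<bar>of_int (n i)\<bar> \<le> sqrt (C * norm z + 1)" by simp
      also have "\<dots> \<le> sqrt C * sqrt (norm z) + 1"
        using sqrt_add_le_add_sqrt[of "C * norm z" 1] C by (simp add: real_sqrt_mult)
      finally have "wl (f i) \<le> 8 * (sqrt C * sqrt (norm z) + 1) + 2" using f(4)[OF i] by simp
      also have "\<dots> \<le> (8 * sqrt C + 10) * (sqrt (norm z) + 1)" using C by (simp add: algebra_simps)
      finally show "real (wl (f i)) \<le> (8 * sqrt C + 10) * (sqrt (norm z) + 1)" .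
    qed
    also have "\<dots> \<le> c * (sqrt (norm z) + 1)"
    proof -
      have "(\<Sum>i\<in>?I. (8 * sqrt C + 10) * (sqrt (norm z) + 1)) = (card ?I * (8 * sqrt C + 10)) * (sqrt (norm z) + 1)"
        by simp
      also have "\<dots> \<le> c * (sqrt (norm z) + 1)" using c0 unfolding c_def by (intro mult_right_mono) auto
      finally show ?thesis .
    qed
    finally have 2: "real (wl x) \<le> c * (sqrt (norm z) + 1)" .
    have "card ?I * c0 ^ 3 \<le> c" using C by (simp add: c_def)
    then show ?thesis using 1 2 x by (intro bexI[of _ x]) auto
  qed
  then show ?thesis using c by blast
qed

lemma wl_bounded: "\<exists>M. \<forall>g\<in>carrier G. norm (\<pi> g) \<le> R \<longrightarrow> norm (\<zeta> g) \<le> R \<longrightarrow> wl g \<le> M"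
proof -
  have "finite (wl ` {g \<in> carrier G. norm (\<pi> g) \<le> R \<and> norm (\<zeta> g) \<le> R})" using fin by blast
  then obtain M where "\<forall>k\<in>wl ` {g \<in> carrier G. norm (\<pi> g) \<le> R \<and> norm (\<zeta> g) \<le> R}. k \<le> M"
    by (meson finite_nat_set_iff_bounded_le)
  then show ?thesis by blast
qed


lemmas [simp] = B.zero_left B.zero_right

text \<open>Upper half of the ball-box estimate; the lower half is \<open>pi_bound\<close> and
  \<open>zeta_bound\<close>. First \<open>g1\<close> matches \<open>\<pi> g\<close>, then
  \<open>g2\<close>, with \<open>\<pi> g2 = 0\<close>, matches what is left of
  \<open>\<zeta>\<close>. The remaining factor has bounded coordinates, hence bounded
  length.\<close>

lemma ballbox: "\<exists>c\<ge>1. \<forall>g\<in>carrier G. wl g \<le> c * (norm (\<pi> g) + sqrt (norm (\<zeta> g)) + 1)"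
proof -
  obtain c1 where c1: "c1 \<ge> 0" "\<And>v. v \<in> V \<Longrightarrow> \<exists>g\<in>carrier G. norm (\<pi> g - v) \<le> c1 \<and> wl g \<le> c1 * (norm v + 1)"
    using approx_pi by blast
  obtain c2 where c2: "c2 \<ge> 0" "\<And>z. z \<in> Z \<Longrightarrow> \<exists>g\<in>carrier G. \<pi> g = 0 \<and> norm (\<zeta> g - z) \<le> c2 \<and> wl g \<le> c2 * (sqrt (norm z) + 1)"
    using approx_zeta by blast
  obtain M :: nat where M: "\<And>g. g \<in> carrier G \<Longrightarrow> norm (\<pi> g) \<le> max c1 c2 \<Longrightarrow> norm (\<zeta> g) \<le> max c1 c2 \<Longrightarrow> wl g \<le> M"
    using wl_bounded[of "max c1 c2"] by blast
  define K where "K = 2 * c0 ^ 3 * c1\<^sup>2 + c0 * c1"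
  have K: "0 \<le> K" using c0 c1 by (simp add: K_def)
  define c where "c = c1 + c2 * (sqrt K + 1) + c2 + M + 1"
  have c: "c \<ge> 1" using c1 c2 K by (simp add: c_def)
  have "wl g \<le> c * (norm (\<pi> g) + sqrt (norm (\<zeta> g)) + 1)" if g: "g \<in> carrier G" for g
  proof -
    let ?p = "norm (\<pi> g)" and ?q = "norm (\<zeta> g)"
    obtain g1 where g1: "g1 \<in> carrier G" "norm (\<pi> g1 - \<pi> g) \<le> c1" "wl g1 \<le> c1 * (?p + 1)"
      using c1(2)[OF piV[OF g]] by blast
    define u where "u = inv g1 \<otimes> g"
    have u: "u \<in> carrier G" using g g1 by (simp add: u_def)
    have piu: "\<pi> u = \<pi> g - \<pi> g1" and zu: "\<zeta> u = \<zeta> g - \<zeta> g1 - (1/2) *\<^sub>R B (\<pi> g1) (\<pi> g)"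
      using g g1 by (simp_all add: u_def pi_inv_mult zeta_inv_mult)
    \<comment> \<open>Since \<open>B\<close> is alternating, only the bounded difference of the
      arguments counts.\<close>
    have "norm (B (\<pi> g1) (\<pi> g)) = norm (B (\<pi> g1 - \<pi> g) (\<pi> g))" by (simp add: B.diff_left)
    also have "\<dots> \<le> c0 * c1 * ?p" by (intro B_le') (use g1 in auto)
    finally have b: "norm (B (\<pi> g1) (\<pi> g)) \<le> c0 * c1 * ?p" .
    have "(real (wl g1))\<^sup>2 \<le> (c1 * (?p + 1))\<^sup>2" using g1 by (intro power_mono) auto
    then have "2 * c0 ^ 3 * (real (wl g1))\<^sup>2 \<le> 2 * c0 ^ 3 * (c1\<^sup>2 * (?p + 1)\<^sup>2)"
      using c0 by (intro mult_left_mono) (auto simp: power_mult_distrib)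
    then have zg1: "norm (\<zeta> g1) \<le> 2 * c0 ^ 3 * c1\<^sup>2 * (?p + 1)\<^sup>2"
      using zeta_bound[OF g1(1)] by (simp add: mult.assoc)
    have "norm (\<zeta> u) \<le> ?q + norm (\<zeta> g1) + norm (B (\<pi> g1) (\<pi> g))"
      unfolding zu using norm_triangle_ineq4[of "\<zeta> g - \<zeta> g1" "(1/2) *\<^sub>R B (\<pi> g1) (\<pi> g)"]
        norm_triangle_ineq4[of "\<zeta> g" "\<zeta> g1"] norm_ge_zero[of "B (\<pi> g1) (\<pi> g)"]
      unfolding norm_scaleR by linarith
    also have "\<dots> \<le> ?q + 2 * c0 ^ 3 * c1\<^sup>2 * (?p + 1)\<^sup>2 + c0 * c1 * (?p + 1)\<^sup>2"
    proof -
      have "?p \<le> (?p + 1)\<^sup>2" by (simp add: power2_eq_square algebra_simps)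
      then have "c0 * c1 * ?p \<le> c0 * c1 * (?p + 1)\<^sup>2" using c0 c1 by (intro mult_left_mono) auto
      then show ?thesis using b zg1 by simp
    qed
    finally have "norm (\<zeta> u) \<le> ?q + K * (?p + 1)\<^sup>2" by (simp add: K_def algebra_simps)
    then have "sqrt (norm (\<zeta> u)) \<le> sqrt (?q + K * (?p + 1)\<^sup>2)" by simp
    also have "\<dots> \<le> sqrt ?q + sqrt K * (?p + 1)"
      using sqrt_add_le_add_sqrt[of ?q "K * (?p + 1)\<^sup>2"] K by (simp add: real_sqrt_mult)
    finally have su: "sqrt (norm (\<zeta> u)) \<le> sqrt ?q + sqrt K * (?p + 1)" .
    obtain g2 where g2: "g2 \<in> carrier G" "\<pi> g2 = 0" "norm (\<zeta> g2 - \<zeta> u) \<le> c2"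
      "wl g2 \<le> c2 * (sqrt (norm (\<zeta> u)) + 1)" using c2(2)[OF zetaZ[OF u]] by blast
    have "wl (inv g2 \<otimes> u) \<le> M"
      using g1 g2 u piu by (intro M) (auto simp: pi_inv_mult zeta_inv_mult norm_minus_commute le_max_iff_disj)
    moreover have "g = g1 \<otimes> (g2 \<otimes> (inv g2 \<otimes> u))"
      using g g1 g2 by (simp add: u_def m_assoc[symmetric])
    moreover have "wl (g1 \<otimes> (g2 \<otimes> (inv g2 \<otimes> u))) \<le> wl g1 + (wl g2 + wl (inv g2 \<otimes> u))"
      using g1 g2 u wl_mult[of g1 "g2 \<otimes> (inv g2 \<otimes> u)"] wl_mult[of g2 "inv g2 \<otimes> u"] by simp
    ultimately have "real (wl g) \<le> real (wl g1) + real (wl g2) + M" by simp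
    also have "\<dots> \<le> c1 * (?p + 1) + c2 * (sqrt ?q + sqrt K * (?p + 1) + 1) + M"
      using g1(3) g2(4) mult_left_mono[OF su c2(1)] by (simp add: algebra_simps)
    also have "\<dots> \<le> c * (?p + sqrt ?q + 1)"
    proof -
      let ?X = "?p + sqrt ?q + 1"
      have X: "?p + 1 \<le> ?X" "1 \<le> ?X" "sqrt ?q \<le> ?X" by auto
      have "c1 * (?p + 1) \<le> c1 * ?X" using c1 X by (intro mult_left_mono) auto
      moreover have "c2 * (sqrt ?q + sqrt K * (?p + 1) + 1) \<le> c2 * ((sqrt K + 1) * ?X + ?X)"
      proof (rule mult_left_mono)
        have "sqrt K * (?p + 1) \<le> sqrt K * ?X" using K X by (intro mult_left_mono) auto
        then show "sqrt ?q + sqrt K * (?p + 1) + 1 \<le> (sqrt K + 1) * ?X + ?X" using X by (simp add: algebra_simps)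
      qed (use c2 in auto)
      moreover have "real M * 1 \<le> real M * ?X" using X by (intro mult_left_mono) auto
      moreover have "c * ?X = c1 * ?X + c2 * ((sqrt K + 1) * ?X + ?X) + M * ?X + ?X"
        unfolding c_def by (simp add: algebra_simps)
      ultimately show ?thesis using X by linarith
    qed
    finally show ?thesis .
  qed
  then show ?thesis using c by blast
qed

text \<open>\<open>x\<close> is the word with \<open>t i\<close> inserted after its
  \<open>i\<close>-th letter, and \<open>T\<close> is the product of all \<open>t i\<close>. Pulling
  each \<open>t i\<close> to the front past the prefix before it leaves the commutators in the
  sum.\<close>

lemma insertion_aux:
  assumes "set w \<subseteq> S" "\<And>i. t i \<in> carrier G"
  shows "\<exists>x\<in>carrier G. \<exists>T\<in>carrier G. wl x \<le> length w + (\<Sum>i\<le>length w. wl (t i)) \<and>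
    wl T \<le> (\<Sum>i\<le>length w. wl (t i)) \<and> \<pi> x = \<pi> T + \<pi> (ev w) \<and>
    \<zeta> x = \<zeta> T + \<zeta> (ev w) + (1/2) *\<^sub>R B (\<pi> T) (\<pi> (ev w)) + (\<Sum>i\<le>length w. B (\<pi> (ev (take i w))) (\<pi> (t i)))"
  using assms(1)
proof (induction w rule: rev_induct)
  case Nil
  show ?case using assms(2) by (intro bexI[of _ "t 0"]) auto
next
  case (snoc a w)
  have a: "set w \<subseteq> S" "a \<in> S" "a \<in> carrier G" using snoc.prems S_closed by auto
  define h where "h = ev w"
  define t' where "t' = t (Suc (length w))"
  have h: "h \<in> carrier G" and t': "t' \<in> carrier G" using a assms(2) by (simp_all add: h_def t'_def)
  define \<Sigma> where "\<Sigma> = (\<Sum>i\<le>length w. B (\<pi> (ev (take i w))) (\<pi> (t i)))"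
  obtain x T where x: "x \<in> carrier G" "T \<in> carrier G" "wl x \<le> length w + (\<Sum>i\<le>length w. wl (t i))"
    "wl T \<le> (\<Sum>i\<le>length w. wl (t i))" "\<pi> x = \<pi> T + \<pi> h"
    "\<zeta> x = \<zeta> T + \<zeta> h + (1/2) *\<^sub>R B (\<pi> T) (\<pi> h) + \<Sigma>"
    using snoc.IH[OF a(1)] unfolding h_def \<Sigma>_def by blast
  have half: "(1/2) *\<^sub>R y + (1/2) *\<^sub>R y = y" for y :: 'z by (simp flip: scaleR_left_distrib)
  have eva: "ev (w @ [a]) = h \<otimes> a" using a by (simp add: ev_append h_def)
  have sum': "(\<Sum>i\<le>length (w @ [a]). B (\<pi> (ev (take i (w @ [a])))) (\<pi> (t i))) = \<Sigma> + B (\<pi> h + \<pi> a) (\<pi> t')"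
    using h a eva by (simp add: \<Sigma>_def t'_def pi_mult)
  let ?x = "x \<otimes> a \<otimes> t'" and ?T = "T \<otimes> t'"
  have "\<zeta> ?x = \<zeta> ?T + \<zeta> (h \<otimes> a) + (1/2) *\<^sub>R B (\<pi> ?T) (\<pi> (h \<otimes> a)) +
      (\<Sigma> + ((1/2) *\<^sub>R B (\<pi> h + \<pi> a) (\<pi> t') + (1/2) *\<^sub>R B (\<pi> h + \<pi> a) (\<pi> t')))"
    using x a h t' B_skew[of "\<pi> t'" "\<pi> h"] B_skew[of "\<pi> t'" "\<pi> a"]
    by (simp add: pi_mult zeta_mult B.add_left B.add_right algebra_simps)
  then have "\<zeta> ?x = \<zeta> ?T + \<zeta> (h \<otimes> a) + (1/2) *\<^sub>R B (\<pi> ?T) (\<pi> (h \<otimes> a)) + (\<Sigma> + B (\<pi> h + \<pi> a) (\<pi> t'))"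
    by (simp only: half)
  moreover have "\<pi> ?x = \<pi> ?T + \<pi> (h \<otimes> a)" using x a h t' by (simp add: pi_mult algebra_simps)
  moreover have "wl ?x \<le> wl x + 1 + wl t'"
    using x a t' wl_mult[of "x \<otimes> a" t'] wl_mult[of x a] wl_gen[OF a(2)] by simp
  moreover have "wl ?T \<le> wl T + wl t'" using x t' by (simp add: wl_mult)
  ultimately show ?case unfolding sum' eva using x a t'
    by (intro bexI[of _ ?x] bexI[of _ ?T]) (auto simp: t'_def)
qed

text \<open>
  Carrying the element \<open>t i\<close> along from the start of the word up to position \<open>i\<close> changes the product
  by a commutator with the prefix, hence moves \<open>\<zeta>\<close> without moving \<open>\<pi>\<close>.
\<close>

lemma insertion:
  assumes w: "set w \<subseteq> S" and t: "\<And>i. t i \<in> carrier G"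
  shows "\<exists>h\<in>carrier G. wl h \<le> length w + 2 * (\<Sum>i\<le>length w. wl (t i)) \<and> \<pi> h = \<pi> (ev w) \<and>
    \<zeta> h = \<zeta> (ev w) + (\<Sum>i\<le>length w. B (\<pi> (ev (take i w))) (\<pi> (t i)))"
proof -
  obtain x T where x: "x \<in> carrier G" "T \<in> carrier G" "wl x \<le> length w + (\<Sum>i\<le>length w. wl (t i))"
    "wl T \<le> (\<Sum>i\<le>length w. wl (t i))" "\<pi> x = \<pi> T + \<pi> (ev w)"
    "\<zeta> x = \<zeta> T + \<zeta> (ev w) + (1/2) *\<^sub>R B (\<pi> T) (\<pi> (ev w)) + (\<Sum>i\<le>length w. B (\<pi> (ev (take i w))) (\<pi> (t i)))"
    using insertion_aux[where t = t, OF w t] by (elim bexE conjE) (rule that)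
  \<comment> \<open>Cancelling \<open>T\<close> in front restores \<open>\<pi>\<close> and leaves
    nothing in \<open>\<zeta>\<close> but the commutators.\<close>
  let ?h = "inv T \<otimes> x"
  have h: "?h \<in> carrier G" using x(1,2) by simp
  have "wl ?h \<le> wl T + wl x" using wl_mult[of "inv T" x] x(1,2) by simp
  then have "wl ?h \<le> length w + 2 * (\<Sum>i\<le>length w. wl (t i))" using x(3,4) by linarith
  moreover have "\<pi> ?h = \<pi> (ev w)" using x(1,2,5) by (simp add: pi_inv_mult)
  moreover have "\<zeta> ?h = \<zeta> x - \<zeta> T - (1/2) *\<^sub>R B (\<pi> T) (\<pi> (ev w))"
    using x(1,2,5) by (simp add: zeta_inv_mult B.add_right)
  then have "\<zeta> ?h = \<zeta> (ev w) + (\<Sum>i\<le>length w. B (\<pi> (ev (take i w))) (\<pi> (t i)))"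
    unfolding x(6) by simp
  ultimately show ?thesis using h by blast
qed

text \<open>The sum is homogeneous of degree 2 in \<open>v\<close> and in \<open>z\<close>, so its
  positive minimum over a product of two compact unit spheres gives the uniform bound.\<close>

lemma nondeg_uniform: "\<exists>\<mu>>0. \<forall>v\<in>V. \<forall>z\<in>Z. \<mu> * (norm v)\<^sup>2 * (norm z)\<^sup>2 \<le> (\<Sum>s\<in>S. (B v (\<pi> s) \<bullet> z)\<^sup>2)"
proof (cases "Z \<inter> sphere 0 1 = {}")
  case True
  have z0: "z = 0" if "z \<in> Z" for z
  proof (rule ccontr)
    assume "z \<noteq> 0"
    then have "(1 / norm z) *\<^sub>R z \<in> Z \<inter> sphere 0 1" using that subZ by (simp add: subspace_scale)
    then show False using True by blast
  qed
  have "1 * (norm v)\<^sup>2 * (norm z)\<^sup>2 \<le> (\<Sum>s\<in>S. (B v (\<pi> s) \<bullet> z)\<^sup>2)" if "z \<in> Z" for v z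
    by (simp add: z0[OF that])
  then show ?thesis by (intro exI[of _ 1]) simp
next
  case False
  let ?K = "(V \<inter> sphere 0 1) \<times> (Z \<inter> sphere 0 1)"
  let ?q = "\<lambda>x. \<Sum>s\<in>S. (B (fst x) (\<pi> s) \<bullet> snd x)\<^sup>2"
  obtain v0 where v0: "v0 \<in> V" "v0 \<noteq> 0" using V_nz by blast
  then have "(1 / norm v0) *\<^sub>R v0 \<in> V \<inter> sphere 0 1" using subV by (simp add: subspace_scale)
  then have ne: "?K \<noteq> {}" using False by blast
  have K: "compact ?K" using subV subZ by (intro compact_Times) (auto simp: closed_Int_compact closed_subspace)
  have "continuous_on ?K ?q"
    by (intro continuous_intros B.continuous_on)
  then obtain x where x: "x \<in> ?K" "\<And>y. y \<in> ?K \<Longrightarrow> ?q x \<le> ?q y"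
    using continuous_attains_inf[OF K ne] by blast
  have "fst x \<in> V" "fst x \<noteq> 0" "snd x \<in> Z" "snd x \<noteq> 0" using x(1) by auto
  then obtain s where "s \<in> S" "B (fst x) (\<pi> s) \<bullet> snd x \<noteq> 0" using nondeg by blast
  then have pos: "0 < ?q x" using finS by (intro sum_pos2[of _ s]) auto
  have "?q x * (norm v)\<^sup>2 * (norm z)\<^sup>2 \<le> (\<Sum>s\<in>S. (B v (\<pi> s) \<bullet> z)\<^sup>2)" if "v \<in> V" "z \<in> Z" for v z
  proof (cases "v = 0 \<or> z = 0")
    case True
    then show ?thesis by (auto intro: sum_nonneg)
  next
    case False
    have "?q x \<le> ?q ((1 / norm v) *\<^sub>R v, (1 / norm z) *\<^sub>R z)"
      using that False subV subZ by (intro x) (simp add: subspace_scale)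
    also have "\<dots> = (\<Sum>s\<in>S. (B v (\<pi> s) \<bullet> z)\<^sup>2) / ((norm v)\<^sup>2 * (norm z)\<^sup>2)"
      by (simp add: B.scaleR_left power_divide sum_divide_distrib power_mult_distrib mult.commute)
    finally show ?thesis using False by (simp add: field_simps)
  qed
  then show ?thesis using pos by blast
qed

lemma pi_take: "set w \<subseteq> S \<Longrightarrow> i \<le> length w \<Longrightarrow> \<pi> (ev (take i w)) = (\<Sum>l<i. \<pi> (w ! l))"
proof (induction i)
  case (Suc i)
  have wi: "w ! i \<in> S" using Suc.prems nth_mem by fastforce
  have "set (take i w) \<subseteq> S" using Suc.prems by (auto dest: in_set_takeD)
  then show ?case using Suc wi by (simp add: take_Suc_conv_app_nth ev_append pi_mult S_closed)
qed simp


text \<open>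
  A word whose path travels a distance comparable to its length can be modified, at bounded cost per
  unit \<open>n\<close>, to move \<open>\<zeta>\<close> by any \<open>z\<close> of size \<open>n\<close> times the length: the real
  exponents solving the linearised problem are rounded by stopping part of the way along the path.
\<close>

lemma shift_zeta:
  fixes A \<epsilon> :: real
  assumes A: "0 \<le> A" and \<epsilon>: "0 < \<epsilon>"
  shows "\<exists>c\<ge>0. \<forall>n::real. \<forall>w j z. 1 \<le> n \<longrightarrow> set w \<subseteq> S \<longrightarrow> j \<le> length w \<longrightarrow>
    \<epsilon> * length w \<le> norm (\<pi> (ev (take j w))) \<longrightarrow> n \<le> length w \<longrightarrow> z \<in> Z \<longrightarrow> norm z \<le> A * n * length w \<longrightarrow>
    (\<exists>h\<in>carrier G. wl h \<le> length w + c * n \<and> \<pi> h = \<pi> (ev w) \<and> norm (\<zeta> (ev w) + z - \<zeta> h) \<le> c)"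
proof -
  obtain \<mu> where \<mu>: "0 < \<mu>" "\<And>v z. v \<in> V \<Longrightarrow> z \<in> Z \<Longrightarrow> \<mu> * (norm v)\<^sup>2 * (norm z)\<^sup>2 \<le> (\<Sum>s\<in>S. (B v (\<pi> s) \<bullet> z)\<^sup>2)"
    using nondeg_uniform by blast
  define m where "m = real (card S)"
  \<comment> \<open>The bound for the exponents per unit of \<open>n\<close>. The length of the word
    cancels in it, because the coercivity constant grows with the square of the length.\<close>
  define Q where "Q = c0 ^ 3 * (A + m * (2 * c0 ^ 3)) / (\<mu> * \<epsilon>\<^sup>2) + 1"
  define c where "c = 2 * m * (Q + 1) + m * c0 ^ 3"
  have pos: "0 \<le> m" "0 \<le> c0" "0 \<le> c0 ^ 3" using c0 by (auto simp: m_def)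
  have Q: "1 \<le> Q" using pos A \<mu> \<epsilon> by (simp add: Q_def)
  have c: "0 \<le> c" using pos Q by (simp add: c_def)
  have "\<exists>h\<in>carrier G. wl h \<le> length w + c * n \<and> \<pi> h = \<pi> (ev w) \<and> norm (\<zeta> (ev w) + z - \<zeta> h) \<le> c"
    if n: "1 \<le> n" and w: "set w \<subseteq> S" and j: "j \<le> length w" and far: "\<epsilon> * length w \<le> norm (\<pi> (ev (take j w)))"
      and nK: "n \<le> length w" and z: "z \<in> Z" "norm z \<le> A * n * length w"
    for n :: real and w j z
  proof -
    define K where "K = real (length w)"
    have K: "1 \<le> K" "n \<le> K" "real j \<le> K" using n nK j by (simp_all add: K_def)
    have wS: "w ! l \<in> S" if "l < j" for l using w that j nth_mem[of l w] by auto
    have wn: "norm (\<pi> (w ! l)) \<le> c0" "\<pi> (w ! l) \<in> V" if "l < j" for l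
      using c0 piV S_closed wS[OF that] by auto
    define v where "v = \<pi> (ev (take j w))"
    have vsum: "v = (\<Sum>l<j. \<pi> (w ! l))" using pi_take[OF w j] by (simp add: v_def)
    have v: "v \<in> V" unfolding vsum using subV wn by (intro subspace_sum) auto
    have vK: "\<epsilon> * K \<le> norm v" using far by (simp add: v_def K_def)
    define cl where "cl x = max 0 (min 1 x)" for x :: real
    have cl: "0 \<le> cl x" "cl x \<le> 1" for x by (auto simp: cl_def)
    \<comment> \<open>The polygonal path through the \<open>\<pi>\<close>-values of the prefixes of
      length at most \<open>j\<close>, parametrised by the unit interval. \<open>near\<close>
      compares it with the last vertex passed, at most one letter away.\<close>
    define p where "p t = (\<Sum>l<j. cl (j * t - l) *\<^sub>R \<pi> (w ! l))" for t :: real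
    have pV: "p t \<in> V" for t unfolding p_def using subV wn by (intro subspace_sum subspace_scale) auto
    have p0: "p 0 = 0" unfolding p_def by (intro sum.neutral) (auto simp: cl_def)
    have p1: "p 1 = v" unfolding p_def vsum by (intro sum.cong) (auto simp: cl_def)
    have pn: "norm (p t) \<le> c0 * K" for t
    proof -
      have "norm (p t) \<le> card {..<j} * c0" unfolding p_def
      proof (rule sum_norm_bound)
        fix l assume l: "l \<in> {..<j}"
        have "cl (j * t - l) * norm (\<pi> (w ! l)) \<le> 1 * c0" using cl wn l pos by (intro mult_mono) auto
        then show "norm (cl (j * t - l) *\<^sub>R \<pi> (w ! l)) \<le> c0" using cl by simp
      qed
      also have "\<dots> \<le> c0 * K" using mult_right_mono[OF K(3) pos(2)] by (simp add: mult.commute)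
      finally show ?thesis .
    qed
    have vn: "norm v \<le> c0 * K" using pn[of 1] p1 by simp
    have near: "norm (p t - \<pi> (ev (take i w))) \<le> c0" if t: "t \<in> {0..1}" and i: "i = nat \<lfloor>j * t\<rfloor>" for t :: real and i
    proof -
      have jt: "0 \<le> j * t" "j * t \<le> j" using t by (auto simp: mult_left_le)
      then have ij: "i \<le> j" unfolding i by linarith
      have fl: "real i \<le> j * t" "j * t < real i + 1" using jt unfolding i by linarith+
      have "\<pi> (ev (take i w)) = (\<Sum>l<i. \<pi> (w ! l))" using w ij j by (intro pi_take) auto
      also have "\<dots> = (\<Sum>l<j. (if l < i then \<pi> (w ! l) else 0))"
        using ij by (simp add: sum.If_cases Int_def) (rule sum.cong, auto)
      finally have "p t - \<pi> (ev (take i w)) = (\<Sum>l<j. cl (j * t - l) *\<^sub>R \<pi> (w ! l) - (if l < i then \<pi> (w ! l) else 0))"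
        by (simp add: p_def sum_subtractf)
      also have "\<dots> = (\<Sum>l<j. if l = i then cl (j * t - l) *\<^sub>R \<pi> (w ! l) else 0)"
      proof (intro sum.cong refl)
        fix l
        show "cl (j * t - l) *\<^sub>R \<pi> (w ! l) - (if l < i then \<pi> (w ! l) else 0) =
            (if l = i then cl (j * t - l) *\<^sub>R \<pi> (w ! l) else 0)"
          using fl by (cases l i rule: linorder_cases) (auto simp: cl_def)
      qed
      also have "\<dots> = (if i < j then cl (j * t - i) *\<^sub>R \<pi> (w ! i) else 0)" by simp
      also have "norm \<dots> \<le> c0"
      proof (cases "i < j")
        case True
        have "cl (j * t - i) * norm (\<pi> (w ! i)) \<le> 1 * c0" using cl wn True pos by (intro mult_mono) auto
        then show ?thesis using cl True by simp
      qed (use pos in auto)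
      finally show ?thesis .
    qed
    define b where "b s = B v (\<pi> s)" for s
    define \<gamma> where "\<gamma> s t = B (p t) (\<pi> s)" for s t
    have bn: "norm (b s) \<le> c0 ^ 3 * K" if "s \<in> S" for s
    proof -
      have "norm (b s) \<le> c0 * (c0 * K) * c0" unfolding b_def using vn c0 that by (intro B_le') auto
      then show ?thesis by (simp add: power3_eq_cube algebra_simps)
    qed
    \<comment> \<open>Coercivity constant of the family \<open>b s\<close>: the uniform
      nondegeneracy times the square of the distance \<open>\<epsilon> * K\<close>
      travelled.\<close>
    define M where "M = \<mu> * \<epsilon>\<^sup>2 * K\<^sup>2"
    have M: "0 < M" using \<mu> \<epsilon> K by (simp add: M_def)
    have "\<exists>k :: 'a \<Rightarrow> int. \<exists>t. (\<Sum>s\<in>S. of_int (k s) *\<^sub>R b s + \<gamma> s (t s)) = z \<and>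
      (\<forall>s\<in>S. t s \<in> {0..1} \<and> \<bar>of_int (k s)\<bar> \<le> norm (b s) * ((norm z + real (card S) * (2 * c0 ^ 3 * K)) / M) + 1)"
    proof (rule lattice_curves_surj[OF finS subZ _ _ _ _ _ _ _ M _ z(1)])
      show "b s \<in> Z" if "s \<in> S" for s using that v by (auto simp: b_def intro!: BZ piV S_closed)
      show "continuous_on {0..1} (\<gamma> s)" for s
        unfolding \<gamma>_def p_def cl_def by (intro B.continuous_on continuous_intros)
      show "\<gamma> s t \<in> Z" if "s \<in> S" for s t using that pV by (auto simp: \<gamma>_def intro!: BZ piV S_closed)
      show "\<gamma> s 0 = 0" "\<gamma> s 1 = b s" for s by (simp_all add: \<gamma>_def b_def p0 p1)
      show "norm (\<gamma> s t - t *\<^sub>R b s) \<le> 2 * c0 ^ 3 * K" if "s \<in> S" "t \<in> {0..1}" for s t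
      proof -
        have "norm (p t - t *\<^sub>R v) \<le> norm (p t) + \<bar>t\<bar> * norm v" using norm_triangle_ineq4[of "p t" "t *\<^sub>R v"] by simp
        also have "\<dots> \<le> c0 * K + 1 * (c0 * K)" using that vn pn[of t] by (intro add_mono mult_mono) auto
        finally have "norm (p t - t *\<^sub>R v) \<le> 2 * c0 * K" by (simp add: mult.commute)
        then have "norm (B (p t - t *\<^sub>R v) (\<pi> s)) \<le> c0 * (2 * c0 * K) * c0" using that c0 by (intro B_le') auto
        then show ?thesis by (simp add: \<gamma>_def b_def B.diff_left B.scaleR_left power3_eq_cube algebra_simps)
      qed
      show "0 \<le> 2 * c0 ^ 3 * K" using pos K by simp
      show "M * (norm u)\<^sup>2 \<le> (\<Sum>s\<in>S. (b s \<bullet> u)\<^sup>2)" if "u \<in> Z" for u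
      proof -
        have "(\<epsilon> * K)\<^sup>2 \<le> (norm v)\<^sup>2" using vK \<epsilon> K by (intro power_mono) auto
        then have "M * (norm u)\<^sup>2 \<le> \<mu> * (norm v)\<^sup>2 * (norm u)\<^sup>2"
          unfolding M_def using \<mu> by (intro mult_right_mono) (auto simp: power_mult_distrib)
        then show ?thesis using \<mu>(2)[OF v that] by (simp add: b_def)
      qed
    qed
    then obtain k :: "'a \<Rightarrow> int" and t where kt: "(\<Sum>s\<in>S. of_int (k s) *\<^sub>R b s + \<gamma> s (t s)) = z"
      and t: "\<And>s. s \<in> S \<Longrightarrow> t s \<in> {0..1}"
      and k: "\<And>s. s \<in> S \<Longrightarrow> \<bar>of_int (k s)\<bar> \<le> norm (b s) * ((norm z + m * (2 * c0 ^ 3 * K)) / M) + 1"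
      unfolding m_def by blast
    have kQ: "\<bar>of_int (k s)\<bar> \<le> Q * n" if "s \<in> S" for s
    proof -
      have "norm z + m * (2 * c0 ^ 3 * K) \<le> (A + m * (2 * c0 ^ 3)) * (n * K)"
      proof -
        have "m * (2 * c0 ^ 3) * (1 * K) \<le> m * (2 * c0 ^ 3) * (n * K)" using pos n K
          by (intro mult_left_mono mult_right_mono) auto
        then show ?thesis using z(2) by (simp add: K_def algebra_simps)
      qed
      then have "(norm z + m * (2 * c0 ^ 3 * K)) / M \<le> (A + m * (2 * c0 ^ 3)) * (n * K) / M"
        using M by (intro divide_right_mono) auto
      then have "norm (b s) * ((norm z + m * (2 * c0 ^ 3 * K)) / M) \<le> (c0 ^ 3 * K) * ((A + m * (2 * c0 ^ 3)) * (n * K) / M)"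
        using bn[OF that] pos K M by (intro mult_mono) (auto intro!: divide_nonneg_pos add_nonneg_nonneg)
      also have "\<dots> = (Q - 1) * n" using K \<mu> \<epsilon> by (simp add: Q_def M_def field_simps power2_eq_square)
      finally show ?thesis using k[OF that] n by (simp add: algebra_simps)
    qed
    define i where "i s = nat \<lfloor>j * t s\<rfloor>" for s
    have ij: "i s \<le> j" if "s \<in> S" for s
    proof -
      have "j * t s \<le> j" using t[OF that] by (auto simp: mult_left_le)
      then show ?thesis unfolding i_def by linarith
    qed
    \<comment> \<open>\<open>k s\<close> copies of \<open>s\<close> are carried all the way to
      position \<open>j\<close>. One more copy stops at position \<open>i s\<close>, where it
      realises the fractional part \<open>\<gamma> s (t s)\<close> up to a bounded error.\<close>
    define e where "e l s = (if l = i s then 1 else 0) + (if l = j then k s else 0)" for l s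
    define T where "T l = pw (e l)" for l
    obtain h where h: "h \<in> carrier G" "wl h \<le> length w + 2 * (\<Sum>l\<le>length w. wl (T l))" "\<pi> h = \<pi> (ev w)"
      "\<zeta> h = \<zeta> (ev w) + (\<Sum>l\<le>length w. B (\<pi> (ev (take l w))) (\<pi> (T l)))"
      using insertion[OF w, of T] by (auto simp: T_def)
    have es: "(\<Sum>l\<le>length w. of_int (e l s) *\<^sub>R f l) = f (i s) + of_int (k s) *\<^sub>R f j" if "s \<in> S" for s and f :: "nat \<Rightarrow> 'z"
    proof -
      have "(\<Sum>l\<le>length w. of_int (e l s) *\<^sub>R f l) =
          (\<Sum>l\<le>length w. (if l = i s then f l else 0) + (if l = j then of_int (k s) *\<^sub>R f l else 0))"
        by (intro sum.cong) (auto simp: e_def scaleR_add_left)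
      also have "\<dots> = f (i s) + of_int (k s) *\<^sub>R f j"
        using ij[OF that] j by (simp add: sum.distrib)
      finally show ?thesis .
    qed
    have "(\<Sum>l\<le>length w. B (\<pi> (ev (take l w))) (\<pi> (T l))) =
        (\<Sum>l\<le>length w. \<Sum>s\<in>S. of_int (e l s) *\<^sub>R B (\<pi> (ev (take l w))) (\<pi> s))"
      by (simp add: T_def pi_pw B.sum_right B.scaleR_right)
    also have "\<dots> = (\<Sum>s\<in>S. \<Sum>l\<le>length w. of_int (e l s) *\<^sub>R B (\<pi> (ev (take l w))) (\<pi> s))" by (rule sum.swap)
    also have "\<dots> = (\<Sum>s\<in>S. B (\<pi> (ev (take (i s) w))) (\<pi> s) + of_int (k s) *\<^sub>R b s)"
      by (intro sum.cong refl) (simp add: es b_def v_def)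
    finally have zh: "\<zeta> (ev w) + z - \<zeta> h = (\<Sum>s\<in>S. B (p (t s) - \<pi> (ev (take (i s) w))) (\<pi> s))"
      unfolding h(4) kt[symmetric] by (simp add: \<gamma>_def B.diff_left sum.distrib sum_subtractf)
    have "norm (\<zeta> (ev w) + z - \<zeta> h) \<le> card S * c0 ^ 3" unfolding zh
    proof (rule sum_norm_bound)
      fix s assume s: "s \<in> S"
      have "norm (B (p (t s) - \<pi> (ev (take (i s) w))) (\<pi> s)) \<le> c0 * c0 * c0"
        using near[OF t[OF s] i_def] c0 s by (intro B_le') auto
      then show "norm (B (p (t s) - \<pi> (ev (take (i s) w))) (\<pi> s)) \<le> c0 ^ 3" by (simp add: power3_eq_cube)
    qed
    moreover have "real (wl h) \<le> length w + 2 * m * (Q + 1) * n"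
    proof -
      have "(\<Sum>l\<le>length w. wl (T l)) \<le> (\<Sum>l\<le>length w. \<Sum>s\<in>S. nat \<bar>e l s\<bar>)"
        unfolding T_def by (intro sum_mono wl_pw)
      also have "\<dots> = (\<Sum>s\<in>S. \<Sum>l\<le>length w. nat \<bar>e l s\<bar>)" by (rule sum.swap)
      also have "\<dots> \<le> (\<Sum>s\<in>S. 1 + nat \<bar>k s\<bar>)"
      proof (rule sum_mono)
        fix s assume s: "s \<in> S"
        have "(\<Sum>l\<le>length w. nat \<bar>e l s\<bar>) \<le> (\<Sum>l\<le>length w. (if l = i s then 1 else 0) + (if l = j then nat \<bar>k s\<bar> else 0))"
          by (intro sum_mono) (auto simp: e_def)
        also have "\<dots> = 1 + nat \<bar>k s\<bar>" using ij[OF s] j by (simp add: sum.distrib)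
        finally show "(\<Sum>l\<le>length w. nat \<bar>e l s\<bar>) \<le> 1 + nat \<bar>k s\<bar>" .
      qed
      finally have "real (\<Sum>l\<le>length w. wl (T l)) \<le> real (\<Sum>s\<in>S. 1 + nat \<bar>k s\<bar>)" by (rule of_nat_mono)
      also have "\<dots> = (\<Sum>s\<in>S. 1 + \<bar>of_int (k s)\<bar>)" by simp
      also have "\<dots> \<le> (\<Sum>s\<in>S. (Q + 1) * n)"
        using kQ n by (intro sum_mono) (simp add: algebra_simps add_mono)
      also have "\<dots> = m * (Q + 1) * n" by (simp add: m_def)
      finally have "real (\<Sum>l\<le>length w. wl (T l)) \<le> m * (Q + 1) * n" .
      moreover have "real (wl h) \<le> length w + 2 * real (\<Sum>l\<le>length w. wl (T l))"
        using of_nat_mono[OF h(2), where 'a = real] by simp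
      ultimately show ?thesis by simp
    qed
    moreover have "2 * m * (Q + 1) * n \<le> c * n" using n pos by (intro mult_right_mono) (auto simp: c_def)
    moreover have "card S * c0 ^ 3 \<le> c" using pos Q by (simp add: c_def m_def)
    ultimately show ?thesis using h by (intro bexI[of _ h]) auto
  qed
  then show ?thesis using c by blast
qed

text \<open>Arithmetic and geometric mean with weights. A small \<open>\<delta>\<close> allows the
  term in \<open>a\<close> to be absorbed elsewhere.\<close>

lemma sqrt_mult_le: "0 \<le> a \<Longrightarrow> 0 \<le> b \<Longrightarrow> 0 < \<delta> \<Longrightarrow> sqrt (a * b) \<le> \<delta> * a + b / \<delta>" for a b \<delta> :: real
proof -
  assume a: "0 \<le> a" "0 \<le> b" "0 < \<delta>"
  have "a * b = (\<delta> * a) * (b / \<delta>)" using a by simp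
  also have "sqrt \<dots> \<le> (\<delta> * a + b / \<delta>) / 2" using a by (intro arith_geo_mean_sqrt) auto
  also have "\<dots> \<le> \<delta> * a + b / \<delta>"
  proof -
    have h: "(x + y) / 2 \<le> x + y" if "0 \<le> x" "0 \<le> y" for x y :: real using that by simp
    show ?thesis by (rule h) (use a in simp_all)
  qed
  finally show ?thesis .
qed

text \<open>Let K be the length of \<open>w\<close>. If K is below \<open>n\<close>, the ball-box
  estimate for \<open>u\<close> suffices. If some prefix reaches distance
  \<open>\<epsilon> * K\<close>, \<open>shift_zeta\<close> absorbs \<open>\<zeta> u\<close>. If all
  prefixes stay within \<open>\<epsilon> * K\<close>, then \<open>\<zeta>\<close> of the product is
  small compared with the square of K, and the ball-box estimate for the whole product already gives
  at most K plus a multiple of \<open>n\<close>.\<close>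

lemma wl_near_word:
  assumes A: "0 \<le> A"
  shows "\<exists>c\<ge>0. \<forall>n::real. \<forall>w u. 1 \<le> n \<longrightarrow> set w \<subseteq> S \<longrightarrow> u \<in> carrier G \<longrightarrow> norm (\<pi> u) \<le> A * n \<longrightarrow>
    norm (\<zeta> u) \<le> A * n * (length w + n) \<longrightarrow> wl (ev w \<otimes> u) \<le> length w + c * n"
proof -
  obtain cb where cb: "1 \<le> cb" "\<And>g. g \<in> carrier G \<Longrightarrow> wl g \<le> cb * (norm (\<pi> g) + sqrt (norm (\<zeta> g)) + 1)"
    using ballbox by blast
  \<comment> \<open>These constants make the coefficients of the word length in the last case,
    \<open>cb * \<epsilon>\<close>, \<open>cb * c0 * \<eta>\<close> and
    \<open>cb * \<delta>\<close>, at most 1/4 each.\<close>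
  define \<eta> where "\<eta> = 1 / (4 * cb * c0)"
  define \<epsilon> where "\<epsilon> = \<eta>\<^sup>2"
  define \<delta> where "\<delta> = 1 / (4 * cb)"
  have cc: "1 \<le> cb * c0" using mult_mono[OF cb(1) c0(1)] cb c0 by simp
  have \<eta>: "0 < \<eta>" "\<eta> \<le> 1 / 4" using cb c0 cc by (simp_all add: \<eta>_def field_simps)
  have \<epsilon>': "0 < \<epsilon>" "\<epsilon> \<le> \<eta>" using \<eta> mult_left_mono[of \<eta> 1 \<eta>] by (auto simp: \<epsilon>_def power2_eq_square)
  then have \<epsilon>: "0 < \<epsilon>" "\<epsilon> \<le> \<eta>" "\<epsilon> \<le> 1" using \<eta> by linarith+
  have \<delta>: "0 < \<delta>" using cb by (simp add: \<delta>_def)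
  have cb\<epsilon>: "cb * \<epsilon> \<le> 1 / 4"
  proof -
    have "cb * \<epsilon> \<le> cb * c0 * \<eta>" using \<epsilon> cb c0 \<eta> mult_mono[of \<epsilon> \<eta> 1 c0] by (simp add: algebra_simps)
    also have "\<dots> = 1 / 4" using cb c0 by (simp add: \<eta>_def)
    finally show ?thesis .
  qed
  obtain c3 :: real where c3: "0 \<le> c3" "\<And>(n::real) w j z. 1 \<le> n \<Longrightarrow> set w \<subseteq> S \<Longrightarrow> j \<le> length w \<Longrightarrow>
    \<epsilon> * length w \<le> norm (\<pi> (ev (take j w))) \<Longrightarrow> n \<le> length w \<Longrightarrow> z \<in> Z \<Longrightarrow> norm z \<le> 2 * A * n * length w \<Longrightarrow>
    \<exists>h\<in>carrier G. wl h \<le> length w + c3 * n \<and> \<pi> h = \<pi> (ev w) \<and> norm (\<zeta> (ev w) + z - \<zeta> h) \<le> c3"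
    using shift_zeta[of "2 * A" \<epsilon>] A \<epsilon> by auto
  define C where "C = c0 + 2 * A + c0 * A"
  have C: "0 \<le> C" using A c0 by (simp add: C_def)
  define c1 where "c1 = cb * (A + sqrt (2 * A) + 1)"
  define c2 where "c2 = c3 + cb * (A + sqrt c3 + 1)"
  define c4 where "c4 = cb * (A + C / \<delta> + sqrt C + 1)"
  have cpos: "0 \<le> c1" "0 \<le> c2" "0 \<le> c4" using A cb c3 C \<delta> by (simp_all add: c1_def c2_def c4_def)
  have "wl (ev w \<otimes> u) \<le> length w + (c1 + c2 + c4) * n"
    if n: "1 \<le> n" and w: "set w \<subseteq> S" and u: "u \<in> carrier G" "norm (\<pi> u) \<le> A * n" "norm (\<zeta> u) \<le> A * n * (length w + n)"
    for n :: real and w u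
  proof -
    let ?g = "ev w \<otimes> u"
    define K where "K = real (length w)"
    have K: "0 \<le> K" by (simp add: K_def)
    have g: "?g \<in> carrier G" using w u by simp
    have le: "c1 * n \<le> (c1 + c2 + c4) * n" "c2 * n \<le> (c1 + c2 + c4) * n" "c4 * n \<le> (c1 + c2 + c4) * n"
      using n cpos by (auto intro!: mult_right_mono)
    consider (short) "K < n" | (far) j where "n \<le> K" "j \<le> length w" "\<epsilon> * K \<le> norm (\<pi> (ev (take j w)))"
      | (near) "\<And>j. j \<le> length w \<Longrightarrow> norm (\<pi> (ev (take j w))) \<le> \<epsilon> * K" by fastforce
    then show ?thesis
    proof cases
      case short
      have "norm (\<zeta> u) \<le> A * n * (n + n)"
        using u(3) short A n by (elim order_trans, intro mult_left_mono) (auto simp: K_def)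
      then have "sqrt (norm (\<zeta> u)) \<le> sqrt (2 * A * n\<^sup>2)" by (simp add: power2_eq_square algebra_simps)
      then have s: "sqrt (norm (\<zeta> u)) \<le> sqrt (2 * A) * n" using n by (simp add: real_sqrt_mult)
      have "real (wl ?g) \<le> wl (ev w) + wl u" using wl_mult[of "ev w" u] w u by (simp del: of_nat_add add: of_nat_add[symmetric])
      also have "\<dots> \<le> length w + cb * (norm (\<pi> u) + sqrt (norm (\<zeta> u)) + 1)"
        using wl_ev[OF w] cb(2)[OF u(1)] by linarith
      also have "\<dots> \<le> length w + cb * (A * n + sqrt (2 * A) * n + n)"
        using cb u s n by (intro add_left_mono mult_left_mono add_mono) auto
      also have "\<dots> = length w + c1 * n" by (simp add: c1_def algebra_simps)
      finally show ?thesis using le by linarith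
    next
      case far
      have zu: "norm (\<zeta> u) \<le> 2 * A * n * length w"
      proof -
        have "A * n * (length w + n) \<le> A * n * (length w + length w)" using far A n
          by (intro mult_left_mono) (auto simp: K_def)
        then show ?thesis using u(3) by (simp add: algebra_simps)
      qed
      obtain h where h: "h \<in> carrier G" "wl h \<le> length w + c3 * n" "\<pi> h = \<pi> (ev w)" "norm (\<zeta> (ev w) + \<zeta> u - \<zeta> h) \<le> c3"
        using c3(2)[OF n w far(2) _ _ zetaZ[OF u(1)] zu] far by (auto simp: K_def)
      let ?r = "inv h \<otimes> ?g"
      have r: "?r \<in> carrier G" using h g by simp
      have "\<pi> ?r = \<pi> u" using h(3) u w by (simp add: pi_inv_mult[OF h(1) g]) (simp add: pi_mult)
      moreover have "\<zeta> ?r = \<zeta> (ev w) + \<zeta> u - \<zeta> h"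
        using h(3) u w by (simp add: zeta_inv_mult[OF h(1) g]) (simp add: zeta_mult pi_mult B.add_right)
      ultimately have "wl ?r \<le> cb * (norm (\<pi> u) + sqrt (norm (\<zeta> (ev w) + \<zeta> u - \<zeta> h)) + 1)" using cb(2)[OF r] by simp
      also have "\<dots> \<le> cb * (A * n + sqrt c3 * n + n)"
      proof (intro mult_left_mono add_mono u n)
        have "sqrt (norm (\<zeta> (ev w) + \<zeta> u - \<zeta> h)) \<le> sqrt c3 * 1" using h by simp
        also have "\<dots> \<le> sqrt c3 * n" using n c3 by (intro mult_left_mono) auto
        finally show "sqrt (norm (\<zeta> (ev w) + \<zeta> u - \<zeta> h)) \<le> sqrt c3 * n" .
      qed (use cb in auto)
      finally have r': "wl ?r \<le> cb * (A * n + sqrt c3 * n + n)" .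
      have "?g = h \<otimes> ?r" using h g by (simp add: m_assoc[symmetric])
      then have "real (wl ?g) \<le> wl h + wl ?r" using wl_mult[OF h(1) r] by (simp flip: of_nat_add)
      also have "\<dots> \<le> length w + c2 * n" using h(2) r' by (simp add: c2_def algebra_simps)
      finally show ?thesis using le by linarith
    next
      case near
      let ?h = "ev w"
      have ph: "norm (\<pi> ?h) \<le> \<epsilon> * K" using near[of "length w"] by simp
      have zh: "norm (\<zeta> ?h) \<le> c0 * K + c0 * (\<epsilon> * K) * (c0 * K)" using zeta_ev[OF w, of "\<epsilon> * K"] near by (simp add: K_def)
      have pg: "norm (\<pi> ?g) \<le> \<epsilon> * K + A * n"
        using w u ph norm_triangle_ineq[of "\<pi> ?h" "\<pi> u"] by (simp add: pi_mult)
      have "norm (\<zeta> ?g) \<le> (c0 * \<eta> * K)\<^sup>2 + K * (C * n) + C * n\<^sup>2"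
      proof -
        have "norm (B (\<pi> ?h) (\<pi> u)) \<le> c0 * (\<epsilon> * K) * (A * n)" using ph u by (intro B_le') auto
        also have "\<dots> \<le> c0 * (1 * K) * (A * n)"
          using \<epsilon> c0 A n K by (intro mult_right_mono mult_left_mono) auto
        finally have b: "norm (B (\<pi> ?h) (\<pi> u)) \<le> c0 * A * (K * n)" by (simp add: algebra_simps)
        have "norm (\<zeta> ?g) \<le> norm (\<zeta> ?h) + norm (\<zeta> u) + norm (B (\<pi> ?h) (\<pi> u))"
          using w u norm_triangle_ineq[of "\<zeta> ?h + \<zeta> u" "(1/2) *\<^sub>R B (\<pi> ?h) (\<pi> u)"] norm_triangle_ineq[of "\<zeta> ?h" "\<zeta> u"]
            norm_ge_zero[of "B (\<pi> ?h) (\<pi> u)"] unfolding zeta_mult[OF ev_closed[OF w] u(1)] norm_scaleR by linarith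
        also have "\<dots> \<le> c0 * K + c0 * (\<epsilon> * K) * (c0 * K) + A * n * (K + n) + c0 * A * (K * n)"
          using zh u(3) b by (simp add: K_def)
        also have "\<dots> \<le> c0 * (K * n) + c0 * (\<epsilon> * K) * (c0 * K) + A * n * (K + n) + c0 * A * (K * n)"
          using mult_left_mono[OF mult_left_mono[OF n K], of c0] c0(1) by simp
        also have "\<dots> \<le> (c0 * \<eta> * K)\<^sup>2 + K * (C * n) + C * n\<^sup>2"
          using A c0 n K by (simp add: C_def \<epsilon>_def power2_eq_square algebra_simps)
        finally show ?thesis .
      qed
      then have "sqrt (norm (\<zeta> ?g)) \<le> sqrt ((c0 * \<eta> * K)\<^sup>2 + K * (C * n) + C * n\<^sup>2)" by simp
      also have "\<dots> \<le> sqrt ((c0 * \<eta> * K)\<^sup>2) + sqrt (K * (C * n)) + sqrt (C * n\<^sup>2)"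
        using sqrt_add_le_add_sqrt[of "(c0 * \<eta> * K)\<^sup>2 + K * (C * n)" "C * n\<^sup>2"]
          sqrt_add_le_add_sqrt[of "(c0 * \<eta> * K)\<^sup>2" "K * (C * n)"] C n K by fastforce
      also have "\<dots> \<le> c0 * \<eta> * K + (\<delta> * K + C * n / \<delta>) + sqrt C * n"
        using sqrt_mult_le[OF K _ \<delta>, of "C * n"] C n c0 \<eta> K by (simp add: real_sqrt_mult)
      finally have s: "sqrt (norm (\<zeta> ?g)) \<le> c0 * \<eta> * K + (\<delta> * K + C * n / \<delta>) + sqrt C * n" .
      from pg this n have "norm (\<pi> ?g) + sqrt (norm (\<zeta> ?g)) + 1 \<le>
          (\<epsilon> * K + A * n) + (c0 * \<eta> * K + (\<delta> * K + C * n / \<delta>) + sqrt C * n) + n" by linarith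
      then have "cb * (norm (\<pi> ?g) + sqrt (norm (\<zeta> ?g)) + 1) \<le>
          cb * ((\<epsilon> * K + A * n) + (c0 * \<eta> * K + (\<delta> * K + C * n / \<delta>) + sqrt C * n) + n)"
        using cb by (intro mult_left_mono) auto
      also have "\<dots> = (cb * \<epsilon> + cb * c0 * \<eta> + cb * \<delta>) * K + c4 * n"
        by (simp add: c4_def algebra_simps)
      also have "\<dots> \<le> 1 * K + c4 * n"
      proof (intro add_right_mono mult_right_mono K)
        have "cb * c0 * \<eta> = 1 / 4" "cb * \<delta> = 1 / 4" using cb c0 by (simp_all add: \<eta>_def \<delta>_def)
        then show "cb * \<epsilon> + cb * c0 * \<eta> + cb * \<delta> \<le> 1" using cb\<epsilon> by simp
      qed
      finally have "cb * (norm (\<pi> ?g) + sqrt (norm (\<zeta> ?g)) + 1) \<le> K + c4 * n" by simp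
      then show ?thesis using cb(2)[OF g] le unfolding K_def by linarith
    qed
  qed
  then show ?thesis using cpos by (intro exI[of _ "c1 + c2 + c4"]) auto
qed

end

section \<open>Scaling of the word length\<close>

lemma norm_diff_half: "norm (x - (1/2) *\<^sub>R t) \<le> norm x + norm t" for x t :: "'z::real_normed_vector"
  using norm_triangle_ineq4[of x "(1/2) *\<^sub>R t"] norm_ge_zero[of t] unfolding norm_scaleR by linarith

lemma norm_add_half: "norm (x + (y + (1/2) *\<^sub>R t)) \<le> norm x + norm y + norm t" for x y t :: "'z::real_normed_vector"
  using norm_triangle_ineq[of x "y + (1/2) *\<^sub>R t"] norm_triangle_ineq[of y "(1/2) *\<^sub>R t"] norm_ge_zero[of t]
  unfolding norm_scaleR by linarith

context nilpotent_coords begin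

text \<open>Bilinear terms between different letters scale by exactly \<open>n\<^sup>2\<close>, and
  within a power of one letter they vanish. Only the term \<open>\<zeta> s\<close> of a single
  letter scales by \<open>n\<close> instead, which causes the error.\<close>

lemma zeta_ev_replicate:
  assumes "set w \<subseteq> S" "1 \<le> n"
  defines "v \<equiv> concat (map (replicate n) w)"
  shows "\<pi> (ev v) = real n *\<^sub>R \<pi> (ev w) \<and> norm (\<zeta> (ev v) - (real n)\<^sup>2 *\<^sub>R \<zeta> (ev w)) \<le> (real n)\<^sup>2 * c0 * length w
    \<and> set v \<subseteq> S \<and> length v = n * length w"
  using assms(1) unfolding v_def
proof (induction w)
  case (Cons s w)
  let ?v = "concat (map (replicate n) w)"
  have s: "s \<in> S" "s \<in> carrier G" "set w \<subseteq> S" using Cons.prems S_closed by auto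
  have IH: "\<pi> (ev ?v) = real n *\<^sub>R \<pi> (ev w)" "norm (\<zeta> (ev ?v) - (real n)\<^sup>2 *\<^sub>R \<zeta> (ev w)) \<le> (real n)\<^sup>2 * c0 * length w"
    "set ?v \<subseteq> S" "length ?v = n * length w" using Cons.IH s by auto
  have rep: "ev (replicate n s) = s [^] n" for n
  proof (induction n)
    case (Suc n)
    then have "ev (replicate (Suc n) s) = s \<otimes> s [^] n" by simp
    then show ?case using nat_pow_Suc2[OF s(2), of n] by (simp only:)
  qed simp
  have ev: "ev (replicate n s @ ?v) = s [^] n \<otimes> ev ?v" using s IH by (subst ev_append) (auto simp: rep)
  have "\<zeta> (s [^] n \<otimes> ev ?v) - (real n)\<^sup>2 *\<^sub>R \<zeta> (s \<otimes> ev w) =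
      (real n - (real n)\<^sup>2) *\<^sub>R \<zeta> s + (\<zeta> (ev ?v) - (real n)\<^sup>2 *\<^sub>R \<zeta> (ev w))"
    using s IH by (simp add: zeta_mult zeta_pow pi_pow B.scaleR_left B.scaleR_right power2_eq_square algebra_simps)
  then have "norm (\<zeta> (s [^] n \<otimes> ev ?v) - (real n)\<^sup>2 *\<^sub>R \<zeta> (s \<otimes> ev w)) \<le>
      \<bar>real n - (real n)\<^sup>2\<bar> * norm (\<zeta> s) + norm (\<zeta> (ev ?v) - (real n)\<^sup>2 *\<^sub>R \<zeta> (ev w))"
    by (metis norm_scaleR norm_triangle_ineq)
  also have "\<dots> \<le> (real n)\<^sup>2 * c0 + (real n)\<^sup>2 * c0 * length w"
  proof (intro add_mono mult_mono IH c0 s)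
    have "real n \<le> (real n)\<^sup>2" using assms(2) by (simp add: power2_eq_square)
    then show "\<bar>real n - (real n)\<^sup>2\<bar> \<le> (real n)\<^sup>2" by simp
  qed auto
  finally show ?case using s IH ev by (simp add: pi_mult pi_pow set_replicate_conv_if algebra_simps)
qed simp

text \<open>The dilated word has length \<open>n * wl g\<close>, so the permitted error
  \<open>A * n\<^sup>2 * (wl g + 1)\<close> is of order \<open>n\<close> times this length plus
  \<open>n\<^sup>2\<close>: just what \<open>wl_near_word\<close> absorbs at a cost proportional to
  \<open>n\<close>.\<close>

lemma scaling_upper:
  assumes A: "0 \<le> (A::real)"
  shows "\<exists>c::real. 0 \<le> c \<and> (\<forall>n g g'. 1 \<le> n \<longrightarrow> g \<in> carrier G \<longrightarrow> g' \<in> carrier G \<longrightarrow> norm (\<pi> g' - real n *\<^sub>R \<pi> g) \<le> A * n \<longrightarrow>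
    norm (\<zeta> g' - (real n)\<^sup>2 *\<^sub>R \<zeta> g) \<le> A * (real n)\<^sup>2 * (wl g + 1) \<longrightarrow> wl g' \<le> n * real (wl g) + c * n)"
proof -
  define A' where "A' = A + c0 + c0 * c0 * A"
  have A': "A \<le> A'" "0 \<le> A'" using A c0 by (auto simp: A'_def)
  obtain c :: real where c: "0 \<le> c" "\<And>(n::real) w u. 1 \<le> n \<Longrightarrow> set w \<subseteq> S \<Longrightarrow> u \<in> carrier G \<Longrightarrow> norm (\<pi> u) \<le> A' * n \<Longrightarrow>
      norm (\<zeta> u) \<le> A' * n * (length w + n) \<Longrightarrow> wl (ev w \<otimes> u) \<le> length w + c * n"
    using wl_near_word[OF A'(2)] by auto
  have "wl g' \<le> n * real (wl g) + c * n" if n: "1 \<le> n" and g: "g \<in> carrier G" "g' \<in> carrier G"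
      and P: "norm (\<pi> g' - real n *\<^sub>R \<pi> g) \<le> A * n"
      and Z: "norm (\<zeta> g' - (real n)\<^sup>2 *\<^sub>R \<zeta> g) \<le> A * (real n)\<^sup>2 * (wl g + 1)" for n g g'
  proof -
    obtain w where w: "length w = wl g" "set w \<subseteq> S" "ev w = g" using wl_word g by metis
    define v where "v = concat (map (replicate n) w)"
    have v: "\<pi> (ev v) = real n *\<^sub>R \<pi> g" "norm (\<zeta> (ev v) - (real n)\<^sup>2 *\<^sub>R \<zeta> g) \<le> (real n)\<^sup>2 * c0 * wl g"
      "set v \<subseteq> S" "length v = n * wl g"
      using zeta_ev_replicate[OF w(2) n] w unfolding v_def by auto
    define h where "h = ev v"
    have h: "h \<in> carrier G" using v by (simp add: h_def)
    let ?u = "inv h \<otimes> g'"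
    have pu: "\<pi> ?u = \<pi> g' - real n *\<^sub>R \<pi> g" using h g v by (simp add: pi_inv_mult) (simp add: h_def)
    have "B (\<pi> h) (\<pi> g') = B (\<pi> h) (\<pi> g' - \<pi> h)" by (simp add: B.diff_right)
    also have "norm \<dots> \<le> c0 * (n * (c0 * wl g)) * (A * n)"
    proof (rule B_le')
      show "norm (\<pi> h) \<le> n * (c0 * wl g)" using v(1) pi_bound[OF g(1)] by (simp add: h_def mult_left_mono)
      show "norm (\<pi> g' - \<pi> h) \<le> A * n" using P v(1) by (simp add: h_def)
    qed
    finally have b: "norm (B (\<pi> h) (\<pi> g')) \<le> c0 * c0 * A * ((real n)\<^sup>2 * wl g)" by (simp add: power2_eq_square algebra_simps)
    have "\<zeta> ?u = (\<zeta> g' - (real n)\<^sup>2 *\<^sub>R \<zeta> g) - (\<zeta> h - (real n)\<^sup>2 *\<^sub>R \<zeta> g) - (1/2) *\<^sub>R B (\<pi> h) (\<pi> g')"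
      using h g by (simp add: zeta_inv_mult)
    also have "norm \<dots> \<le> norm (\<zeta> g' - (real n)\<^sup>2 *\<^sub>R \<zeta> g) + norm (\<zeta> h - (real n)\<^sup>2 *\<^sub>R \<zeta> g) + norm (B (\<pi> h) (\<pi> g'))"
      by (intro order_trans[OF norm_diff_half] add_right_mono norm_triangle_ineq4)
    also have "\<dots> \<le> A * (real n)\<^sup>2 * (wl g + 1) + (real n)\<^sup>2 * c0 * wl g + c0 * c0 * A * ((real n)\<^sup>2 * wl g)"
      using Z b v(2) by (simp add: h_def)
    also have "\<dots> \<le> A' * n * (length v + n)"
    proof -
      have "A' * n * (length v + n) = A' * ((real n)\<^sup>2 * wl g) + A' * (real n)\<^sup>2"
        using v(4) by (simp add: power2_eq_square algebra_simps)
      moreover have "A * (real n)\<^sup>2 \<le> A' * (real n)\<^sup>2" using A' by (intro mult_right_mono) auto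
      ultimately show ?thesis by (simp add: A'_def algebra_simps)
    qed
    finally have zu: "norm (\<zeta> ?u) \<le> A' * n * (length v + n)" .
    have "A * n \<le> A' * n" using A' by (intro mult_right_mono) auto
    then have "norm (\<pi> ?u) \<le> A' * n" using pu P by simp
    then have "wl (ev v \<otimes> ?u) \<le> length v + c * n" using n v h g zu by (intro c) auto
    moreover have "ev v \<otimes> ?u = g'" using h g by (simp add: h_def[symmetric] m_assoc[symmetric])
    ultimately show ?thesis using v by simp
  qed
  then show ?thesis using c by blast
qed

text \<open>The path of \<open>thin n t\<close> stays close to \<open>1/n\<close> times the path of \<open>t\<close>.\<close>

primrec thin :: "nat \<Rightarrow> 'a list \<Rightarrow> nat \<Rightarrow> 'a list" where
  "thin n t 0 = []"
| "thin n t (Suc i) = thin n t i @ (if n dvd count_list (take (Suc i) t) (t ! i) then [t ! i] else [])"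

lemma thin_count:
  assumes "i \<le> length t" "1 \<le> n"
  shows "count_list (thin n t i) s = count_list (take i t) s div n"
  using assms(1)
proof (induction i)
  case (Suc i)
  let ?k = "count_list (take i t)"
  have tk: "take (Suc i) t = take i t @ [t ! i]" using Suc.prems by (simp add: take_Suc_conv_app_nth)
  have IH: "count_list (thin n t i) s = ?k s div n" using Suc by simp
  have "Suc (?k s) div n = ?k s div n + (if n dvd Suc (?k s) then 1 else 0)"
    by (simp add: div_Suc dvd_eq_mod_eq_0)
  then show ?case using IH by (auto simp: tk)
qed simp

lemma thin_S: "set t \<subseteq> S \<Longrightarrow> i \<le> length t \<Longrightarrow> set (thin n t i) \<subseteq> S"
  by (induction i) (auto dest: nth_mem)

lemma pi_ev_count:
  assumes "set w \<subseteq> S"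
  shows "\<pi> (ev w) = (\<Sum>s\<in>S. real (count_list w s) *\<^sub>R \<pi> s)"
  using assms
proof (induction w)
  case (Cons a w)
  have "(\<Sum>s\<in>S. real (count_list (a # w) s) *\<^sub>R \<pi> s) = (\<Sum>s\<in>S. real (count_list w s) *\<^sub>R \<pi> s + (if s = a then \<pi> s else 0))"
    by (intro sum.cong) (auto simp: algebra_simps)
  then show ?case using Cons finS by (simp add: pi_mult S_closed sum.distrib)
qed simp

lemma length_count: "set w \<subseteq> S \<Longrightarrow> length w = (\<Sum>s\<in>S. count_list w s)"
  using finS by (simp add: sum_count_set)

text \<open>All errors come from the remainders modulo \<open>n\<close> of the letter counts, one
  for each generator.\<close>

lemma thin_estimates:
  fixes m :: real
  assumes t: "set t \<subseteq> S" and i: "i \<le> length t" and n: "1 \<le> n"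
  defines "m \<equiv> real (card S)"
  shows "norm (\<pi> (ev (take i t)) - real n *\<^sub>R \<pi> (ev (thin n t i))) \<le> n * m * c0" (is ?P)
    and "n * length (thin n t i) \<le> i" (is ?L) and "real i \<le> n * length (thin n t i) + n * m" (is ?U)
proof -
  have S: "set (take i t) \<subseteq> S" "set (thin n t i) \<subseteq> S" using t i thin_S by (auto dest: in_set_takeD)
  let ?k = "\<lambda>s. count_list (take i t) s"
  have mod: "real (?k s) = real n * real (?k s div n) + real (?k s mod n)" for s
    by (metis mult_div_mod_eq of_nat_add of_nat_mult)
  have md: "real (?k s mod n) \<le> n" for s using n by (simp add: less_imp_le)
  have len: "length (take i t) = i" using i by simp
  have "\<pi> (ev (take i t)) - real n *\<^sub>R \<pi> (ev (thin n t i)) = (\<Sum>s\<in>S. real (?k s mod n) *\<^sub>R \<pi> s)"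
  proof -
    have "\<pi> (ev (take i t)) = (\<Sum>s\<in>S. real n *\<^sub>R real (?k s div n) *\<^sub>R \<pi> s + real (?k s mod n) *\<^sub>R \<pi> s)"
      unfolding pi_ev_count[OF S(1)] by (intro sum.cong refl) (subst mod, simp add: scaleR_add_left)
    then show ?thesis unfolding pi_ev_count[OF S(2)] thin_count[OF i n] by (simp add: sum.distrib scaleR_sum_right)
  qed
  also have "norm \<dots> \<le> card S * (n * c0)"
  proof (rule sum_norm_bound)
    fix s assume "s \<in> S"
    then have "real (?k s mod n) * norm (\<pi> s) \<le> n * c0" using md c0 by (intro mult_mono) auto
    then show "norm (real (?k s mod n) *\<^sub>R \<pi> s) \<le> n * c0" by simp
  qed
  finally show ?P by (simp add: m_def algebra_simps)
  have "i = (\<Sum>s\<in>S. ?k s)" using length_count[OF S(1)] len by simp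
  then have "real i = (\<Sum>s\<in>S. real (?k s))" by (metis of_nat_sum)
  also have "\<dots> = n * real (length (thin n t i)) + (\<Sum>s\<in>S. real (?k s mod n))"
    unfolding length_count[OF S(2)] thin_count[OF i n]
    by (subst mod) (simp add: sum.distrib sum_distrib_left)
  finally have e: "real i = n * real (length (thin n t i)) + (\<Sum>s\<in>S. real (?k s mod n))" .
  have "(\<Sum>s\<in>S. real (?k s mod n)) \<le> (\<Sum>s\<in>S. real n)" by (intro sum_mono md)
  then show ?U using e by (simp add: m_def algebra_simps)
  have "0 \<le> (\<Sum>s\<in>S. real (?k s mod n))" by (simp add: sum_nonneg)
  then have "real (n * length (thin n t i)) \<le> real i" using e by simp
  then show ?L by (simp only: of_nat_le_iff)
qed

text \<open>The plain difference of the \<open>\<zeta>\<close>-values cannot be bounded letter by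
  letter: a dropped letter \<open>a\<close> changes it by half of \<open>n\<close> times
  \<open>B (Q i) (\<pi> a)\<close>, which grows with the path. Subtracting half of \<open>n\<close>
  times \<open>B (Q i) (R i)\<close> cancels this drift. The corrected \<open>J\<close> grows by
  O(n) for each letter and by O(n^2) for each kept letter, and at most one letter in
  \<open>n\<close> is kept.\<close>

lemma thin_zeta:
  fixes m :: real
  assumes t: "set t \<subseteq> S" and n: "1 \<le> n"
  defines "m \<equiv> real (card S)"
  shows "norm (\<zeta> (ev t) - (real n)\<^sup>2 *\<^sub>R \<zeta> (ev (thin n t (length t)))) \<le> (2 * c0 + 3 * m * c0 ^ 3) * n * length t"
proof -
  define P where "P i = \<pi> (ev (take i t))" for i
  define Q where "Q i = \<pi> (ev (thin n t i))" for i
  define R where "R i = P i - real n *\<^sub>R Q i" for i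
  define J where "J i = \<zeta> (ev (take i t)) - (real n)\<^sup>2 *\<^sub>R \<zeta> (ev (thin n t i)) - (real n / 2) *\<^sub>R B (Q i) (R i)" for i
  have R: "norm (R i) \<le> n * m * c0" if "i \<le> length t" for i
    using thin_estimates(1)[OF t that n] by (simp add: R_def P_def Q_def m_def)
  have m: "0 \<le> m" by (simp add: m_def)
  let ?b = "\<lambda>i. (c0 + n * m * c0 ^ 3) * i + (n\<^sup>2 * c0 + n\<^sup>2 * m * c0 ^ 3) * length (thin n t i)"
  have J: "norm (J i) \<le> ?b i" if "i \<le> length t" for i
    using that
  proof (induction i)
    case 0
    show ?case by (simp add: J_def Q_def)
  next
    case (Suc i)
    define a where "a = t ! i"
    have "t ! i \<in> set t" using Suc.prems by simp
    then have a: "a \<in> S" "a \<in> carrier G" using t S_closed by (auto simp: a_def)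
    have S: "set (take i t) \<subseteq> S" "set (thin n t i) \<subseteq> S" using t thin_S Suc.prems by (auto dest: in_set_takeD)
    have ev1: "ev (take (Suc i) t) = ev (take i t) \<otimes> a"
      using S a Suc.prems by (simp add: take_Suc_conv_app_nth ev_append a_def)
    have P': "P (Suc i) = P i + \<pi> a" using S a by (simp add: P_def ev1 pi_mult)
    have IH: "norm (J i) \<le> ?b i" using Suc by simp
    have na: "norm (\<pi> a) \<le> c0" "norm (\<zeta> a) \<le> c0" using a c0 by auto
    have RB: "norm (B (R i) (\<pi> a)) \<le> n * m * c0 ^ 3" "norm (B (\<pi> a) (R (Suc i))) \<le> n * m * c0 ^ 3"
      using B_le'[OF R na(1), of i] B_le'[OF na(1) R, of "Suc i"] Suc.prems
      by (simp_all add: power3_eq_cube algebra_simps)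
    have half: "x = (1/2) *\<^sub>R x + (1/2) *\<^sub>R x" for x :: 'z by (simp flip: scaleR_left_distrib)
    show ?case
    proof (cases "n dvd count_list (take (Suc i) t) (t ! i)")
      case False
      then have th: "thin n t (Suc i) = thin n t i" by simp
      have Q': "Q (Suc i) = Q i" unfolding Q_def th ..
      have R': "R (Suc i) = R i + \<pi> a" by (simp add: R_def P' Q')
      have PR: "P i = R i + real n *\<^sub>R Q i" by (simp add: R_def)
      have z1: "\<zeta> (ev (take (Suc i) t)) = \<zeta> (ev (take i t)) + \<zeta> a + (1/2) *\<^sub>R B (P i) (\<pi> a)"
        using S a by (simp add: ev1 zeta_mult P_def)
      have "J (Suc i) = J i + (\<zeta> a + (1/2) *\<^sub>R B (R i) (\<pi> a))"
        unfolding J_def z1 th Q' R' PR by (simp add: B.add_right B.add_left B.scaleR_left algebra_simps)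
      then have "norm (J (Suc i)) \<le> norm (J i) + norm (\<zeta> a) + norm (B (R i) (\<pi> a))"
        using norm_add_half[of "J i" "\<zeta> a"] by simp
      then show ?thesis using IH na RB th by (simp add: algebra_simps)
    next
      case True
      then have th: "thin n t (Suc i) = thin n t i @ [a]" by (simp add: a_def)
      have ev2: "ev (thin n t (Suc i)) = ev (thin n t i) \<otimes> a" unfolding th using S a by (simp add: ev_append)
      have Q': "Q (Suc i) = Q i + \<pi> a" unfolding Q_def ev2 using S a by (simp add: pi_mult)
      have R': "R (Suc i) = R i + \<pi> a - real n *\<^sub>R \<pi> a" by (simp add: R_def P' Q' algebra_simps)
      have PR: "P i = R i + real n *\<^sub>R Q i" by (simp add: R_def)
      have z1: "\<zeta> (ev (take (Suc i) t)) = \<zeta> (ev (take i t)) + \<zeta> a + (1/2) *\<^sub>R B (P i) (\<pi> a)"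
        using S a by (simp add: ev1 zeta_mult P_def)
      have z2: "\<zeta> (ev (thin n t (Suc i))) = \<zeta> (ev (thin n t i)) + \<zeta> a + (1/2) *\<^sub>R B (Q i) (\<pi> a)"
        unfolding ev2 using S a by (simp add: zeta_mult Q_def)
      have JJ: "J (Suc i) = J i + ((1 - (real n)\<^sup>2) *\<^sub>R \<zeta> a + (1/2) *\<^sub>R B (R i) (\<pi> a) - (real n / 2) *\<^sub>R B (\<pi> a) (R (Suc i)))"
        unfolding J_def z1 z2 Q' R' PR
        by (simp add: B.add_right B.add_left B.diff_right B.scaleR_left B.scaleR_right algebra_simps power2_eq_square)
      have "norm (J (Suc i)) \<le> norm (J i) + (norm ((1 - (real n)\<^sup>2) *\<^sub>R \<zeta> a) + norm ((1/2) *\<^sub>R B (R i) (\<pi> a))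
          + norm ((real n / 2) *\<^sub>R B (\<pi> a) (R (Suc i))))"
        unfolding JJ using norm_triangle_ineq norm_triangle_ineq4 by (smt (verit, best))
      also have "\<dots> \<le> ?b i + ((1 + (real n)\<^sup>2) * c0 + n * m * c0 ^ 3 + n * (n * m * c0 ^ 3))"
      proof (intro add_mono IH)
        show "norm ((1 - (real n)\<^sup>2) *\<^sub>R \<zeta> a) \<le> (1 + (real n)\<^sup>2) * c0"
          unfolding norm_scaleR using na by (intro mult_mono) (auto simp: abs_le_iff)
        show "norm ((1/2) *\<^sub>R B (R i) (\<pi> a)) \<le> n * m * c0 ^ 3" using RB(1) norm_ge_zero[of "B (R i) (\<pi> a)"] unfolding norm_scaleR by linarith
        have "norm ((real n / 2) *\<^sub>R B (\<pi> a) (R (Suc i))) \<le> (real n) * norm (B (\<pi> a) (R (Suc i)))"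
          unfolding norm_scaleR by (intro mult_right_mono) auto
        also have "\<dots> \<le> n * (n * m * c0 ^ 3)" using RB by (intro mult_left_mono) auto
        finally show "norm ((real n / 2) *\<^sub>R B (\<pi> a) (R (Suc i))) \<le> n * (n * m * c0 ^ 3)" .
      qed
      also have "\<dots> = ?b (Suc i)" unfolding th by (simp add: power2_eq_square algebra_simps)
      finally show ?thesis .
    qed
  qed
  define l where "l = length t"
  have est: "n * length (thin n t l) \<le> l" using thin_estimates(2)[OF t _ n, of l] by (simp add: l_def)
  have nl: "n * real (length (thin n t l)) \<le> l" using of_nat_mono[OF est, where 'a = real] by simp
  have "norm (B (Q l) (R l)) \<le> c0 * (c0 * length (thin n t l)) * (n * m * c0)"
    using R[of l] pi_ev[of "thin n t l"] thin_S[OF t, of l n] by (intro B_le') (auto simp: l_def Q_def)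
  also have "\<dots> = m * c0 ^ 3 * (n * length (thin n t l))" by (simp add: power3_eq_cube)
  also have "\<dots> \<le> m * c0 ^ 3 * l" using nl m c0 by (intro mult_left_mono) auto
  finally have "norm ((real n / 2) *\<^sub>R B (Q l) (R l)) \<le> (real n / 2) * (m * c0 ^ 3 * l)"
    unfolding norm_scaleR by (intro mult_mono) auto
  also have "\<dots> \<le> n * (m * c0 ^ 3 * l)" using m c0 by (intro mult_right_mono) auto
  finally have b: "norm ((real n / 2) *\<^sub>R B (Q l) (R l)) \<le> n * (m * c0 ^ 3 * l)" .
  have "norm (J l) \<le> ?b l" by (rule J) (simp add: l_def)
  also have "\<dots> \<le> (2 * c0 + 2 * m * c0 ^ 3) * n * l"
  proof -
    have "(n\<^sup>2 * c0 + n\<^sup>2 * m * c0 ^ 3) * length (thin n t l) = (n * c0 + n * m * c0 ^ 3) * (n * length (thin n t l))"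
      by (simp add: power2_eq_square algebra_simps)
    also have "\<dots> \<le> (n * c0 + n * m * c0 ^ 3) * l" using nl m c0 by (intro mult_left_mono) auto
    finally have 1: "(n\<^sup>2 * c0 + n\<^sup>2 * m * c0 ^ 3) * length (thin n t l) \<le> (n * c0 + n * m * c0 ^ 3) * l" .
    have "c0 * l \<le> n * c0 * l" using n c0 by (intro mult_right_mono) auto
    then show ?thesis using 1 by (simp add: algebra_simps)
  qed
  finally have "norm (J l) \<le> (2 * c0 + 2 * m * c0 ^ 3) * n * l" .
  moreover have "\<zeta> (ev t) - (real n)\<^sup>2 *\<^sub>R \<zeta> (ev (thin n t l)) = J l + (real n / 2) *\<^sub>R B (Q l) (R l)"
    by (simp add: J_def l_def)
  ultimately have "norm (\<zeta> (ev t) - (real n)\<^sup>2 *\<^sub>R \<zeta> (ev (thin n t l))) \<le> (2 * c0 + 2 * m * c0 ^ 3) * n * l + n * (m * c0 ^ 3 * l)"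
    using b norm_triangle_ineq[of "J l" "(real n / 2) *\<^sub>R B (Q l) (R l)"] by simp
  then show ?thesis by (simp add: l_def algebra_simps)
qed

text \<open>A shortest word for \<open>g'\<close> is thinned to a word for some \<open>h\<close> of
  length at most \<open>wl g' / n\<close>. Undoing the dilation shows that
  \<open>inv h \<otimes> g\<close> is an admissible error for \<open>wl_near_word\<close> at scale
  1, so \<open>wl g\<close> exceeds that length by a constant only.\<close>

lemma scaling_lower:
  assumes A: "0 \<le> (A::real)"
  shows "\<exists>c::real. 0 \<le> c \<and> (\<forall>n g g'. 1 \<le> n \<longrightarrow> g \<in> carrier G \<longrightarrow> g' \<in> carrier G \<longrightarrow> norm (\<pi> g' - real n *\<^sub>R \<pi> g) \<le> A * n \<longrightarrow>
    norm (\<zeta> g' - (real n)\<^sup>2 *\<^sub>R \<zeta> g) \<le> A * (real n)\<^sup>2 * (wl g + 1) \<longrightarrow> n * real (wl g) \<le> wl g' + c * n)"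
proof -
  obtain cb where cb: "1 \<le> cb" "\<And>g. g \<in> carrier G \<Longrightarrow> wl g \<le> cb * (norm (\<pi> g) + sqrt (norm (\<zeta> g)) + 1)"
    using ballbox by blast
  define m where "m = real (card S)"
  define E where "E = 2 * c0 + 3 * m * c0 ^ 3"
  define D where "D = A + m * c0"
  define \<delta> where "\<delta> = 1 / (2 * cb)"
  have pos: "0 \<le> m" "0 \<le> c0" "0 \<le> E" "0 \<le> D" "0 < \<delta>" using A c0 cb by (auto simp: m_def E_def D_def \<delta>_def)
  define F where "F = c0 + D + sqrt (2 * c0 ^ 3) + A / \<delta> + (A + E * (1 + m) + 1) + 1"
  define C2 where "C2 = 2 * cb * F"
  have C2: "0 \<le> C2" using pos cb A by (simp add: C2_def F_def)
  define A' where "A' = D + A * (C2 + 1) + E * (1 + m) + c0 * c0 * D"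
  have A': "0 \<le> A'" "D \<le> A'" using A pos C2 by (auto simp: A'_def)
  obtain c :: real where c: "0 \<le> c" "\<And>(n::real) w u. 1 \<le> n \<Longrightarrow> set w \<subseteq> S \<Longrightarrow> u \<in> carrier G \<Longrightarrow> norm (\<pi> u) \<le> A' * n \<Longrightarrow>
      norm (\<zeta> u) \<le> A' * n * (length w + n) \<Longrightarrow> wl (ev w \<otimes> u) \<le> length w + c * n"
    using wl_near_word[OF A'(1)] by auto
  have "n * real (wl g) \<le> wl g' + c * n" if n: "1 \<le> n" and g: "g \<in> carrier G" "g' \<in> carrier G"
      and P: "norm (\<pi> g' - real n *\<^sub>R \<pi> g) \<le> A * n"
      and Z: "norm (\<zeta> g' - (real n)\<^sup>2 *\<^sub>R \<zeta> g) \<le> A * (real n)\<^sup>2 * (wl g + 1)" for n g g'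
  proof -
    obtain t where t: "length t = wl g'" "set t \<subseteq> S" "ev t = g'" using wl_word g by metis
    define v where "v = thin n t (length t)"
    define h where "h = ev v"
    define k where "k = real (length v)"
    have v: "set v \<subseteq> S" using thin_S[OF t(2)] by (simp add: v_def)
    have h: "h \<in> carrier G" using v by (simp add: h_def)
    have k0: "0 \<le> k" by (simp add: k_def)
    have n0: "0 < real n" using n by simp
    have est: "norm (\<pi> g' - real n *\<^sub>R \<pi> h) \<le> n * m * c0" "n * length v \<le> wl g'" "real (wl g') \<le> n * k + n * m"
      using thin_estimates[OF t(2) order_refl n] t by (simp_all add: v_def h_def m_def k_def)
    have zt: "norm (\<zeta> g' - (real n)\<^sup>2 *\<^sub>R \<zeta> h) \<le> E * n * wl g'"
      using thin_zeta[OF t(2) n] t by (simp add: v_def h_def m_def E_def)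
    let ?u = "inv h \<otimes> g"
    have "real n * norm (\<pi> g - \<pi> h) = norm ((\<pi> g' - real n *\<^sub>R \<pi> h) - (\<pi> g' - real n *\<^sub>R \<pi> g))"
      by (simp flip: scaleR_diff_right)
    also have "\<dots> \<le> n * m * c0 + A * n" using norm_triangle_ineq4 est(1) P by (meson add_mono order_trans)
    also have "\<dots> = real n * D" by (simp add: D_def algebra_simps)
    finally have pu: "norm (\<pi> g - \<pi> h) \<le> D" using n0 by simp
    have "(real n)\<^sup>2 * norm (\<zeta> g - \<zeta> h) = norm ((\<zeta> g' - (real n)\<^sup>2 *\<^sub>R \<zeta> h) - (\<zeta> g' - (real n)\<^sup>2 *\<^sub>R \<zeta> g))"
      by (simp flip: scaleR_diff_right)
    also have "\<dots> \<le> E * n * wl g' + A * (real n)\<^sup>2 * (wl g + 1)" using norm_triangle_ineq4 zt Z by (meson add_mono order_trans)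
    also have "\<dots> \<le> E * n * (n * k + n * m) + A * (real n)\<^sup>2 * (wl g + 1)"
      using est(3) pos by (intro add_right_mono mult_left_mono) auto
    also have "\<dots> = (real n)\<^sup>2 * (E * (k + m) + A * (wl g + 1))" by (simp add: power2_eq_square algebra_simps)
    finally have zu: "norm (\<zeta> g - \<zeta> h) \<le> E * (k + m) + A * (wl g + 1)" using n0 by simp
    have km: "k + m \<le> (1 + m) * (k + 1)" using k0 pos by (simp add: algebra_simps)
    have hk: "real (wl h) \<le> k" using wl_ev[OF v] by (simp add: h_def k_def)
    have ph: "norm (\<pi> h) \<le> c0 * k" using pi_ev[OF v] by (simp add: h_def k_def)
    have zh: "norm (\<zeta> h) \<le> 2 * c0 ^ 3 * k\<^sup>2"
    proof -
      have "2 * c0 ^ 3 * (real (wl h))\<^sup>2 \<le> 2 * c0 ^ 3 * k\<^sup>2" using hk c0 by (intro mult_left_mono power_mono) auto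
      then show ?thesis using zeta_bound[OF h] by simp
    qed
    \<comment> \<open>The bound on \<open>\<zeta>\<close> contains \<open>wl g\<close> itself. In
      the ball-box estimate this unknown stands under a square root, and
      \<open>\<delta> = 1 / (2 * cb)\<close> lets half of it be absorbed.\<close>
    have wlg: "wl g \<le> C2 * (k + 1)"
    proof -
      have 1: "norm (\<pi> g) \<le> c0 * k + D" using ph pu norm_triangle_ineq[of "\<pi> h" "\<pi> g - \<pi> h"] by simp
      let ?y = "A + E * (k + m)"
      have "norm (\<zeta> g) \<le> 2 * c0 ^ 3 * k\<^sup>2 + wl g * A + ?y"
        using zh zu norm_triangle_ineq[of "\<zeta> h" "\<zeta> g - \<zeta> h"] by (simp add: algebra_simps)
      then have "sqrt (norm (\<zeta> g)) \<le> sqrt (2 * c0 ^ 3 * k\<^sup>2 + wl g * A + ?y)" by simp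
      also have "\<dots> \<le> sqrt (2 * c0 ^ 3 * k\<^sup>2) + sqrt (wl g * A) + sqrt ?y"
      proof -
        have "0 \<le> 2 * c0 ^ 3 * k\<^sup>2" "0 \<le> wl g * A" "0 \<le> ?y" using pos A k0 by simp_all
        then show ?thesis
          using sqrt_add_le_add_sqrt[of "2 * c0 ^ 3 * k\<^sup>2 + wl g * A" ?y] sqrt_add_le_add_sqrt[of "2 * c0 ^ 3 * k\<^sup>2" "wl g * A"] by linarith
      qed
      also have "\<dots> \<le> sqrt (2 * c0 ^ 3) * k + (\<delta> * wl g + A / \<delta>) + (?y + 1)"
      proof (intro add_mono)
        show "sqrt (2 * c0 ^ 3 * k\<^sup>2) \<le> sqrt (2 * c0 ^ 3) * k" using k0 by (simp add: real_sqrt_mult)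
        show "sqrt (wl g * A) \<le> \<delta> * wl g + A / \<delta>" using sqrt_mult_le[of "wl g" A \<delta>] A pos by simp
        have y0: "0 \<le> ?y" using A pos k0 by simp
        have "y \<le> (y + 1)\<^sup>2" if "0 \<le> y" for y :: real
        proof -
          have "y \<le> 1 * (y + 1)" by simp
          also have "\<dots> \<le> (y + 1) * (y + 1)" using that by (intro mult_right_mono) auto
          finally show ?thesis by (simp only: power2_eq_square)
        qed
        from this[OF y0] show "sqrt ?y \<le> ?y + 1" using y0 by (intro real_le_lsqrt) auto
      qed
      finally have 2: "sqrt (norm (\<zeta> g)) \<le> sqrt (2 * c0 ^ 3) * k + (\<delta> * wl g + A / \<delta>) + (?y + 1)" .
      have "c0 * k + D + (sqrt (2 * c0 ^ 3) * k + A / \<delta> + (?y + 1)) + 1 \<le> F * (k + 1)"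
      proof -
        have a: "c0 * k \<le> c0 * (k + 1)" "D * 1 \<le> D * (k + 1)" "sqrt (2 * c0 ^ 3) * k \<le> sqrt (2 * c0 ^ 3) * (k + 1)"
          "A / \<delta> * 1 \<le> A / \<delta> * (k + 1)" "A * 1 \<le> A * (k + 1)"
          using pos A k0 by (intro mult_left_mono; simp)+
        have b: "E * (k + m) \<le> E * ((1 + m) * (k + 1))" using km pos by (intro mult_left_mono) auto
        have "F * (k + 1) = c0 * (k + 1) + D * (k + 1) + sqrt (2 * c0 ^ 3) * (k + 1) + A / \<delta> * (k + 1)
            + (A * (k + 1) + E * ((1 + m) * (k + 1)) + (k + 1)) + (k + 1)" unfolding F_def ring_distribs by simp
        then show ?thesis using a b k0 by linarith
      qed
      then have "norm (\<pi> g) + sqrt (norm (\<zeta> g)) + 1 \<le> F * (k + 1) + \<delta> * wl g" using 1 2 by linarith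
      then have "cb * (norm (\<pi> g) + sqrt (norm (\<zeta> g)) + 1) \<le> cb * (F * (k + 1) + \<delta> * wl g)"
        using cb by (intro mult_left_mono) auto
      then have "wl g \<le> cb * (F * (k + 1) + \<delta> * wl g)" using cb(2)[OF g(1)] by linarith
      also have "\<dots> = C2 * (k + 1) / 2 + wl g / 2" using cb by (simp add: C2_def \<delta>_def field_simps)
      finally show ?thesis by linarith
    qed
    have "B (\<pi> h) (\<pi> g) = B (\<pi> h) (\<pi> g - \<pi> h)" by (simp add: B.diff_right)
    also have "norm \<dots> \<le> c0 * (c0 * k) * D" using ph pu by (rule B_le')
    finally have b: "norm (B (\<pi> h) (\<pi> g)) \<le> c0 * (c0 * k) * D" .
    have "\<zeta> ?u = (\<zeta> g - \<zeta> h) - (1/2) *\<^sub>R B (\<pi> h) (\<pi> g)" using h g by (simp add: zeta_inv_mult)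
    then have "norm (\<zeta> ?u) \<le> norm (\<zeta> g - \<zeta> h) + norm (B (\<pi> h) (\<pi> g))"
      using norm_diff_half[of "\<zeta> g - \<zeta> h"] by simp
    also have "\<dots> \<le> (E * (k + m) + A * (wl g + 1)) + c0 * (c0 * k) * D" using zu b by simp
    also have "\<dots> \<le> A' * (k + 1)"
    proof -
      have "E * (k + m) \<le> E * ((1 + m) * (k + 1))" using km pos by (intro mult_left_mono) auto
      moreover have "A * (wl g + 1) \<le> A * ((C2 + 1) * (k + 1))"
        using wlg A k0 by (intro mult_left_mono) (auto simp: algebra_simps)
      moreover have "c0 * (c0 * k) * D \<le> c0 * c0 * D * (k + 1)" using pos by (simp add: algebra_simps)
      moreover have "0 \<le> D * (k + 1)" using pos k0 by simp
      moreover have "A' * (k + 1) = D * (k + 1) + A * ((C2 + 1) * (k + 1)) + E * ((1 + m) * (k + 1)) + c0 * c0 * D * (k + 1)"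
        unfolding A'_def ring_distribs by simp
      ultimately show ?thesis by linarith
    qed
    finally have "norm (\<zeta> ?u) \<le> A' * 1 * (real (length v) + 1)" by (simp add: k_def)
    moreover have "norm (\<pi> ?u) \<le> A' * 1" using pu A' h g by (simp add: pi_inv_mult)
    ultimately have "wl (ev v \<otimes> ?u) \<le> length v + c * 1" using v h g by (intro c) auto
    moreover have "ev v \<otimes> ?u = g" using h g by (simp add: h_def[symmetric] m_assoc[symmetric])
    ultimately have "real (wl g) \<le> length v + c" by simp
    then have "n * real (wl g) \<le> n * (length v + c)" by (intro mult_left_mono) auto
    also have "\<dots> \<le> wl g' + c * n" using of_nat_mono[OF est(2), where 'a = real] by (simp add: algebra_simps)
    finally show ?thesis .
  qed
  then show ?thesis using c by blast
qed

lemma scaling: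
  assumes A: "0 \<le> (A::real)"
  shows "\<exists>c::real. 0 \<le> c \<and> (\<forall>n g g'. 1 \<le> n \<longrightarrow> g \<in> carrier G \<longrightarrow> g' \<in> carrier G \<longrightarrow> norm (\<pi> g' - real n *\<^sub>R \<pi> g) \<le> A * n \<longrightarrow>
    norm (\<zeta> g' - (real n)\<^sup>2 *\<^sub>R \<zeta> g) \<le> A * (real n)\<^sup>2 * (wl g + 1) \<longrightarrow> \<bar>real (wl g') - n * real (wl g)\<bar> \<le> c * n)"
proof -
  from scaling_upper[OF A] obtain c1 :: real where c1: "0 \<le> c1" and upper: "\<forall>n g g'. 1 \<le> n \<longrightarrow> g \<in> carrier G \<longrightarrow> g' \<in> carrier G \<longrightarrow> norm (\<pi> g' - real n *\<^sub>R \<pi> g) \<le> A * n \<longrightarrow>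
    norm (\<zeta> g' - (real n)\<^sup>2 *\<^sub>R \<zeta> g) \<le> A * (real n)\<^sup>2 * (wl g + 1) \<longrightarrow> wl g' \<le> n * real (wl g) + c1 * n"
    by (elim exE conjE) (rule that)
  from scaling_lower[OF A] obtain c2 :: real where c2: "0 \<le> c2" and lower: "\<forall>n g g'. 1 \<le> n \<longrightarrow> g \<in> carrier G \<longrightarrow> g' \<in> carrier G \<longrightarrow> norm (\<pi> g' - real n *\<^sub>R \<pi> g) \<le> A * n \<longrightarrow>
    norm (\<zeta> g' - (real n)\<^sup>2 *\<^sub>R \<zeta> g) \<le> A * (real n)\<^sup>2 * (wl g + 1) \<longrightarrow> n * real (wl g) \<le> wl g' + c2 * n"
    by (elim exE conjE) (rule that)
  have "\<bar>real (wl g') - n * real (wl g)\<bar> \<le> (c1 + c2) * n"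
    if "1 \<le> n" "g \<in> carrier G" "g' \<in> carrier G" "norm (\<pi> g' - real n *\<^sub>R \<pi> g) \<le> A * n"
      "norm (\<zeta> g' - (real n)\<^sup>2 *\<^sub>R \<zeta> g) \<le> A * (real n)\<^sup>2 * (wl g + 1)" for n g g'
    using upper[rule_format, OF that] lower[rule_format, OF that] mult_nonneg_nonneg[OF c1, of "real n"] mult_nonneg_nonneg[OF c2, of "real n"]
    by (simp add: algebra_simps abs_le_iff)
  then show ?thesis using c1 c2 by (intro exI[of _ "c1 + c2"]) auto
qed

end

section \<open>The limit metric\<close>

context nilpotent_coords begin

text \<open>The bounded quantities are the coordinates of \<open>(v, z)\<^sup>-\<^sup>1 g\<close> in
  the group law on \<open>V \<times> Z\<close>. After \<open>\<pi>\<close> has been matched, an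
  element with vanishing \<open>\<pi>\<close> repairs \<open>\<zeta>\<close> without disturbing
  it.\<close>

lemma approx_point: "\<exists>R\<ge>0. \<forall>v\<in>V. \<forall>z\<in>Z. \<exists>g\<in>carrier G. norm (\<pi> g - v) \<le> R \<and> norm (\<zeta> g - z - (1/2) *\<^sub>R B v (\<pi> g)) \<le> R"
proof -
  obtain c1 where c1: "c1 \<ge> 0" "\<And>v. v \<in> V \<Longrightarrow> \<exists>g\<in>carrier G. norm (\<pi> g - v) \<le> c1 \<and> wl g \<le> c1 * (norm v + 1)"
    using approx_pi by blast
  obtain c2 where c2: "c2 \<ge> 0" "\<And>z. z \<in> Z \<Longrightarrow> \<exists>g\<in>carrier G. \<pi> g = 0 \<and> norm (\<zeta> g - z) \<le> c2 \<and> wl g \<le> c2 * (sqrt (norm z) + 1)"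
    using approx_zeta by blast
  have "\<exists>g\<in>carrier G. norm (\<pi> g - v) \<le> max c1 c2 \<and> norm (\<zeta> g - z - (1/2) *\<^sub>R B v (\<pi> g)) \<le> max c1 c2"
    if v: "v \<in> V" and z: "z \<in> Z" for v z
  proof -
    obtain g1 where g1: "g1 \<in> carrier G" "norm (\<pi> g1 - v) \<le> c1" using c1(2)[OF v] by blast
    have "z + (1/2) *\<^sub>R B v (\<pi> g1) - \<zeta> g1 \<in> Z"
      using subZ z BZ[OF v piV[OF g1(1)]] zetaZ[OF g1(1)] by (intro subspace_diff subspace_add subspace_scale)
    from c2(2)[OF this] obtain g2 where g2: "g2 \<in> carrier G" "\<pi> g2 = 0" "norm (\<zeta> g2 - (z + (1/2) *\<^sub>R B v (\<pi> g1) - \<zeta> g1)) \<le> c2" by blast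
    have e: "\<zeta> (g1 \<otimes> g2) - z - (1/2) *\<^sub>R B v (\<pi> (g1 \<otimes> g2)) = \<zeta> g2 - (z + (1/2) *\<^sub>R B v (\<pi> g1) - \<zeta> g1)"
      using g1 g2 by (simp add: zeta_mult pi_mult algebra_simps)
    have "norm (\<zeta> (g1 \<otimes> g2) - z - (1/2) *\<^sub>R B v (\<pi> (g1 \<otimes> g2))) \<le> max c1 c2"
      unfolding e using g2(3) by simp
    moreover have "norm (\<pi> (g1 \<otimes> g2) - v) \<le> max c1 c2" using g1 g2 by (simp add: pi_mult)
    ultimately show ?thesis using g1 g2 by (intro bexI[of _ "g1 \<otimes> g2"]) auto
  qed
  then show ?thesis using c1 by (intro exI[of _ "max c1 c2"]) auto
qed

definition R0 :: real where
  "R0 = (SOME R. 0 \<le> R \<and> (\<forall>v\<in>V. \<forall>z\<in>Z. \<exists>g\<in>carrier G. norm (\<pi> g - v) \<le> R \<and> norm (\<zeta> g - z - (1/2) *\<^sub>R B v (\<pi> g)) \<le> R))"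

lemma R0: "0 \<le> R0"
  "v \<in> V \<Longrightarrow> z \<in> Z \<Longrightarrow> \<exists>g\<in>carrier G. norm (\<pi> g - v) \<le> R0 \<and> norm (\<zeta> g - z - (1/2) *\<^sub>R B v (\<pi> g)) \<le> R0"
  using someI_ex[OF approx_point] unfolding R0_def[symmetric] by auto

text \<open>
  A group element close to the image of \<open>x\<close> under the dilation \<open>(v, z) \<mapsto> (n v, n\<^sup>2 z)\<close>; the
  \<open>B\<close>-term is what makes closeness invariant under left translation.
\<close>

definition apx :: "nat \<Rightarrow> 'v \<times> 'z \<Rightarrow> 'a" where
  "apx n x = (SOME g. g \<in> carrier G \<and> norm (\<pi> g - real n *\<^sub>R fst x) \<le> R0 \<and>
     norm (\<zeta> g - (real n)\<^sup>2 *\<^sub>R snd x - (1/2) *\<^sub>R B (real n *\<^sub>R fst x) (\<pi> g)) \<le> R0)"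

lemma apx:
  assumes "x \<in> V \<times> Z"
  shows "apx n x \<in> carrier G" "norm (\<pi> (apx n x) - real n *\<^sub>R fst x) \<le> R0"
    "norm (\<zeta> (apx n x) - (real n)\<^sup>2 *\<^sub>R snd x - (1/2) *\<^sub>R B (real n *\<^sub>R fst x) (\<pi> (apx n x))) \<le> R0"
proof -
  have "real n *\<^sub>R fst x \<in> V" "(real n)\<^sup>2 *\<^sub>R snd x \<in> Z" using assms subV subZ by (auto intro: subspace_scale)
  from R0(2)[OF this] have "\<exists>g. g \<in> carrier G \<and> norm (\<pi> g - real n *\<^sub>R fst x) \<le> R0 \<and>
     norm (\<zeta> g - (real n)\<^sup>2 *\<^sub>R snd x - (1/2) *\<^sub>R B (real n *\<^sub>R fst x) (\<pi> g)) \<le> R0" by blast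
  from someI_ex[OF this] show "apx n x \<in> carrier G" "norm (\<pi> (apx n x) - real n *\<^sub>R fst x) \<le> R0"
    "norm (\<zeta> (apx n x) - (real n)\<^sup>2 *\<^sub>R snd x - (1/2) *\<^sub>R B (real n *\<^sub>R fst x) (\<pi> (apx n x))) \<le> R0"
    unfolding apx_def by auto
qed

abbreviation dd :: "nat \<Rightarrow> 'v \<times> 'z \<Rightarrow> 'v \<times> 'z \<Rightarrow> 'a" where
  "dd n x y \<equiv> inv (apx n x) \<otimes> apx n y"

text \<open>The central coordinate of \<open>x\<^sup>-\<^sup>1 y\<close> in the group law of \<open>\<pi>\<close> and \<open>\<zeta>\<close> on \<open>V \<times> Z\<close>.\<close>

definition W :: "'v \<times> 'z \<Rightarrow> 'v \<times> 'z \<Rightarrow> 'z" where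
  "W x y = snd y - snd x - (1/2) *\<^sub>R B (fst x) (fst y)"

lemma dd_closed: "x \<in> V \<times> Z \<Longrightarrow> y \<in> V \<times> Z \<Longrightarrow> dd n x y \<in> carrier G"
  using apx by simp

lemma pi_dd:
  assumes "x \<in> V \<times> Z" "y \<in> V \<times> Z"
  shows "norm (\<pi> (dd n x y) - real n *\<^sub>R (fst y - fst x)) \<le> 2 * R0"
proof -
  have "\<pi> (dd n x y) - real n *\<^sub>R (fst y - fst x) = (\<pi> (apx n y) - real n *\<^sub>R fst y) - (\<pi> (apx n x) - real n *\<^sub>R fst x)"
    using apx assms by (simp add: pi_inv_mult algebra_simps)
  also have "norm \<dots> \<le> R0 + R0" using norm_triangle_ineq4 apx(2) assms by (meson add_mono order_trans)
  finally show ?thesis by simp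
qed

text \<open>Closeness is left invariant, so the positions of \<open>x\<close> and \<open>y\<close>
  cancel and only their displacement enters, linearly in \<open>n\<close>. This is what makes the
  later estimates uniform in \<open>x\<close> and \<open>y\<close>.\<close>

lemma zeta_dd:
  assumes "x \<in> V \<times> Z" "y \<in> V \<times> Z"
  shows "norm (\<zeta> (dd n x y) - (real n)\<^sup>2 *\<^sub>R W x y) \<le> 2 * R0 + c0 * R0\<^sup>2 + c0 * R0 * (n * norm (fst y - fst x))"
proof -
  define v v' z z' where "v = fst x" "v' = fst y" "z = snd x" "z' = snd y"
  define \<alpha> \<alpha>' where "\<alpha> = \<pi> (apx n x) - real n *\<^sub>R v" "\<alpha>' = \<pi> (apx n y) - real n *\<^sub>R v'"
  define \<beta> \<beta>' where "\<beta> = \<zeta> (apx n x) - (real n)\<^sup>2 *\<^sub>R z - (1/2) *\<^sub>R B (real n *\<^sub>R v) (\<pi> (apx n x))"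
    "\<beta>' = \<zeta> (apx n y) - (real n)\<^sup>2 *\<^sub>R z' - (1/2) *\<^sub>R B (real n *\<^sub>R v') (\<pi> (apx n y))"
  note defs = v_v'_z_z'_def
  have p: "\<pi> (apx n x) = real n *\<^sub>R v + \<alpha>" "\<pi> (apx n y) = real n *\<^sub>R v' + \<alpha>'" by (simp_all add: \<alpha>_\<alpha>'_def)
  have q: "\<zeta> (apx n x) = (real n)\<^sup>2 *\<^sub>R z + (1/2) *\<^sub>R B (real n *\<^sub>R v) \<alpha> + \<beta>"
    "\<zeta> (apx n y) = (real n)\<^sup>2 *\<^sub>R z' + (1/2) *\<^sub>R B (real n *\<^sub>R v') \<alpha>' + \<beta>'"
    by (simp_all add: \<beta>_\<beta>'_def p B.add_right B.scaleR_left B.scaleR_right)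
  have R: "norm \<alpha> \<le> R0" "norm \<alpha>' \<le> R0" "norm \<beta> \<le> R0" "norm \<beta>' \<le> R0"
    using apx(2,3)[OF assms(1), of n] apx(2,3)[OF assms(2), of n] unfolding \<alpha>_\<alpha>'_def \<beta>_\<beta>'_def defs by auto
  have "\<zeta> (dd n x y) = \<zeta> (apx n y) - \<zeta> (apx n x) - (1/2) *\<^sub>R B (\<pi> (apx n x)) (\<pi> (apx n y))"
    using apx assms by (simp add: zeta_inv_mult)
  also have "\<dots> = (real n)\<^sup>2 *\<^sub>R W x y + ((\<beta>' - \<beta>) - (1/2) *\<^sub>R B \<alpha> \<alpha>' + (n / 2) *\<^sub>R B (v' - v) (\<alpha> + \<alpha>'))"
    unfolding p q W_def defs[symmetric] using B_skew[of v' \<alpha>]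
    by (simp add: B.add_left B.add_right B.diff_left B.scaleR_left B.scaleR_right power2_eq_square algebra_simps)
  finally have "norm (\<zeta> (dd n x y) - (real n)\<^sup>2 *\<^sub>R W x y) = norm ((\<beta>' - \<beta>) - (1/2) *\<^sub>R B \<alpha> \<alpha>' + (n / 2) *\<^sub>R B (v' - v) (\<alpha> + \<alpha>'))" by simp
  also have "\<dots> \<le> norm (\<beta>' - \<beta>) + norm (B \<alpha> \<alpha>') + norm ((n / 2) *\<^sub>R B (v' - v) (\<alpha> + \<alpha>'))"
    by (intro order_trans[OF norm_triangle_ineq] add_right_mono norm_diff_half)
  also have "\<dots> \<le> 2 * R0 + c0 * R0 * R0 + (n / 2) * (c0 * norm (v' - v) * (2 * R0))"
  proof (intro add_mono)
    show "norm (\<beta>' - \<beta>) \<le> 2 * R0" using norm_triangle_ineq4[of \<beta>' \<beta>] R by linarith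
    show "norm (B \<alpha> \<alpha>') \<le> c0 * R0 * R0" using R by (intro B_le') auto
    have "norm (B (v' - v) (\<alpha> + \<alpha>')) \<le> c0 * norm (v' - v) * (2 * R0)"
      using norm_triangle_ineq[of \<alpha> \<alpha>'] R by (intro B_le') auto
    then show "norm ((n / 2) *\<^sub>R B (v' - v) (\<alpha> + \<alpha>')) \<le> (n / 2) * (c0 * norm (v' - v) * (2 * R0))"
      unfolding norm_scaleR by (intro mult_mono) auto
  qed
  finally show ?thesis by (simp add: defs power2_eq_square algebra_simps)
qed

section \<open>Convergence of the rescaled word metrics\<close>

definition r :: "nat \<Rightarrow> 'v \<times> 'z \<Rightarrow> 'v \<times> 'z \<Rightarrow> real" where "r n x y = wl (dd n x y) / n"

text \<open>The scales \<open>n\<close> and \<open>m\<close> are both compared with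
  \<open>n * m\<close>: \<open>dd (n * m) x y\<close> is close to the \<open>m\<close>-dilate of
  \<open>dd n x y\<close>. The displacement in the error is at most a multiple of the word length
  plus a constant, by \<open>pi_bound\<close>, which brings it into the form that
  \<open>scaling\<close> admits.\<close>

lemma r_cauchy: "\<exists>c\<ge>0. \<forall>n m. \<forall>x\<in>V\<times>Z. \<forall>y\<in>V\<times>Z. 1 \<le> n \<longrightarrow> 1 \<le> m \<longrightarrow> \<bar>r n x y - r m x y\<bar> \<le> c / n + c / m"
proof -
  define A where "A = 4 * R0 + 2 * c0 * R0\<^sup>2 + 2 * c0 * R0 * (c0 + 2 * R0)"
  have A: "0 \<le> A" using R0(1) c0(1) by (simp add: A_def)
  from scaling[OF A] obtain c :: real where c: "0 \<le> c" and sc: "\<forall>n g g'. 1 \<le> n \<longrightarrow> g \<in> carrier G \<longrightarrow> g' \<in> carrier G \<longrightarrow> norm (\<pi> g' - real n *\<^sub>R \<pi> g) \<le> A * n \<longrightarrow>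
    norm (\<zeta> g' - (real n)\<^sup>2 *\<^sub>R \<zeta> g) \<le> A * (real n)\<^sup>2 * (wl g + 1) \<longrightarrow> \<bar>real (wl g') - n * real (wl g)\<bar> \<le> c * n"
    by (elim exE conjE) (rule that)
  have mul: "\<bar>r (n * m) x y - r n x y\<bar> \<le> c / n" if n: "1 \<le> n" and m: "1 \<le> m" and x: "x \<in> V\<times>Z" and y: "y \<in> V\<times>Z" for n m x y
  proof -
    define D where "D = norm (fst y - fst x)"
    have m1: "1 \<le> real m" "1 \<le> (real m)\<^sup>2" "real m \<le> (real m)\<^sup>2"
      using m by (auto simp: one_le_power self_le_power)
    have "\<pi> (dd (n * m) x y) - real m *\<^sub>R \<pi> (dd n x y) = (\<pi> (dd (n * m) x y) - real (n * m) *\<^sub>R (fst y - fst x))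
        - real m *\<^sub>R (\<pi> (dd n x y) - real n *\<^sub>R (fst y - fst x))" by (simp add: algebra_simps)
    also have "norm \<dots> \<le> 2 * R0 + real m * (2 * R0)"
    proof (rule order_trans[OF norm_triangle_ineq4 add_mono[OF pi_dd[OF x y]]])
      show "norm (real m *\<^sub>R (\<pi> (dd n x y) - real n *\<^sub>R (fst y - fst x))) \<le> real m * (2 * R0)"
        unfolding norm_scaleR using pi_dd[OF x y, of n] by (intro mult_mono) auto
    qed
    also have "\<dots> \<le> 4 * R0 * m" using mult_left_mono[OF m1(1) R0(1)] by (simp add: mult.commute)
    also have "\<dots> \<le> A * m" using R0(1) c0(1) by (intro mult_right_mono) (auto simp: A_def)
    finally have 1: "norm (\<pi> (dd (n * m) x y) - real m *\<^sub>R \<pi> (dd n x y)) \<le> A * m" .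
    have nD: "n * D \<le> c0 * wl (dd n x y) + 2 * R0"
    proof -
      have "n * D = norm (real n *\<^sub>R (fst y - fst x))" by (simp add: D_def)
      also have "\<dots> \<le> norm (\<pi> (dd n x y)) + norm (\<pi> (dd n x y) - real n *\<^sub>R (fst y - fst x))"
        using norm_triangle_ineq4[of "\<pi> (dd n x y)" "\<pi> (dd n x y) - real n *\<^sub>R (fst y - fst x)"] by simp
      finally show ?thesis using pi_bound[OF dd_closed[OF x y, of n]] pi_dd[OF x y, of n] by linarith
    qed
    have e: "\<zeta> (dd (n * m) x y) - (real m)\<^sup>2 *\<^sub>R \<zeta> (dd n x y) = (\<zeta> (dd (n * m) x y) - (real (n * m))\<^sup>2 *\<^sub>R W x y)
        - (real m)\<^sup>2 *\<^sub>R (\<zeta> (dd n x y) - (real n)\<^sup>2 *\<^sub>R W x y)" by (simp add: algebra_simps power_mult_distrib)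
    have "norm (\<zeta> (dd (n * m) x y) - (real m)\<^sup>2 *\<^sub>R \<zeta> (dd n x y)) \<le>
        (2 * R0 + c0 * R0\<^sup>2 + c0 * R0 * (real (n * m) * D)) + (real m)\<^sup>2 * (2 * R0 + c0 * R0\<^sup>2 + c0 * R0 * (n * D))"
    proof (unfold D_def e, rule order_trans[OF norm_triangle_ineq4 add_mono[OF zeta_dd[OF x y]]])
      show "norm ((real m)\<^sup>2 *\<^sub>R (\<zeta> (dd n x y) - (real n)\<^sup>2 *\<^sub>R W x y)) \<le>
          (real m)\<^sup>2 * (2 * R0 + c0 * R0\<^sup>2 + c0 * R0 * (n * norm (fst y - fst x)))"
        unfolding norm_scaleR using zeta_dd[OF x y, of n] by (intro mult_mono) auto
    qed
    also have "\<dots> \<le> (real m)\<^sup>2 * (4 * R0 + 2 * c0 * R0\<^sup>2 + 2 * c0 * R0 * (n * D))"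
    proof -
      have "(2 * R0 + c0 * R0\<^sup>2) * 1 \<le> (2 * R0 + c0 * R0\<^sup>2) * (real m)\<^sup>2"
        by (rule mult_left_mono[OF m1(2)]) (use R0(1) c0(1) in simp)
      moreover have "c0 * R0 * (n * D) * real m \<le> c0 * R0 * (n * D) * (real m)\<^sup>2"
        by (rule mult_left_mono[OF m1(3)]) (use R0(1) c0(1) in \<open>simp add: D_def\<close>)
      ultimately show ?thesis by (simp add: algebra_simps)
    qed
    also have "\<dots> \<le> (real m)\<^sup>2 * (A * (wl (dd n x y) + 1))"
    proof (rule mult_left_mono)
      let ?w = "real (wl (dd n x y))"
      have "2 * c0 * R0 * (n * D) \<le> 2 * c0 * R0 * (c0 * ?w + 2 * R0)" using nD R0(1) c0(1) by (intro mult_left_mono) auto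
      also have "\<dots> \<le> 2 * c0 * R0 * ((c0 + 2 * R0) * (?w + 1))"
        using R0(1) c0(1) by (intro mult_left_mono) (auto simp: algebra_simps)
      finally have h1: "2 * c0 * R0 * (n * D) \<le> 2 * c0 * R0 * ((c0 + 2 * R0) * (?w + 1))" .
      have h2: "(4 * R0 + 2 * c0 * R0\<^sup>2) * 1 \<le> (4 * R0 + 2 * c0 * R0\<^sup>2) * (?w + 1)"
        using R0(1) c0(1) by (intro mult_left_mono) auto
      have h3: "A * (?w + 1) = (4 * R0 + 2 * c0 * R0\<^sup>2) * (?w + 1) + 2 * c0 * R0 * ((c0 + 2 * R0) * (?w + 1))"
        unfolding A_def ring_distribs by simp
      show "4 * R0 + 2 * c0 * R0\<^sup>2 + 2 * c0 * R0 * (n * D) \<le> A * (wl (dd n x y) + 1)"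
        unfolding of_nat_add of_nat_1 h3 by (rule add_mono[OF h2[unfolded mult_1_right] h1])
    qed simp
    finally have 2: "norm (\<zeta> (dd (n * m) x y) - (real m)\<^sup>2 *\<^sub>R \<zeta> (dd n x y)) \<le> A * (real m)\<^sup>2 * (wl (dd n x y) + 1)"
      by (simp add: algebra_simps)
    have "\<bar>real (wl (dd (n * m) x y)) - m * real (wl (dd n x y))\<bar> \<le> c * m"
      using sc[rule_format, OF m dd_closed[OF x y] dd_closed[OF x y] 1 2] .
    then have "\<bar>real (wl (dd (n * m) x y)) - m * real (wl (dd n x y))\<bar> / (real n * real m) \<le> c * m / (real n * real m)"
      by (intro divide_right_mono) auto
    moreover have "\<bar>real (wl (dd (n * m) x y)) - m * real (wl (dd n x y))\<bar> / (real n * real m) = \<bar>r (n * m) x y - r n x y\<bar>"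
      using n m unfolding r_def by (simp add: diff_divide_distrib flip: abs_divide) (simp add: field_simps abs_mult)
    ultimately show ?thesis using m by simp
  qed
  have "\<bar>r n x y - r m x y\<bar> \<le> c / n + c / m" if "1 \<le> n" "1 \<le> m" "x \<in> V\<times>Z" "y \<in> V\<times>Z" for n m x y
    using mul[OF that] mul[OF that(2,1,3,4)] by (simp add: mult.commute)
  then show ?thesis using c by blast
qed

text \<open>The default 0 keeps \<open>cd\<close> nonnegative and symmetric on the whole type, as
  \<open>Metric_space\<close> demands.\<close>

definition cd :: "'v \<times> 'z \<Rightarrow> 'v \<times> 'z \<Rightarrow> real" where
  "cd x y = (if x \<in> V \<times> Z \<and> y \<in> V \<times> Z then lim (\<lambda>n. r n x y) else 0)"

lemma r_cd:
  shows "\<exists>c\<ge>0. \<forall>n. \<forall>x\<in>V\<times>Z. \<forall>y\<in>V\<times>Z. 1 \<le> n \<longrightarrow> \<bar>r n x y - cd x y\<bar> \<le> c / n"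
    and r_lim: "x \<in> V\<times>Z \<Longrightarrow> y \<in> V\<times>Z \<Longrightarrow> (\<lambda>n. r n x y) \<longlonglongrightarrow> cd x y"
proof -
  obtain c where c: "0 \<le> c" "\<And>n m x y. 1 \<le> n \<Longrightarrow> 1 \<le> m \<Longrightarrow> x \<in> V\<times>Z \<Longrightarrow> y \<in> V\<times>Z \<Longrightarrow> \<bar>r n x y - r m x y\<bar> \<le> c / n + c / m"
    using r_cauchy by blast
  show lim: "(\<lambda>n. r n x y) \<longlonglongrightarrow> cd x y" if xy: "x \<in> V\<times>Z" "y \<in> V\<times>Z" for x y
  proof -
    have "Cauchy (\<lambda>n. r n x y)"
    proof (rule metric_CauchyI)
      fix e :: real assume e: "0 < e"
      obtain M :: nat where M: "2 * c / e < M" using reals_Archimedean2 by blast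
      have "dist (r m x y) (r n x y) < e" if "m \<ge> Suc M" "n \<ge> Suc M" for m n
      proof -
        have lt: "c / k < e / 2" if "k \<ge> Suc M" for k :: nat
        proof -
          have "2 * c / e < k" using M that by linarith
          then have "2 * c < e * k" using e by (simp add: field_simps)
          moreover have "0 < real k" using that by simp
          ultimately show ?thesis by (simp add: field_simps)
        qed
        have "\<bar>r m x y - r n x y\<bar> \<le> c / m + c / n" using c(2)[of m n x y] that xy by simp
        then show ?thesis using lt[of m] lt[of n] that unfolding dist_real_def by linarith
      qed
      then show "\<exists>M. \<forall>m\<ge>M. \<forall>n\<ge>M. dist (r m x y) (r n x y) < e" by blast
    qed
    then show ?thesis using xy by (simp add: cd_def Cauchy_convergent_iff convergent_LIMSEQ_iff)
  qed
  have "\<bar>r n x y - cd x y\<bar> \<le> c / n" if n: "1 \<le> n" and xy: "x \<in> V\<times>Z" "y \<in> V\<times>Z" for n x y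
  proof (rule LIMSEQ_le)
    show "(\<lambda>m. \<bar>r n x y - r m x y\<bar>) \<longlonglongrightarrow> \<bar>r n x y - cd x y\<bar>"
      by (intro tendsto_intros lim xy)
    show "(\<lambda>m. c / n + c / real m) \<longlonglongrightarrow> c / n"
      using tendsto_add[OF tendsto_const[of "c / n"] lim_const_over_n[of c]] by simp
    show "\<exists>M. \<forall>m\<ge>M. \<bar>r n x y - r m x y\<bar> \<le> c / n + c / real m" using c(2)[OF n _ xy] by blast
  qed
  then show "\<exists>c\<ge>0. \<forall>n. \<forall>x\<in>V\<times>Z. \<forall>y\<in>V\<times>Z. 1 \<le> n \<longrightarrow> \<bar>r n x y - cd x y\<bar> \<le> c / n"
    using c(1) by blast
qed

section \<open>The limit is a proper metric\<close>

lemma r_nonneg: "0 \<le> r n x y" by (simp add: r_def)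

lemma r_commute:
  assumes "x \<in> V\<times>Z" "y \<in> V\<times>Z" shows "r n x y = r n y x"
proof -
  have "dd n x y = inv (dd n y x)" using apx assms by (simp add: inv_mult_group)
  then show ?thesis using wl_inv[OF dd_closed[OF assms(2,1), of n]] by (simp add: r_def)
qed

lemma r_triangle:
  assumes "x \<in> V\<times>Z" "y \<in> V\<times>Z" "u \<in> V\<times>Z" shows "r n x u \<le> r n x y + r n y u"
proof -
  have "dd n x u = dd n x y \<otimes> dd n y u"
    using apx assms by (simp add: m_assoc) (simp add: m_assoc[symmetric])
  then have "wl (dd n x u) \<le> wl (dd n x y) + wl (dd n y u)"
    using wl_mult[OF dd_closed dd_closed] assms by metis
  then have "real (wl (dd n x u)) \<le> real (wl (dd n x y)) + real (wl (dd n y u))" by (simp flip: of_nat_add)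
  then show ?thesis by (simp add: r_def divide_right_mono flip: add_divide_distrib)
qed

lemma cd_fst_bound:
  assumes "x \<in> V\<times>Z" "y \<in> V\<times>Z" shows "norm (fst y - fst x) \<le> c0 * cd x y"
proof (rule LIMSEQ_le)
  show "(\<lambda>n. norm (fst y - fst x)) \<longlonglongrightarrow> norm (fst y - fst x)" by (rule tendsto_const)
  show "(\<lambda>n. c0 * r n x y + 2 * R0 / real n) \<longlonglongrightarrow> c0 * cd x y"
    using tendsto_add[OF tendsto_mult[OF tendsto_const r_lim[OF assms]] lim_const_over_n[of "2 * R0"]] by simp
  have "norm (fst y - fst x) \<le> c0 * r n x y + 2 * R0 / n" if "1 \<le> n" for n
  proof -
    have "n * norm (fst y - fst x) = norm (real n *\<^sub>R (fst y - fst x))" by simp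
    also have "\<dots> \<le> norm (\<pi> (dd n x y)) + norm (\<pi> (dd n x y) - real n *\<^sub>R (fst y - fst x))"
      using norm_triangle_ineq4[of "\<pi> (dd n x y)" "\<pi> (dd n x y) - real n *\<^sub>R (fst y - fst x)"] by simp
    also have "\<dots> \<le> c0 * wl (dd n x y) + 2 * R0"
      using pi_bound[OF dd_closed[OF assms, of n]] pi_dd[OF assms, of n] by linarith
    finally show ?thesis using that by (simp add: r_def field_simps)
  qed
  then show "\<exists>N. \<forall>n\<ge>N. norm (fst y - fst x) \<le> c0 * r n x y + 2 * R0 / n" by blast
qed

lemma zeta_err_lim: "(\<lambda>n. (2 * R0 + c0 * R0\<^sup>2 + c0 * R0 * (real n * D)) / (real n)\<^sup>2) \<longlonglongrightarrow> 0"
proof -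
  have "(\<lambda>n. (2 * R0 + c0 * R0\<^sup>2) * (1 / real n * (1 / real n)) + c0 * R0 * D * (1 / real n)) \<longlonglongrightarrow>
      (2 * R0 + c0 * R0\<^sup>2) * (0 * 0) + c0 * R0 * D * 0"
    by (intro tendsto_intros lim_const_over_n)
  moreover have "\<forall>\<^sub>F n in sequentially. (2 * R0 + c0 * R0\<^sup>2) * (1 / real n * (1 / real n)) + c0 * R0 * D * (1 / real n) =
      (2 * R0 + c0 * R0\<^sup>2 + c0 * R0 * (real n * D)) / (real n)\<^sup>2"
    using eventually_gt_at_top[of 0] by eventually_elim (simp add: field_simps power2_eq_square)
  ultimately show ?thesis by (simp add: tendsto_cong)
qed

lemma cd_W_bound:
  assumes "x \<in> V\<times>Z" "y \<in> V\<times>Z" shows "norm (W x y) \<le> 2 * c0 ^ 3 * (cd x y)\<^sup>2"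
proof (rule LIMSEQ_le)
  let ?e = "\<lambda>n. (2 * R0 + c0 * R0\<^sup>2 + c0 * R0 * (real n * norm (fst y - fst x)))"
  show "(\<lambda>n. norm (W x y)) \<longlonglongrightarrow> norm (W x y)" by (rule tendsto_const)
  show "(\<lambda>n. 2 * c0 ^ 3 * (r n x y)\<^sup>2 + ?e n / (real n)\<^sup>2) \<longlonglongrightarrow> 2 * c0 ^ 3 * (cd x y)\<^sup>2"
    using tendsto_add[OF tendsto_mult[OF tendsto_const tendsto_power[OF r_lim[OF assms]]] zeta_err_lim] by simp
  have "norm (W x y) \<le> 2 * c0 ^ 3 * (r n x y)\<^sup>2 + ?e n / (real n)\<^sup>2" if "1 \<le> n" for n
  proof -
    have "(real n)\<^sup>2 * norm (W x y) = norm ((real n)\<^sup>2 *\<^sub>R W x y)" by simp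
    also have "\<dots> \<le> norm (\<zeta> (dd n x y)) + norm (\<zeta> (dd n x y) - (real n)\<^sup>2 *\<^sub>R W x y)"
      using norm_triangle_ineq4[of "\<zeta> (dd n x y)" "\<zeta> (dd n x y) - (real n)\<^sup>2 *\<^sub>R W x y"] by simp
    also have "\<dots> \<le> 2 * c0 ^ 3 * (real (wl (dd n x y)))\<^sup>2 + ?e n"
      using zeta_bound[OF dd_closed[OF assms, of n]] zeta_dd[OF assms, of n] by linarith
    finally show ?thesis using that by (simp add: r_def field_simps)
  qed
  then show "\<exists>N. \<forall>n\<ge>N. norm (W x y) \<le> 2 * c0 ^ 3 * (r n x y)\<^sup>2 + ?e n / (real n)\<^sup>2" by blast
qed

text \<open>The additive constant of the ball-box estimate disappears in the limit. With
  \<open>cd_fst_bound\<close> and \<open>cd_W_bound\<close> this makes \<open>cd\<close> comparable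
  to a homogeneous norm of \<open>x\<^sup>-\<^sup>1 y\<close>, from which definiteness and
  properness follow.\<close>

lemma cd_upper: "\<exists>c\<ge>0. \<forall>x\<in>V\<times>Z. \<forall>y\<in>V\<times>Z. cd x y \<le> c * (norm (fst y - fst x) + sqrt (norm (W x y)))"
proof -
  obtain cb where cb: "1 \<le> cb" "\<And>g. g \<in> carrier G \<Longrightarrow> wl g \<le> cb * (norm (\<pi> g) + sqrt (norm (\<zeta> g)) + 1)"
    using ballbox by blast
  have "cd x y \<le> cb * (norm (fst y - fst x) + sqrt (norm (W x y)))" if xy: "x \<in> V\<times>Z" "y \<in> V\<times>Z" for x y
  proof (rule LIMSEQ_le)
    let ?D = "norm (fst y - fst x)"
    let ?e = "\<lambda>n. (2 * R0 + c0 * R0\<^sup>2 + c0 * R0 * (real n * ?D))"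
    show "(\<lambda>n. r n x y) \<longlonglongrightarrow> cd x y" by (rule r_lim[OF xy])
    have "(\<lambda>n. cb * ((?D + 2 * R0 / n) + sqrt (norm (W x y) + ?e n / (real n)\<^sup>2) + 1 / n)) \<longlonglongrightarrow>
        cb * ((?D + 0) + sqrt (norm (W x y) + 0) + 0)"
      by (intro tendsto_intros lim_const_over_n zeta_err_lim)
    then show "(\<lambda>n. cb * ((?D + 2 * R0 / n) + sqrt (norm (W x y) + ?e n / (real n)\<^sup>2) + 1 / n)) \<longlonglongrightarrow> cb * (?D + sqrt (norm (W x y)))" by simp
    have "r n x y \<le> cb * ((?D + 2 * R0 / n) + sqrt (norm (W x y) + ?e n / (real n)\<^sup>2) + 1 / n)" if n: "1 \<le> n" for n
    proof -
      have "norm (\<pi> (dd n x y)) \<le> n * ?D + 2 * R0"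
        using norm_triangle_ineq[of "real n *\<^sub>R (fst y - fst x)" "\<pi> (dd n x y) - real n *\<^sub>R (fst y - fst x)"] pi_dd[OF xy, of n] by simp
      then have 1: "norm (\<pi> (dd n x y)) / n \<le> ?D + 2 * R0 / n" using n by (simp add: field_simps)
      have "norm (\<zeta> (dd n x y)) \<le> (real n)\<^sup>2 * norm (W x y) + ?e n"
        using norm_triangle_ineq[of "(real n)\<^sup>2 *\<^sub>R W x y" "\<zeta> (dd n x y) - (real n)\<^sup>2 *\<^sub>R W x y"] zeta_dd[OF xy, of n] by simp
      then have "norm (\<zeta> (dd n x y)) / (real n)\<^sup>2 \<le> norm (W x y) + ?e n / (real n)\<^sup>2" using n by (simp add: field_simps)
      then have "sqrt (norm (\<zeta> (dd n x y)) / (real n)\<^sup>2) \<le> sqrt (norm (W x y) + ?e n / (real n)\<^sup>2)" by simp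
      then have 2: "sqrt (norm (\<zeta> (dd n x y))) / n \<le> sqrt (norm (W x y) + ?e n / (real n)\<^sup>2)" by (simp add: real_sqrt_divide)
      have "r n x y \<le> cb * (norm (\<pi> (dd n x y)) + sqrt (norm (\<zeta> (dd n x y))) + 1) / n"
        unfolding r_def using cb(2)[OF dd_closed[OF xy]] by (intro divide_right_mono) auto
      also have "\<dots> = cb * (norm (\<pi> (dd n x y)) / n + sqrt (norm (\<zeta> (dd n x y))) / n + 1 / n)"
        by (simp only: add_divide_distrib[symmetric] times_divide_eq_right)
      also have "\<dots> \<le> cb * ((?D + 2 * R0 / n) + sqrt (norm (W x y) + ?e n / (real n)\<^sup>2) + 1 / n)"
        using 1 2 cb(1) by (intro mult_left_mono add_mono) auto
      finally show ?thesis .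
    qed
    then show "\<exists>N. \<forall>n\<ge>N. r n x y \<le> cb * ((?D + 2 * R0 / n) + sqrt (norm (W x y) + ?e n / (real n)\<^sup>2) + 1 / n)" by blast
  qed
  then show ?thesis using cb(1) by (intro exI[of _ cb]) auto
qed

lemma Metric_cd: "Metric_space (V \<times> Z) cd"
proof
  fix x y u
  show "0 \<le> cd x y"
    using LIMSEQ_le_const[OF r_lim[of x y], of 0] r_nonneg by (cases "x \<in> V\<times>Z \<and> y \<in> V\<times>Z") (auto simp: cd_def)
  show "cd x y = cd y x"
    using r_commute[of x y] by (auto simp: cd_def)
  show "cd x u \<le> cd x y + cd y u" if "x \<in> V \<times> Z" "y \<in> V \<times> Z" "u \<in> V \<times> Z"
    by (rule LIMSEQ_le[OF r_lim tendsto_add[OF r_lim r_lim]]) (use that r_triangle in auto)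
  show "(cd x y = 0) = (x = y)" if xy: "x \<in> V \<times> Z" "y \<in> V \<times> Z"
  proof
    assume 0: "cd x y = 0"
    have 1: "fst x = fst y" using cd_fst_bound[OF xy] 0 by simp
    have "W x y = 0" using cd_W_bound[OF xy] 0 by simp
    then have "snd x = snd y" by (simp add: W_def 1)
    with 1 show "x = y" by (simp add: prod_eq_iff)
  next
    assume "x = y"
    obtain c where "cd x x \<le> c * (norm (fst x - fst x) + sqrt (norm (W x x)))" using cd_upper xy by blast
    then have "cd x x \<le> 0" by (simp add: W_def)
    moreover have "0 \<le> cd x x" using LIMSEQ_le_const[OF r_lim[of x x], of 0] r_nonneg xy by auto
    ultimately show "cd x y = 0" using \<open>x = y\<close> by simp
  qed
qed

lemma proper_cd: "proper_metric (V \<times> Z) cd"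
proof -
  interpret M: Metric_space "V \<times> Z" cd by (rule Metric_cd)
  have "compactin M.mtopology (M.mcball x R)" if x: "x \<in> V \<times> Z" for x R
    unfolding M.compactin_sequentially
  proof (intro conjI allI impI)
    show "M.mcball x R \<subseteq> V \<times> Z" by auto
    fix \<sigma> :: "nat \<Rightarrow> 'v \<times> 'z" assume "range \<sigma> \<subseteq> M.mcball x R"
    then have "\<sigma> k \<in> M.mcball x R" for k by blast
    then have \<sigma>: "\<sigma> k \<in> V \<times> Z" "cd x (\<sigma> k) \<le> R" for k by (auto simp only: M.in_mcball)
    have R: "0 \<le> R" using \<sigma>(2)[of 0] M.nonneg[of x "\<sigma> 0"] by linarith
    have bf: "norm (fst (\<sigma> k)) \<le> norm (fst x) + c0 * R" for k
    proof -
      have "norm (fst (\<sigma> k) - fst x) \<le> c0 * R"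
        using cd_fst_bound[OF x \<sigma>(1)[of k]] mult_left_mono[OF \<sigma>(2)[of k], of c0] c0(1) by linarith
      then show ?thesis using norm_triangle_ineq2[of "fst (\<sigma> k)" "fst x"] by simp
    qed
    have bs: "norm (snd (\<sigma> k)) \<le> norm (snd x) + 2 * c0 ^ 3 * R\<^sup>2 + c0 * norm (fst x) * (norm (fst x) + c0 * R)" for k
    proof -
      have "norm (W x (\<sigma> k)) \<le> 2 * c0 ^ 3 * (cd x (\<sigma> k))\<^sup>2" by (rule cd_W_bound[OF x \<sigma>(1)])
      also have "\<dots> \<le> 2 * c0 ^ 3 * R\<^sup>2" using \<sigma>(2)[of k] c0(1) by (intro mult_left_mono power_mono) auto
      finally have w: "norm (W x (\<sigma> k)) \<le> 2 * c0 ^ 3 * R\<^sup>2" .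
      have b: "norm (B (fst x) (fst (\<sigma> k))) \<le> c0 * norm (fst x) * (norm (fst x) + c0 * R)" using bf by (intro B_le') auto
      have "snd (\<sigma> k) = snd x + (W x (\<sigma> k) + (1/2) *\<^sub>R B (fst x) (fst (\<sigma> k)))" by (simp add: W_def)
      then have "norm (snd (\<sigma> k)) \<le> norm (snd x) + norm (W x (\<sigma> k)) + norm (B (fst x) (fst (\<sigma> k)))"
        using norm_add_half by metis
      then show ?thesis using w b by linarith
    qed
    \<comment> \<open>A bounded set for \<open>cd\<close> has bounded coordinates, so a Euclidean
      limit exists along a subsequence; \<open>cd_upper\<close> turns it into a limit for
      \<open>cd\<close>.\<close>
    define K where "K = (V \<inter> cball 0 (norm (fst x) + c0 * R)) \<times>
        (Z \<inter> cball 0 (norm (snd x) + 2 * c0 ^ 3 * R\<^sup>2 + c0 * norm (fst x) * (norm (fst x) + c0 * R)))"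
    have "compact K" unfolding K_def using subV subZ by (intro compact_Times) (auto simp: closed_Int_compact closed_subspace)
    moreover have "\<forall>k. \<sigma> k \<in> K" unfolding K_def using \<sigma>(1) bf bs by (auto simp: mem_Times_iff)
    ultimately obtain l \<rho> where l: "l \<in> K" "strict_mono \<rho>" "(\<sigma> \<circ> \<rho>) \<longlonglongrightarrow> l"
      unfolding compact_def by blast
    have lVZ: "l \<in> V \<times> Z" using l by (auto simp: K_def)
    obtain c where c: "0 \<le> c" "\<And>x y. x \<in> V\<times>Z \<Longrightarrow> y \<in> V\<times>Z \<Longrightarrow> cd x y \<le> c * (norm (fst y - fst x) + sqrt (norm (W x y)))"
      using cd_upper by blast
    have f: "(\<lambda>k. fst (\<sigma> (\<rho> k))) \<longlonglongrightarrow> fst l" "(\<lambda>k. snd (\<sigma> (\<rho> k))) \<longlonglongrightarrow> snd l"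
      using tendsto_fst[OF l(3)] tendsto_snd[OF l(3)] by (simp_all add: comp_def)
    have "(\<lambda>k. c * (norm (fst l - fst (\<sigma> (\<rho> k))) + sqrt (norm (W (\<sigma> (\<rho> k)) l)))) \<longlonglongrightarrow> c * (norm (fst l - fst l) + sqrt (norm (snd l - snd l - (1/2) *\<^sub>R B (fst l) (fst l))))"
      unfolding W_def by (intro tendsto_intros f B.tendsto)
    then have up: "(\<lambda>k. c * (norm (fst l - fst (\<sigma> (\<rho> k))) + sqrt (norm (W (\<sigma> (\<rho> k)) l)))) \<longlonglongrightarrow> 0"
      by (simp only: B_alt diff_self scaleR_zero_right norm_zero real_sqrt_zero add_0_right mult_zero_right)
    have cd0: "(\<lambda>k. cd (\<sigma> (\<rho> k)) l) \<longlonglongrightarrow> 0"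
    proof (rule tendsto_sandwich[OF always_eventually always_eventually tendsto_const up])
      show "\<forall>k. 0 \<le> cd (\<sigma> (\<rho> k)) l" by simp
      show "\<forall>k. cd (\<sigma> (\<rho> k)) l \<le> c * (norm (fst l - fst (\<sigma> (\<rho> k))) + sqrt (norm (W (\<sigma> (\<rho> k)) l)))"
        using c(2)[OF \<sigma>(1) lVZ] by blast
    qed
    then have lim: "limitin M.mtopology (\<sigma> \<circ> \<rho>) l sequentially"
      using \<sigma>(1) lVZ by (simp add: M.limitin_metric_dist_null comp_def)
    have "cd x l \<le> R"
    proof (rule LIMSEQ_le_const[where X = "\<lambda>k. R + cd (\<sigma> (\<rho> k)) l"])
      show "(\<lambda>k. R + cd (\<sigma> (\<rho> k)) l) \<longlonglongrightarrow> R"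
        using tendsto_add[OF tendsto_const[of R] cd0] by simp
      show "\<exists>N. \<forall>n\<ge>N. cd x l \<le> R + cd (\<sigma> (\<rho> n)) l"
        using M.triangle[OF x \<sigma>(1) lVZ] \<sigma>(2) by (meson add_right_mono order_trans)
    qed
    then show "\<exists>l \<rho>. l \<in> M.mcball x R \<and> strict_mono \<rho> \<and> limitin M.mtopology (\<sigma> \<circ> \<rho>) l sequentially"
      using l(2) lim lVZ x by (intro exI[of _ l] exI[of _ \<rho>]) auto
  qed
  then show ?thesis using Metric_cd by (simp add: proper_metric_def)
qed

text \<open>For \<open>x\<close> take the coordinates of \<open>g\<close>, scaled down by
  \<open>n\<close> and \<open>n\<^sup>2\<close>. Then \<open>inv g \<otimes> apx n x\<close> has
  coordinates bounded by \<open>R0\<close>, hence bounded length.\<close>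

lemma apx_onto: "\<exists>c::real. 0 \<le> c \<and> (\<forall>n g. 1 \<le> n \<longrightarrow> g \<in> carrier G \<longrightarrow> (\<exists>x\<in>V\<times>Z. real (wl (inv g \<otimes> apx n x)) \<le> c))"
proof -
  obtain M :: nat where M: "\<And>g. g \<in> carrier G \<Longrightarrow> norm (\<pi> g) \<le> R0 \<Longrightarrow> norm (\<zeta> g) \<le> R0 \<Longrightarrow> wl g \<le> M"
    using wl_bounded[of R0] by blast
  have "\<exists>x\<in>V\<times>Z. real (wl (inv g \<otimes> apx n x)) \<le> M" if n: "1 \<le> n" and g: "g \<in> carrier G" for n g
  proof -
    define x where "x = ((1 / n) *\<^sub>R \<pi> g, (1 / (real n)\<^sup>2) *\<^sub>R \<zeta> g)"
    have x: "x \<in> V\<times>Z" using piV[OF g] zetaZ[OF g] subV subZ by (simp add: x_def subspace_scale)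
    have nx: "real n *\<^sub>R fst x = \<pi> g" "(real n)\<^sup>2 *\<^sub>R snd x = \<zeta> g" using n by (simp_all add: x_def)
    have "wl (inv g \<otimes> apx n x) \<le> M"
      using apx[OF x, of n] g by (intro M) (auto simp: pi_inv_mult zeta_inv_mult nx)
    then show ?thesis using x by (intro bexI[of _ x]) auto
  qed
  then show ?thesis by (intro exI[of _ "real M"]) auto
qed

end

section \<open>Gromov-Hausdorff distance and correspondences\<close>

definition correspondence :: "'x set \<Rightarrow> 'y set \<Rightarrow> ('x \<times> 'y) set \<Rightarrow> bool" where
  "correspondence X Y R \<longleftrightarrow> R \<subseteq> X \<times> Y \<and> (\<forall>x\<in>X. \<exists>y. (x, y) \<in> R) \<and> (\<forall>y\<in>Y. \<exists>x. (x, y) \<in> R)"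

definition distortion_le :: "('x \<Rightarrow> 'x \<Rightarrow> real) \<Rightarrow> ('y \<Rightarrow> 'y \<Rightarrow> real) \<Rightarrow> ('x \<times> 'y) set \<Rightarrow> real \<Rightarrow> bool" where
  "distortion_le dX dY R e \<longleftrightarrow> (\<forall>(x, y)\<in>R. \<forall>(x', y')\<in>R. \<bar>dX x x' - dY y y'\<bar> \<le> e)"

definition GH_set :: "'x set \<Rightarrow> ('x \<Rightarrow> 'x \<Rightarrow> real) \<Rightarrow> 'y set \<Rightarrow> ('y \<Rightarrow> 'y \<Rightarrow> real) \<Rightarrow> real set" where
  "GH_set X dX Y dY = {hausdorff_distance dZ (f ` X) (g ` Y) |(Z :: ('x + 'y) set) dZ f g.
            Metric_space Z dZ \<and> isometric_embedding X dX Z dZ f \<and> isometric_embedding Y dY Z dZ g}"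

lemma GH_distance_eq: "GH_distance X dX Y dY = Inf (GH_set X dX Y dY)"
  by (simp add: GH_distance_def GH_set_def)

lemma hausdorff_le:
  assumes "0 \<le> r" "\<And>a. a \<in> A \<Longrightarrow> \<exists>b\<in>B. d a b \<le> r" "\<And>b. b \<in> B \<Longrightarrow> \<exists>a\<in>A. d a b \<le> r"
  shows "hausdorff_distance d A B \<le> r"
  unfolding hausdorff_distance_def using assms by (intro cInf_lower) (auto intro!: bdd_belowI[of _ 0])

text \<open>The standard metric on a disjoint union in which related points are at distance
  \<open>r\<close>. Both mixed cases carry the same formula, which makes it symmetric.\<close>

definition glue :: "('x \<Rightarrow> 'x \<Rightarrow> real) \<Rightarrow> ('y \<Rightarrow> 'y \<Rightarrow> real) \<Rightarrow> ('x \<times> 'y) set \<Rightarrow> real \<Rightarrow> 'x + 'y \<Rightarrow> 'x + 'y \<Rightarrow> real" where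
  "glue dX dY R r a b = (case (a, b) of
     (Inl x, Inl x') \<Rightarrow> dX x x'
   | (Inr y, Inr y') \<Rightarrow> dY y y'
   | (Inl x, Inr y) \<Rightarrow> (INF (x', y')\<in>R. dX x x' + r + dY y' y)
   | (Inr y, Inl x) \<Rightarrow> (INF (x', y')\<in>R. dX x x' + r + dY y' y))"

lemma glue_metric:
  assumes X: "Metric_space X dX" and Y: "Metric_space Y dY" and R: "correspondence X Y R" "R \<noteq> {}"
    and dis: "distortion_le dX dY R (2 * r)" and r: "0 < r"
  shows "Metric_space (Inl ` X \<union> Inr ` Y) (glue dX dY R r)"
proof -
  interpret X: Metric_space X dX by (rule X)
  interpret Y: Metric_space Y dY by (rule Y)
  define c where "c x y = (INF (x', y')\<in>R. dX x x' + r + dY y' y)" for x y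
  have bdd: "bdd_below ((\<lambda>(x', y'). dX x x' + r + dY y' y) ` R)" for x y
    using r by (intro bdd_belowI[of _ 0]) (auto intro!: add_nonneg_nonneg)
  have c_le: "c x y \<le> dX x x' + r + dY y' y" if "(x', y') \<in> R" for x y x' y'
    unfolding c_def using cINF_lower[OF bdd that] by simp
  have c_ge: "b \<le> c x y" if "\<And>x' y'. (x', y') \<in> R \<Longrightarrow> b \<le> dX x x' + r + dY y' y" for b x y
    unfolding c_def using that R(2) by (intro cINF_greatest) auto
  have c_pos: "r \<le> c x y" for x y by (rule c_ge) simp
  have c_nz: "c x y \<noteq> 0" for x y using c_pos[of x y] r by linarith
  have RX: "x \<in> X" "y \<in> Y" if "(x, y) \<in> R" for x y using that R(1) by (auto simp: correspondence_def)
  have c_XX: "c x y \<le> dX x x1 + c x1 y" if "x \<in> X" "x1 \<in> X" "y \<in> Y" for x x1 y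
  proof -
    have "c x y - dX x x1 \<le> c x1 y"
    proof (rule c_ge)
      fix x' y' assume p: "(x', y') \<in> R"
      show "c x y - dX x x1 \<le> dX x1 x' + r + dY y' y"
        using c_le[OF p, of x y] X.triangle[of x x1 x'] that RX[OF p] by simp
    qed
    then show ?thesis by simp
  qed
  have c_YY: "c x y \<le> c x y1 + dY y1 y" if "x \<in> X" "y1 \<in> Y" "y \<in> Y" for x y1 y
  proof -
    have "c x y - dY y1 y \<le> c x y1"
    proof (rule c_ge)
      fix x' y' assume p: "(x', y') \<in> R"
      show "c x y - dY y1 y \<le> dX x x' + r + dY y' y1"
        using c_le[OF p, of x y] Y.triangle[of y' y1 y] that RX[OF p] by simp
    qed
    then show ?thesis by simp
  qed
  have c_XX': "c x y \<le> c x1 y + dX x1 x" if "x \<in> X" "x1 \<in> X" "y \<in> Y" for x x1 y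
    using c_XX[OF that] by (simp add: X.commute)
  have c_YY': "c x y \<le> dY y y1 + c x y1" if "x \<in> X" "y1 \<in> Y" "y \<in> Y" for x y1 y
    using c_YY[OF that] by (simp add: Y.commute add.commute)
  \<comment> \<open>A detour through the other space crosses over twice; the cost
    \<open>2 * r\<close> of the crossings pays for the distortion.\<close>
  have XcX: "dX x x1 \<le> c x y + c x1 y" if "x \<in> X" "x1 \<in> X" "y \<in> Y" for x x1 y
  proof -
    have "dX x x1 - c x1 y \<le> c x y"
    proof (rule c_ge)
      fix x' y' assume p: "(x', y') \<in> R"
      have "dX x x1 - (dX x x' + r + dY y' y) \<le> c x1 y"
      proof (rule c_ge)
        fix x2 y2 assume q: "(x2, y2) \<in> R"
        have "dX x x1 \<le> dX x x' + dX x' x2 + dX x1 x2"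
          using X.triangle[of x x' x1] X.triangle[of x' x2 x1] that RX[OF p] RX[OF q] X.commute[of x1 x2] by simp
        moreover have "dX x' x2 \<le> dY y' y2 + 2 * r" using dis p q by (fastforce simp: distortion_le_def)
        moreover have "dY y' y2 \<le> dY y' y + dY y2 y"
          using Y.triangle[of y' y y2] that RX[OF p] RX[OF q] Y.commute[of y2 y] by simp
        ultimately show "dX x x1 - (dX x x' + r + dY y' y) \<le> dX x1 x2 + r + dY y2 y" by simp
      qed
      then show "dX x x1 - c x1 y \<le> dX x x' + r + dY y' y" by simp
    qed
    then show ?thesis by simp
  qed
  have YcY: "dY y y1 \<le> c x y + c x y1" if "x \<in> X" "y \<in> Y" "y1 \<in> Y" for x y y1
  proof -
    have "dY y y1 - c x y1 \<le> c x y"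
    proof (rule c_ge)
      fix x' y' assume p: "(x', y') \<in> R"
      have "dY y y1 - (dX x x' + r + dY y' y) \<le> c x y1"
      proof (rule c_ge)
        fix x2 y2 assume q: "(x2, y2) \<in> R"
        have "dY y y1 \<le> dY y' y + dY y' y2 + dY y2 y1"
          using Y.triangle[of y y' y1] Y.triangle[of y' y2 y1] that RX[OF p] RX[OF q] Y.commute[of y y'] by simp
        moreover have "dY y' y2 \<le> dX x' x2 + 2 * r" using dis p q by (fastforce simp: distortion_le_def)
        moreover have "dX x' x2 \<le> dX x x' + dX x x2"
          using X.triangle[of x' x x2] that RX[OF p] RX[OF q] X.commute[of x' x] by simp
        ultimately show "dY y y1 - (dX x x' + r + dY y' y) \<le> dX x x2 + r + dY y2 y1" by simp
      qed
      then show "dY y y1 - c x y1 \<le> dX x x' + r + dY y' y" by simp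
    qed
    then show ?thesis by simp
  qed
  have g: "glue dX dY R r (Inl x) (Inl x') = dX x x'" "glue dX dY R r (Inr y) (Inr y') = dY y y'"
    "glue dX dY R r (Inl x) (Inr y) = c x y" "glue dX dY R r (Inr y) (Inl x) = c x y" for x x' y y'
    by (simp_all add: glue_def c_def)
  show ?thesis
  proof
    fix a b :: "'a + 'b"
    show "0 \<le> glue dX dY R r a b"
      using c_pos r by (cases a; cases b) (auto simp: g intro: order_trans[of 0 r])
    show "glue dX dY R r a b = glue dX dY R r b a"
      by (cases a; cases b) (auto simp: g X.commute Y.commute)
  next
    fix a b assume "a \<in> Inl ` X \<union> Inr ` Y" "b \<in> Inl ` X \<union> Inr ` Y"
    then show "(glue dX dY R r a b = 0) = (a = b)"
      using c_nz by (cases a; cases b) (auto simp: g)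
  next
    fix a b e assume "a \<in> Inl ` X \<union> Inr ` Y" "b \<in> Inl ` X \<union> Inr ` Y" "e \<in> Inl ` X \<union> Inr ` Y"
    then show "glue dX dY R r a e \<le> glue dX dY R r a b + glue dX dY R r b e"
      using X.triangle Y.triangle c_XX c_YY XcX YcY c_XX' c_YY'
      by (cases a; cases b; cases e) (auto simp: g)
  qed
qed

lemma GH_set_correspondence:
  assumes X: "Metric_space X dX" and Y: "Metric_space Y dY" and R: "correspondence X Y R" "R \<noteq> {}"
    and dis: "distortion_le dX dY R (2 * r)" and r: "0 < r"
  shows "\<exists>h\<in>GH_set X dX Y dY. h \<le> r"
proof -
  interpret X: Metric_space X dX by (rule X)
  interpret Y: Metric_space Y dY by (rule Y)
  let ?d = "glue dX dY R r"
  have bdd: "bdd_below ((\<lambda>(x', y'). dX x x' + r + dY y' y) ` R)" for x y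
    using r by (intro bdd_belowI[of _ 0]) (auto intro!: add_nonneg_nonneg)
  have RX: "x \<in> X" "y \<in> Y" if "(x, y) \<in> R" for x y using that R(1) by (auto simp: correspondence_def)
  have dr: "?d (Inl x) (Inr y) \<le> r" if "(x, y) \<in> R" for x y
    using cINF_lower[OF bdd that, of x y] RX[OF that] by (simp add: glue_def)
  have "hausdorff_distance ?d (Inl ` X) (Inr ` Y) \<le> r"
  proof (rule hausdorff_le)
    fix a :: "'a + 'b" assume "a \<in> Inl ` X"
    then obtain x y where "a = Inl x" "(x, y) \<in> R" using R(1) by (auto simp: correspondence_def)
    then show "\<exists>b\<in>Inr ` Y. ?d a b \<le> r" using dr RX by blast
  next
    fix b :: "'a + 'b" assume "b \<in> Inr ` Y"
    then obtain x y where "b = Inr y" "(x, y) \<in> R" using R(1) by (auto simp: correspondence_def)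
    then show "\<exists>a\<in>Inl ` X. ?d a b \<le> r" using dr RX by blast
  qed (use r in simp)
  moreover have "hausdorff_distance ?d (Inl ` X) (Inr ` Y) \<in> GH_set X dX Y dY"
    unfolding GH_set_def using glue_metric[OF assms]
    by (intro CollectI exI[of _ "Inl ` X \<union> Inr ` Y"] exI[of _ ?d] exI[of _ Inl] exI[of _ Inr])
       (auto simp: isometric_embedding_def glue_def)
  ultimately show ?thesis by blast
qed

definition bounded_metric :: "'x set \<Rightarrow> ('x \<Rightarrow> 'x \<Rightarrow> real) \<Rightarrow> bool" where
  "bounded_metric X d \<longleftrightarrow> (\<exists>D. \<forall>x\<in>X. \<forall>y\<in>X. d x y \<le> D)"

text \<open>For bounded spaces the infima defining the distances are not over empty sets.\<close>

lemma hausdorff_cases: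
  assumes Z: "Metric_space Z dZ" and f: "isometric_embedding X dX Z dZ f" and g: "isometric_embedding Y dY Z dZ g"
    and ne: "X \<noteq> {}" "Y \<noteq> {}" and bdd: "bounded_metric X dX" "bounded_metric Y dY"
  shows "0 \<le> hausdorff_distance dZ (f ` X) (g ` Y)"
    and "hausdorff_distance dZ (f ` X) (g ` Y) < e \<Longrightarrow>
      (\<forall>x\<in>X. \<exists>y\<in>Y. dZ (f x) (g y) \<le> e) \<and> (\<forall>y\<in>Y. \<exists>x\<in>X. dZ (f x) (g y) \<le> e)"
proof -
  interpret Z: Metric_space Z dZ by (rule Z)
  let ?S = "{r. 0 \<le> r \<and> (\<forall>a\<in>f ` X. \<exists>b\<in>g ` Y. dZ a b \<le> r) \<and> (\<forall>b\<in>g ` Y. \<exists>a\<in>f ` X. dZ a b \<le> r)}"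
  obtain x0 y0 where x0: "x0 \<in> X" and y0: "y0 \<in> Y" using ne by blast
  obtain D1 where D1: "\<And>x y. x \<in> X \<Longrightarrow> y \<in> X \<Longrightarrow> dX x y \<le> D1" using bdd(1) unfolding bounded_metric_def by blast
  obtain D2 where D2: "\<And>x y. x \<in> Y \<Longrightarrow> y \<in> Y \<Longrightarrow> dY x y \<le> D2" using bdd(2) unfolding bounded_metric_def by blast
  have fZ: "f x \<in> Z" if "x \<in> X" for x using f that by (auto simp: isometric_embedding_def)
  have gZ: "g x \<in> Z" if "x \<in> Y" for x using g that by (auto simp: isometric_embedding_def)
  have fd: "dZ (f x) (f x') = dX x x'" if "x \<in> X" "x' \<in> X" for x x' using f that by (auto simp: isometric_embedding_def)
  have gd: "dZ (g x) (g x') = dY x x'" if "x \<in> Y" "x' \<in> Y" for x x' using g that by (auto simp: isometric_embedding_def)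
  define M where "M = \<bar>D1\<bar> + \<bar>D2\<bar> + dZ (f x0) (g y0)"
  have 1: "dZ (f x) (g y0) \<le> M" if "x \<in> X" for x
  proof -
    have "dZ (f x) (g y0) \<le> dX x x0 + dZ (f x0) (g y0)"
      using Z.triangle[OF fZ[OF that] fZ[OF x0] gZ[OF y0]] fd[OF that x0] by simp
    then show ?thesis using D1[OF that x0] by (simp add: M_def)
  qed
  have 2: "dZ (f x0) (g y) \<le> M" if "y \<in> Y" for y
  proof -
    have "dZ (f x0) (g y) \<le> dZ (f x0) (g y0) + dY y0 y"
      using Z.triangle[OF fZ[OF x0] gZ[OF y0] gZ[OF that]] gd[OF y0 that] by simp
    then show ?thesis using D2[OF y0 that] by (simp add: M_def)
  qed
  have "M \<in> ?S" using 1 2 x0 y0 by (auto simp: M_def)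
  then have ne: "?S \<noteq> {}" by blast
  show "0 \<le> hausdorff_distance dZ (f ` X) (g ` Y)"
    unfolding hausdorff_distance_def using ne by (intro cInf_greatest) auto
  assume "hausdorff_distance dZ (f ` X) (g ` Y) < e"
  then obtain r where r: "r \<in> ?S" "r < e" unfolding hausdorff_distance_def using cInf_lessD[OF ne] by blast
  show "(\<forall>x\<in>X. \<exists>y\<in>Y. dZ (f x) (g y) \<le> e) \<and> (\<forall>y\<in>Y. \<exists>x\<in>X. dZ (f x) (g y) \<le> e)"
  proof (intro conjI ballI)
    fix x assume "x \<in> X"
    then obtain y where "y \<in> Y" "dZ (f x) (g y) \<le> r" using r by auto
    then show "\<exists>y\<in>Y. dZ (f x) (g y) \<le> e" using r by force
  next
    fix y assume "y \<in> Y"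
    then obtain x where "x \<in> X" "dZ (f x) (g y) \<le> r" using r by auto
    then show "\<exists>x\<in>X. dZ (f x) (g y) \<le> e" using r by force
  qed
qed

lemma GH_set_nonneg:
  assumes "X \<noteq> {}" "Y \<noteq> {}" "bounded_metric X dX" "bounded_metric Y dY" "h \<in> GH_set X dX Y dY"
  shows "0 \<le> h"
  using assms hausdorff_cases(1) unfolding GH_set_def by blast

lemma GH_distance_le:
  assumes X: "Metric_space X dX" and Y: "Metric_space Y dY" and R: "correspondence X Y R" "R \<noteq> {}"
    and dis: "distortion_le dX dY R (2 * r)" and r: "0 < r"
    and bdd: "bounded_metric X dX" "bounded_metric Y dY"
  shows "0 \<le> GH_distance X dX Y dY" "GH_distance X dX Y dY \<le> r"
proof -
  obtain h where h: "h \<in> GH_set X dX Y dY" "h \<le> r" using GH_set_correspondence[OF X Y R dis r] by blast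
  have ne: "X \<noteq> {}" "Y \<noteq> {}" using R by (auto simp: correspondence_def)
  show "0 \<le> GH_distance X dX Y dY" unfolding GH_distance_eq
    using h GH_set_nonneg[OF ne bdd] by (intro cInf_greatest) auto
  have "GH_distance X dX Y dY \<le> h" unfolding GH_distance_eq
    using h GH_set_nonneg[OF ne bdd] by (intro cInf_lower) (auto intro!: bdd_belowI[of _ 0])
  then show "GH_distance X dX Y dY \<le> r" using h by simp
qed

lemma GH_distance_less:
  assumes X: "Metric_space X dX" and Y: "Metric_space Y dY" and ne: "X \<noteq> {}" "Y \<noteq> {}"
    and bdd: "bounded_metric X dX" "bounded_metric Y dY" and less: "GH_distance X dX Y dY < e"
  shows "\<exists>R. correspondence X Y R \<and> distortion_le dX dY R (2 * e)"
proof -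
  obtain D1 where D1: "\<And>x y. x \<in> X \<Longrightarrow> y \<in> X \<Longrightarrow> dX x y \<le> D1" using bdd(1) unfolding bounded_metric_def by blast
  obtain D2 where D2: "\<And>x y. x \<in> Y \<Longrightarrow> y \<in> Y \<Longrightarrow> dY x y \<le> D2" using bdd(2) unfolding bounded_metric_def by blast
  \<comment> \<open>The full product is a correspondence of finite distortion. Hence the set whose
    infimum is taken is nonempty, and the infimum can be approached.\<close>
  have "\<bar>dX x x' - dY y y'\<bar> \<le> 2 * (\<bar>D1\<bar> + \<bar>D2\<bar> + 1)" if "x \<in> X" "x' \<in> X" "y \<in> Y" "y' \<in> Y" for x x' y y'
    using D1[OF that(1,2)] D2[OF that(3,4)] Metric_space.nonneg[OF X, of x x'] Metric_space.nonneg[OF Y, of y y']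
      by argo
  then have "distortion_le dX dY (X \<times> Y) (2 * (\<bar>D1\<bar> + \<bar>D2\<bar> + 1))" by (auto simp: distortion_le_def)
  moreover have "correspondence X Y (X \<times> Y)" "X \<times> Y \<noteq> {}" using ne by (auto simp: correspondence_def)
  ultimately have "GH_set X dX Y dY \<noteq> {}" using GH_set_correspondence[OF X Y, of "X \<times> Y" "\<bar>D1\<bar> + \<bar>D2\<bar> + 1"] by fastforce
  then obtain h where h: "h \<in> GH_set X dX Y dY" "h < e" using cInf_lessD less unfolding GH_distance_eq by blast
  then obtain Z :: "('a + 'b) set" and dZ f g where Z: "Metric_space Z dZ" "isometric_embedding X dX Z dZ f"
    "isometric_embedding Y dY Z dZ g" "h = hausdorff_distance dZ (f ` X) (g ` Y)" unfolding GH_set_def by blast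
  interpret Z: Metric_space Z dZ by (rule Z)
  have near: "(\<forall>x\<in>X. \<exists>y\<in>Y. dZ (f x) (g y) \<le> e) \<and> (\<forall>y\<in>Y. \<exists>x\<in>X. dZ (f x) (g y) \<le> e)"
    using hausdorff_cases(2)[OF Z(1-3) ne bdd] Z(4) h(2) by simp
  define R where "R = {(x, y). x \<in> X \<and> y \<in> Y \<and> dZ (f x) (g y) \<le> e}"
  have "correspondence X Y R" using near by (auto simp: R_def correspondence_def)
  moreover have "distortion_le dX dY R (2 * e)"
  proof -
    have "\<bar>dX x x' - dY y y'\<bar> \<le> 2 * e" if "(x, y) \<in> R" "(x', y') \<in> R" for x y x' y'
    proof -
      have m: "x \<in> X" "x' \<in> X" "y \<in> Y" "y' \<in> Y" "dZ (f x) (g y) \<le> e" "dZ (f x') (g y') \<le> e" using that by (auto simp: R_def)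
      have z: "f x \<in> Z" "f x' \<in> Z" "g y \<in> Z" "g y' \<in> Z" using Z(2,3) m by (auto simp: isometric_embedding_def)
      have "dX x x' = dZ (f x) (f x')" "dY y y' = dZ (g y) (g y')" using Z(2,3) m by (auto simp: isometric_embedding_def)
      moreover have "dZ (f x) (f x') \<le> dZ (f x) (g y) + dZ (g y) (g y') + dZ (g y') (f x')"
        using Z.triangle[of "f x" "g y" "f x'"] Z.triangle[of "g y" "g y'" "f x'"] z by simp
      moreover have "dZ (g y) (g y') \<le> dZ (g y) (f x) + dZ (f x) (f x') + dZ (f x') (g y')"
        using Z.triangle[of "g y" "f x" "g y'"] Z.triangle[of "f x" "f x'" "g y'"] z by simp
      moreover have "dZ (g y') (f x') = dZ (f x') (g y')" "dZ (g y) (f x) = dZ (f x) (g y)" by (simp_all add: Z.commute)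
      ultimately show ?thesis using m by linarith
    qed
    then show ?thesis by (auto simp: distortion_le_def)
  qed
  ultimately show ?thesis by blast
qed

section \<open>Spaces approximated by their asymptotic cone\<close>

lemma diagonal_limits:
  assumes M: "Metric_space M d" and \<Gamma>: "countable \<Gamma>" "\<Gamma> \<noteq> {}"
    and K: "\<And>g. g \<in> \<Gamma> \<Longrightarrow> \<exists>K. compactin (Metric_space.mtopology M d) K \<and> (\<forall>k::nat. f k g \<in> K)"
  shows "\<exists>s l. strict_mono s \<and> (\<forall>g\<in>\<Gamma>. l g \<in> M \<and> (\<lambda>k. d (f (s k) g) (l g)) \<longlonglongrightarrow> 0)"
proof -
  interpret M: Metric_space M d by (rule M)
  define e where "e = from_nat_into \<Gamma>"
  have e: "e n \<in> \<Gamma>" for n using \<Gamma> by (simp add: e_def from_nat_into)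
  define P where "P n s \<longleftrightarrow> (\<exists>l\<in>M. (\<lambda>k. d (f (s k) (e n)) l) \<longlonglongrightarrow> 0)" for n and s :: "nat \<Rightarrow> nat"
  interpret subseqs P
  proof
    fix n and s :: "nat \<Rightarrow> nat"
    obtain K where K: "compactin M.mtopology K" "\<And>k. f k (e n) \<in> K" using K[OF e] by blast
    have "range (\<lambda>k. f (s k) (e n)) \<subseteq> K" using K by blast
    then obtain l r' where lr: "l \<in> K" "strict_mono r'" "limitin M.mtopology ((\<lambda>k. f (s k) (e n)) \<circ> r') l sequentially"
      using K(1) unfolding M.compactin_sequentially by meson
    then have "l \<in> M" "(\<lambda>k. d (f ((s \<circ> r') k) (e n)) l) \<longlonglongrightarrow> 0"
      by (simp_all add: M.limitin_metric_dist_null comp_def)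
    then show "\<exists>r'. strict_mono r' \<and> P n (s \<circ> r')" using lr(2) unfolding P_def by blast
  qed
  have st: "P n (s \<circ> r)" if sr: "strict_mono r" "P n s" for r s n
  proof -
    obtain l where l: "l \<in> M" "(\<lambda>k. d (f (s k) (e n)) l) \<longlonglongrightarrow> 0" using sr(2) unfolding P_def by blast
    have "(\<lambda>k. d (f (s (r k)) (e n)) l) \<longlonglongrightarrow> 0" using LIMSEQ_subseq_LIMSEQ[OF l(2) sr(1)] by (simp add: comp_def)
    then show ?thesis using l(1) unfolding P_def by (auto simp: comp_def)
  qed
  \<comment> \<open>The diagonal sequence is a subsequence of the one chosen for \<open>n\<close>
    only after a shift by \<open>Suc n\<close>, which a limit does not see.\<close>
  have "P n (diagseq \<circ> (+) (Suc n))" for n by (rule diagseq_holds[OF st])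
  then have "\<exists>l\<in>M. (\<lambda>k. d (f (diagseq k) (e n)) l) \<longlonglongrightarrow> 0" for n
  proof -
    obtain l where l: "l \<in> M" "(\<lambda>k. d (f (diagseq (k + Suc n)) (e n)) l) \<longlonglongrightarrow> 0"
      using \<open>P n (diagseq \<circ> (+) (Suc n))\<close> unfolding P_def by (auto simp: comp_def add.commute)
    then show ?thesis using LIMSEQ_offset[OF l(2)] by blast
  qed
  then have "\<forall>g\<in>\<Gamma>. \<exists>l. l \<in> M \<and> (\<lambda>k. d (f (diagseq k) g) l) \<longlonglongrightarrow> 0"
    using from_nat_into_surj[OF \<Gamma>(1)] unfolding e_def by metis
  from bchoice[OF this] show ?thesis using subseq_diagseq by blast
qed

text \<open>\<open>a n\<close> is a dilation by \<open>n\<close> of the candidate cone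
  \<open>Y\<close> into \<open>\<Gamma>\<close>; the point is that its additive error
  \<open>c\<close> does not grow with \<open>n\<close>. \<open>geod\<close> is coarse geodesicity,
  with slack 1 because words have integer length.\<close>

locale cone_approx =
  fixes \<Gamma> :: "'a set" and \<rho> :: "'a \<Rightarrow> 'a \<Rightarrow> real" and p :: 'a
    and Y :: "'y set" and d :: "'y \<Rightarrow> 'y \<Rightarrow> real" and q :: 'y and a :: "nat \<Rightarrow> 'y \<Rightarrow> 'a" and c :: real
  assumes \<rho>: "Metric_space \<Gamma> \<rho>" and p: "p \<in> \<Gamma>" and proper_d: "proper_metric Y d" and q: "q \<in> Y" and c: "0 \<le> c"
    and a_in: "\<And>n y. 1 \<le> n \<Longrightarrow> y \<in> Y \<Longrightarrow> a n y \<in> \<Gamma>"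
    and a_dist: "\<And>n x y. 1 \<le> n \<Longrightarrow> x \<in> Y \<Longrightarrow> y \<in> Y \<Longrightarrow> \<bar>\<rho> (a n x) (a n y) - n * d x y\<bar> \<le> c"
    and a_onto: "\<And>n g. 1 \<le> n \<Longrightarrow> g \<in> \<Gamma> \<Longrightarrow> \<exists>x\<in>Y. \<rho> g (a n x) \<le> c"
    and a_base: "\<And>n. 1 \<le> n \<Longrightarrow> \<rho> p (a n q) \<le> c"
    and geod: "\<And>g t. g \<in> \<Gamma> \<Longrightarrow> 0 \<le> t \<Longrightarrow> \<exists>g'\<in>\<Gamma>. \<rho> p g' \<le> t \<and> \<rho> g' g \<le> max 0 (\<rho> p g - t) + 1"
    and finite_ball: "\<And>R. finite {g \<in> \<Gamma>. \<rho> p g \<le> R}"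
    \<comment> \<open>The balls of the cone need not be compared with base points preserved; this recovers the base point.\<close>
    and centre: "\<And>R. 0 < R \<Longrightarrow> \<exists>\<epsilon>>0. \<exists>N. \<forall>n\<ge>N. \<forall>g\<in>\<Gamma>. \<rho> p g \<le> real n * R \<longrightarrow>
          (\<forall>h\<in>\<Gamma>. \<rho> p h \<le> real n * R \<longrightarrow> \<rho> g h \<le> real n * (R + \<epsilon>)) \<longrightarrow> \<rho> p g \<le> real n"
begin

sublocale \<Gamma>: Metric_space \<Gamma> \<rho> by (rule \<rho>)

sublocale Y: Metric_space Y d using proper_d by (simp add: proper_metric_def)

lemma proper_\<rho>: "proper_metric \<Gamma> \<rho>"
  unfolding proper_metric_def
proof (intro conjI ballI allI \<rho>)
  fix x R assume x: "x \<in> \<Gamma>"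
  have "\<Gamma>.mcball x R \<subseteq> {g \<in> \<Gamma>. \<rho> p g \<le> \<rho> p x + R}"
    using \<Gamma>.triangle[OF p x] by fastforce
  then have "finite (\<Gamma>.mcball x R)" using finite_ball finite_subset by blast
  then show "compactin \<Gamma>.mtopology (\<Gamma>.mcball x R)" by (intro finite_imp_compactin) auto
qed

lemma scaled: "1 \<le> n \<Longrightarrow> Metric_space \<Gamma> (\<lambda>x x'. 1 / real n * \<rho> x x')"
  by unfold_locales (auto simp: \<Gamma>.commute \<Gamma>.triangle divide_right_mono simp flip: add_divide_distrib)

lemma ball_bounded: "Metric_space M e \<Longrightarrow> x \<in> M \<Longrightarrow> bounded_metric (Metric_space.mcball M e x R) e"
proof -
  assume M: "Metric_space M e" and x: "x \<in> M"
  interpret M: Metric_space M e by (rule M)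
  have "e y z \<le> R + R" if "y \<in> M.mcball x R" "z \<in> M.mcball x R" for y z
    using M.triangle[of y x z] that M.commute[of y x] by auto
  then show ?thesis unfolding bounded_metric_def by blast
qed

text \<open>Relating \<open>g\<close> to \<open>y\<close> when \<open>g\<close> is near
  \<open>a n y\<close> gives a correspondence whose distortion is bounded before division by
  \<open>n\<close>.\<close>

lemma gh_le:
  assumes n: "1 \<le> n" and R: "0 < R"
  defines "B \<equiv> Metric_space.mcball \<Gamma> (\<lambda>x x'. 1 / real n * \<rho> x x') p R"
  shows "0 \<le> GH_distance B (\<lambda>x x'. 1 / real n * \<rho> x x') (Y.mcball q R) d"
    and "GH_distance B (\<lambda>x x'. 1 / real n * \<rho> x x') (Y.mcball q R) d \<le> (9 * c + 3) / n"
proof -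
  let ?\<rho> = "\<lambda>x x'. 1 / real n * \<rho> x x'"
  interpret S: Metric_space \<Gamma> ?\<rho> by (rule scaled[OF n])
  have n0: "0 < real n" using n by simp
  have B: "g \<in> B \<longleftrightarrow> g \<in> \<Gamma> \<and> \<rho> p g \<le> n * R" for g
    using p n0 unfolding B_def S.in_mcball by (auto simp: field_simps)
  have YB: "y \<in> Y.mcball q R \<longleftrightarrow> y \<in> Y \<and> d q y \<le> R" for y using q by auto
  define \<R> where "\<R> = {(g, y). g \<in> B \<and> y \<in> Y.mcball q R \<and> \<rho> g (a n y) \<le> 4 * c + 1}"
  have pq: "(p, q) \<in> \<R>" using a_base[OF n] c p q R n0 by (auto simp: \<R>_def B YB)
  have "\<exists>y. (g, y) \<in> \<R>" if g: "g \<in> B" for g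
  proof (cases "n * R < 3 * c")
    case True
    have "\<rho> g (a n q) \<le> \<rho> p g + \<rho> p (a n q)" using \<Gamma>.triangle[of g p "a n q"] g B p a_in[OF n q] \<Gamma>.commute[of g p] by auto
    then have "\<rho> g (a n q) \<le> 4 * c + 1" using True g B a_base[OF n] by fastforce
    then show ?thesis using g q R by (auto simp: \<R>_def YB)
  next
    case False
    \<comment> \<open>A point near the boundary of the ball could be related to a point outside the
      ball of the cone. So \<open>g\<close> is first moved inwards by \<open>3 * c\<close>: one
      \<open>c\<close> each for the base point, for approximating \<open>g'\<close> and for the
      dilation.\<close>
    define t where "t = n * R - 3 * c"
    obtain g' where g': "g' \<in> \<Gamma>" "\<rho> p g' \<le> t" "\<rho> g' g \<le> max 0 (\<rho> p g - t) + 1"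
      using geod[of g t] g False by (auto simp: B t_def)
    have g'g: "\<rho> g' g \<le> 3 * c + 1" using g' g c by (auto simp: B t_def)
    obtain x where x: "x \<in> Y" "\<rho> g' (a n x) \<le> c" using a_onto[OF n g'(1)] by blast
    have "n * d q x \<le> \<rho> (a n q) (a n x) + c" using a_dist[OF n q x(1)] by linarith
    also have "\<rho> (a n q) (a n x) \<le> \<rho> p (a n q) + \<rho> p g' + \<rho> g' (a n x)"
      using \<Gamma>.triangle[of "a n q" p "a n x"] \<Gamma>.triangle[of p g' "a n x"] p g' a_in[OF n] q x \<Gamma>.commute[of "a n q" p] by simp
    also have "\<dots> \<le> c + t + c" using a_base[OF n] g' x by simp
    finally have "n * d q x \<le> n * R" by (simp add: t_def)
    then have "d q x \<le> R" using n0 by simp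
    moreover have "\<rho> g (a n x) \<le> 4 * c + 1"
      using \<Gamma>.triangle[of g g' "a n x"] g' x g'g g a_in[OF n x(1)] \<Gamma>.commute[of g g'] by (auto simp: B)
    ultimately show ?thesis using g x q by (auto simp: \<R>_def YB)
  qed
  moreover have "\<exists>g. (g, y) \<in> \<R>" if y: "y \<in> Y.mcball q R" for y
  proof -
    have yY: "y \<in> Y" "d q y \<le> R" using y by (auto simp: YB)
    have ay: "a n y \<in> \<Gamma>" by (rule a_in[OF n yY(1)])
    obtain g where g: "g \<in> \<Gamma>" "\<rho> p g \<le> n * R" "\<rho> g (a n y) \<le> max 0 (\<rho> p (a n y) - n * R) + 1"
      using geod[OF ay, of "n * R"] R by auto
    have "\<rho> p (a n y) \<le> \<rho> p (a n q) + \<rho> (a n q) (a n y)" using \<Gamma>.triangle[OF p a_in[OF n q] ay] .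
    also have "\<dots> \<le> c + (n * d q y + c)" using a_base[OF n] a_dist[OF n q yY(1)] by linarith
    also have "\<dots> \<le> c + (n * R + c)" using yY by (simp add: mult_left_mono)
    finally have "\<rho> g (a n y) \<le> 4 * c + 1" using g(3) c by linarith
    then show ?thesis using g y by (auto simp: \<R>_def B)
  qed
  ultimately have cor: "correspondence B (Y.mcball q R) \<R>" by (auto simp: correspondence_def \<R>_def)
  have "\<bar>1 / real n * \<rho> g g' - d y y'\<bar> \<le> 2 * ((9 * c + 3) / n)" if "(g, y) \<in> \<R>" "(g', y') \<in> \<R>" for g y g' y'
  proof -
    have m: "g \<in> \<Gamma>" "g' \<in> \<Gamma>" "y \<in> Y" "y' \<in> Y" "\<rho> g (a n y) \<le> 4 * c + 1" "\<rho> g' (a n y') \<le> 4 * c + 1"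
      using that by (auto simp: \<R>_def B YB)
    have A: "a n y \<in> \<Gamma>" "a n y' \<in> \<Gamma>" using m a_in[OF n] by auto
    have "\<bar>\<rho> g g' - \<rho> (a n y) (a n y')\<bar> \<le> \<rho> g (a n y) + \<rho> g' (a n y')"
      using \<Gamma>.triangle[of g "a n y" g'] \<Gamma>.triangle[of "a n y" "a n y'" g'] \<Gamma>.triangle[of "a n y" g "a n y'"] \<Gamma>.triangle[of g g' "a n y'"]
        m A \<Gamma>.commute[of "a n y" g] \<Gamma>.commute[of "a n y'" g'] by (simp add: abs_le_iff)
    then have "\<bar>\<rho> g g' - n * d y y'\<bar> \<le> 9 * c + 2" using a_dist[OF n m(3,4)] m by linarith
    then have "\<bar>\<rho> g g' - n * d y y'\<bar> / n \<le> (9 * c + 2) / n" by (intro divide_right_mono) auto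
    moreover have "\<bar>\<rho> g g' - n * d y y'\<bar> / n = \<bar>1 / real n * \<rho> g g' - d y y'\<bar>"
      using n0 by (simp add: abs_divide[symmetric] diff_divide_distrib del: abs_divide)
         (metis abs_divide abs_of_nat diff_divide_distrib nonzero_mult_div_cancel_left of_nat_0_less_iff order_less_irrefl)
    moreover have "(9 * c + 2) / n \<le> 2 * ((9 * c + 3) / n)" using c n0 by (simp add: field_simps)
    ultimately show ?thesis by linarith
  qed
  then have dis: "distortion_le ?\<rho> d \<R> (2 * ((9 * c + 3) / n))" by (auto simp: distortion_le_def)
  have MB: "Metric_space B ?\<rho>" unfolding B_def by (rule S.subspace[OF S.mcball_subset_mspace])
  have MY: "Metric_space (Y.mcball q R) d" by (rule Y.subspace[OF Y.mcball_subset_mspace])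
  have bB: "bounded_metric B ?\<rho>" unfolding B_def by (rule ball_bounded[OF scaled[OF n] p])
  have bY: "bounded_metric (Y.mcball q R) d" by (rule ball_bounded[OF Y.Metric_space_axioms q])
  have pos: "0 < (9 * c + 3) / n" using c n0 by simp
  have ne: "\<R> \<noteq> {}" using pq by blast
  show "0 \<le> GH_distance B ?\<rho> (Y.mcball q R) d" "GH_distance B ?\<rho> (Y.mcball q R) d \<le> (9 * c + 3) / n"
    using GH_distance_le[OF MB MY cor ne dis pos bB bY] by auto
qed

theorem cone: "asymptotic_cone \<Gamma> \<rho> p Y d q"
proof -
  have "(\<lambda>n. GH_distance (Metric_space.mcball \<Gamma> (\<lambda>x x'. 1 / real n * \<rho> x x') p R) (\<lambda>x x'. 1 / real n * \<rho> x x') (Y.mcball q R) d) \<longlonglongrightarrow> 0"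
    if R: "0 < R" for R
  proof (rule tendsto_sandwich[OF _ _ tendsto_const lim_const_over_n[of "9 * c + 3"]])
    show "\<forall>\<^sub>F n in sequentially. 0 \<le> GH_distance (Metric_space.mcball \<Gamma> (\<lambda>x x'. 1 / real n * \<rho> x x') p R) (\<lambda>x x'. 1 / real n * \<rho> x x') (Y.mcball q R) d"
      using eventually_ge_at_top[of 1] by eventually_elim (rule gh_le(1)[OF _ R])
    show "\<forall>\<^sub>F n in sequentially. GH_distance (Metric_space.mcball \<Gamma> (\<lambda>x x'. 1 / real n * \<rho> x x') p R) (\<lambda>x x'. 1 / real n * \<rho> x x') (Y.mcball q R) d \<le> (9 * c + 3) / real n"
      using eventually_ge_at_top[of 1] by eventually_elim (rule gh_le(2)[OF _ R])
  qed
  then show ?thesis unfolding asymptotic_cone_def pointed_GH_limit_def using proper_\<rho> proper_d p q by blast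
qed

text \<open>A coarse inverse of \<open>a 1\<close> followed by \<open>a n\<close> is a dilation of
  \<open>\<Gamma>\<close> itself. \<open>Y\<close> no longer occurs in it, so
  \<open>\<Gamma>\<close> can be compared with an arbitrary cone. The error is proportional to
  \<open>n\<close>, that is, bounded after rescaling.\<close>

lemma dilation:
  obtains D :: "nat \<Rightarrow> 'a \<Rightarrow> 'a" where
    "\<And>n g. 1 \<le> n \<Longrightarrow> g \<in> \<Gamma> \<Longrightarrow> D n g \<in> \<Gamma>"
    "\<And>n g h. 1 \<le> n \<Longrightarrow> g \<in> \<Gamma> \<Longrightarrow> h \<in> \<Gamma> \<Longrightarrow> \<bar>\<rho> (D n g) (D n h) - n * \<rho> g h\<bar> \<le> 4 * c * n"
    "\<And>n h. 1 \<le> n \<Longrightarrow> h \<in> \<Gamma> \<Longrightarrow> \<exists>g\<in>\<Gamma>. \<rho> h (D n g) \<le> 4 * c * n"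
    "\<And>n. 1 \<le> n \<Longrightarrow> \<rho> p (D n p) \<le> 5 * c * n"
proof -
  have "\<forall>g\<in>\<Gamma>. \<exists>x. x \<in> Y \<and> \<rho> g (a 1 x) \<le> c" using a_onto[of 1] by blast
  from bchoice[OF this] obtain x where x: "\<And>g. g \<in> \<Gamma> \<Longrightarrow> x g \<in> Y" "\<And>g. g \<in> \<Gamma> \<Longrightarrow> \<rho> g (a 1 (x g)) \<le> c" by blast
  define D where "D n g = a n (x g)" for n g
  have a1: "a 1 y \<in> \<Gamma>" if "y \<in> Y" for y by (rule a_in[OF order_refl that])
  have near: "\<bar>d (x g) y - \<rho> g (a 1 y)\<bar> \<le> 2 * c" if "g \<in> \<Gamma>" "y \<in> Y" for g y
  proof -
    have "\<bar>\<rho> (a 1 (x g)) (a 1 y) - d (x g) y\<bar> \<le> c" using a_dist[of 1 "x g" y] x that by simp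
    moreover have "\<bar>\<rho> (a 1 (x g)) (a 1 y) - \<rho> g (a 1 y)\<bar> \<le> \<rho> g (a 1 (x g))"
      using \<Gamma>.triangle[OF that(1) a1[OF x(1)[OF that(1)]] a1[OF that(2)]] \<Gamma>.triangle[OF a1[OF x(1)[OF that(1)]] that(1) a1[OF that(2)]]
        \<Gamma>.commute[of "a 1 (x g)" g] by (simp add: abs_le_iff)
    ultimately show ?thesis using x(2)[OF that(1)] by linarith
  qed
  have d: "\<bar>d (x g) (x h) - \<rho> g h\<bar> \<le> 3 * c" if "g \<in> \<Gamma>" "h \<in> \<Gamma>" for g h
  proof -
    have "\<bar>\<rho> g (a 1 (x h)) - \<rho> g h\<bar> \<le> \<rho> h (a 1 (x h))"
      using \<Gamma>.triangle[OF that(1) that(2) a1[OF x(1)[OF that(2)]]] \<Gamma>.triangle[OF that(1) a1[OF x(1)[OF that(2)]] that(2)]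
        \<Gamma>.commute[of "a 1 (x h)" h] by (simp add: abs_le_iff)
    then show ?thesis using near[OF that(1) x(1)[OF that(2)]] x(2)[OF that(2)] by linarith
  qed
  have mul: "\<bar>\<rho> (a n y) (a n z) - n * t\<bar> \<le> (k + 1) * c * n"
    if "1 \<le> n" "y \<in> Y" "z \<in> Y" "\<bar>d y z - t\<bar> \<le> k * c" for n y z t k
  proof -
    have "\<bar>real n * d y z - n * t\<bar> = n * \<bar>d y z - t\<bar>" by (simp add: abs_mult flip: right_diff_distrib)
    also have "\<dots> \<le> n * (k * c)" using that by (intro mult_left_mono) auto
    finally have "\<bar>real n * d y z - n * t\<bar> \<le> n * (k * c)" .
    moreover have "c * 1 \<le> c * n" using that c by (intro mult_left_mono) auto
    ultimately show ?thesis using a_dist[OF that(1-3)] by (simp add: algebra_simps)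
  qed
  show thesis
  proof (rule that)
    show "D n g \<in> \<Gamma>" if "1 \<le> n" "g \<in> \<Gamma>" for n g using that x a_in by (simp add: D_def)
    show "\<bar>\<rho> (D n g) (D n h) - n * \<rho> g h\<bar> \<le> 4 * c * n" if "1 \<le> n" "g \<in> \<Gamma>" "h \<in> \<Gamma>" for n g h
      using mul[OF that(1) x(1)[OF that(2)] x(1)[OF that(3)] d[OF that(2,3)]] by (simp add: D_def)
    show "\<exists>g\<in>\<Gamma>. \<rho> h (D n g) \<le> 4 * c * n" if n: "1 \<le> n" and h: "h \<in> \<Gamma>" for n h
    proof -
      obtain y where y: "y \<in> Y" "\<rho> h (a n y) \<le> c" using a_onto[OF n h] by blast
      define g where "g = a 1 y"
      have g: "g \<in> \<Gamma>" unfolding g_def by (rule a1[OF y(1)])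
      have "\<bar>d (x g) y - 0\<bar> \<le> 2 * c" using near[OF g y(1)] g by (simp add: g_def)
      from mul[OF n x(1)[OF g] y(1) this] have "\<rho> (D n g) (a n y) \<le> 3 * c * n" by (simp add: D_def)
      moreover have "\<rho> h (D n g) \<le> \<rho> h (a n y) + \<rho> (D n g) (a n y)"
        using \<Gamma>.triangle[OF h a_in[OF n y(1)], of "D n g"] x g a_in[OF n] \<Gamma>.commute[of "a n y" "D n g"] by (simp add: D_def)
      moreover have "c * 1 \<le> c * n" using n c by (intro mult_left_mono) auto
      ultimately show ?thesis using y g by (intro bexI[of _ g]) auto
    qed
    show "\<rho> p (D n p) \<le> 5 * c * n" if n: "1 \<le> n" for n
    proof -
      have "\<bar>d (x p) q - 0\<bar> \<le> 3 * c" using near[OF p q] a_base[of 1] by simp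
      from mul[OF n x(1)[OF p] q this] have "\<rho> (D n p) (a n q) \<le> 4 * c * n" by (simp add: D_def)
      moreover have "\<rho> p (D n p) \<le> \<rho> p (a n q) + \<rho> (D n p) (a n q)"
        using \<Gamma>.triangle[OF p a_in[OF n q], of "D n p"] x p a_in[OF n] \<Gamma>.commute[of "a n q" "D n p"] by (simp add: D_def)
      moreover have "c * 1 \<le> c * n" using n c by (intro mult_left_mono) auto
      ultimately show ?thesis using a_base[OF n] by simp
    qed
  qed
qed

text \<open>A correspondence between balls need not relate the base points. However, a point
  \<open>g0\<close> related to \<open>q'\<close> has the whole ball around \<open>p\<close> within
  the rescaled distance \<open>R + \<epsilon>\<close>, and \<open>centre\<close> then forces
  \<open>g0\<close> close to \<open>p\<close>.\<close>

lemma approximation: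
  assumes cone: "asymptotic_cone \<Gamma> \<rho> p X dX q'" and R: "0 < R"
  shows "\<exists>n \<R> g0. 1 \<le> n \<and> \<R> \<subseteq> \<Gamma> \<times> X \<and> (\<forall>g\<in>\<Gamma>. \<rho> p g \<le> real n * R \<longrightarrow> (\<exists>y. (g, y) \<in> \<R>)) \<and>
    (\<forall>y\<in>X. dX q' y \<le> R \<longrightarrow> (\<exists>g. (g, y) \<in> \<R>)) \<and>
    (\<forall>g y g' y'. (g, y) \<in> \<R> \<longrightarrow> (g', y') \<in> \<R> \<longrightarrow> \<bar>\<rho> g g' / n - dX y y'\<bar> \<le> 1) \<and> (g0, q') \<in> \<R> \<and> \<rho> p g0 \<le> n"
proof -
  have X: "Metric_space X dX" and q': "q' \<in> X"
    and lim: "(\<lambda>n. GH_distance (Metric_space.mcball \<Gamma> (\<lambda>x x'. 1 / real n * \<rho> x x') p R) (\<lambda>x x'. 1 / real n * \<rho> x x')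
          (Metric_space.mcball X dX q' R) dX) \<longlonglongrightarrow> 0"
    using cone R unfolding asymptotic_cone_def proper_metric_def pointed_GH_limit_def by blast+
  interpret X: Metric_space X dX by (rule X)
  obtain \<epsilon> N where \<epsilon>: "0 < \<epsilon>" and N: "\<And>n g. n \<ge> N \<Longrightarrow> g \<in> \<Gamma> \<Longrightarrow> \<rho> p g \<le> real n * R \<Longrightarrow>
          (\<And>h. h \<in> \<Gamma> \<Longrightarrow> \<rho> p h \<le> real n * R \<Longrightarrow> \<rho> g h \<le> real n * (R + \<epsilon>)) \<Longrightarrow> \<rho> p g \<le> real n"
    using centre[OF R] by blast
  define \<delta> where "\<delta> = min \<epsilon> 1 / 2"
  have \<delta>: "0 < \<delta>" "2 * \<delta> \<le> \<epsilon>" "2 * \<delta> \<le> 1" using \<epsilon> by (auto simp: \<delta>_def)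
  have "\<forall>\<^sub>F n in sequentially. GH_distance (Metric_space.mcball \<Gamma> (\<lambda>x x'. 1 / real n * \<rho> x x') p R) (\<lambda>x x'. 1 / real n * \<rho> x x')
          (Metric_space.mcball X dX q' R) dX < \<delta>"
    using order_tendstoD(2)[OF lim \<delta>(1)] .
  then obtain M where M: "\<And>n. n \<ge> M \<Longrightarrow> GH_distance (Metric_space.mcball \<Gamma> (\<lambda>x x'. 1 / real n * \<rho> x x') p R) (\<lambda>x x'. 1 / real n * \<rho> x x')
          (Metric_space.mcball X dX q' R) dX < \<delta>" unfolding eventually_sequentially by blast
  define n where "n = max 1 (max N M)"
  have n: "1 \<le> n" "N \<le> n" "M \<le> n" by (auto simp: n_def)
  let ?\<rho> = "\<lambda>x x'. 1 / real n * \<rho> x x'"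
  interpret S: Metric_space \<Gamma> ?\<rho> by (rule scaled[OF n(1)])
  have n0: "0 < real n" using n by simp
  have B: "g \<in> S.mcball p R \<longleftrightarrow> g \<in> \<Gamma> \<and> \<rho> p g \<le> n * R" for g
    using p n0 unfolding S.in_mcball by (auto simp: field_simps)
  have "\<exists>\<R>. correspondence (S.mcball p R) (X.mcball q' R) \<R> \<and> distortion_le ?\<rho> dX \<R> (2 * \<delta>)"
  proof (rule GH_distance_less[OF S.subspace[OF S.mcball_subset_mspace] X.subspace[OF X.mcball_subset_mspace] _ _ _ _ M[OF n(3)]])
    show "S.mcball p R \<noteq> {}" "X.mcball q' R \<noteq> {}" unfolding S.mcball_eq_empty X.mcball_eq_empty using p q' R by auto
  qed (intro ball_bounded S.Metric_space_axioms X.Metric_space_axioms p q')+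
  then obtain \<R> where cor: "correspondence (S.mcball p R) (X.mcball q' R) \<R>" and dis: "distortion_le ?\<rho> dX \<R> (2 * \<delta>)" by blast
  have dis': "\<bar>\<rho> g g' / n - dX y y'\<bar> \<le> 2 * \<delta>" if "(g, y) \<in> \<R>" "(g', y') \<in> \<R>" for g y g' y'
    using dis that by (fastforce simp: distortion_le_def)
  have sub: "\<R> \<subseteq> S.mcball p R \<times> X.mcball q' R" using cor by (simp add: correspondence_def)
  have tot1: "\<exists>y. (g, y) \<in> \<R>" if "g \<in> \<Gamma>" "\<rho> p g \<le> n * R" for g using cor that B unfolding correspondence_def by blast
  have tot2: "\<exists>g. (g, y) \<in> \<R>" if "y \<in> X" "dX q' y \<le> R" for y
  proof -
    have "y \<in> X.mcball q' R" using that q' by simp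
    then show ?thesis using cor unfolding correspondence_def by blast
  qed
  obtain g0 where g0: "(g0, q') \<in> \<R>" using tot2[OF q'] R q' by auto
  have "g0 \<in> S.mcball p R" using g0 sub by blast
  then have g0\<Gamma>: "g0 \<in> \<Gamma>" "\<rho> p g0 \<le> n * R" unfolding B by blast+
  have "\<rho> p g0 \<le> n"
  proof (rule N[OF n(2) g0\<Gamma>])
    fix h assume h: "h \<in> \<Gamma>" "\<rho> p h \<le> n * R"
    then obtain y where y: "(h, y) \<in> \<R>" using tot1 by blast
    then have "y \<in> X.mcball q' R" using sub by blast
    then have "dX q' y \<le> R" by simp
    then have "\<rho> g0 h / n \<le> R + \<epsilon>" using dis'[OF g0 y] \<delta> by linarith
    then show "\<rho> g0 h \<le> n * (R + \<epsilon>)" using n0 by (simp add: field_simps)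
  qed
  moreover have "\<R> \<subseteq> \<Gamma> \<times> X"
  proof -
    have "S.mcball p R \<times> X.mcball q' R \<subseteq> \<Gamma> \<times> X" using B by auto
    then show ?thesis using sub by (rule order_trans[rotated])
  qed
  moreover have "\<bar>\<rho> g g' / n - dX y y'\<bar> \<le> 1" if "(g, y) \<in> \<R>" "(g', y') \<in> \<R>" for g y g' y'
    using dis'[OF that] \<delta> by linarith
  ultimately show ?thesis using n(1) tot1 tot2 g0 by (intro exI[of _ n] exI[of _ \<R>] exI[of _ g0]) blast
qed

text \<open>\<open>\<Gamma>\<close> is mapped to \<open>X\<close> directly, without an isometry
  between cones: at each scale, \<open>g\<close> goes to its dilate and on to a related point of
  \<open>X\<close>. Since \<open>X\<close> is proper, a diagonal subsequence yields a limit map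
  \<open>l\<close>. Its error consists of the rescaled error \<open>4 * c\<close> of the dilations,
  the distortion 1 of the correspondences and the distances to the limits.\<close>

theorem cone_quasi_isometric:
  assumes cone: "asymptotic_cone \<Gamma> \<rho> p X dX q'"
  shows "\<exists>C>0. one_quasi_isometric C \<Gamma> \<rho> X dX"
proof -
  have properX: "proper_metric X dX" and q': "q' \<in> X" using cone by (auto simp: asymptotic_cone_def)
  then have X: "Metric_space X dX" by (simp add: proper_metric_def)
  interpret X: Metric_space X dX by (rule X)
  obtain D :: "nat \<Rightarrow> 'a \<Rightarrow> 'a" where D: "\<And>n g. 1 \<le> n \<Longrightarrow> g \<in> \<Gamma> \<Longrightarrow> D n g \<in> \<Gamma>"
    and Dd: "\<And>n g h. 1 \<le> n \<Longrightarrow> g \<in> \<Gamma> \<Longrightarrow> h \<in> \<Gamma> \<Longrightarrow> \<bar>\<rho> (D n g) (D n h) - n * \<rho> g h\<bar> \<le> 4 * c * n"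
    and Donto: "\<And>n h. 1 \<le> n \<Longrightarrow> h \<in> \<Gamma> \<Longrightarrow> \<exists>g\<in>\<Gamma>. \<rho> h (D n g) \<le> 4 * c * n"
    and Dp: "\<And>n. 1 \<le> n \<Longrightarrow> \<rho> p (D n p) \<le> 5 * c * n"
    using dilation by blast
  define Q where "Q k n \<R> g0 \<longleftrightarrow> 1 \<le> n \<and> \<R> \<subseteq> \<Gamma> \<times> X \<and> (\<forall>g\<in>\<Gamma>. \<rho> p g \<le> real n * real (Suc k) \<longrightarrow> (\<exists>y. (g, y) \<in> \<R>)) \<and>
    (\<forall>y\<in>X. dX q' y \<le> real (Suc k) \<longrightarrow> (\<exists>g. (g, y) \<in> \<R>)) \<and>
    (\<forall>g y g' y'. (g, y) \<in> \<R> \<longrightarrow> (g', y') \<in> \<R> \<longrightarrow> \<bar>\<rho> g g' / n - dX y y'\<bar> \<le> 1) \<and> (g0, q') \<in> \<R> \<and> \<rho> p g0 \<le> n"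
    for k n \<R> g0
  have "\<exists>n \<R> g0. Q k n \<R> g0" for k
    unfolding Q_def by (rule approximation[OF cone]) simp
  then obtain N \<R> g0 where Q: "\<And>k. Q k (N k) (\<R> k) (g0 k)" by metis
  have N: "1 \<le> N k" "0 < real (N k)" and sub: "\<R> k \<subseteq> \<Gamma> \<times> X"
    and tot1: "\<And>g. g \<in> \<Gamma> \<Longrightarrow> \<rho> p g \<le> real (N k) * real (Suc k) \<Longrightarrow> \<exists>y. (g, y) \<in> \<R> k"
    and tot2: "\<And>y. y \<in> X \<Longrightarrow> dX q' y \<le> real (Suc k) \<Longrightarrow> \<exists>g. (g, y) \<in> \<R> k"
    and dis: "\<And>g y g' y'. (g, y) \<in> \<R> k \<Longrightarrow> (g', y') \<in> \<R> k \<Longrightarrow> \<bar>\<rho> g g' / N k - dX y y'\<bar> \<le> 1"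
    and g0: "(g0 k, q') \<in> \<R> k" "\<rho> p (g0 k) \<le> N k" for k
    using Q[of k] unfolding Q_def by (blast, force, blast+)
  have div: "\<bar>\<rho> (D (N k) g) (D (N k) h) / N k - \<rho> g h\<bar> \<le> 4 * c" if "g \<in> \<Gamma>" "h \<in> \<Gamma>" for g h k
  proof -
    have "\<bar>\<rho> (D (N k) g) (D (N k) h) - N k * \<rho> g h\<bar> / N k \<le> 4 * c * N k / N k"
      using Dd[OF N(1) that] by (intro divide_right_mono) auto
    moreover have "\<bar>\<rho> (D (N k) g) (D (N k) h) - N k * \<rho> g h\<bar> / N k = \<bar>\<rho> (D (N k) g) (D (N k) h) / N k - \<rho> g h\<bar>"
      using N(2)[of k] by (metis abs_divide abs_of_pos diff_divide_distrib nonzero_mult_div_cancel_left order_less_irrefl)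
    ultimately show ?thesis using N(2)[of k] by simp
  qed
  have Dball: "\<rho> p (D (N k) g) / N k \<le> \<rho> p g + 9 * c" if g: "g \<in> \<Gamma>" for g k
  proof -
    have "\<rho> p (D (N k) g) \<le> \<rho> p (D (N k) p) + \<rho> (D (N k) p) (D (N k) g)"
      using \<Gamma>.triangle[OF p D[OF N(1) p] D[OF N(1) g]] .
    then have "\<rho> p (D (N k) g) / N k \<le> (\<rho> p (D (N k) p) + \<rho> (D (N k) p) (D (N k) g)) / N k"
      by (intro divide_right_mono) auto
    moreover have "\<rho> p (D (N k) p) / N k \<le> 5 * c" using Dp[OF N(1), of k] N(2)[of k] by (simp add: field_simps)
    ultimately show ?thesis using div[OF p g, of k] by (simp add: add_divide_distrib)
  qed
  \<comment> \<open>As long as the dilate of \<open>g\<close> is unrelated to any point, the value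
    is the base point; the sequence for a fixed \<open>g\<close> thus stays bounded.\<close>
  define f where "f k g = (if \<exists>y. (D (N k) g, y) \<in> \<R> k then SOME y. (D (N k) g, y) \<in> \<R> k else q')" for k g
  have f: "(D (N k) g, f k g) \<in> \<R> k" if g: "g \<in> \<Gamma>" and k: "\<rho> p g + 9 * c \<le> Suc k" for g k
  proof -
    have "\<rho> p (D (N k) g) / N k \<le> Suc k" using Dball[OF g, of k] k by linarith
    then have "\<rho> p (D (N k) g) \<le> real (N k) * real (Suc k)" using N(2)[of k] by (simp add: field_simps)
    then have "\<exists>y. (D (N k) g, y) \<in> \<R> k" by (rule tot1[OF D[OF N(1) g]])
    then show ?thesis unfolding f_def by (auto intro: someI_ex)
  qed
  have fX: "f k g \<in> X" for k g
    using sub[of k] q' someI_ex[of "\<lambda>y. (D (N k) g, y) \<in> \<R> k"] unfolding f_def by auto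
  have g0\<Gamma>: "g0 k \<in> \<Gamma>" for k using g0(1)[of k] sub[of k] by blast
  have f_near: "dX q' (f k g) \<le> \<rho> p g + 9 * c + 2" if g: "g \<in> \<Gamma>" for k g
  proof (cases "\<exists>y. (D (N k) g, y) \<in> \<R> k")
    case True
    then have m: "(D (N k) g, f k g) \<in> \<R> k" unfolding f_def by (auto intro: someI_ex)
    have "\<rho> (g0 k) (D (N k) g) \<le> \<rho> p (g0 k) + \<rho> p (D (N k) g)"
      using \<Gamma>.triangle[OF g0\<Gamma> p D[OF N(1) g], of k k] \<Gamma>.commute[of "g0 k" p] by simp
    then have "\<rho> (g0 k) (D (N k) g) / N k \<le> (\<rho> p (g0 k) + \<rho> p (D (N k) g)) / N k" by (intro divide_right_mono) auto
    moreover have "\<rho> p (g0 k) / N k \<le> 1" using g0(2)[of k] N(2)[of k] by simp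
    ultimately show ?thesis using dis[OF g0(1) m] Dball[OF g, of k] by (simp add: add_divide_distrib)
  next
    case False
    then show ?thesis using q' c \<Gamma>.nonneg[of p g] by (simp add: f_def)
  qed
  have "countable \<Gamma>"
  proof -
    have "\<Gamma> = (\<Union>k::nat. {g \<in> \<Gamma>. \<rho> p g \<le> k})" using real_arch_simple by auto
    moreover have "countable (\<Union>k::nat. {g \<in> \<Gamma>. \<rho> p g \<le> k})"
      using finite_ball by (intro countable_UN) (auto intro: countable_finite)
    ultimately show ?thesis by simp
  qed
  moreover have "\<exists>K. compactin X.mtopology K \<and> (\<forall>k. f k g \<in> K)" if g: "g \<in> \<Gamma>" for g
  proof (intro exI conjI allI)
    show "compactin X.mtopology (X.mcball q' (\<rho> p g + 9 * c + 2))" using properX q' by (simp add: proper_metric_def)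
    show "f k g \<in> X.mcball q' (\<rho> p g + 9 * c + 2)" for k using f_near[OF g] fX q' by simp
  qed
  ultimately obtain s l where s: "strict_mono s" and l: "\<And>g. g \<in> \<Gamma> \<Longrightarrow> l g \<in> X" "\<And>g. g \<in> \<Gamma> \<Longrightarrow> (\<lambda>k. dX (f (s k) g) (l g)) \<longlonglongrightarrow> 0"
    using diagonal_limits[OF X, of \<Gamma> f] p by blast
  have sk: "k \<le> s k" for k using s by (rule seq_suble)
  define C where "C = 4 * c + 3"
  have l_dist: "\<bar>dX (l g) (l h) - \<rho> g h\<bar> \<le> C" if g: "g \<in> \<Gamma>" and h: "h \<in> \<Gamma>" for g h
  proof -
    obtain K where K: "max (\<rho> p g) (\<rho> p h) + 9 * c \<le> real K" using real_arch_simple by blast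
    have "\<forall>\<^sub>F k in sequentially. dX (f (s k) g) (l g) < 1" "\<forall>\<^sub>F k in sequentially. dX (f (s k) h) (l h) < 1"
      using order_tendstoD(2)[OF l(2)[OF g], of 1] order_tendstoD(2)[OF l(2)[OF h], of 1] by auto
    then have "\<forall>\<^sub>F k in sequentially. dX (f (s k) g) (l g) < 1 \<and> dX (f (s k) h) (l h) < 1 \<and> K \<le> k"
      using eventually_ge_at_top[of K] by eventually_elim auto
    from eventually_happens'[OF sequentially_bot this]
    obtain k where k: "dX (f (s k) g) (l g) < 1" "dX (f (s k) h) (l h) < 1" "K \<le> k" by blast
    have "real K \<le> real (Suc (s k))" using k(3) sk[of k] by simp
    then have m: "(D (N (s k)) g, f (s k) g) \<in> \<R> (s k)" "(D (N (s k)) h, f (s k) h) \<in> \<R> (s k)"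
      using f[OF g, of "s k"] f[OF h, of "s k"] K by linarith+
    have "\<bar>dX (f (s k) g) (f (s k) h) - \<rho> g h\<bar> \<le> 4 * c + 1"
      using dis[OF m] div[OF g h, of "s k"] by linarith
    moreover have "\<bar>dX (l g) (l h) - dX (f (s k) g) (f (s k) h)\<bar> \<le> dX (f (s k) g) (l g) + dX (f (s k) h) (l h)"
      using X.triangle[OF l(1)[OF g] fX l(1)[OF h], of "s k" g] X.triangle[OF fX fX l(1)[OF h], of "s k" g "s k" h]
        X.triangle[OF fX l(1)[OF g] fX, of "s k" g "s k" h] X.triangle[OF l(1)[OF g] l(1)[OF h] fX, of "s k" h]
        X.commute[of "l g" "f (s k) g"] X.commute[of "l h" "f (s k) h"] by (simp add: abs_le_iff)
    ultimately show ?thesis using k by (simp add: C_def)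
  qed
  \<comment> \<open>At every large scale \<open>y\<close> is almost hit by some \<open>u\<close> in
    a fixed finite ball of \<open>\<Gamma>\<close>; by the pigeonhole principle one \<open>u\<close>
    serves infinitely many scales of the subsequence.\<close>
  have l_onto: "\<exists>g\<in>\<Gamma>. dX y (l g) \<le> C" if y: "y \<in> X" for y
  proof -
    define t where "t = dX q' y"
    define T where "T = t + 2 + 17 * c"
    obtain K where K: "max t (T + 9 * c) \<le> real K" using real_arch_simple by blast
    have "\<exists>u\<in>{g \<in> \<Gamma>. \<rho> p g \<le> T}. dX y (f k u) \<le> 4 * c + 1" if k: "K \<le> k" for k
    proof -
      have Kk: "real K \<le> real (Suc k)" using k by simp
      then obtain h where h: "(h, y) \<in> \<R> k" using tot2[OF y, of k] K by (auto simp: t_def)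
      have h\<Gamma>: "h \<in> \<Gamma>" using h sub by blast
      have hp: "\<rho> p h / N k \<le> t + 2"
      proof -
        have "\<rho> p h / N k \<le> (\<rho> p (g0 k) + \<rho> (g0 k) h) / N k" using \<Gamma>.triangle[OF p g0\<Gamma> h\<Gamma>] by (intro divide_right_mono) auto
        moreover have "\<rho> p (g0 k) / N k \<le> 1" using g0(2)[of k] N(2)[of k] by simp
        ultimately show ?thesis using dis[OF g0(1) h] by (simp add: add_divide_distrib t_def)
      qed
      obtain u where u: "u \<in> \<Gamma>" "\<rho> h (D (N k) u) \<le> 4 * c * N k" using Donto[OF N(1) h\<Gamma>] by blast
      have hu: "\<rho> h (D (N k) u) / N k \<le> 4 * c" using u(2) N(2)[of k] by (simp add: field_simps)
      have "\<rho> (D (N k) p) (D (N k) u) \<le> \<rho> p (D (N k) p) + (\<rho> p h + \<rho> h (D (N k) u))"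
        using \<Gamma>.triangle[OF D[OF N(1) p] p D[OF N(1) u(1)], of k k] \<Gamma>.triangle[OF p h\<Gamma> D[OF N(1) u(1)], of k]
          \<Gamma>.commute[of "D (N k) p" p] by simp
      then have "\<rho> (D (N k) p) (D (N k) u) / N k \<le> (\<rho> p (D (N k) p) + (\<rho> p h + \<rho> h (D (N k) u))) / N k"
        by (intro divide_right_mono) auto
      moreover have "\<rho> p (D (N k) p) / N k \<le> 5 * c" using Dp[OF N(1), of k] N(2)[of k] by (simp add: field_simps)
      ultimately have pu: "\<rho> p u \<le> T" using div[OF p u(1), of k] hp hu c by (simp add: T_def add_divide_distrib)
      then have m: "(D (N k) u, f k u) \<in> \<R> k" using f[OF u(1), of k] K Kk by linarith
      have "dX y (f k u) \<le> 4 * c + 1" using dis[OF h m] hu by linarith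
      then show ?thesis using u(1) pu by blast
    qed
    then have "\<forall>k\<in>{K..}. \<exists>u\<in>{g \<in> \<Gamma>. \<rho> p g \<le> T}. dX y (f (s k) u) \<le> 4 * c + 1"
      using sk by (meson atLeast_iff order_trans)
    from pigeonhole_infinite_rel[OF infinite_Ici finite_ball this]
    obtain u where u: "u \<in> \<Gamma>" and inf: "infinite {k \<in> {K..}. dX y (f (s k) u) \<le> 4 * c + 1}" by blast
    have "\<forall>\<^sub>F k in sequentially. dX (f (s k) u) (l u) < 1" using order_tendstoD(2)[OF l(2)[OF u], of 1] by simp
    then obtain M where M: "\<And>k. M \<le> k \<Longrightarrow> dX (f (s k) u) (l u) < 1" unfolding eventually_sequentially by blast
    obtain k where k: "M \<le> k" "dX y (f (s k) u) \<le> 4 * c + 1"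
      using inf unfolding infinite_nat_iff_unbounded_le by blast
    have "dX y (l u) \<le> C" using X.triangle[OF y fX l(1)[OF u], of "s k" u] M[OF k(1)] k(2) by (simp add: C_def)
    then show ?thesis using u by blast
  qed
  have "one_quasi_isometric C \<Gamma> \<rho> X dX"
    unfolding one_quasi_isometric_def using l(1) l_dist l_onto by (intro exI[of _ l]) auto
  then show ?thesis using c by (intro exI[of _ C]) (simp add: C_def)
qed

end

section \<open>The asymptotic cone of a nilpotent group\<close>

text \<open>The final statement asks for a cone inside the type of group elements, so the metric on
  \<open>V \<times> Z\<close> has to be moved along an injection.\<close>

lemma proper_transport:
  fixes j :: "'y \<Rightarrow> 'x"
  assumes P: "proper_metric Y d" and j: "inj_on j Y"
  shows "proper_metric (j ` Y) (\<lambda>x y. d (inv_into Y j x) (inv_into Y j y))"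
proof -
  interpret Y: Metric_space Y d using P by (simp add: proper_metric_def)
  let ?k = "inv_into Y j"
  let ?d = "\<lambda>x y. d (?k x) (?k y)"
  have kY: "?k x \<in> Y" if "x \<in> j ` Y" for x using that by (rule inv_into_into)
  have jk: "j (?k x) = x" if "x \<in> j ` Y" for x using that by (rule f_inv_into_f)
  have kj: "?k (j x) = x" if "x \<in> Y" for x using j that by simp
  have M: "Metric_space (j ` Y) ?d"
  proof
    fix x y z
    show "0 \<le> ?d x y" "?d x y = ?d y x" by (simp_all add: Y.commute)
    show "(?d x y = 0) = (x = y)" if "x \<in> j ` Y" "y \<in> j ` Y" using that kY jk by (metis Y.zero)
    show "?d x z \<le> ?d x y + ?d y z" if "x \<in> j ` Y" "y \<in> j ` Y" "z \<in> j ` Y" using that kY Y.triangle by blast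
  qed
  interpret J: Metric_space "j ` Y" ?d by (rule M)
  have "compactin J.mtopology (J.mcball x R)" if x: "x \<in> j ` Y" for x R
    unfolding J.compactin_sequentially
  proof (intro conjI allI impI)
    show "J.mcball x R \<subseteq> j ` Y" by auto
    fix \<sigma> :: "nat \<Rightarrow> 'x" assume "range \<sigma> \<subseteq> J.mcball x R"
    then have "\<sigma> i \<in> J.mcball x R" for i by blast
    then have \<sigma>: "\<sigma> i \<in> j ` Y" "?d x (\<sigma> i) \<le> R" for i by (auto simp only: J.in_mcball)
    have "range (?k \<circ> \<sigma>) \<subseteq> Y.mcball (?k x) R" using \<sigma> kY x by auto
    moreover have "compactin Y.mtopology (Y.mcball (?k x) R)" using P kY[OF x] by (simp add: proper_metric_def)
    ultimately obtain l r where lr: "l \<in> Y.mcball (?k x) R" "strict_mono r" "limitin Y.mtopology ((?k \<circ> \<sigma>) \<circ> r) l sequentially"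
      unfolding Y.compactin_sequentially by meson
    have lY: "l \<in> Y" "d (?k x) l \<le> R" using lr(1) by auto
    have "limitin J.mtopology (\<sigma> \<circ> r) (j l) sequentially"
      using lr(3) \<sigma> lY kj[OF lY(1)] by (simp add: J.limitin_metric_dist_null Y.limitin_metric_dist_null comp_def)
    moreover have "j l \<in> J.mcball x R" using lY x kj[OF lY(1)] by simp
    ultimately show "\<exists>l r. l \<in> J.mcball x R \<and> strict_mono r \<and> limitin J.mtopology (\<sigma> \<circ> r) l sequentially" using lr(2) by blast
  qed
  then show ?thesis using M by (simp add: proper_metric_def)
qed

context nilpotent_coords begin

text \<open>The translation is iterated. An element of the enlarged ball is split into one of length
  at most \<open>R\<close>, to which \<open>drift\<close> applies, and a short rest. Each round adds
  \<open>\<epsilon>\<close>, and at most 1 for rounding \<open>R\<close> down to an integer.\<close>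

lemma ball_drift:
  fixes \<epsilon> R :: real
  assumes g: "g \<in> carrier G" and R: "0 \<le> R"
    and drift: "\<And>h. h \<in> carrier G \<Longrightarrow> wl h \<le> R \<Longrightarrow> wl (inv g \<otimes> h) \<le> R + \<epsilon>" and \<epsilon>: "0 \<le> \<epsilon>"
  shows "wl (g [^] (j::nat)) \<le> R + j * (\<epsilon> + 1)"
proof -
  have "wl (inv (g [^] j) \<otimes> h) \<le> R + j * (\<epsilon> + 1)" if "h \<in> carrier G" "wl h \<le> R" for h
    using that
  proof (induction j arbitrary: h)
    case (Suc j)
    define u where "u = inv (g [^] j) \<otimes> h"
    have u: "u \<in> carrier G" using g Suc.prems by (simp add: u_def)
    have IH: "wl u \<le> R + j * (\<epsilon> + 1)" using Suc by (simp add: u_def)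
    have e: "inv (g [^] Suc j) \<otimes> h = inv g \<otimes> u"
      using g Suc.prems by (simp add: u_def inv_mult_group m_assoc)
    define i where "i = min (wl u) (nat \<lfloor>R\<rfloor>)"
    have fl: "real (nat \<lfloor>R\<rfloor>) \<le> R" "R < real (nat \<lfloor>R\<rfloor>) + 1" using R by linarith+
    obtain x y where xy: "x \<in> carrier G" "y \<in> carrier G" "x \<otimes> y = u" "wl x \<le> i" "wl y \<le> wl u - i"
      using wl_split[OF u, of i] by (auto simp: i_def)
    have "wl x \<le> R" using xy(4) fl by (simp add: i_def)
    from drift[OF xy(1) this] have "wl (inv g \<otimes> x) \<le> R + \<epsilon>" .
    moreover have "wl (inv g \<otimes> u) \<le> wl (inv g \<otimes> x) + wl y"
      using wl_mult[of "inv g \<otimes> x" y] xy g by (simp add: m_assoc)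
    then have "real (wl (inv g \<otimes> u)) \<le> real (wl (inv g \<otimes> x)) + real (wl y)" by (simp flip: of_nat_add)
    moreover have "real (wl y) \<le> j * (\<epsilon> + 1) + 1"
    proof (cases "wl u \<le> nat \<lfloor>R\<rfloor>")
      case True
      then have "wl y = 0" using xy(5) by (simp add: i_def)
      then show ?thesis using \<epsilon> by simp
    next
      case False
      then have "real (wl y) \<le> real (wl u) - real (nat \<lfloor>R\<rfloor>)" using xy(5) by (simp add: i_def)
      then show ?thesis using IH fl by linarith
    qed
    ultimately show ?case unfolding e by (simp add: algebra_simps)
  qed (use g in simp)
  from this[of \<one>] show ?thesis using g R by simp
qed

text \<open>If one translation by \<open>g\<close> hardly enlarges a ball, neither do about
  \<open>R / \<epsilon>\<close> of them, so a high power of \<open>g\<close> is still short. But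
  \<open>\<pi>\<close> and \<open>\<zeta>\<close> of the \<open>j\<close>-th power are
  \<open>j\<close> times those of \<open>g\<close>; hence the coordinates of \<open>g\<close> are
  small, and the ball-box estimate bounds its length.\<close>

lemma centre:
  fixes R :: real
  assumes R: "0 < R"
  shows "\<exists>\<epsilon>>0. \<exists>N. \<forall>n\<ge>N. \<forall>g\<in>carrier G. wl g \<le> real n * R \<longrightarrow>
    (\<forall>h\<in>carrier G. wl h \<le> real n * R \<longrightarrow> wl (inv g \<otimes> h) \<le> real n * (R + \<epsilon>)) \<longrightarrow> wl g \<le> real n"
proof -
  obtain cb where cb: "1 \<le> cb" "\<And>g. g \<in> carrier G \<Longrightarrow> wl g \<le> cb * (norm (\<pi> g) + sqrt (norm (\<zeta> g)) + 1)"
    using ballbox by blast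
  define M where "M = 18 * c0 ^ 3 * (R + 1)"
  have M: "0 < M" using c0(1) R by (simp add: M_def)
  \<comment> \<open>The two fractions bound the contributions of \<open>\<pi> g\<close> and
    \<open>\<zeta> g\<close> before the factor \<open>cb\<close> by \<open>n / (4 * cb)\<close>
    each. \<open>N\<close> takes care of the 1 in the ball-box estimate and of the rounding in
    \<open>ball_drift\<close>.\<close>
  define \<epsilon> where "\<epsilon> = min 1 (min (1 / (12 * cb * c0)) (1 / (16 * cb\<^sup>2 * M)))"
  have cpos: "0 < cb" "0 < c0" using cb c0 by auto
  have \<epsilon>: "0 < \<epsilon>" "\<epsilon> \<le> 1" "\<epsilon> \<le> 1 / (12 * cb * c0)" "\<epsilon> \<le> 1 / (16 * cb\<^sup>2 * M)"
    using cpos M by (auto simp: \<epsilon>_def)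
  define N where "N = max (nat \<lceil>1 / \<epsilon>\<rceil>) (nat \<lceil>2 * cb\<rceil>)"
  have "wl g \<le> real n" if n: "n \<ge> N" and g: "g \<in> carrier G"
      and drift: "\<And>h. h \<in> carrier G \<Longrightarrow> wl h \<le> real n * R \<Longrightarrow> wl (inv g \<otimes> h) \<le> real n * (R + \<epsilon>)" for n g
  proof -
    have "1 / \<epsilon> \<le> real n" "2 * cb \<le> real n" using n unfolding N_def by linarith+
    then have n\<epsilon>: "1 \<le> real n * \<epsilon>" "2 * cb \<le> n" "0 < real n" using \<epsilon>(1) cb(1) by (auto simp: field_simps)
    have pow: "wl (g [^] j) \<le> n * R + j * (n * \<epsilon> + 1)" for j :: nat
    proof (rule ball_drift[OF g])
      show "wl (inv g \<otimes> h) \<le> real n * R + real n * \<epsilon>" if "h \<in> carrier G" "wl h \<le> real n * R" for h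
        using drift[OF that] by (simp add: algebra_simps)
    qed (use R \<epsilon> in auto)
    define j where "j = nat \<lceil>R / \<epsilon>\<rceil>"
    have R\<epsilon>: "0 < R / \<epsilon>" using R \<epsilon> by simp
    then have Rj: "R / \<epsilon> \<le> j" "real j \<le> R / \<epsilon> + 1" unfolding j_def by linarith+
    have j: "R \<le> j * \<epsilon>" "j * \<epsilon> \<le> R + 1" "0 < real j"
      using Rj \<epsilon>(1,2) order_less_le_trans[OF R\<epsilon> Rj(1)] by (simp_all add: field_simps)
    have "wl (g [^] j) \<le> n * (j * \<epsilon>) + j * (n * \<epsilon> + n * \<epsilon>)"
    proof -
      have "n * R \<le> n * (j * \<epsilon>)" using j by (intro mult_left_mono) auto
      moreover have "j * (n * \<epsilon> + 1) \<le> j * (n * \<epsilon> + n * \<epsilon>)" using n\<epsilon>(1) by (intro mult_left_mono add_left_mono) auto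
      ultimately show ?thesis using pow[of j] by linarith
    qed
    then have wj: "wl (g [^] j) \<le> 3 * n * j * \<epsilon>" by (simp add: algebra_simps)
    have gj: "g [^] j \<in> carrier G" using g by simp
    have "j * norm (\<pi> g) = norm (\<pi> (g [^] j))" using g by (simp add: pi_pow)
    also have "\<dots> \<le> c0 * wl (g [^] j)" by (rule pi_bound[OF gj])
    also have "\<dots> \<le> c0 * (3 * n * j * \<epsilon>)" using wj c0(1) by (intro mult_left_mono) auto
    also have "\<dots> = j * (3 * c0 * \<epsilon> * n)" by simp
    finally have 1: "norm (\<pi> g) \<le> 3 * c0 * \<epsilon> * n" using j(3) by simp
    have "j * norm (\<zeta> g) = norm (\<zeta> (g [^] j))" using g by (simp add: zeta_pow)
    also have "\<dots> \<le> 2 * c0 ^ 3 * (real (wl (g [^] j)))\<^sup>2" by (rule zeta_bound[OF gj])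
    also have "\<dots> \<le> 2 * c0 ^ 3 * (3 * n * j * \<epsilon>)\<^sup>2" using wj c0(1) by (intro mult_left_mono power_mono) auto
    also have "\<dots> = j * (18 * c0 ^ 3 * (real n)\<^sup>2 * \<epsilon> * (j * \<epsilon>))" by (simp add: power2_eq_square)
    finally have "norm (\<zeta> g) \<le> 18 * c0 ^ 3 * (real n)\<^sup>2 * \<epsilon> * (j * \<epsilon>)" using j(3) by (simp only: mult_le_cancel_left_pos)
    also have "\<dots> \<le> 18 * c0 ^ 3 * (real n)\<^sup>2 * \<epsilon> * (R + 1)" using j c0(1) \<epsilon> by (intro mult_left_mono) auto
    also have "\<dots> = (real n)\<^sup>2 * (M * \<epsilon>)" by (simp add: M_def)
    finally have "sqrt (norm (\<zeta> g)) \<le> sqrt ((real n)\<^sup>2 * (M * \<epsilon>))" by simp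
    then have 2: "sqrt (norm (\<zeta> g)) \<le> n * sqrt (M * \<epsilon>)" by (simp add: real_sqrt_mult)
    have "M * \<epsilon> \<le> M * (1 / (16 * cb\<^sup>2 * M))" using \<epsilon>(4) M by (intro mult_left_mono) auto
    also have "\<dots> = (1 / (4 * cb))\<^sup>2" using M by (simp add: power_divide power_mult_distrib)
    finally have "M * \<epsilon> \<le> (1 / (4 * cb))\<^sup>2" .
    then have sM: "sqrt (M * \<epsilon>) \<le> 1 / (4 * cb)" using cpos M \<epsilon>(1) by (intro real_le_lsqrt) auto
    have 3: "3 * c0 * \<epsilon> \<le> 1 / (4 * cb)"
    proof -
      have "3 * c0 * \<epsilon> \<le> 3 * c0 * (1 / (12 * cb * c0))" using \<epsilon>(3) cpos by (intro mult_left_mono) auto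
      then show ?thesis using cpos by (simp add: field_simps)
    qed
    have "cb * (norm (\<pi> g) + sqrt (norm (\<zeta> g)) + 1) \<le> cb * (1 / (4 * cb) * n + n * (1 / (4 * cb)) + n / (2 * cb))"
    proof (intro mult_left_mono add_mono)
      show "norm (\<pi> g) \<le> 1 / (4 * cb) * n" using 1 mult_right_mono[OF 3, of "real n"] by simp
      show "sqrt (norm (\<zeta> g)) \<le> n * (1 / (4 * cb))" using 2 mult_left_mono[OF sM, of "real n"] by simp
      show "1 \<le> n / (2 * cb)" using n\<epsilon>(2) cpos by (simp add: field_simps)
    qed (use cpos in auto)
    also have "\<dots> = n" using cpos by (simp add: field_simps)
    finally show ?thesis using cb(2)[OF g] by linarith
  qed
  then show ?thesis using \<epsilon>(1) by (intro exI[of _ \<epsilon>] conjI exI[of _ N]) auto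
qed

theorem cone_approx:
  assumes \<rho>: "Metric_space (carrier G) \<rho>" and \<rho>_wl: "\<And>x y. x \<in> carrier G \<Longrightarrow> y \<in> carrier G \<Longrightarrow> \<rho> x y = wl (inv x \<otimes> y)"
    and j: "inj_on j (V \<times> Z)"
  shows "\<exists>d q a c. cone_approx (carrier G) \<rho> \<one> (j ` (V \<times> Z)) d q a c"
proof -
  obtain c1 where c1: "0 \<le> c1" "\<And>n x y. x \<in> V\<times>Z \<Longrightarrow> y \<in> V\<times>Z \<Longrightarrow> 1 \<le> n \<Longrightarrow> \<bar>r n x y - cd x y\<bar> \<le> c1 / n" using r_cd by blast
  obtain c2 :: real where c2: "0 \<le> c2" "\<And>n g. 1 \<le> n \<Longrightarrow> g \<in> carrier G \<Longrightarrow> \<exists>x\<in>V\<times>Z. real (wl (inv g \<otimes> apx n x)) \<le> c2" using apx_onto by blast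
  obtain M :: nat where M: "\<And>g. g \<in> carrier G \<Longrightarrow> norm (\<pi> g) \<le> R0 \<Longrightarrow> norm (\<zeta> g) \<le> R0 \<Longrightarrow> wl g \<le> M"
    using wl_bounded[of R0] by blast
  define c where "c = c1 + c2 + real M"
  define k where "k = inv_into (V \<times> Z) j"
  have kY: "k y \<in> V \<times> Z" if "y \<in> j ` (V \<times> Z)" for y using that unfolding k_def by (rule inv_into_into)
  have kj: "k (j x) = x" if "x \<in> V \<times> Z" for x using j that by (simp add: k_def)
  have 0: "(0, 0) \<in> V \<times> Z" using subV subZ by (simp add: subspace_0)
  have "cone_approx (carrier G) \<rho> \<one> (j ` (V \<times> Z)) (\<lambda>x y. cd (k x) (k y)) (j (0, 0)) (\<lambda>n y. apx n (k y)) c"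
  proof (rule cone_approx.intro)
    show "Metric_space (carrier G) \<rho>" by (rule \<rho>)
    show "\<one> \<in> carrier G" "j (0, 0) \<in> j ` (V \<times> Z)" "0 \<le> c" using 0 c1 c2 by (auto simp: c_def)
    show "proper_metric (j ` (V \<times> Z)) (\<lambda>x y. cd (k x) (k y))" unfolding k_def by (rule proper_transport[OF proper_cd j])
    show "apx n (k y) \<in> carrier G" if "y \<in> j ` (V \<times> Z)" for n y using apx(1)[OF kY[OF that]] .
    show "\<bar>\<rho> (apx n (k x)) (apx n (k y)) - real n * cd (k x) (k y)\<bar> \<le> c"
      if n: "1 \<le> n" and x: "x \<in> j ` (V \<times> Z)" and y: "y \<in> j ` (V \<times> Z)" for n x y
    proof -
      have n0: "0 < real n" using n by simp
      have "\<rho> (apx n (k x)) (apx n (k y)) = real n * r n (k x) (k y)"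
        using apx(1)[OF kY[OF x]] apx(1)[OF kY[OF y]] n0 by (simp add: \<rho>_wl r_def)
      then have "\<bar>\<rho> (apx n (k x)) (apx n (k y)) - real n * cd (k x) (k y)\<bar> = real n * \<bar>r n (k x) (k y) - cd (k x) (k y)\<bar>"
        using n0 by (simp add: abs_mult flip: right_diff_distrib)
      also have "\<dots> \<le> real n * (c1 / n)" using c1(2)[OF kY[OF x] kY[OF y] n] by (intro mult_left_mono) auto
      also have "\<dots> \<le> c" using n0 c2 by (simp add: c_def)
      finally show ?thesis .
    qed
    show "\<exists>x\<in>j ` (V \<times> Z). \<rho> g (apx n (k x)) \<le> c" if n: "1 \<le> n" and g: "g \<in> carrier G" for n g
    proof -
      obtain x where x: "x \<in> V \<times> Z" "real (wl (inv g \<otimes> apx n x)) \<le> c2" using c2(2)[OF n g] by blast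
      then show ?thesis using g apx(1)[OF x(1)] c1(1) kj by (intro bexI[of _ "j x"]) (auto simp: \<rho>_wl c_def)
    qed
    show "\<rho> \<one> (apx n (k (j (0, 0)))) \<le> c" if "1 \<le> n" for n
    proof -
      have "wl (apx n (0, 0)) \<le> M" using apx[OF 0, of n] by (intro M) auto
      then show ?thesis using apx(1)[OF 0, of n] kj[OF 0] c1 c2 by (simp add: \<rho>_wl c_def)
    qed
    show "\<exists>g'\<in>carrier G. \<rho> \<one> g' \<le> t \<and> \<rho> g' g \<le> max 0 (\<rho> \<one> g - t) + 1" if g: "g \<in> carrier G" and t: "0 \<le> t" for g t
    proof -
      define i where "i = min (wl g) (nat \<lfloor>t\<rfloor>)"
      have fl: "real (nat \<lfloor>t\<rfloor>) \<le> t" "t < real (nat \<lfloor>t\<rfloor>) + 1" using t by linarith+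
      obtain x y where xy: "x \<in> carrier G" "y \<in> carrier G" "x \<otimes> y = g" "wl x \<le> i" "wl y \<le> wl g - i"
        using wl_split[OF g, of i] by (auto simp: i_def)
      have y: "inv x \<otimes> g = y" using xy by (simp add: m_assoc[symmetric] flip: xy(3))
      have "real (wl x) \<le> t" using xy(4) fl by (simp add: i_def)
      moreover have "real (wl y) \<le> max 0 (real (wl g) - t) + 1"
      proof (cases "wl g \<le> nat \<lfloor>t\<rfloor>")
        case True
        then show ?thesis using xy(5) by (simp add: i_def)
      next
        case False
        then have "real (wl y) \<le> real (wl g) - real (nat \<lfloor>t\<rfloor>)" using xy(5) by (simp add: i_def)
        then show ?thesis using fl by linarith
      qed
      ultimately show ?thesis using g xy(1) y by (intro bexI[of _ x]) (auto simp: \<rho>_wl)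
    qed
    show "finite {g \<in> carrier G. \<rho> \<one> g \<le> R}" for R
    proof (rule finite_subset[OF _ finite_wl_ball[of "nat \<lceil>R\<rceil>"]])
      show "{g \<in> carrier G. \<rho> \<one> g \<le> R} \<subseteq> {g \<in> carrier G. wl g \<le> nat \<lceil>R\<rceil>}"
        by (auto simp: \<rho>_wl) linarith
    qed
    show "\<exists>\<epsilon>>0. \<exists>N. \<forall>n\<ge>N. \<forall>g\<in>carrier G. \<rho> \<one> g \<le> real n * R \<longrightarrow>
          (\<forall>h\<in>carrier G. \<rho> \<one> h \<le> real n * R \<longrightarrow> \<rho> g h \<le> real n * (R + \<epsilon>)) \<longrightarrow> \<rho> \<one> g \<le> real n" if "0 < R" for R
      using centre[OF that] by (simp add: \<rho>_wl)
  qed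
  then show ?thesis by blast
qed

end

section \<open>Extension of central coordinates\<close>

text \<open>
  Extending \<open>\<kappa>\<close> from the central subgroup \<open>C\<close> one generator at a time; the divisibility of the
  target makes each step possible.
\<close>

locale central_ext = group G for G (structure) +
  fixes C :: "'a set" and \<pi> :: "'a \<Rightarrow> 'v::real_normed_vector" and \<kappa> :: "'a \<Rightarrow> 'z::real_normed_vector"
    and B :: "'v \<Rightarrow> 'v \<Rightarrow> 'z" and Z :: "'z set"
  assumes bilB: "bounded_bilinear B" and B_alt: "\<And>v. B v v = 0" and Z: "subspace Z"
    and BZ: "\<And>x y. x \<in> carrier G \<Longrightarrow> y \<in> carrier G \<Longrightarrow> B (\<pi> x) (\<pi> y) \<in> Z"
    and C: "subgroup C G" and central: "\<And>c g. c \<in> C \<Longrightarrow> g \<in> carrier G \<Longrightarrow> c \<otimes> g = g \<otimes> c"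
    and commC: "\<And>x y. x \<in> carrier G \<Longrightarrow> y \<in> carrier G \<Longrightarrow> comm G x y \<in> C"
    and pi_mult: "\<And>g h. g \<in> carrier G \<Longrightarrow> h \<in> carrier G \<Longrightarrow> \<pi> (g \<otimes> h) = \<pi> g + \<pi> h"
    and pi_C: "\<And>c. c \<in> C \<Longrightarrow> \<pi> c = 0"
    and kappa_mult: "\<And>c c'. c \<in> C \<Longrightarrow> c' \<in> C \<Longrightarrow> \<kappa> (c \<otimes> c') = \<kappa> c + \<kappa> c'"
    and kappa_Z: "\<And>c. c \<in> C \<Longrightarrow> \<kappa> c \<in> Z"
    and kappa_comm: "\<And>x y. x \<in> carrier G \<Longrightarrow> y \<in> carrier G \<Longrightarrow> \<kappa> (comm G x y) = B (\<pi> x) (\<pi> y)"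
begin

sublocale B: bounded_bilinear B by (rule bilB)

lemma B_skew: "B w v = - B v w"
proof -
  have "B (v + w) (v + w) = B w v + B v w" unfolding B.add_left B.add_right by (simp add: B_alt)
  then have "B w v + B v w = 0" by (simp add: B_alt)
  then show ?thesis by (simp add: eq_neg_iff_add_eq_0)
qed

definition ext :: "'a set \<Rightarrow> ('a \<Rightarrow> 'z) \<Rightarrow> bool" where
  "ext H \<zeta> \<longleftrightarrow> subgroup H G \<and> C \<subseteq> H \<and> (\<forall>c\<in>C. \<zeta> c = \<kappa> c) \<and> (\<forall>x\<in>H. \<zeta> x \<in> Z) \<and>
     (\<forall>x\<in>H. \<forall>y\<in>H. \<zeta> (x \<otimes> y) = \<zeta> x + \<zeta> y + (1/2) *\<^sub>R B (\<pi> x) (\<pi> y))"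

lemma pi_pow: "g \<in> carrier G \<Longrightarrow> \<pi> (g [^] (n::int)) = of_int n *\<^sub>R \<pi> g"
proof -
  assume g: "g \<in> carrier G"
  have one: "\<pi> \<one> = 0" using pi_mult[of \<one> \<one>] by simp
  have nat: "\<pi> (g [^] (n::nat)) = real n *\<^sub>R \<pi> g" for n
    by (induction n) (use g one in \<open>simp_all add: pi_mult algebra_simps\<close>)
  have inv: "\<pi> (inv x) = - \<pi> x" if "x \<in> carrier G" for x
    using pi_mult[of x "inv x"] that one by (simp add: eq_neg_iff_add_eq_0 add.commute)
  show ?thesis by (cases n rule: int_cases2) (use g nat inv in \<open>simp_all add: int_pow_int int_pow_neg_int\<close>)
qed

lemma swap_comm: "x \<in> carrier G \<Longrightarrow> y \<in> carrier G \<Longrightarrow> x \<otimes> y = y \<otimes> x \<otimes> comm G x y"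
  by (simp add: comm_def m_assoc[symmetric]) (simp add: m_assoc)

text \<open>Because commutators lie in \<open>C\<close>, hence in \<open>H\<close>, the products
  \<open>h \<otimes> s [^] j\<close> already form a subgroup.\<close>

lemma extend_step:
  assumes ext: "ext H \<zeta>" and s: "s \<in> carrier G"
  shows "\<exists>H' \<zeta>'. ext H' \<zeta>' \<and> H \<subseteq> H' \<and> s \<in> H'"
proof -
  have H: "subgroup H G" "C \<subseteq> H" and zC: "\<And>c. c \<in> C \<Longrightarrow> \<zeta> c = \<kappa> c" and zZ: "\<And>x. x \<in> H \<Longrightarrow> \<zeta> x \<in> Z"
    and zm: "\<And>x y. x \<in> H \<Longrightarrow> y \<in> H \<Longrightarrow> \<zeta> (x \<otimes> y) = \<zeta> x + \<zeta> y + (1/2) *\<^sub>R B (\<pi> x) (\<pi> y)"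
    using ext unfolding ext_def by auto
  interpret H: subgroup H G by (rule H)
  have Hc: "x \<in> carrier G" if "x \<in> H" for x using that by (rule H.mem_carrier)
  have z1: "\<zeta> \<one> = 0" using zm[of \<one> \<one>] pi_mult[of \<one> \<one>] by (simp add: B.zero_left)
  have zpow: "\<zeta> (x [^] (n::int)) = of_int n *\<^sub>R \<zeta> x" if x: "x \<in> H" for x n
  proof -
    have pw: "x [^] (n::nat) \<in> H" for n by (induction n) (use x in auto)
    have nat: "\<zeta> (x [^] (n::nat)) = real n *\<^sub>R \<zeta> x" for n
    proof (induction n)
      case (Suc n)
      have "\<pi> (x [^] n) = real n *\<^sub>R \<pi> x" using pi_pow[OF Hc[OF x], of "int n"] by (simp add: int_pow_int)
      then show ?case using Suc zm[OF pw x, of n] by (simp add: B.scaleR_left B_alt algebra_simps)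
    qed (simp add: z1)
    have inv: "\<zeta> (inv y) = - \<zeta> y" if "y \<in> H" for y
    proof -
      have "\<pi> (inv y) = - \<pi> y" using pi_pow[OF Hc[OF that], of "-1"] Hc[OF that] by (simp add: int_pow_neg)
      then have "B (\<pi> y) (\<pi> (inv y)) = 0" by (simp only: B.minus_right B_alt minus_zero)
      then show ?thesis using zm[of y "inv y"] that Hc[OF that] z1
        by (simp add: eq_neg_iff_add_eq_0 add.commute)
    qed
    show ?thesis by (cases n rule: int_cases2) (use Hc[OF x] pw nat inv in \<open>simp_all add: int_pow_int int_pow_neg_int\<close>)
  qed
  \<comment> \<open>The value at \<open>s\<close>. If a nonzero power \<open>s [^] m\<close> lies in
    \<open>H\<close>, the value has to be the \<open>m\<close>-th part of the value there; otherwise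
    it is free and 0 is taken.\<close>
  obtain u where u: "u \<in> Z" "\<And>i::int. s [^] i \<in> H \<Longrightarrow> \<zeta> (s [^] i) = of_int i *\<^sub>R u"
  proof (cases "\<exists>m::int. m \<noteq> 0 \<and> s [^] m \<in> H")
    case True
    then obtain m :: int where m: "m \<noteq> 0" "s [^] m \<in> H" by blast
    show ?thesis
    proof (rule that)
      show "(1 / of_int m) *\<^sub>R \<zeta> (s [^] m) \<in> Z" using Z zZ[OF m(2)] by (rule subspace_scale)
      fix i :: int assume i: "s [^] i \<in> H"
      have "(s [^] i) [^] m = (s [^] m) [^] i" using s by (simp add: int_pow_pow mult.commute)
      then have "of_int m *\<^sub>R \<zeta> (s [^] i) = of_int i *\<^sub>R \<zeta> (s [^] m)" using zpow[OF i, of m] zpow[OF m(2), of i] by simp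
      then have "(1 / of_int m) *\<^sub>R of_int m *\<^sub>R \<zeta> (s [^] i) = (1 / of_int m) *\<^sub>R of_int i *\<^sub>R \<zeta> (s [^] m)" by simp
      then show "\<zeta> (s [^] i) = of_int i *\<^sub>R (1 / of_int m) *\<^sub>R \<zeta> (s [^] m)" using m(1) by simp
    qed
  next
    case False
    show ?thesis
    proof (rule that[of 0])
      show "0 \<in> Z" using Z by (rule subspace_0)
      fix i :: int assume "s [^] i \<in> H"
      then have "i = 0" using False by blast
      then show "\<zeta> (s [^] i) = of_int i *\<^sub>R 0" by (simp add: z1)
    qed
  qed
  \<comment> \<open>The value at \<open>h \<otimes> s [^] j\<close> that the twisted product rule
    dictates once \<open>s\<close> has the value \<open>u\<close>.\<close>
  define F where "F h j = \<zeta> h + of_int j *\<^sub>R u + (of_int j / 2) *\<^sub>R B (\<pi> h) (\<pi> s)" for h and j :: int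
  have wd: "F h j = F h' j'" if h: "h \<in> H" "h' \<in> H" and e: "h \<otimes> s [^] j = h' \<otimes> s [^] j'" for h h' j j'
  proof -
    define i where "i = j' - j"
    have "s [^] j' = s [^] i \<otimes> s [^] j" using s by (simp add: i_def int_pow_mult[symmetric])
    then have "h \<otimes> s [^] j = (h' \<otimes> s [^] i) \<otimes> s [^] j" using e h Hc s by (simp add: m_assoc)
    then have hh: "h = h' \<otimes> s [^] i" using h Hc s by simp
    then have "s [^] i = inv h' \<otimes> h" using h Hc s by (simp add: m_assoc[symmetric])
    then have iH: "s [^] i \<in> H" using h by simp
    have zh: "\<zeta> h = \<zeta> h' + of_int i *\<^sub>R u + (of_int i / 2) *\<^sub>R B (\<pi> h') (\<pi> s)"
      unfolding hh using zm[OF h(2) iH] u(2)[OF iH] s by (simp add: pi_pow B.scaleR_right)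
    have ph: "\<pi> h = \<pi> h' + of_int i *\<^sub>R \<pi> s" unfolding hh using h Hc s by (simp add: pi_mult pi_pow)
    have "j' = i + j" by (simp add: i_def)
    then show ?thesis unfolding F_def zh ph
      by (simp add: B.add_left B.scaleR_left B_alt algebra_simps add_divide_distrib)
  qed
  define H' where "H' = {h \<otimes> s [^] j | h j. h \<in> H \<and> j \<in> (UNIV :: int set)}"
  define \<zeta>' where "\<zeta>' x = (THE z. \<exists>h\<in>H. \<exists>j. x = h \<otimes> s [^] j \<and> z = F h j)" for x
  have z': "\<zeta>' (h \<otimes> s [^] j) = F h j" if "h \<in> H" for h j
    unfolding \<zeta>'_def
  proof (rule the_equality)
    show "\<exists>h'\<in>H. \<exists>j'. h \<otimes> s [^] j = h' \<otimes> s [^] j' \<and> F h j = F h' j'" using that by blast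
    show "z = F h j" if "\<exists>h'\<in>H. \<exists>j'. h \<otimes> s [^] j = h' \<otimes> s [^] j' \<and> z = F h' j'" for z
      using that wd[OF \<open>h \<in> H\<close>] by metis
  qed
  \<comment> \<open>Collecting the powers of \<open>s\<close> on the right produces a central
    \<open>c\<close>. Its \<open>\<kappa>\<close> reverses the sign of the mixed term in
    \<open>\<pi> s\<close> and \<open>\<pi> h'\<close>, as the product rule requires.\<close>
  have mult: "\<exists>c\<in>C. (h \<otimes> s [^] j) \<otimes> (h' \<otimes> s [^] j') = (h \<otimes> h' \<otimes> c) \<otimes> s [^] (j + j') \<and> \<kappa> c = of_int j *\<^sub>R B (\<pi> s) (\<pi> h')"
    if h: "h \<in> H" "h' \<in> H" for h h' j j'
  proof -
    define c where "c = comm G (s [^] j) h'"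
    have c: "c \<in> C" "c \<in> carrier G" using commC[of "s [^] j" h'] s h Hc H by (auto simp: c_def)
    have "s [^] j \<otimes> h' = h' \<otimes> s [^] j \<otimes> c" unfolding c_def using s h Hc by (intro swap_comm) auto
    also have "\<dots> = h' \<otimes> c \<otimes> s [^] j" using central[OF c(1), of "s [^] j"] s h Hc c by (simp add: m_assoc)
    finally have "(h \<otimes> s [^] j) \<otimes> (h' \<otimes> s [^] j') = h \<otimes> (h' \<otimes> c \<otimes> s [^] j) \<otimes> s [^] j'"
      using s h Hc c by (simp add: m_assoc[symmetric]) (simp add: m_assoc)
    also have "\<dots> = (h \<otimes> h' \<otimes> c) \<otimes> s [^] (j + j')" using s h Hc c by (simp add: int_pow_mult[symmetric] m_assoc)
    finally show ?thesis using c s h Hc kappa_comm[of "s [^] j" h'] by (auto simp: c_def pi_pow B.scaleR_left)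
  qed
  have sub: "subgroup H' G"
  proof (rule subgroupI)
    show "H' \<subseteq> carrier G" using s Hc by (auto simp: H'_def)
    show "H' \<noteq> {}" unfolding H'_def using H.one_closed by blast
  next
    fix x y assume "x \<in> H'" "y \<in> H'"
    then obtain h j h' j' where xy: "h \<in> H" "x = h \<otimes> s [^] (j::int)" "h' \<in> H" "y = h' \<otimes> s [^] (j'::int)" by (auto simp: H'_def)
    obtain c where "c \<in> C" "x \<otimes> y = (h \<otimes> h' \<otimes> c) \<otimes> s [^] (j + j')" using mult[OF xy(1,3), of j j'] xy by auto
    then show "x \<otimes> y \<in> H'" using xy H unfolding H'_def by blast
  next
    fix x assume "x \<in> H'"
    then obtain h j where x: "h \<in> H" "x = h \<otimes> s [^] (j::int)" by (auto simp: H'_def)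
    obtain c where c: "c \<in> C" "(\<one> \<otimes> s [^] (-j)) \<otimes> (inv h \<otimes> s [^] (0::int)) = (\<one> \<otimes> inv h \<otimes> c) \<otimes> s [^] (-j + 0)"
      using mult[of \<one> "inv h" "-j" 0] x by auto
    have "inv x = s [^] (-j) \<otimes> inv h" using x s Hc by (simp add: inv_mult_group int_pow_neg)
    also have "\<dots> = (inv h \<otimes> c) \<otimes> s [^] (-j)" using c x s Hc H by (auto simp: subset_iff)
    finally show "inv x \<in> H'" using c x H unfolding H'_def by blast
  qed
  have HH': "H \<subseteq> H'"
  proof
    fix h assume h: "h \<in> H"
    then have "h = h \<otimes> s [^] (0::int)" using Hc by simp
    then show "h \<in> H'" using h unfolding H'_def by blast
  qed
  have zH: "\<zeta>' h = \<zeta> h" if "h \<in> H" for h using z'[OF that, of 0] that Hc by (simp add: F_def)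
  have "ext H' \<zeta>'" unfolding ext_def
  proof (intro conjI ballI sub)
    show "C \<subseteq> H'" using H HH' by blast
    show "\<zeta>' c = \<kappa> c" if "c \<in> C" for c using zH[of c] zC that H by auto
    show "\<zeta>' x \<in> Z" if xH: "x \<in> H'" for x
    proof -
      obtain h j where "h \<in> H" "x = h \<otimes> s [^] (j::int)" using xH by (auto simp: H'_def)
      then show ?thesis using z'[of h j] zZ u(1) BZ[of h s] s Hc Z
        by (auto simp: F_def intro!: subspace_add subspace_scale)
    qed
    fix x y assume "x \<in> H'" "y \<in> H'"
    then obtain h j h' j' where xy: "h \<in> H" "x = h \<otimes> s [^] (j::int)" "h' \<in> H" "y = h' \<otimes> s [^] (j'::int)" by (auto simp: H'_def)
    obtain c where c: "c \<in> C" "x \<otimes> y = (h \<otimes> h' \<otimes> c) \<otimes> s [^] (j + j')" "\<kappa> c = of_int j *\<^sub>R B (\<pi> s) (\<pi> h')"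
      using mult[OF xy(1,3), of j j'] xy by auto
    have hc: "h \<otimes> h' \<otimes> c \<in> H" "h \<otimes> h' \<in> H" "c \<in> H" using xy c H by auto
    have p: "\<pi> (h \<otimes> h' \<otimes> c) = \<pi> h + \<pi> h'" "\<pi> (h \<otimes> h') = \<pi> h + \<pi> h'"
      using xy Hc hc pi_C[OF c(1)] by (simp_all add: pi_mult)
    have px: "\<pi> x = \<pi> h + of_int j *\<^sub>R \<pi> s" "\<pi> y = \<pi> h' + of_int j' *\<^sub>R \<pi> s" using xy Hc s by (simp_all add: pi_mult pi_pow)
    have half: "x = (1/2) *\<^sub>R x + (1/2) *\<^sub>R x" for x :: 'z by (simp flip: scaleR_left_distrib)
    have "\<zeta> (h \<otimes> h' \<otimes> c) = \<zeta> h + \<zeta> h' + (1/2) *\<^sub>R B (\<pi> h) (\<pi> h') + of_int j *\<^sub>R B (\<pi> s) (\<pi> h')"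
      using zm[OF hc(2,3)] zm[OF xy(1,3)] zC[OF c(1)] c(3) pi_C[OF c(1)] by (simp add: B.zero_right)
    also have "of_int j *\<^sub>R B (\<pi> s) (\<pi> h') = (of_int j / 2) *\<^sub>R B (\<pi> s) (\<pi> h') + (of_int j / 2) *\<^sub>R B (\<pi> s) (\<pi> h')"
      by (simp flip: scaleR_left_distrib)
    finally have z: "\<zeta> (h \<otimes> h' \<otimes> c) = \<zeta> h + \<zeta> h' + (1/2) *\<^sub>R B (\<pi> h) (\<pi> h') + ((of_int j / 2) *\<^sub>R B (\<pi> s) (\<pi> h') + (of_int j / 2) *\<^sub>R B (\<pi> s) (\<pi> h'))" .
    have "\<zeta>' (x \<otimes> y) = F (h \<otimes> h' \<otimes> c) (j + j')" unfolding c(2) by (rule z'[OF hc(1)])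
    also have "\<dots> = F h j + F h' j' + (1/2) *\<^sub>R B (\<pi> x) (\<pi> y)"
      unfolding F_def px p z using B_skew[of "\<pi> s" "\<pi> h'"]
      by (simp add: B.add_left B.add_right B.scaleR_left B.scaleR_right B_alt algebra_simps add_divide_distrib)
    finally show "\<zeta>' (x \<otimes> y) = \<zeta>' x + \<zeta>' y + (1/2) *\<^sub>R B (\<pi> x) (\<pi> y)" using z' xy by simp
  qed
  moreover have "s \<in> H'"
  proof -
    have "s = \<one> \<otimes> s [^] (1::int)" using s by simp
    then show ?thesis using H.one_closed unfolding H'_def by blast
  qed
  ultimately show ?thesis using HH' by blast
qed

theorem extension:
  assumes S: "finite S" "S \<subseteq> carrier G" "generate G S = carrier G"
  shows "\<exists>\<zeta>. (\<forall>c\<in>C. \<zeta> c = \<kappa> c) \<and> (\<forall>x\<in>carrier G. \<zeta> x \<in> Z) \<and>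
     (\<forall>x\<in>carrier G. \<forall>y\<in>carrier G. \<zeta> (x \<otimes> y) = \<zeta> x + \<zeta> y + (1/2) *\<^sub>R B (\<pi> x) (\<pi> y))"
proof -
  have "\<exists>H \<zeta>. ext H \<zeta> \<and> T \<subseteq> H" if "finite T" "T \<subseteq> carrier G" for T
    using that
  proof (induction T)
    case empty
    have "ext C \<kappa>" unfolding ext_def using C kappa_mult kappa_Z pi_C by (simp add: B.zero_left)
    then show ?case by blast
  next
    case (insert s T)
    from insert.prems have "T \<subseteq> carrier G" by simp
    from insert.IH[OF this] obtain H \<zeta> where "ext H \<zeta>" "T \<subseteq> H" by blast
    have "s \<in> carrier G" using insert.prems by simp
    from extend_step[OF \<open>ext H \<zeta>\<close> this] obtain H' \<zeta>' where "ext H' \<zeta>'" "H \<subseteq> H'" "s \<in> H'" by (elim exE conjE)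
    then show ?case using \<open>T \<subseteq> H\<close> by (intro exI[of _ H'] exI[of _ \<zeta>']) auto
  qed
  from this[OF S(1,2)] obtain H \<zeta> where H: "ext H \<zeta>" "S \<subseteq> H" by (elim exE conjE)
  have sub: "subgroup H G" using H(1) unfolding ext_def by (elim conjE)
  have "generate G S \<subseteq> H" by (rule generate_subgroup_incl[OF H(2) sub])
  then have "H = carrier G" using S(3) subgroup.subset[OF sub] by blast
  then show ?thesis using H(1) unfolding ext_def by blast
qed

end

section \<open>Topological groups\<close>

text \<open>A continuous map from a compact set into a Hausdorff space is closed, so it is a
  quotient map onto its image.\<close>

lemma continuous_on_compact_quotient:
  fixes f :: "'x::t2_space \<Rightarrow> 'y::t2_space" and k :: "'y \<Rightarrow> 'z::topological_space"
  assumes Q: "compact Q" and f: "continuous_on Q f" and h: "continuous_on Q h" and k: "\<And>x. x \<in> Q \<Longrightarrow> k (f x) = h x"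
  shows "continuous_on (f ` Q) k"
proof -
  have "closed (f ` Q)" using Q f by (intro compact_imp_closed compact_continuous_image)
  moreover have "closed (k -` C \<inter> f ` Q)" if "closed C" for C
  proof -
    have "closed (Q \<inter> h -` C)" using h that compact_imp_closed[OF Q] by (intro continuous_on_closed_vimage[THEN iffD1, rule_format, of Q h C, simplified Int_commute]) auto
    then have "compact (Q \<inter> h -` C)" using Q by (metis compact_Int_closed inf.idem inf_assoc)
    then have "closed (f ` (Q \<inter> h -` C))"
      using continuous_on_subset[OF f] by (intro compact_imp_closed compact_continuous_image) auto
    moreover have "k -` C \<inter> f ` Q = f ` (Q \<inter> h -` C)" using k by auto
    ultimately show ?thesis by simp
  qed
  ultimately show ?thesis by (simp add: continuous_on_closed_vimage)
qed

text \<open>Integer multiples come from additivity. The fractional part of \<open>n * t\<close>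
  contributes an amount that is bounded by continuity on a segment, and division by \<open>n\<close>
  sends it to 0.\<close>

lemma additive_scaleR:
  fixes g :: "'w::real_normed_vector \<Rightarrow> 'z::real_normed_vector"
  assumes W: "subspace W" and add: "\<And>x y. x \<in> W \<Longrightarrow> y \<in> W \<Longrightarrow> g (x + y) = g x + g y"
    and cont: "continuous_on W g" and w: "w \<in> W"
  shows "g (t *\<^sub>R w) = t *\<^sub>R g w"
proof -
  have sW: "s *\<^sub>R w \<in> W" for s using W w by (rule subspace_scale)
  have g0: "g 0 = 0" using add[of 0 0] subspace_0[OF W] by simp
  have gn: "g (real n *\<^sub>R x) = real n *\<^sub>R g x" if "x \<in> W" for n x
    by (induction n) (use that W in \<open>simp_all add: g0 add scaleR_left_distrib subspace_scale\<close>)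
  have gi: "g (of_int i *\<^sub>R x) = of_int i *\<^sub>R g x" if x: "x \<in> W" for i x
  proof (cases i rule: int_cases2)
    case (nonpos n)
    have "g (real n *\<^sub>R x + - (real n *\<^sub>R x)) = g (real n *\<^sub>R x) + g (- (real n *\<^sub>R x))"
      using x W by (intro add) (auto simp: subspace_scale subspace_neg)
    then show ?thesis unfolding nonpos using gn[OF x, of n] g0 by (simp add: eq_neg_iff_add_eq_0 add.commute)
  qed (use gn[OF x] in simp)
  have "compact ((\<lambda>s. g (s *\<^sub>R w)) ` {0..1})"
    by (intro compact_continuous_image continuous_on_compose2[OF cont]) (auto intro!: continuous_intros sW)
  then have "bounded ((\<lambda>s. g (s *\<^sub>R w)) ` {0..1})" by (rule compact_imp_bounded)
  then obtain M where M: "\<And>s. s \<in> {0..1} \<Longrightarrow> norm (g (s *\<^sub>R w)) \<le> M" unfolding bounded_iff by blast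
  have bd: "norm (g (t *\<^sub>R w) - t *\<^sub>R g w) \<le> (M + norm (g w)) / n" if n: "0 < n" for n :: nat
  proof -
    let ?i = "\<lfloor>n * t\<rfloor>" and ?s = "frac (n * t)"
    have nt: "n * t = of_int ?i + ?s" by (simp add: frac_def)
    have "real n *\<^sub>R g (t *\<^sub>R w) = g ((n * t) *\<^sub>R w)" using gn[OF sW, of n t] by simp
    also have "\<dots> = of_int ?i *\<^sub>R g w + g (?s *\<^sub>R w)"
      by (subst nt) (simp only: scaleR_left_distrib add[OF sW sW] gi[OF w])
    finally have "real n *\<^sub>R (g (t *\<^sub>R w) - t *\<^sub>R g w) = g (?s *\<^sub>R w) - ?s *\<^sub>R g w"
      by (simp add: scaleR_diff_right frac_def scaleR_diff_left)
    then have "real n * norm (g (t *\<^sub>R w) - t *\<^sub>R g w) = norm (g (?s *\<^sub>R w) - ?s *\<^sub>R g w)"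
      by (metis abs_of_nat norm_scaleR)
    also have "\<dots> \<le> norm (g (?s *\<^sub>R w)) + ?s * norm (g w)"
      using norm_triangle_ineq4[of "g (?s *\<^sub>R w)" "?s *\<^sub>R g w"] by simp
    also have "\<dots> \<le> M + 1 * norm (g w)"
      using M[of ?s] by (intro add_mono mult_right_mono) (auto simp: frac_lt_1 less_imp_le)
    finally show ?thesis using n by (simp add: field_simps)
  qed
  have "norm (g (t *\<^sub>R w) - t *\<^sub>R g w) \<le> 0"
  proof (rule LIMSEQ_le_const[OF lim_const_over_n[of "M + norm (g w)"]])
    show "\<exists>N. \<forall>n\<ge>N. norm (g (t *\<^sub>R w) - t *\<^sub>R g w) \<le> (M + norm (g w)) / real n" using bd by (intro exI[of _ 1]) auto
  qed
  then show ?thesis by simp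
qed

locale top_group = group G for G :: "('a::t2_space, 'm) monoid_scheme" (structure) +
  assumes UNIV_carrier: "carrier G = UNIV"
    and mult_cont: "continuous_on UNIV (\<lambda>(x, y). x \<otimes> y)"
    and inv_cont: "continuous_on UNIV (\<lambda>x. inv x)"
begin

lemma in_carrier [simp]: "x \<in> carrier G" by (simp add: UNIV_carrier)

lemma continuous_on_mult [continuous_intros]:
  assumes "continuous_on A f" "continuous_on A g" shows "continuous_on A (\<lambda>x. f x \<otimes> g x)"
  using continuous_on_compose2[OF mult_cont continuous_on_Pair[OF assms]] by simp

lemma continuous_on_inv [continuous_intros]: "continuous_on A f \<Longrightarrow> continuous_on A (\<lambda>x. inv (f x))"
  using continuous_on_compose2[OF inv_cont] by blast

lemma continuous_on_comm [continuous_intros]: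
  "continuous_on A f \<Longrightarrow> continuous_on A g \<Longrightarrow> continuous_on A (\<lambda>x. comm G (f x) (g x))"
  unfolding comm_def by (intro continuous_intros)

lemma open_preimage: "continuous_on UNIV f \<Longrightarrow> open U \<Longrightarrow> open {y. f y \<in> U}" for f :: "'x::topological_space \<Rightarrow> 'a"
  using open_vimage[of U f] by (simp add: vimage_def)

text \<open>A subgroup containing a neighbourhood of the identity is open, and its complement is a
  union of cosets, hence open too.\<close>

lemma open_subgroup:
  assumes conn: "connected (UNIV :: 'a set)" and O: "open O'" "\<one> \<in> O'" "O' \<subseteq> T"
    and T: "\<And>x y. x \<in> T \<Longrightarrow> y \<in> T \<Longrightarrow> x \<otimes> y \<in> T" "\<And>x. x \<in> T \<Longrightarrow> inv x \<in> T"
  shows "T = UNIV"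
proof -
  have op: "open {y. inv x \<otimes> y \<in> O'}" for x by (intro open_preimage continuous_intros O)
  have "open T"
  proof (subst open_subopen, intro ballI exI conjI)
    fix x assume x: "x \<in> T"
    show "open {y. inv x \<otimes> y \<in> O'}" by (rule op)
    show "x \<in> {y. inv x \<otimes> y \<in> O'}" using O by simp
    show "{y. inv x \<otimes> y \<in> O'} \<subseteq> T"
    proof
      fix y assume "y \<in> {y. inv x \<otimes> y \<in> O'}"
      then have "x \<otimes> (inv x \<otimes> y) \<in> T" using O x T by blast
      then show "y \<in> T" by (simp add: m_assoc[symmetric])
    qed
  qed
  moreover have "open (- T)"
  proof (subst open_subopen, intro ballI exI conjI)
    fix x assume x: "x \<in> - T"
    show "open {y. inv x \<otimes> y \<in> O'}" by (rule op)
    show "x \<in> {y. inv x \<otimes> y \<in> O'}" using O by simp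
    show "{y. inv x \<otimes> y \<in> O'} \<subseteq> - T"
    proof
      fix y assume "y \<in> {y. inv x \<otimes> y \<in> O'}"
      then have i: "inv (inv x \<otimes> y) \<in> T" using O T by blast
      show "y \<in> - T"
      proof
        assume "y \<in> T"
        then have "y \<otimes> inv (inv x \<otimes> y) \<in> T" using i T by blast
        then have "x \<in> T" by (simp add: inv_mult_group m_assoc[symmetric])
        then show False using x by simp
      qed
    qed
  qed
  moreover have "T \<noteq> {}" using O by blast
  ultimately show ?thesis using conn unfolding connected_clopen
    by (metis UNIV_I closed_def openin_open_eq open_UNIV subtopology_UNIV closed_closedin openin_subtopology_self topspace_euclidean open_openin)
qed

lemma additive_one: "(\<And>x y. f (x \<otimes> y) = f x + f y) \<Longrightarrow> f \<one> = (0::'b::real_vector)"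
  by (metis add_cancel_right_right in_carrier r_one)

lemma additive_inv: "(\<And>x y. f (x \<otimes> y) = f x + f y) \<Longrightarrow> f (inv x) = - (f x::'b::real_vector)"
  by (metis add.inverse_unique additive_one in_carrier r_inv)

lemma additive_continuous:
  fixes f :: "'a \<Rightarrow> 'b::real_normed_vector"
  assumes add: "\<And>x y. f (x \<otimes> y) = f x + f y" and O: "open O'" "\<one> \<in> O'" and cont: "continuous_on O' f"
  shows "continuous_on UNIV f"
proof -
  have "isCont f x" for x
  proof -
    have "open {y. inv x \<otimes> y \<in> O'}" by (intro open_preimage continuous_intros O)
    moreover have "continuous_on {y. inv x \<otimes> y \<in> O'} (\<lambda>y. f x + f (inv x \<otimes> y))"
      by (intro continuous_intros continuous_on_compose2[OF cont]) auto
    then have "continuous_on {y. inv x \<otimes> y \<in> O'} f"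
      by (simp add: add[symmetric] m_assoc[symmetric])
    ultimately show ?thesis using O by (simp add: continuous_on_eq_continuous_at)
  qed
  then show ?thesis by (simp add: continuous_at_imp_continuous_on)
qed

text \<open>Translation makes discreteness uniform: if quotients of points of \<open>U\<close> lie
  in the neighbourhood \<open>V\<close> isolating \<open>\<one>\<close>, then every translate of
  \<open>U\<close> contains at most one element of \<open>\<Gamma>\<close>, and finitely many
  translates cover \<open>K\<close>.\<close>

lemma finite_compact_discrete:
  assumes K: "compact K" and \<Gamma>: "subgroup \<Gamma> G" "discrete \<Gamma>"
  shows "finite (K \<inter> \<Gamma>)"
proof -
  have "\<one> isolated_in \<Gamma>" using \<Gamma> subgroup.one_closed by (auto simp: discrete_def)
  then obtain V where V: "open V" "V \<inter> \<Gamma> = {\<one>}" by (auto simp: isolated_in_def)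
  have "open {(x, y). inv x \<otimes> y \<in> V}"
  proof -
    have "open {z. inv (fst z) \<otimes> snd z \<in> V}" by (intro open_preimage continuous_intros V)
    moreover have "{(x, y). inv x \<otimes> y \<in> V} = {z. inv (fst z) \<otimes> snd z \<in> V}" by auto
    ultimately show ?thesis by (simp only:)
  qed
  moreover have "(\<one>, \<one>) \<in> {(x, y). inv x \<otimes> y \<in> V}" using V by auto
  ultimately obtain A B where AB: "open A" "open B" "(\<one>, \<one>) \<in> A \<times> B" "A \<times> B \<subseteq> {(x, y). inv x \<otimes> y \<in> V}"
    by (rule open_prod_elim)
  define U where "U = A \<inter> B"
  have U: "open U" "\<one> \<in> U" "\<And>x y. x \<in> U \<Longrightarrow> y \<in> U \<Longrightarrow> inv x \<otimes> y \<in> V" using AB by (auto simp: U_def)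
  define T where "T x = {y. inv x \<otimes> y \<in> U}" for x
  have T: "open (T x)" "x \<in> T x" for x unfolding T_def using U by (auto intro!: open_preimage continuous_intros)
  have one: "y = y'" if "y \<in> T x \<inter> \<Gamma>" "y' \<in> T x \<inter> \<Gamma>" for x y y'
  proof -
    have "inv (inv x \<otimes> y) \<otimes> (inv x \<otimes> y') \<in> V" using U(3) that by (auto simp: T_def)
    moreover have "inv (inv x \<otimes> y) \<otimes> (inv x \<otimes> y') = inv y \<otimes> y'"
      by (simp add: inv_mult_group m_assoc) (simp add: m_assoc[symmetric])
    moreover have "inv y \<otimes> y' \<in> \<Gamma>" using that \<Gamma> by (auto intro: subgroup.m_closed subgroup.m_inv_closed)
    ultimately have "inv y \<otimes> y' = \<one>" using V by auto
    then show ?thesis by (metis in_carrier inv_closed inv_equality inv_inv)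
  qed
  have "K \<subseteq> (\<Union>x\<in>K. T x)" using T by blast
  then obtain F where F: "F \<subseteq> K" "finite F" "K \<subseteq> (\<Union>x\<in>F. T x)" using compactE_image[OF K, of K T] T by blast
  have "finite (T x \<inter> \<Gamma>)" for x
  proof (cases "T x \<inter> \<Gamma> = {}")
    case False
    then obtain y where "y \<in> T x \<inter> \<Gamma>" by blast
    then have "T x \<inter> \<Gamma> \<subseteq> {y}" using one by blast
    then show ?thesis using finite_subset by blast
  qed simp
  then have fin: "finite (\<Union>x\<in>F. T x \<inter> \<Gamma>)" using F by blast
  show ?thesis by (rule finite_subset[OF _ fin]) (use F(3) in blast)
qed

end

locale two_step_group = top_group G for G :: "('a::t2_space, 'm) monoid_scheme" (structure) +
  assumes comm_central: "\<And>x y z. comm G x y \<otimes> z = z \<otimes> comm G x y"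
begin

lemma comm_mult_left: "comm G (x \<otimes> y) z = comm G x z \<otimes> comm G y z"
proof -
  have "comm G (x \<otimes> y) z = inv y \<otimes> (comm G x z \<otimes> (inv z \<otimes> y \<otimes> z))"
    by (simp add: comm_def inv_mult_group m_assoc) (simp add: m_assoc[symmetric])
  also have "\<dots> = inv y \<otimes> ((inv z \<otimes> y \<otimes> z) \<otimes> comm G x z)"
    by (simp only: comm_central[of x z "inv z \<otimes> y \<otimes> z"])
  also have "\<dots> = comm G y z \<otimes> comm G x z" by (simp add: comm_def m_assoc)
  also have "\<dots> = comm G x z \<otimes> comm G y z" by (rule comm_central)
  finally show ?thesis .
qed

lemma inv_comm: "inv (comm G x y) = comm G y x"
  by (simp add: comm_def inv_mult_group m_assoc)

lemma comm_mult_right: "comm G z (x \<otimes> y) = comm G z x \<otimes> comm G z y"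
proof -
  have "comm G z (x \<otimes> y) = inv (comm G (x \<otimes> y) z)" by (simp add: inv_comm)
  also have "\<dots> = comm G z y \<otimes> comm G z x" by (simp add: comm_mult_left inv_mult_group inv_comm)
  also have "\<dots> = comm G z x \<otimes> comm G z y" by (rule comm_central)
  finally show ?thesis .
qed

lemma comm_one [simp]: "comm G \<one> x = \<one>" "comm G x \<one> = \<one>"
  by (simp_all add: comm_def)

lemma comm_inv_right: "comm G z (inv x) = inv (comm G z x)"
proof -
  have "comm G z x \<otimes> comm G z (inv x) = \<one>" using comm_mult_right[of z x "inv x"] by simp
  then show ?thesis by (metis in_carrier inv_equality inv_inv inv_closed)
qed

end

section \<open>The adjoint homomorphism of a 2-step nilpotent Lie group\<close>

text \<open>A finite index type for the standard basis, so that endomorphisms of \<open>'e\<close>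
  can be stored as elements of a Euclidean space.\<close>

typedef (overloaded) ('e::euclidean_space) basis_index = "Basis :: 'e set"
  by (rule nonempty_Basis[unfolded ex_in_conv[symmetric], THEN exE]) auto

instance basis_index :: (euclidean_space) finite
proof
  have "(UNIV :: 'a basis_index set) = Abs_basis_index ` Basis"
    by (metis Abs_basis_index_cases UNIV_eq_I imageI)
  then show "finite (UNIV :: 'a basis_index set)" by (metis finite_Basis finite_imageI)
qed

definition C1_on :: "('x::real_normed_vector \<Rightarrow> 'y::real_normed_vector) \<Rightarrow> 'x set \<Rightarrow> bool" where
  "C1_on f S \<longleftrightarrow> (\<forall>x\<in>S. f differentiable (at x)) \<and> (\<forall>v. continuous_on S (\<lambda>x. frechet_derivative f (at x) v))"

lemma C1_on_smooth: "smooth_on f S \<Longrightarrow> C1_on f S"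
  unfolding smooth_on_def C1_on_def by (drule spec[of _ "Suc 0"]) simp

lemma C1_on_continuous: "C1_on f S \<Longrightarrow> continuous_on S f"
  unfolding C1_on_def by (meson differentiable_imp_continuous_on differentiable_at_imp_differentiable_on)

lemma C1_on_has_derivative: "C1_on f S \<Longrightarrow> x \<in> S \<Longrightarrow> (f has_derivative frechet_derivative f (at x)) (at x)"
  unfolding C1_on_def by (simp add: frechet_derivative_works[symmetric])

lemma C1_on_compose:
  fixes f :: "'x::real_normed_vector \<Rightarrow> 'y::euclidean_space" and g :: "'y \<Rightarrow> 'z::real_normed_vector"
  assumes f: "C1_on f S" and g: "C1_on g T" and fST: "\<And>x. x \<in> S \<Longrightarrow> f x \<in> T"
  shows "C1_on (\<lambda>x. g (f x)) S"
proof -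
  let ?D = "\<lambda>x v. frechet_derivative g (at (f x)) (frechet_derivative f (at x) v)"
  have d: "((\<lambda>x. g (f x)) has_derivative ?D x) (at x)" if "x \<in> S" for x
    using has_derivative_compose[OF C1_on_has_derivative[OF f that] C1_on_has_derivative[OF g fST[OF that]]] by simp
  have fd: "frechet_derivative (\<lambda>x. g (f x)) (at x) = ?D x" if "x \<in> S" for x
    using frechet_derivative_at[OF d[OF that]] by simp
  have "continuous_on S (\<lambda>x. ?D x v)" for v
  proof -
    \<comment> \<open>The direction fed into the derivative of \<open>g\<close> varies with
      \<open>x\<close>, whereas \<open>C1_on\<close> gives continuity for fixed directions;
      expanding in the basis separates the two.\<close>
    have e: "?D x v = (\<Sum>b\<in>Basis. (frechet_derivative f (at x) v \<bullet> b) *\<^sub>R frechet_derivative g (at (f x)) b)" if "x \<in> S" for x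
    proof -
      have lin: "linear (frechet_derivative g (at (f x)))"
        using C1_on_has_derivative[OF g fST[OF that]] has_derivative_linear by blast
      show ?thesis
        by (subst euclidean_representation[symmetric, of "frechet_derivative f (at x) v"])
           (simp add: linear_sum[OF lin] linear_scale[OF lin])
    qed
    have "continuous_on S (\<lambda>x. \<Sum>b\<in>Basis. (frechet_derivative f (at x) v \<bullet> b) *\<^sub>R frechet_derivative g (at (f x)) b)"
    proof (intro continuous_intros)
      show "continuous_on S (\<lambda>x. frechet_derivative f (at x) v)" using f unfolding C1_on_def by blast
      show "continuous_on S (\<lambda>x. frechet_derivative g (at (f x)) b)" for b
        using g fST unfolding C1_on_def
        by (intro continuous_on_compose2[of T "\<lambda>y. frechet_derivative g (at y) b" S f] C1_on_continuous[OF f]) auto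
    qed
    then show ?thesis by (rule continuous_on_eq) (simp add: e)
  qed
  then have "continuous_on S (\<lambda>x. frechet_derivative (\<lambda>x. g (f x)) (at x) v)" for v
    by (rule continuous_on_eq) (simp add: fd)
  moreover have "\<forall>x\<in>S. (\<lambda>x. g (f x)) differentiable (at x)" using d unfolding differentiable_def by blast
  ultimately show ?thesis unfolding C1_on_def by blast
qed

lemma C1_on_Pair:
  assumes f: "C1_on f S" and g: "C1_on g S"
  shows "C1_on (\<lambda>x. (f x, g x)) S"
proof -
  let ?D = "\<lambda>x v. (frechet_derivative f (at x) v, frechet_derivative g (at x) v)"
  have d: "((\<lambda>x. (f x, g x)) has_derivative ?D x) (at x)" if "x \<in> S" for x
    using C1_on_has_derivative[OF f that] C1_on_has_derivative[OF g that] by (rule has_derivative_Pair)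
  have fd: "frechet_derivative (\<lambda>x. (f x, g x)) (at x) = ?D x" if "x \<in> S" for x
    using frechet_derivative_at[OF d[OF that]] by simp
  have "continuous_on S (\<lambda>x. ?D x v)" for v
    using f g unfolding C1_on_def by (intro continuous_on_Pair) blast+
  then have "continuous_on S (\<lambda>x. frechet_derivative (\<lambda>x. (f x, g x)) (at x) v)" for v
    by (rule continuous_on_eq) (simp add: fd)
  moreover have "\<forall>x\<in>S. (\<lambda>x. (f x, g x)) differentiable (at x)" using d unfolding differentiable_def by blast
  ultimately show ?thesis unfolding C1_on_def by blast
qed

lemma C1_on_bounded_linear:
  assumes "bounded_linear f" shows "C1_on f S"
proof -
  have d: "(f has_derivative f) (at x)" for x using assms by (rule bounded_linear_imp_has_derivative)
  have "frechet_derivative f (at x) = f" for x using frechet_derivative_at[OF d] by simp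
  then show ?thesis unfolding C1_on_def using d by (auto simp: differentiable_def)
qed

lemmas C1_on_fst = C1_on_bounded_linear[OF bounded_linear_fst] and C1_on_snd = C1_on_bounded_linear[OF bounded_linear_snd]

locale chart_at_one = lie_group G atlas
  for G :: "('a::{t2_space,second_countable_topology}, 'm) monoid_scheme" (structure)
    and atlas :: "('a set \<times> ('a \<Rightarrow> 'e::euclidean_space)) set" +
  fixes U :: "'a set" and \<phi> :: "'a \<Rightarrow> 'e"
  assumes U: "(U, \<phi>) \<in> atlas" "\<one> \<in> U"
    and connected: "connected (UNIV :: 'a set)"
    and comm_central: "\<And>x y z. comm G x y \<otimes> z = z \<otimes> comm G x y"
begin

sublocale two_step_group G
  by unfold_locales (use carrier_UNIV mult_continuous inv_continuous comm_central in auto)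

definition \<psi> :: "'e \<Rightarrow> 'a" where "\<psi> = inv_into U \<phi>"

abbreviation W0 :: "'e set" where "W0 \<equiv> \<phi> ` U"

definition p :: 'e where "p = \<phi> \<one>"

lemma chart: "open U" "open W0" "homeomorphism U W0 \<phi> \<psi>"
  using charts[OF U(1)] by (auto simp: is_chart_def \<psi>_def)

lemma \<psi>_\<phi> [simp]: "x \<in> U \<Longrightarrow> \<psi> (\<phi> x) = x" and \<phi>_\<psi> [simp]: "a \<in> W0 \<Longrightarrow> \<phi> (\<psi> a) = a"
  and \<psi>_U [simp]: "a \<in> W0 \<Longrightarrow> \<psi> a \<in> U"
  and cont_\<phi>: "continuous_on U \<phi>" and cont_\<psi>: "continuous_on W0 \<psi>"
  using chart(3) by (auto simp: homeomorphism_def)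

lemma p [simp]: "p \<in> W0" "\<psi> p = \<one>"
  using U(2) by (auto simp: p_def)

definition m :: "'e \<times> 'e \<Rightarrow> 'e" where "m = (\<lambda>(a, b). \<phi> (\<psi> a \<otimes> \<psi> b))"
definition mO :: "('e \<times> 'e) set" where "mO = {(a, b). a \<in> W0 \<and> b \<in> W0 \<and> \<psi> a \<otimes> \<psi> b \<in> U}"
definition i :: "'e \<Rightarrow> 'e" where "i a = \<phi> (inv \<psi> a)"
definition iO :: "'e set" where "iO = {a \<in> W0. inv \<psi> a \<in> U}"

lemma C1_m: "C1_on m mO"
  using C1_on_smooth[OF mult_smooth[OF U(1) U(1) U(1)]] by (simp add: m_def mO_def \<psi>_def)

lemma C1_i: "C1_on i iO"
  using C1_on_smooth[OF inv_smooth[OF U(1) U(1)]] by (simp add: i_def[abs_def] iO_def \<psi>_def)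

lemma open_chart_preimage: "open T \<Longrightarrow> continuous_on T h \<Longrightarrow> open {z \<in> T. h z \<in> U}" for h :: "'x::topological_space \<Rightarrow> 'a"
  using continuous_open_preimage[of T h U] chart(1) by (simp add: vimage_def Int_def)

lemma open_iO: "open iO"
  unfolding iO_def by (intro open_chart_preimage chart continuous_intros cont_\<psi>)

lemma cont_fst_snd: "continuous_on (W0 \<times> W0) (\<lambda>z. \<psi> (fst z))" "continuous_on (W0 \<times> W0) (\<lambda>z. \<psi> (snd z))"
  by (intro continuous_on_compose2[OF cont_\<psi>] continuous_intros; force)+

lemma mI [simp]: "a \<in> W0 \<Longrightarrow> b \<in> W0 \<Longrightarrow> \<psi> a \<otimes> \<psi> b \<in> U \<Longrightarrow> (a, b) \<in> mO"
  and m_eq: "m (a, b) = \<phi> (\<psi> a \<otimes> \<psi> b)"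
  by (simp_all add: mO_def m_def)

text \<open>The pairs for which every intermediate product of the commutator stays in the chart, so
  that the commutator is a composition of the coordinate operations \<open>m\<close> and
  \<open>i\<close>.\<close>

definition \<Omega> :: "('e \<times> 'e) set" where
  "\<Omega> = {z \<in> W0 \<times> W0. inv \<psi> (fst z) \<in> U} \<inter> {z \<in> W0 \<times> W0. inv \<psi> (snd z) \<in> U}
     \<inter> {z \<in> W0 \<times> W0. inv \<psi> (fst z) \<otimes> inv \<psi> (snd z) \<in> U}
     \<inter> {z \<in> W0 \<times> W0. inv \<psi> (fst z) \<otimes> inv \<psi> (snd z) \<otimes> \<psi> (fst z) \<in> U}
     \<inter> {z \<in> W0 \<times> W0. comm G (\<psi> (fst z)) (\<psi> (snd z)) \<in> U}"

lemma open_\<Omega>: "open \<Omega>"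
  unfolding \<Omega>_def by (intro open_Int open_chart_preimage open_Times chart continuous_intros cont_fst_snd)

lemma pp_\<Omega>: "(p, p) \<in> \<Omega>"
  using U(2) p by (simp add: \<Omega>_def comm_def)

definition c :: "'e \<times> 'e \<Rightarrow> 'e" where "c z = m (m (m (i (fst z), i (snd z)), fst z), snd z)"

lemma c_eq: "z \<in> \<Omega> \<Longrightarrow> c z = \<phi> (comm G (\<psi> (fst z)) (\<psi> (snd z)))"
  by (auto simp: c_def \<Omega>_def m_eq i_def comm_def)

lemma C1_c: "C1_on c \<Omega>"
proof -
  have 1: "C1_on (\<lambda>z. i (fst z)) \<Omega>" "C1_on (\<lambda>z. i (snd z)) \<Omega>"
    by (rule C1_on_compose[OF C1_on_fst C1_i] C1_on_compose[OF C1_on_snd C1_i]; auto simp: \<Omega>_def iO_def)+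
  have 2: "C1_on (\<lambda>z. m (i (fst z), i (snd z))) \<Omega>"
    by (rule C1_on_compose[OF C1_on_Pair[OF 1] C1_m]) (auto simp: \<Omega>_def i_def intro!: mI)
  have 3: "C1_on (\<lambda>z. m (m (i (fst z), i (snd z)), fst z)) \<Omega>"
    by (rule C1_on_compose[OF C1_on_Pair[OF 2 C1_on_fst] C1_m]) (auto simp: \<Omega>_def i_def m_eq intro!: mI)
  show ?thesis unfolding c_def[abs_def]
    by (rule C1_on_compose[OF C1_on_Pair[OF 3 C1_on_snd] C1_m]) (auto simp: \<Omega>_def i_def m_eq comm_def intro!: mI)
qed

section \<open>Differentials of commutator maps at the identity\<close>

definition F :: "'a \<Rightarrow> 'e \<Rightarrow> 'e" where "F g a = \<phi> (comm G (\<psi> a) g)"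

lemma F_p [simp]: "F g p = p" by (simp add: F_def p_def[symmetric])

lemma near_p:
  assumes "continuous_on W0 h" "h p \<in> U"
  shows "open {a \<in> W0. h a \<in> U}" "p \<in> {a \<in> W0. h a \<in> U}"
  using assms by (auto intro: open_chart_preimage chart)

lemma comm_near: "open {a \<in> W0. comm G (\<psi> a) g \<in> U}" "p \<in> {a \<in> W0. comm G (\<psi> a) g \<in> U}"
  by (rule near_p, intro continuous_intros cont_\<psi>, simp add: U)+

lemma F_local:
  assumes "(p, b) \<in> \<Omega>"
  shows "(F (\<psi> b) has_derivative (\<lambda>v. frechet_derivative c (at (p, b)) (v, 0))) (at p)"
proof -
  have "((\<lambda>a. (a, b)) has_derivative (\<lambda>v. (v, 0))) (at p)" by (auto intro!: derivative_eq_intros)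
  from has_derivative_compose[OF this C1_on_has_derivative[OF C1_c assms]]
  have d: "((\<lambda>a. c (a, b)) has_derivative (\<lambda>v. frechet_derivative c (at (p, b)) (v, 0))) (at p)" .
  have op: "open {a. (a, b) \<in> \<Omega>}"
    using open_vimage[OF open_\<Omega>, of "\<lambda>a. (a, b)"] by (simp add: vimage_def continuous_on_Pair)
  show ?thesis
    by (rule has_derivative_transform_within_open[OF d op]) (use assms in \<open>auto simp: F_def c_eq\<close>)
qed

text \<open>\<open>p\<close> represents the identity element, so fixing either argument at
  \<open>p\<close> leaves the identity map; the two partial derivatives add up.\<close>

lemma m_deriv: "(m has_derivative (\<lambda>(u, v). u + v)) (at (p, p))"
proof -
  have pp: "(p, p) \<in> mO" using U by simp
  let ?D = "frechet_derivative m (at (p, p))"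
  have D: "(m has_derivative ?D) (at (p, p))" by (rule C1_on_has_derivative[OF C1_m pp])
  have lin: "linear ?D" using D has_derivative_linear by blast
  have 1: "?D (v, 0) = v" for v
  proof -
    have "((\<lambda>a. (a, p)) has_derivative (\<lambda>v. (v, 0))) (at p)" by (auto intro!: derivative_eq_intros)
    from has_derivative_compose[OF this D] have "((\<lambda>a. m (a, p)) has_derivative (\<lambda>v. ?D (v, 0))) (at p)" .
    moreover have "((\<lambda>a. m (a, p)) has_derivative (\<lambda>v. v)) (at p)"
      by (rule has_derivative_transform_within_open[OF has_derivative_ident chart(2)]) (auto simp: m_eq)
    ultimately have "(\<lambda>v. ?D (v, 0)) = (\<lambda>v. v)" by (rule has_derivative_unique)
    then show ?thesis by metis
  qed
  have 2: "?D (0, v) = v" for v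
  proof -
    have "((\<lambda>a. (p, a)) has_derivative (\<lambda>v. (0, v))) (at p)" by (auto intro!: derivative_eq_intros)
    from has_derivative_compose[OF this D] have "((\<lambda>a. m (p, a)) has_derivative (\<lambda>v. ?D (0, v))) (at p)" .
    moreover have "((\<lambda>a. m (p, a)) has_derivative (\<lambda>v. v)) (at p)"
      by (rule has_derivative_transform_within_open[OF has_derivative_ident chart(2)]) (auto simp: m_eq)
    ultimately have "(\<lambda>v. ?D (0, v)) = (\<lambda>v. v)" by (rule has_derivative_unique)
    then show ?thesis by metis
  qed
  have "?D (u, v) = u + v" for u v
    using linear_add[OF lin, of "(u, 0)" "(0, v)"] 1 2 by simp
  then have "?D = (\<lambda>(u, v). u + v)" by auto
  then show ?thesis using D by simp
qed

lemma F_mult: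
  assumes f: "(F g has_derivative f) (at p)" and h: "(F g' has_derivative h) (at p)"
  shows "(F (g \<otimes> g') has_derivative (\<lambda>v. f v + h v)) (at p)"
proof -
  have m: "(m has_derivative (\<lambda>(u, v). u + v)) (at (F g p, F g' p))" using m_deriv by simp
  have d: "((\<lambda>a. m (F g a, F g' a)) has_derivative (\<lambda>v. f v + h v)) (at p)"
    using has_derivative_compose[OF has_derivative_Pair[OF f h] m] by simp
  show ?thesis
  proof (rule has_derivative_transform_within_open[OF d open_Int[OF comm_near(1)[of g] comm_near(1)[of g']]])
    show "p \<in> {a \<in> W0. comm G (\<psi> a) g \<in> U} \<inter> {a \<in> W0. comm G (\<psi> a) g' \<in> U}" using comm_near(2) by blast
  qed (auto simp: F_def m_eq comm_mult_right)
qed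

lemma F_inv:
  assumes f: "(F g has_derivative f) (at p)" shows "F (inv g) differentiable (at p)"
proof -
  have "p \<in> iO" using U by (simp add: iO_def)
  then have "(i has_derivative frechet_derivative i (at p)) (at (F g p))" using C1_on_has_derivative[OF C1_i] by simp
  from has_derivative_compose[OF f this]
  have d: "((\<lambda>a. i (F g a)) has_derivative (\<lambda>v. frechet_derivative i (at p) (f v))) (at p)" .
  have "(F (inv g) has_derivative (\<lambda>v. frechet_derivative i (at p) (f v))) (at p)"
    by (rule has_derivative_transform_within_open[OF d comm_near(1)[of g] comm_near(2)])
       (auto simp: F_def i_def comm_inv_right)
  then show ?thesis by (auto simp: differentiable_def)
qed

lemma open_\<Omega>_slice: "open (U \<inter> \<phi> -` {b. (p, b) \<in> \<Omega>})" "\<one> \<in> U \<inter> \<phi> -` {b. (p, b) \<in> \<Omega>}"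
proof -
  have "open {b. (p, b) \<in> \<Omega>}"
    using open_vimage[OF open_\<Omega>, of "\<lambda>b. (p, b)"] by (simp add: vimage_def continuous_on_Pair)
  then show "open (U \<inter> \<phi> -` {b. (p, b) \<in> \<Omega>})" by (rule continuous_open_preimage[OF cont_\<phi> chart(1)])
  show "\<one> \<in> U \<inter> \<phi> -` {b. (p, b) \<in> \<Omega>}" using U pp_\<Omega> by (simp add: p_def[symmetric])
qed

text \<open>Smoothness in the chart settles only \<open>g\<close> near \<open>\<one>\<close>.
  Because the commutator is multiplicative in \<open>g\<close>, the good \<open>g\<close> form a
  subgroup, and a connected group has no proper subgroup containing a neighbourhood of
  \<open>\<one>\<close>.\<close>

lemma F_differentiable: "F g differentiable (at p)"
proof -
  have "{g. F g differentiable (at p)} = UNIV"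
  proof (rule open_subgroup[OF connected open_\<Omega>_slice])
    show "U \<inter> \<phi> -` {b. (p, b) \<in> \<Omega>} \<subseteq> {g. F g differentiable (at p)}"
    proof
      fix g assume "g \<in> U \<inter> \<phi> -` {b. (p, b) \<in> \<Omega>}"
      then have "g \<in> U" "(p, \<phi> g) \<in> \<Omega>" by auto
      then show "g \<in> {g. F g differentiable (at p)}" using F_local[of "\<phi> g"] by (auto simp: differentiable_def)
    qed
    show "x \<otimes> y \<in> {g. F g differentiable (at p)}"
      if "x \<in> {g. F g differentiable (at p)}" "y \<in> {g. F g differentiable (at p)}" for x y
      using that F_mult unfolding differentiable_def by blast
    show "inv x \<in> {g. F g differentiable (at p)}" if "x \<in> {g. F g differentiable (at p)}" for x
      using that F_inv unfolding differentiable_def mem_Collect_eq by blast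
  qed
  then show ?thesis by blast
qed

definition D :: "'a \<Rightarrow> 'e \<Rightarrow> 'e" where "D g = frechet_derivative (F g) (at p)"

lemma D: "(F g has_derivative D g) (at p)"
  using F_differentiable unfolding D_def by (simp add: frechet_derivative_works[symmetric])

lemma D_mult: "D (g \<otimes> h) v = D g v + D h v"
  using has_derivative_unique[OF D F_mult[OF D D], of g h] by metis

lemma D_local: "(p, b) \<in> \<Omega> \<Longrightarrow> D (\<psi> b) v = frechet_derivative c (at (p, b)) (v, 0)"
  using has_derivative_unique[OF D F_local] by metis

lemma D_continuous: "continuous_on UNIV (\<lambda>g. D g v)"
proof (rule additive_continuous)
  show "D (x \<otimes> y) v = D x v + D y v" for x y by (rule D_mult)
  let ?O = "U \<inter> \<phi> -` {b. (p, b) \<in> \<Omega>}"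
  show "open ?O" "\<one> \<in> ?O" by (rule open_\<Omega>_slice)+
  have "continuous_on \<Omega> (\<lambda>z. frechet_derivative c (at z) (v, 0))" using C1_c unfolding C1_on_def by blast
  then have "continuous_on ?O (\<lambda>g. frechet_derivative c (at (p, \<phi> g)) (v, 0))"
    by (rule continuous_on_compose2) (auto intro!: continuous_intros continuous_on_subset[OF cont_\<phi>])
  then show "continuous_on ?O (\<lambda>g. D g v)"
  proof (rule continuous_on_eq)
    fix g assume "g \<in> ?O"
    then show "frechet_derivative c (at (p, \<phi> g)) (v, 0) = D g v" using D_local[of "\<phi> g" v] by auto
  qed
qed

text \<open>
  If the derivative at \<open>1\<close> of the homomorphism \<open>x \<mapsto> [x, g]\<close> vanishes, so does its derivative
  everywhere, by translation; the homomorphism is then locally constant.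
\<close>

lemma D_zero_central:
  assumes "\<And>v. D g v = 0" shows "comm G x g = \<one>"
proof -
  define k where "k x = comm G x g" for x
  have k: "k (x \<otimes> y) = k x \<otimes> k y" "k \<one> = \<one>" "k (inv x) = inv (k x)" for x y
    using inv_comm[of g "inv x"] inv_comm[of g x] inv_comm[of x g]
    by (simp_all add: k_def comm_mult_left comm_inv_right)
  have Fk: "F g a = \<phi> (k (\<psi> a))" for a by (simp add: F_def k_def)
  have F0: "(F g has_derivative (\<lambda>_. 0)) (at p)" using D[of g] ext[of "D g" "\<lambda>_. 0", OF assms] by simp
  define A where "A = iO \<inter> {a \<in> W0. k (\<psi> a) \<in> U}"
  have "open A" unfolding A_def k_def using open_iO comm_near(1)[of g] by (rule open_Int)
  moreover have pA: "p \<in> A" unfolding A_def k_def using comm_near(2)[of g] U by (simp add: iO_def)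
  ultimately obtain e where e: "0 < e" "ball p e \<subseteq> A" by (meson open_contains_ball)
  have deriv: "(F g has_derivative (\<lambda>_. 0)) (at a)" if a: "a \<in> A" for a
  proof -
    have aW: "a \<in> W0" "inv \<psi> a \<in> U" "k (\<psi> a) \<in> U" using a by (auto simp: A_def iO_def)
    have ia: "(i a, a) \<in> mO" "m (i a, a) = p" using aW U by (simp_all add: i_def m_eq p_def)
    have Fa: "(F g a, p) \<in> mO" using aW by (simp add: Fk)
    have h1: "((\<lambda>b. m (i a, b)) has_derivative (\<lambda>v. frechet_derivative m (at (i a, a)) (0, v))) (at a)"
    proof -
      have "((\<lambda>b. (i a, b)) has_derivative (\<lambda>v. (0, v))) (at a)" by (auto intro!: derivative_eq_intros)
      from has_derivative_compose[OF this C1_on_has_derivative[OF C1_m ia(1)]] show ?thesis .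
    qed
    have h2: "((\<lambda>b. F g (m (i a, b))) has_derivative (\<lambda>v. 0)) (at a)"
      using has_derivative_compose[OF h1, of "F g" "\<lambda>_. 0"] F0 ia(2) by simp
    have h3: "((\<lambda>b. (F g a, F g (m (i a, b)))) has_derivative (\<lambda>v. (0, 0))) (at a)"
      by (intro has_derivative_Pair has_derivative_const h2)
    have D0: "frechet_derivative m (at (F g a, p)) (0, 0) = 0"
      using linear_0[OF has_derivative_linear[OF C1_on_has_derivative[OF C1_m Fa]]] by (simp add: zero_prod_def)
    have Fia: "F g (m (i a, a)) = p" by (simp add: ia(2))
    have "((\<lambda>b. m (F g a, F g (m (i a, b)))) has_derivative (\<lambda>v. frechet_derivative m (at (F g a, p)) (0, 0))) (at a)"
      using has_derivative_compose[OF h3, of m] C1_on_has_derivative[OF C1_m Fa] Fia by simp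
    then have d: "((\<lambda>b. m (F g a, F g (m (i a, b)))) has_derivative (\<lambda>v. 0)) (at a)" by (simp add: D0)
    define T where "T = {b \<in> W0. inv \<psi> a \<otimes> \<psi> b \<in> U} \<inter> {b \<in> W0. k (inv \<psi> a \<otimes> \<psi> b) \<in> U}"
    have "open T" unfolding T_def k_def
      by (intro open_Int open_chart_preimage chart continuous_intros cont_\<psi>)
    moreover have "a \<in> T" using aW U k by (simp add: T_def)
    ultimately show ?thesis
    proof (rule has_derivative_transform_within_open[OF d])
      fix b assume b: "b \<in> T"
      then have bW: "b \<in> W0" "inv \<psi> a \<otimes> \<psi> b \<in> U" "k (inv \<psi> a \<otimes> \<psi> b) \<in> U" by (auto simp: T_def)
      have "k (\<psi> a) \<otimes> k (inv \<psi> a \<otimes> \<psi> b) = k (\<psi> b)" by (simp add: k(1)[symmetric] m_assoc[symmetric])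
      then show "m (F g a, F g (m (i a, b))) = F g b" using aW bW by (simp add: Fk m_eq i_def)
    qed
  qed
  have const: "F g a = p" if "a \<in> ball p e" for a
  proof -
    have "\<exists>c. \<forall>x\<in>ball p e. F g x = c"
    proof (rule has_derivative_zero_constant[OF convex_ball])
      fix x assume "x \<in> ball p e"
      then have "x \<in> A" using e by blast
      then show "(F g has_derivative (\<lambda>h. 0)) (at x within ball p e)"
        by (rule has_derivative_at_withinI[OF deriv])
    qed
    then show ?thesis using that e F_p[of g] by (metis centre_in_ball)
  qed
  have "{x. k x = \<one>} = UNIV"
  proof (rule open_subgroup[OF connected])
    have "ball p e \<subseteq> W0" using e by (auto simp: A_def)
    show "open (U \<inter> \<phi> -` ball p e)" by (rule continuous_open_preimage[OF cont_\<phi> chart(1) open_ball])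
    show "\<one> \<in> U \<inter> \<phi> -` ball p e" using U e by (simp add: p_def[symmetric])
    show "U \<inter> \<phi> -` ball p e \<subseteq> {x. k x = \<one>}"
    proof
      fix x assume x: "x \<in> U \<inter> \<phi> -` ball p e"
      then have "\<phi> x \<in> A" using e by auto
      then have kU: "k x \<in> U" using x by (simp add: A_def)
      have "\<phi> (k x) = \<phi> \<one>" using const[of "\<phi> x"] x by (simp add: Fk p_def[symmetric])
      then have "k x = \<one>" using kU U \<psi>_\<phi> by metis
      then show "x \<in> {x. k x = \<one>}" by simp
    qed
  qed (auto simp: k)
  then show ?thesis by (auto simp: k_def)
qed

definition \<Phi> :: "'a \<Rightarrow> 'e ^ 'e basis_index" where "\<Phi> g = (\<chi> b. D g (Rep_basis_index b))"

lemma \<Phi>_mult: "\<Phi> (g \<otimes> h) = \<Phi> g + \<Phi> h"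
  by (simp add: \<Phi>_def D_mult vec_eq_iff)

lemma \<Phi>_continuous: "continuous_on UNIV \<Phi>"
  unfolding \<Phi>_def by (intro continuous_on_vec_lambda D_continuous)

lemma \<Phi>_zero: "\<Phi> g = 0 \<longleftrightarrow> (\<forall>x. comm G x g = \<one>)"
proof
  assume 0: "\<Phi> g = 0"
  have lin: "linear (D g)" using D has_derivative_linear by blast
  have "D g b = 0" if b: "b \<in> Basis" for b
  proof -
    have "\<Phi> g $ Abs_basis_index b = D g b" using b by (simp add: \<Phi>_def Abs_basis_index_inverse)
    then show ?thesis using 0 by simp
  qed
  then have "D g v = 0" for v using linear_eq_0_on_span[OF lin, of Basis v] by (simp add: span_Basis)
  then show "\<forall>x. comm G x g = \<one>" using D_zero_central by blast
next
  assume "\<forall>x. comm G x g = \<one>"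
  then have "F g = (\<lambda>_. p)" by (auto simp: F_def p_def)
  then have "D g = (\<lambda>_. 0)" using has_derivative_unique[OF D[of g]] by simp
  then show "\<Phi> g = 0" by (simp add: \<Phi>_def vec_eq_iff)
qed

end

section \<open>Linear coordinates on non-singular groups\<close>

lemma orthogonal_projection:
  fixes T :: "'w::euclidean_space set"
  assumes T: "subspace T"
  shows "\<exists>P. linear P \<and> (\<forall>x. P x \<in> T) \<and> (\<forall>x\<in>T. P x = x) \<and> (\<forall>x. (\<forall>t\<in>T. x \<bullet> t = 0) \<longrightarrow> P x = 0)"
proof -
  obtain E where E: "E \<subseteq> T" "pairwise orthogonal E" "\<And>x. x \<in> E \<Longrightarrow> norm x = 1" "independent E" "span E = T"
    using orthonormal_basis_subspace[OF T] by metis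
  have fin: "finite E" using E(4) by (rule independent_imp_finite)
  define P where "P x = (\<Sum>b\<in>E. (x \<bullet> b) *\<^sub>R b)" for x
  have lin: "linear P" unfolding P_def
    by (intro linearI) (simp_all add: inner_add_left scaleR_left_distrib sum.distrib scaleR_sum_right)
  have PE: "P b = b" if b: "b \<in> E" for b
  proof -
    have "P b = (\<Sum>b'\<in>E. if b' = b then b else 0)"
      unfolding P_def
    proof (intro sum.cong refl)
      fix b' assume b': "b' \<in> E"
      show "(b \<bullet> b') *\<^sub>R b' = (if b' = b then b else 0)"
        using E(2) E(3)[OF b] b b' by (auto simp: pairwise_def orthogonal_def norm_eq_1)
    qed
    then show ?thesis using fin b by simp
  qed
  have "P x = x" if "x \<in> T" for x
    using linear_eq_on_span[OF lin linear_id[unfolded id_def], of E x] PE that E(5) by auto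
  moreover have "P x \<in> T" for x unfolding P_def using E(1) T by (intro subspace_sum subspace_scale) auto
  moreover have "P x = 0" if "\<And>t. t \<in> T \<Longrightarrow> x \<bullet> t = 0" for x
    unfolding P_def using that E(1) by (intro sum.neutral) auto
  ultimately show ?thesis using lin by blast
qed

lemma continuous_on_balls:
  fixes g :: "'w::euclidean_space \<Rightarrow> 'z::topological_space"
  assumes "\<And>R. continuous_on (W \<inter> cball 0 R) g" shows "continuous_on W g"
  unfolding continuous_on_eq_continuous_within
proof
  fix w assume w: "w \<in> W"
  let ?B = "ball (0::'w) (norm w + 1)"
  have "continuous_on (W \<inter> ?B) g" by (rule continuous_on_subset[OF assms[of "norm w + 1"]]) auto
  then have "continuous (at w within (W \<inter> ?B)) g" using w by (simp add: continuous_on_eq_continuous_within)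
  moreover have "at w within (W \<inter> ?B) = at w within W"
    by (rule at_within_nhd[of w ?B]) auto
  ultimately show "continuous (at w within W) g" by simp
qed

text \<open>\<open>Z\<close> is to be both the centre and the commutator subgroup;
  \<open>comm_surj\<close> is non-singularity.\<close>

locale adjoint_group = two_step_group G
  for G :: "('a::{t2_space,second_countable_topology}, 'm) monoid_scheme" (structure) +
  fixes \<Phi> :: "'a \<Rightarrow> 'w::euclidean_space" and Z :: "'a set"
  assumes path_conn: "path_connected (UNIV :: 'a set)"
    and loc_compact: "\<exists>V K. open V \<and> \<one> \<in> V \<and> V \<subseteq> K \<and> compact (K :: 'a set)"
    and \<Phi>_mult: "\<And>g h. \<Phi> (g \<otimes> h) = \<Phi> g + \<Phi> h" and \<Phi>_cont: "continuous_on UNIV \<Phi>"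
    and \<Phi>_zero: "\<And>g. \<Phi> g = 0 \<longleftrightarrow> g \<in> Z"
    and Z_central: "\<And>g x. g \<in> Z \<longleftrightarrow> (\<forall>x. comm G x g = \<one>)"
    and comm_Z: "\<And>x y. comm G x y \<in> Z"
    and comm_surj: "\<And>x z. x \<notin> Z \<Longrightarrow> z \<in> Z \<Longrightarrow> \<exists>y. comm G x y = z"
    and non_abelian: "\<exists>x. x \<notin> Z"
begin

lemma \<Phi>_one: "\<Phi> \<one> = 0"
  by (rule additive_one[of \<Phi>, OF \<Phi>_mult])

lemma \<Phi>_inv: "\<Phi> (inv x) = - \<Phi> x"
  by (rule additive_inv[of \<Phi>, OF \<Phi>_mult])

lemma \<Phi>_eq: "\<Phi> x = \<Phi> y \<longleftrightarrow> inv x \<otimes> y \<in> Z"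
proof -
  have "inv x \<otimes> y \<in> Z \<longleftrightarrow> - \<Phi> x + \<Phi> y = 0" by (simp add: \<Phi>_zero[symmetric] \<Phi>_mult \<Phi>_inv)
  also have "\<dots> \<longleftrightarrow> \<Phi> x = \<Phi> y" by (metis add.commute diff_conv_add_uminus eq_iff_diff_eq_0)
  finally show ?thesis by blast
qed

lemma \<Phi>_int_pow: "\<Phi> (x [^] (n::int)) = of_int n *\<^sub>R \<Phi> x"
proof -
  have nat: "\<Phi> (x [^] (n::nat)) = real n *\<^sub>R \<Phi> x" for n
    by (induction n) (simp_all add: \<Phi>_mult \<Phi>_one algebra_simps)
  show ?thesis by (cases n rule: int_cases2) (simp_all add: nat int_pow_int int_pow_neg_int \<Phi>_inv)
qed

lemma Z_closed: "closed Z"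
proof -
  have "Z = \<Phi> -` {0}" using \<Phi>_zero by auto
  then show ?thesis using continuous_closed_vimage[of "{0}" \<Phi>] \<Phi>_cont by (simp add: continuous_on_eq_continuous_at)
qed

abbreviation W :: "'w set" where "W \<equiv> range \<Phi>"

text \<open>
  Products of paths from \<open>1\<close> give a compact set over each ball of \<open>W\<close>; in particular \<open>W\<close>,
  a priori only a path-connected subgroup, is a linear subspace.
\<close>

lemma compact_prod_sets:
  assumes "\<And>w. w \<in> set l \<Longrightarrow> compact (K w)"
  shows "compact (foldr (\<lambda>w S. (\<lambda>(x, y). x \<otimes> y) ` (K w \<times> S)) l {\<one> :: 'a})"
  using assms
  by (induction l) (auto intro!: compact_continuous_image compact_Times continuous_on_subset[OF mult_cont])

lemma prod_sets:
  assumes "\<And>w. w \<in> set l \<Longrightarrow> h w \<in> K w"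
  shows "foldr (\<lambda>w g. h w \<otimes> g) l \<one> \<in> foldr (\<lambda>w S. (\<lambda>(x, y). x \<otimes> y) ` (K w \<times> S)) l {\<one> :: 'a}"
  using assms
proof (induction l)
  case (Cons w l)
  then have "(h w, foldr (\<lambda>w g. h w \<otimes> g) l \<one>) \<in> K w \<times> foldr (\<lambda>w S. (\<lambda>(x, y). x \<otimes> y) ` (K w \<times> S)) l {\<one>}" by simp
  then show ?case by (simp only: foldr.simps o_apply) (rule image_eqI[rotated], assumption, simp)
qed simp

text \<open>For basis vectors \<open>w\<close> of the span of \<open>W\<close>, the image of the
  path \<open>\<gamma> w\<close> serves as the curve from 0 to \<open>w\<close>. Rounding along
  these curves writes every vector of the span as the image of a product of factors
  \<open>x w [^] n w \<otimes> \<gamma> w (t w)\<close>, with bounded exponents for bounded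
  vectors.\<close>

lemma W_lift: "subspace W \<and> (\<forall>R. \<exists>Q. compact Q \<and> W \<inter> cball 0 R \<subseteq> \<Phi> ` Q)"
proof -
  define W' where "W' = span W"
  have W': "subspace W'" by (simp add: W'_def)
  obtain E where E: "E \<subseteq> W" "independent E" "W \<subseteq> span E" using maximal_independent_subset by blast
  have spanE: "span E = W'" using E span_mono span_eq unfolding W'_def by (metis span_span subset_antisym)
  have finE: "finite E" using E(2) by (rule independent_imp_finite)
  have "\<forall>w\<in>E. \<exists>x. \<Phi> x = w" using E(1) by blast
  from bchoice[OF this] obtain x where x: "\<And>w. w \<in> E \<Longrightarrow> \<Phi> (x w) = w" by blast
  have "\<exists>g. path g \<and> pathstart g = \<one> \<and> pathfinish g = x w" for w
    using path_conn unfolding path_connected_def by blast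
  then obtain \<gamma> where \<gamma>: "\<And>w. path (\<gamma> w)" "\<And>w. \<gamma> w 0 = \<one>" "\<And>w. \<gamma> w 1 = x w" unfolding pathstart_def pathfinish_def by metis
  have cg: "continuous_on {0..1} (\<gamma> w)" for w using \<gamma>(1) by (simp add: path_def)
  have cP: "continuous_on {0..1} (\<lambda>t. \<Phi> (\<gamma> w t))" for w by (rule continuous_on_compose2[OF \<Phi>_cont cg]) auto
  have "\<exists>b. \<forall>t\<in>{0..1}. norm (\<Phi> (\<gamma> w t) - t *\<^sub>R w) \<le> b" for w
  proof -
    have "compact ((\<lambda>t. \<Phi> (\<gamma> w t) - t *\<^sub>R w) ` {0..1})" by (intro compact_continuous_image continuous_intros cP) auto
    then have "bounded ((\<lambda>t. \<Phi> (\<gamma> w t) - t *\<^sub>R w) ` {0..1})" by (rule compact_imp_bounded)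
    then show ?thesis unfolding bounded_iff by blast
  qed
  then obtain b where b: "\<And>w t. t \<in> {0..1} \<Longrightarrow> norm (\<Phi> (\<gamma> w t) - t *\<^sub>R w) \<le> b w" by metis
  define e where "e = (\<Sum>w\<in>E. \<bar>b w\<bar>)"
  have e: "0 \<le> e" by (simp add: e_def sum_nonneg)
  have be: "b w \<le> e" if "w \<in> E" for w
    using member_le_sum[of w E "\<lambda>w. \<bar>b w\<bar>"] that finE unfolding e_def by fastforce
  have "\<exists>w\<in>E. w \<bullet> u \<noteq> 0" if "u \<in> W'" "u \<noteq> 0" for u
  proof (rule ccontr)
    assume "\<not> ?thesis"
    then have "\<And>w. w \<in> E \<Longrightarrow> orthogonal u w" by (auto simp: orthogonal_def inner_commute)
    then have "orthogonal u u" using that spanE orthogonal_to_span by blast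
    then show False using that by (simp add: orthogonal_def)
  qed
  then obtain \<mu> where \<mu>: "0 < \<mu>" "\<And>u. u \<in> W' \<Longrightarrow> \<mu> * (norm u)\<^sup>2 \<le> (\<Sum>w\<in>E. (w \<bullet> u)\<^sup>2)"
    using coercive_family[OF finE W', of "\<lambda>w. w"] by blast
  obtain l where l: "set l = E" "distinct l" using finite_distinct_list[OF finE] by blast
  have cover: "\<exists>Q. compact Q \<and> W' \<inter> cball 0 R \<subseteq> \<Phi> ` Q" for R
  proof -
    define M where "M = (\<Sum>w\<in>E. nat \<lceil>norm w * ((\<bar>R\<bar> + real (card E) * e) / \<mu>) + 1\<rceil>)"
    define K where "K w = (\<Union>n\<in>{- int M..int M}. (\<lambda>t. x w [^] n \<otimes> \<gamma> w t) ` {0..1})" for w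
    have K: "compact (K w)" for w unfolding K_def
      by (intro compact_UN compact_continuous_image continuous_intros cg) auto
    define Q where "Q = foldr (\<lambda>w S. (\<lambda>(x, y). x \<otimes> y) ` (K w \<times> S)) l {\<one>}"
    have "compact Q" unfolding Q_def by (rule compact_prod_sets[OF K])
    moreover have "W' \<inter> cball 0 R \<subseteq> \<Phi> ` Q"
    proof
      fix z assume z: "z \<in> W' \<inter> cball 0 R"
      then have zW: "z \<in> W'" and zR: "norm z \<le> \<bar>R\<bar>" by auto
      have "\<exists>n :: 'w \<Rightarrow> int. \<exists>t. (\<Sum>w\<in>E. of_int (n w) *\<^sub>R w + \<Phi> (\<gamma> w (t w))) = z \<and>
        (\<forall>w\<in>E. t w \<in> {0..1} \<and> \<bar>of_int (n w)\<bar> \<le> norm w * ((norm z + real (card E) * e) / \<mu>) + 1)"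
      proof (rule lattice_curves_surj[OF finE W' _ cP _ _ _ _ e \<mu>(1) \<mu>(2) zW])
        show "w \<in> W'" if "w \<in> E" for w using that E(1) by (auto simp: W'_def intro: span_base)
        show "\<Phi> (\<gamma> w t) \<in> W'" for w t by (auto simp: W'_def intro: span_base)
        show "\<Phi> (\<gamma> w 0) = 0" "\<Phi> (\<gamma> w 1) = w" if "w \<in> E" for w using \<gamma>(2,3) x that by (simp_all add: \<Phi>_one)
        show "norm (\<Phi> (\<gamma> w t) - t *\<^sub>R w) \<le> e" if "w \<in> E" "t \<in> {0..1}" for w t
          using b[OF that(2), of w] be[OF that(1)] by linarith
      qed
      then obtain n :: "'w \<Rightarrow> int" and t where nt: "(\<Sum>w\<in>E. of_int (n w) *\<^sub>R w + \<Phi> (\<gamma> w (t w))) = z"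
        and t: "\<And>w. w \<in> E \<Longrightarrow> t w \<in> {0..1}"
        and n: "\<And>w. w \<in> E \<Longrightarrow> \<bar>of_int (n w)\<bar> \<le> norm w * ((norm z + real (card E) * e) / \<mu>) + 1" by blast
      define h where "h w = x w [^] n w \<otimes> \<gamma> w (t w)" for w
      have nM: "n w \<in> {- int M..int M}" if w: "w \<in> E" for w
      proof -
        have "norm w * ((norm z + real (card E) * e) / \<mu>) \<le> norm w * ((\<bar>R\<bar> + real (card E) * e) / \<mu>)"
          using zR \<mu>(1) by (intro mult_left_mono divide_right_mono add_right_mono) auto
        then have "\<bar>of_int (n w)\<bar> \<le> norm w * ((\<bar>R\<bar> + real (card E) * e) / \<mu>) + 1" using n[OF w] by linarith
        then have "\<bar>n w\<bar> \<le> \<lceil>norm w * ((\<bar>R\<bar> + real (card E) * e) / \<mu>) + 1\<rceil>" by linarith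
        moreover have "nat \<lceil>norm w * ((\<bar>R\<bar> + real (card E) * e) / \<mu>) + 1\<rceil> \<le> M"
          unfolding M_def using w finE by (intro member_le_sum) auto
        ultimately show ?thesis by auto
      qed
      have inQ: "foldr (\<lambda>w g. h w \<otimes> g) l \<one> \<in> Q" unfolding Q_def
      proof (rule prod_sets)
        fix w assume "w \<in> set l"
        then have w: "w \<in> E" by (simp add: l)
        show "h w \<in> K w" unfolding K_def h_def by (rule UN_I[OF nM[OF w]], rule image_eqI[OF refl t[OF w]])
      qed
      have "\<Phi> (foldr (\<lambda>w g. h w \<otimes> g) l' \<one>) = (\<Sum>w\<in>set l'. \<Phi> (h w))" if "distinct l'" for l'
        using that by (induction l') (simp_all add: \<Phi>_mult \<Phi>_one)
      then have "\<Phi> (foldr (\<lambda>w g. h w \<otimes> g) l \<one>) = (\<Sum>w\<in>E. \<Phi> (h w))" using l by metis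
      also have "\<dots> = z" unfolding nt[symmetric] using x by (intro sum.cong) (auto simp: h_def \<Phi>_mult \<Phi>_int_pow)
      finally have "\<Phi> (foldr (\<lambda>w g. h w \<otimes> g) l \<one>) = z" .
      then show "z \<in> \<Phi> ` Q" using inQ by blast
    qed
    ultimately show ?thesis by blast
  qed
  have "W' \<subseteq> W"
  proof
    fix z assume "z \<in> W'"
    then show "z \<in> W" using cover[of "norm z"] by auto
  qed
  then have "W = W'" using span_superset[of W] unfolding W'_def by blast
  then show ?thesis using cover W' by simp
qed

lemma subspace_W: "subspace W" and lift: "\<exists>Q. compact Q \<and> W \<inter> cball 0 R \<subseteq> \<Phi> ` Q"
  using W_lift by auto

text \<open>Over each ball \<open>\<Phi>\<close> is covered by a compact set of the group, on which
  it is a quotient map.\<close>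

lemma factor_continuous:
  fixes h :: "'a \<Rightarrow> 'z::topological_space"
  assumes h: "continuous_on UNIV h" and k: "\<And>y. k (\<Phi> y) = h y"
  shows "continuous_on W k"
proof (rule continuous_on_balls)
  fix R
  obtain Q where Q: "compact Q" "W \<inter> cball 0 R \<subseteq> \<Phi> ` Q" using lift by blast
  have "continuous_on (\<Phi> ` Q) k"
    using Q(1) \<Phi>_cont h k by (intro continuous_on_compact_quotient[of Q \<Phi> h]) (auto intro: continuous_on_subset)
  then show "continuous_on (W \<inter> cball 0 R) k" using Q(2) by (rule continuous_on_subset)
qed

section \<open>The centre as a quotient of a vector space\<close>

definition sec :: "'w \<Rightarrow> 'a" where "sec w = (SOME y. \<Phi> y = w)"

lemma sec: "w \<in> W \<Longrightarrow> \<Phi> (sec w) = w"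
  unfolding sec_def by (rule someI_ex) auto

lemma comm_\<Phi>: "\<Phi> y = \<Phi> y' \<Longrightarrow> comm G x y = comm G x y'"
proof -
  assume "\<Phi> y = \<Phi> y'"
  then have z: "inv y \<otimes> y' \<in> Z" by (simp add: \<Phi>_eq)
  have "comm G x y' = comm G x (y \<otimes> (inv y \<otimes> y'))" by (simp add: m_assoc[symmetric])
  also have "\<dots> = comm G x y" using z Z_central by (simp add: comm_mult_right)
  finally show ?thesis by simp
qed

lemma comm_sec [simp]: "comm G x (sec (\<Phi> y)) = comm G x y"
  by (rule comm_\<Phi>) (simp add: sec)

lemma comm_self: "comm G x x = \<one>" by (simp add: comm_def m_assoc)

definition x0 :: 'a where "x0 = (SOME x. x \<notin> Z)"

lemma x0: "x0 \<notin> Z" unfolding x0_def using non_abelian by (rule someI_ex)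

text \<open>Commutation with the fixed non-central \<open>x0\<close> induces a homomorphism of the
  vector space \<open>W\<close> onto the centre, surjective by non-singularity. It is the source of
  linear structure on \<open>Z\<close>.\<close>

definition f :: "'w \<Rightarrow> 'a" where "f w = comm G x0 (sec w)"

lemma f_\<Phi>: "f (\<Phi> y) = comm G x0 y" by (simp add: f_def)

lemma f_add: "w \<in> W \<Longrightarrow> w' \<in> W \<Longrightarrow> f (w + w') = f w \<otimes> f w'"
  by (auto simp: f_\<Phi> \<Phi>_mult[symmetric] comm_mult_right)

lemma f_minus: "w \<in> W \<Longrightarrow> f (- w) = inv (f w)"
  by (auto simp: f_\<Phi> \<Phi>_inv[symmetric] comm_inv_right)

lemma f_Z: "f w \<in> Z" by (simp add: f_def comm_Z)

lemma f_surj: "z \<in> Z \<Longrightarrow> \<exists>w\<in>W. f w = z"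
  using comm_surj[OF x0] f_\<Phi> by blast

lemma f_continuous: "continuous_on W f"
  by (rule factor_continuous[of "\<lambda>y. comm G x0 y"]) (auto simp: f_\<Phi> intro!: continuous_intros)

text \<open>The kernel of \<open>f\<close>, so far only known as an additive subgroup.
  \<open>Zs\<close>, the orthogonal complement of its span in \<open>W\<close>, represents the
  linear part of \<open>W / K\<close>.\<close>

definition K :: "'w set" where "K = {w \<in> W. f w = \<one>}"
definition Zs :: "'w set" where "Zs = {w \<in> W. \<forall>k\<in>K. k \<bullet> w = 0}"

lemma f_eq: "w \<in> W \<Longrightarrow> w' \<in> W \<Longrightarrow> f w = f w' \<longleftrightarrow> w - w' \<in> K"
proof -
  assume w: "w \<in> W" "w' \<in> W"
  have "w - w' \<in> W" using w subspace_W by (rule subspace_diff[rotated])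
  moreover have "f (w - w') = f w \<otimes> inv (f w')"
    using f_add[OF w(1), of "- w'"] f_minus[OF w(2)] w subspace_neg[OF subspace_W] by simp
  moreover have "f w \<otimes> inv (f w') = \<one> \<longleftrightarrow> f w = f w'" by (metis in_carrier inv_closed inv_equality inv_inv r_inv)
  ultimately show ?thesis by (simp add: K_def)
qed

lemma subspace_Zs: "subspace Zs"
  using subspace_W unfolding subspace_def Zs_def by (auto simp: inner_add_right)

definition P :: "'w \<Rightarrow> 'w" where
  "P = (SOME P. linear P \<and> (\<forall>x. P x \<in> Zs) \<and> (\<forall>x\<in>Zs. P x = x) \<and> (\<forall>x. (\<forall>t\<in>Zs. x \<bullet> t = 0) \<longrightarrow> P x = 0))"

lemma P: "linear P" "P x \<in> Zs" "x \<in> Zs \<Longrightarrow> P x = x" "(\<And>t. t \<in> Zs \<Longrightarrow> x \<bullet> t = 0) \<Longrightarrow> P x = 0"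
  using someI_ex[OF orthogonal_projection[OF subspace_Zs]] unfolding P_def[symmetric] by auto

lemma P_K: "k \<in> span K \<Longrightarrow> P k = 0"
proof (rule P(4))
  fix t assume k: "k \<in> span K" and t: "t \<in> Zs"
  have "orthogonal t k" by (rule orthogonal_to_span[OF k]) (use t in \<open>auto simp: Zs_def orthogonal_def inner_commute\<close>)
  then show "k \<bullet> t = 0" by (simp add: orthogonal_def inner_commute)
qed

lemma P_decomp: "w \<in> W \<Longrightarrow> w - P w \<in> span K"
proof -
  assume w: "w \<in> W"
  obtain y z where yz: "y \<in> span K" "\<And>t. t \<in> span K \<Longrightarrow> orthogonal z t" "w = y + z"
    using orthogonal_subspace_decomp_exists[of K w] by blast
  have KW: "span K \<subseteq> W" using subspace_W by (intro span_minimal) (auto simp: K_def)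
  have "z = w - y" using yz(3) by simp
  then have "z \<in> W" using w yz(1) KW subspace_W by (auto intro: subspace_diff)
  then have "z \<in> Zs" using yz(2) span_base by (fastforce simp: Zs_def orthogonal_def inner_commute)
  then have "P w = z" using P(3) P_K[OF yz(1)] linear_add[OF P(1)] by (simp add: yz(3))
  then show ?thesis using yz by simp
qed

text \<open>The centre is \<open>W / K\<close> through \<open>f\<close>, and this is its projection
  to \<open>W / span K\<close>, represented by \<open>Zs\<close>. The choice of the preimage does
  not matter because \<open>P\<close> vanishes on \<open>K\<close>.\<close>

definition \<kappa> :: "'a \<Rightarrow> 'w" where "\<kappa> z = P (SOME w. w \<in> W \<and> f w = z)"

lemma \<kappa>_f: "w \<in> W \<Longrightarrow> \<kappa> (f w) = P w"
proof -
  assume w: "w \<in> W"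
  let ?v = "SOME v. v \<in> W \<and> f v = f w"
  have v: "?v \<in> W \<and> f ?v = f w" by (rule someI[of _ w]) (use w in simp)
  then have "?v - w \<in> K" using f_eq w by blast
  then have "P (?v - w) = 0" by (intro P_K span_base)
  then show ?thesis by (simp add: \<kappa>_def linear_diff[OF P(1)])
qed

lemma \<kappa>_mult: "z \<in> Z \<Longrightarrow> z' \<in> Z \<Longrightarrow> \<kappa> (z \<otimes> z') = \<kappa> z + \<kappa> z'"
proof -
  assume "z \<in> Z" "z' \<in> Z"
  then obtain w w' where w: "w \<in> W" "f w = z" "w' \<in> W" "f w' = z'" using f_surj by blast
  then have "\<kappa> (f (w + w')) = P w + P w'"
    using subspace_add[OF subspace_W w(1,3)] by (simp only: \<kappa>_f linear_add[OF P(1)])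
  then show ?thesis using w f_add[OF w(1,3)] \<kappa>_f by auto
qed

lemma \<kappa>_Zs: "\<kappa> z \<in> Zs" by (simp add: \<kappa>_def P)

lemma \<kappa>_surj: "v \<in> Zs \<Longrightarrow> \<exists>z\<in>Z. \<kappa> z = v"
  using \<kappa>_f[of v] P(3)[of v] f_Z[of v] by (intro bexI[of _ "f v"]) (auto simp: Zs_def)

lemma Z_inv: "z \<in> Z \<Longrightarrow> inv z \<in> Z" using \<Phi>_inv \<Phi>_zero by (metis neg_equal_zero neg_0_equal_iff_equal)
lemma Z_mult: "z \<in> Z \<Longrightarrow> z' \<in> Z \<Longrightarrow> z \<otimes> z' \<in> Z" by (simp add: \<Phi>_zero[symmetric] \<Phi>_mult)
lemma Z_one: "\<one> \<in> Z" using \<Phi>_one \<Phi>_zero by blast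

lemma f_compact: "compact (f ` (W \<inter> cball 0 R))"
  using subspace_W by (intro compact_continuous_image continuous_on_subset[OF f_continuous])
    (auto simp: closed_Int_compact closed_subspace)

text \<open>An open mapping argument: the images under \<open>f\<close> of balls of integer radius
  are compact and cover the locally compact \<open>Z\<close>, so by Baire one of them has an
  interior point, which is then translated to \<open>\<one>\<close>.\<close>

lemma Z_neighbourhood: "\<exists>V R. open V \<and> \<one> \<in> V \<and> V \<inter> Z \<subseteq> f ` (W \<inter> cball 0 R)"
proof -
  let ?X = "top_of_set Z"
  obtain V0 K0 where VK: "open V0" "\<one> \<in> V0" "V0 \<subseteq> K0" "compact (K0 :: 'a set)" using loc_compact by blast
  have "locally_compact_space (euclidean :: 'a topology)" unfolding locally_compact_space_def
  proof
    fix x :: 'a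
    have "open {y. inv x \<otimes> y \<in> V0}" by (intro open_preimage continuous_intros VK)
    moreover have "compact ((\<lambda>y. x \<otimes> y) ` K0)" by (intro compact_continuous_image continuous_intros VK)
    moreover have "{y. inv x \<otimes> y \<in> V0} \<subseteq> (\<lambda>y. x \<otimes> y) ` K0"
    proof
      fix y assume "y \<in> {y. inv x \<otimes> y \<in> V0}"
      then show "y \<in> (\<lambda>y. x \<otimes> y) ` K0" using VK by (intro image_eqI[of _ _ "inv x \<otimes> y"]) (auto simp: m_assoc[symmetric])
    qed
    ultimately show "\<exists>U K. openin euclidean U \<and> compactin euclidean K \<and> x \<in> U \<and> U \<subseteq> K"
      using VK(2) by (intro exI[of _ "{y. inv x \<otimes> y \<in> V0}"] exI[of _ "(\<lambda>y. x \<otimes> y) ` K0"]) auto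
  qed
  then have lc: "locally_compact_space ?X" using Z_closed by (intro locally_compact_space_closed_subset) auto
  have "Hausdorff_space (euclidean :: 'a topology)"
    unfolding Hausdorff_space_def disjnt_def by (simp add: open_openin[symmetric]) (metis hausdorff)
  then have reg: "regular_space ?X" using lc by (intro locally_compact_Hausdorff_imp_regular_space Hausdorff_space_subtopology)
  let ?G = "range (\<lambda>n::nat. f ` (W \<inter> cball 0 n))"
  have "\<exists>n::nat. ?X interior_of (f ` (W \<inter> cball 0 n)) \<noteq> {}"
  proof (rule ccontr)
    assume none: "\<not> ?thesis"
    have "?X interior_of \<Union>?G = {}"
    proof (rule Baire_category_alt)
      show "completely_metrizable_space ?X \<or> locally_compact_space ?X \<and> regular_space ?X" using lc reg by blast
      show "countable ?G" by simp
      fix T assume "T \<in> ?G"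
      then obtain n :: nat where T: "T = f ` (W \<inter> cball 0 n)" by blast
      have "closed T" unfolding T using f_compact by (rule compact_imp_closed)
      moreover have "T \<subseteq> Z" using f_Z T by auto
      ultimately show "closedin ?X T \<and> ?X interior_of T = {}" using none T by (auto simp: closed_subset)
    qed
    moreover have "\<Union>?G = Z"
    proof
      show "\<Union>?G \<subseteq> Z" using f_Z by auto
      show "Z \<subseteq> \<Union>?G"
      proof
        fix z assume "z \<in> Z"
        then obtain w where w: "w \<in> W" "f w = z" using f_surj by blast
        obtain n :: nat where "norm w \<le> n" using real_arch_simple by blast
        then have "z \<in> f ` (W \<inter> cball 0 n)" using w by auto
        then show "z \<in> \<Union>?G" by blast
      qed
    qed
    ultimately have "?X interior_of Z = {}" by simp
    moreover have "?X interior_of Z = Z" using interior_of_topspace[of ?X] by simp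
    ultimately show False using Z_one by blast
  qed
  then obtain n :: nat and t0 where "t0 \<in> ?X interior_of (f ` (W \<inter> cball 0 n))" by blast
  then obtain T where T: "open T" "t0 \<in> T \<inter> Z" "T \<inter> Z \<subseteq> f ` (W \<inter> cball 0 n)"
    unfolding interior_of_def openin_subtopology by auto
  have "t0 \<in> f ` (W \<inter> cball 0 n)" using T(2,3) by (rule subsetD[rotated])
  then obtain w0 where w0': "t0 = f w0" "w0 \<in> W \<inter> cball 0 n" by (rule imageE)
  have w0: "w0 \<in> W" "norm w0 \<le> n" "f w0 = t0"
    using IntD1[OF w0'(2)] IntD2[OF w0'(2)] w0'(1) by (simp_all only: mem_cball_0)
  let ?V = "{y. t0 \<otimes> y \<in> T}"
  have "?V \<inter> Z \<subseteq> f ` (W \<inter> cball 0 (2 * n))"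
  proof
    fix y assume y: "y \<in> ?V \<inter> Z"
    then have "t0 \<otimes> y \<in> T \<inter> Z" using T(2) Z_mult by auto
    then have "t0 \<otimes> y \<in> f ` (W \<inter> cball 0 n)" by (rule subsetD[OF T(3)])
    then obtain w where w': "t0 \<otimes> y = f w" "w \<in> W \<inter> cball 0 n" by (rule imageE)
    have w: "w \<in> W" "norm w \<le> n" "t0 \<otimes> y = f w"
      using IntD1[OF w'(2)] IntD2[OF w'(2)] w'(1) by (simp_all only: mem_cball_0)
    have "f (w - w0) = f (- w0 + w)" by simp
    also have "\<dots> = inv (f w0) \<otimes> f w" using f_add[OF _ w(1), of "- w0"] f_minus[OF w0(1)] subspace_neg[OF subspace_W w0(1)] by simp
    also have "\<dots> = y" using w(3) w0(3) by (simp add: m_assoc[symmetric] flip: w(3))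
    finally have "y = f (w - w0)" by simp
    moreover have "w - w0 \<in> W" using subspace_W w(1) w0(1) by (rule subspace_diff)
    moreover have "norm (w - w0) \<le> 2 * n" using norm_triangle_ineq4[of w w0] w w0 by simp
    ultimately show "y \<in> f ` (W \<inter> cball 0 (2 * n))" by auto
  qed
  moreover have "open ?V" by (intro open_preimage continuous_intros T)
  ultimately show ?thesis using T(2) by (intro exI[of _ ?V] exI[of _ "2 * real n"]) auto
qed

section \<open>The commutator as a bilinear form\<close>

lemma \<kappa>_comm_mult: "\<kappa> (comm G x (y \<otimes> y')) = \<kappa> (comm G x y) + \<kappa> (comm G x y')"
  by (simp add: comm_mult_right \<kappa>_mult comm_Z)

lemma \<kappa>_inv: "z \<in> Z \<Longrightarrow> \<kappa> (inv z) = - \<kappa> z"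
proof -
  assume z: "z \<in> Z"
  have "\<kappa> \<one> = 0" using \<kappa>_mult[OF Z_one Z_one] by simp
  then show ?thesis using \<kappa>_mult[OF z Z_inv[OF z]] by (simp add: eq_neg_iff_add_eq_0 add.commute)
qed

lemma \<kappa>_comm_skew: "\<kappa> (comm G y x) = - \<kappa> (comm G x y)"
  using \<kappa>_inv[OF comm_Z, of x y] by (simp add: inv_comm)

text \<open>By additivity only points near \<open>\<one>\<close> matter. There the commutator lies
  in the image under \<open>f\<close> of a compact ball, and on this image \<open>\<kappa>\<close>
  is continuous because \<open>\<kappa> (f w) = P w\<close> is continuous in
  \<open>w\<close>.\<close>

lemma \<kappa>_comm_continuous: "continuous_on UNIV (\<lambda>y. \<kappa> (comm G x y))"
proof -
  obtain V R where V: "open V" "\<one> \<in> V" "V \<inter> Z \<subseteq> f ` (W \<inter> cball 0 R)" using Z_neighbourhood by blast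
  have \<kappa>: "continuous_on (f ` (W \<inter> cball 0 R)) \<kappa>"
  proof (rule continuous_on_compact_quotient[of _ f P])
    show "compact (W \<inter> cball 0 R)" using subspace_W by (simp add: closed_Int_compact closed_subspace)
    show "continuous_on (W \<inter> cball 0 R) f" by (rule continuous_on_subset[OF f_continuous]) auto
    show "continuous_on (W \<inter> cball 0 R) P" using P(1) by (rule linear_continuous_on[OF linear_conv_bounded_linear[THEN iffD1]])
  qed (simp add: \<kappa>_f)
  show ?thesis
  proof (rule additive_continuous)
    show "\<kappa> (comm G x (y \<otimes> y')) = \<kappa> (comm G x y) + \<kappa> (comm G x y')" for y y' by (rule \<kappa>_comm_mult)
    show "open {y. comm G x y \<in> V}" by (intro open_preimage continuous_intros V)
    show "\<one> \<in> {y. comm G x y \<in> V}" using V by simp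
    show "continuous_on {y. comm G x y \<in> V} (\<lambda>y. \<kappa> (comm G x y))"
      by (rule continuous_on_compose2[OF \<kappa>]) (use V comm_Z in \<open>auto intro!: continuous_intros\<close>)
  qed
qed

text \<open>Additivity comes from the commutator identities and homogeneity from continuity. The
  projection \<open>Q\<close> onto \<open>W\<close> extends the form to the whole type, as
  \<open>bounded_bilinear\<close> demands.\<close>

lemma bilinear_form:
  "\<exists>B. bounded_bilinear B \<and> (\<forall>v. B v v = 0) \<and> (\<forall>x y. B (\<Phi> x) (\<Phi> y) = \<kappa> (comm G x y)) \<and> (\<forall>v w. B v w \<in> Zs)"
proof -
  obtain Q where Q: "linear Q" "\<And>x. Q x \<in> W" "\<And>x. x \<in> W \<Longrightarrow> Q x = x" using orthogonal_projection[OF subspace_W] by blast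
  define B0 where "B0 v w = \<kappa> (comm G (sec v) (sec w))" for v w
  have sec_left: "comm G (sec (\<Phi> x)) y = comm G x y" for x y
    using comm_\<Phi>[of "sec (\<Phi> x)" x y] by (metis inv_comm sec rangeI)
  have B0: "B0 (\<Phi> x) (\<Phi> y) = \<kappa> (comm G x y)" for x y by (simp add: B0_def sec_left)
  have B0_skew: "B0 w v = - B0 v w" for v w unfolding B0_def by (rule \<kappa>_comm_skew)
  have B0_add: "B0 v (w + w') = B0 v w + B0 v w'" if "v \<in> W" "w \<in> W" "w' \<in> W" for v w w'
    using that by (auto simp: B0 \<Phi>_mult[symmetric] \<kappa>_comm_mult)
  have B0_scale: "B0 v (t *\<^sub>R w) = t *\<^sub>R B0 v w" if v: "v \<in> W" and w: "w \<in> W" for v w t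
  proof (rule additive_scaleR[OF subspace_W _ _ w])
    show "B0 v (x + y) = B0 v x + B0 v y" if "x \<in> W" "y \<in> W" for x y by (rule B0_add[OF v that])
    obtain x where "v = \<Phi> x" using v by blast
    then show "continuous_on W (B0 v)" by (intro factor_continuous[OF \<kappa>_comm_continuous[of x]]) (simp add: B0)
  qed
  define B where "B v w = B0 (Q v) (Q w)" for v w
  have lin: "linear (\<lambda>w. B v w)" for v
    by (rule linearI) (simp_all add: B_def linear_add[OF Q(1)] linear_scale[OF Q(1)] B0_add B0_scale Q)
  have skew: "B w v = - B v w" for v w by (simp add: B_def B0_skew[of "Q w" "Q v"])
  have "linear (\<lambda>v. B v w)" for w
  proof -
    have "(\<lambda>v. B v w) = (\<lambda>v. - B w v)" by (rule ext) (rule skew)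
    then show ?thesis using linear_compose_neg[OF lin[of w]] by simp
  qed
  then have "bilinear B" using lin by (simp add: bilinear_def)
  moreover have "B v v = 0" for v
  proof -
    have "comm G (sec (Q v)) (sec (Q v)) = \<one>" by (rule comm_self)
    moreover have "\<kappa> \<one> = 0" using \<kappa>_mult[OF Z_one Z_one] by simp
    ultimately show ?thesis by (simp add: B_def B0_def)
  qed
  moreover have "B (\<Phi> x) (\<Phi> y) = \<kappa> (comm G x y)" for x y by (simp add: B_def Q B0)
  moreover have "B v w \<in> Zs" for v w unfolding B_def B0_def by (rule \<kappa>_Zs)
  ultimately show ?thesis unfolding bilinear_conv_bounded_bilinear by blast
qed

text \<open>Subtracting integer combinations of elements of \<open>K\<close> bounds the part of \<open>w\<close> in \<open>span K\<close>.\<close>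

lemma \<kappa>_proper: "\<exists>b. \<forall>z\<in>Z. \<exists>w\<in>W. f w = z \<and> norm w \<le> norm (\<kappa> z) + b"
proof -
  obtain E where E: "E \<subseteq> K" "independent E" "K \<subseteq> span E" using maximal_independent_subset by blast
  have finE: "finite E" using E(2) by (rule independent_imp_finite)
  have spanE: "span E = span K" using E by (metis span_mono span_span subset_antisym span_superset)
  have KW: "K \<subseteq> W" by (auto simp: K_def)
  have Ksub: "x + y \<in> K" "- x \<in> K" if "x \<in> K" "y \<in> K" for x y
    using that f_add f_minus subspace_add[OF subspace_W] subspace_neg[OF subspace_W] by (auto simp: K_def)
  have K0: "0 \<in> K" using f_\<Phi>[of \<one>] \<Phi>_one subspace_0[OF subspace_W] by (simp add: K_def)
  have Kn: "real n *\<^sub>R x \<in> K" if "x \<in> K" for x n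
    by (induction n) (use that K0 Ksub in \<open>auto simp: algebra_simps\<close>)
  have Ki: "of_int i *\<^sub>R x \<in> K" if "x \<in> K" for x i
  proof (cases i rule: int_cases2)
    case (nonneg n)
    then show ?thesis using Kn[OF that, of n] by simp
  next
    case (nonpos n)
    then show ?thesis using Ksub(2)[OF Kn[OF that] Kn[OF that], of n] by simp
  qed
  have "\<exists>w\<in>W. f w = z \<and> norm w \<le> norm (\<kappa> z) + (\<Sum>e\<in>E. norm e)" if z: "z \<in> Z" for z
  proof -
    obtain w where w: "w \<in> W" "f w = z" using f_surj[OF z] by blast
    have "w - P w \<in> span E" using P_decomp[OF w(1)] spanE by simp
    then obtain u where u: "w - P w = (\<Sum>e\<in>E. u e *\<^sub>R e)" using span_finite[OF finE] by auto
    define k where "k = (\<Sum>e\<in>E. of_int \<lfloor>u e\<rfloor> *\<^sub>R e)"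
    have "k \<in> K" unfolding k_def using finE E(1)
      by (induction E rule: finite_induct) (auto intro: K0 Ksub Ki)
    define w' where "w' = w - k"
    have w'W: "w' \<in> W" using subspace_W w(1) \<open>k \<in> K\<close> KW by (auto simp: w'_def intro: subspace_diff)
    have "f w = f w'" using f_eq[OF w(1) w'W] \<open>k \<in> K\<close> by (simp add: w'_def)
    moreover have "norm w' \<le> norm (\<kappa> z) + (\<Sum>e\<in>E. norm e)"
    proof -
      have "w' = P w + (\<Sum>e\<in>E. frac (u e) *\<^sub>R e)"
        using u by (simp add: w'_def k_def frac_def scaleR_diff_left sum_subtractf algebra_simps)
      moreover have "norm (\<Sum>e\<in>E. frac (u e) *\<^sub>R e) \<le> (\<Sum>e\<in>E. norm e)"
      proof (rule sum_norm_le)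
        fix e assume "e \<in> E"
        have "frac (u e) * norm e \<le> 1 * norm e" by (intro mult_right_mono) (auto simp: frac_lt_1 less_imp_le)
        then show "norm (frac (u e) *\<^sub>R e) \<le> norm e" by simp
      qed
      moreover have "\<kappa> z = P w" using \<kappa>_f[OF w(1)] w(2) by simp
      ultimately show ?thesis using norm_triangle_ineq[of "P w" "\<Sum>e\<in>E. frac (u e) *\<^sub>R e"] by simp
    qed
    ultimately show ?thesis using w w'W by (intro bexI[of _ w']) auto
  qed
  then show ?thesis by blast
qed

end

section \<open>Lattices\<close>

context top_group
begin

text \<open>
  The strips \<open>k t \<le> h < (k + 1) t\<close> of \<open>G / \<Gamma>\<close> are translates of each other, so by finiteness of
  the measure they are null sets, while they cover \<open>G / \<Gamma>\<close>.
\<close>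

lemma lattice_hom_zero:
  fixes h :: "'a \<Rightarrow> real"
  assumes latt: "lattice_subgroup G \<Gamma>" and cont: "continuous_on UNIV h"
    and add: "\<And>x y. h (x \<otimes> y) = h x + h y" and h\<Gamma>: "\<And>x. x \<in> \<Gamma> \<Longrightarrow> h x = 0"
  shows "h g = 0"
proof (rule ccontr)
  assume "h g \<noteq> 0"
  moreover have "h (inv g) = - h g" by (rule additive_inv[of h, OF add])
  ultimately have "\<exists>g. 0 < h g" by (metis linorder_less_linear neg_0_less_iff_less)
  then obtain g where g: "0 < h g" by blast
  define t where "t = h g"
  have t: "0 < t" using g by (simp add: t_def)
  let ?L = "lcosets \<Gamma>"
  obtain \<mu> where sets: "sets \<mu> = sets (coset_borel G \<Gamma>)" and fin: "finite_measure \<mu>" and nz: "emeasure \<mu> (space \<mu>) \<noteq> 0"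
    and inva: "\<And>E. E \<in> sets \<mu> \<Longrightarrow> emeasure \<mu> ((\<lambda>c. g <# c) ` E) = emeasure \<mu> E"
    using latt unfolding lattice_subgroup_def by auto
  interpret finite_measure \<mu> by (rule fin)
  interpret \<Gamma>: subgroup \<Gamma> G using latt by (simp add: lattice_subgroup_def)
  have sp: "space \<mu> = ?L"
    using sets_eq_imp_space_eq[OF sets] by (simp add: coset_borel_def space_measure_of_conv)
  \<comment> \<open>Since \<open>h\<close> vanishes on \<open>\<Gamma>\<close>, it is constant on
    cosets and any representative gives the same value.\<close>
  define u where "u c = h (SOME x. x \<in> c)" for c
  have hc: "h x = h a" if "x \<in> a <# \<Gamma>" for x a
    using that by (auto simp: l_coset_def add h\<Gamma>)
  have self: "a \<in> a <# \<Gamma>" for a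
    unfolding l_coset_def using \<Gamma>.one_closed by (intro UN_I[of \<one>]) simp_all
  have u: "u (a <# \<Gamma>) = h a" for a
    unfolding u_def by (rule hc) (rule someI[of _ a], rule self)
  have L: "c \<in> ?L \<longleftrightarrow> (\<exists>a. c = a <# \<Gamma>)" for c by (auto simp: LCOSETS_def)
  define O' where "O' r = {c \<in> ?L. u c < r}" for r
  have "O' r \<in> sets \<mu>" for r
  proof -
    have "\<Union>(O' r) = {x. h x < r}"
    proof (intro subset_antisym subsetI)
      fix x assume "x \<in> \<Union>(O' r)"
      then obtain a where "u (a <# \<Gamma>) < r" "x \<in> a <# \<Gamma>" by (auto simp: O'_def L)
      then show "x \<in> {x. h x < r}" by (simp add: u hc)
    next
      fix x assume "x \<in> {x. h x < r}"
      then have "x <# \<Gamma> \<in> O' r" by (auto simp: O'_def L u)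
      then show "x \<in> \<Union>(O' r)" using self by blast
    qed
    moreover have "open {x. h x < r}"
      using open_vimage[OF open_lessThan[of r] cont] by (simp add: vimage_def)
    ultimately have "O' r \<in> {\<U>. \<U> \<subseteq> ?L \<and> open (\<Union>\<U>)}" by (auto simp: O'_def)
    moreover have "{\<U>. \<U> \<subseteq> ?L \<and> open (\<Union>\<U>)} \<subseteq> Pow ?L" by blast
    ultimately show ?thesis unfolding sets coset_borel_def by (simp add: sets_measure_of sigma_sets.Basic)
  qed
  then have E: "O' (of_int (k + 1) * t) - O' (of_int k * t) \<in> sets \<mu>" for k :: int by blast
  define E where "E k = O' (of_int (k + 1) * t) - O' (of_int k * t)" for k :: int
  have Em: "E k \<in> sets \<mu>" for k unfolding E_def by (rule E)
  have Ek: "c \<in> E k \<longleftrightarrow> c \<in> ?L \<and> of_int k * t \<le> u c \<and> u c < of_int (k + 1) * t" for c k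
    by (auto simp: E_def O'_def)
  have tr: "(\<lambda>c. g <# c) ` E k = E (k + 1)" for k
  proof -
    have gc: "g <# (a <# \<Gamma>) = (g \<otimes> a) <# \<Gamma>" for a by (intro lcos_m_assoc) (auto simp: UNIV_carrier)
    have "c \<in> (\<lambda>c. g <# c) ` E k" if c: "c \<in> E (k + 1)" for c
    proof -
      obtain a where a: "c = a <# \<Gamma>" using c Ek L by blast
      have hi: "h (inv g \<otimes> a) = h a - t" by (simp add: add additive_inv[of h, OF add] t_def)
      show ?thesis
      proof (rule image_eqI)
        show "c = g <# ((inv g \<otimes> a) <# \<Gamma>)" unfolding gc a by (simp add: m_assoc[symmetric])
        show "(inv g \<otimes> a) <# \<Gamma> \<in> E k" using c unfolding Ek a u hi by (auto simp: L algebra_simps)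
      qed
    qed
    moreover have "g <# c \<in> E (k + 1)" if c: "c \<in> E k" for c
    proof -
      obtain a where a: "c = a <# \<Gamma>" using c Ek L by blast
      have hi: "h (g \<otimes> a) = h a + t" by (simp add: add t_def)
      show ?thesis using c unfolding Ek a gc u hi by (auto simp: L algebra_simps)
    qed
    ultimately show ?thesis by blast
  qed
  have "emeasure \<mu> (E (k + 1)) = emeasure \<mu> (E k)" for k using inva[OF Em, of k] by (simp add: tr)
  then have step: "measure \<mu> (E (k + 1)) = measure \<mu> (E k)" for k by (simp add: measure_def)
  have eq: "measure \<mu> (E k) = measure \<mu> (E 0)" for k
  proof (induction k rule: int_induct[where k = 0])
    case (step2 i)
    then show ?case using step[of "i - 1"] by simp
  qed (use step in simp_all)
  have disj: "E i \<inter> E k = {}" if "i < k" for i k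
  proof -
    have "of_int (i + 1) * t \<le> of_int k * t" using that t by (intro mult_right_mono) auto
    then show ?thesis by (auto simp: Ek)
  qed
  have "disjoint_family (\<lambda>n::nat. E (int n))"
    unfolding disjoint_family_on_def
  proof (intro ballI impI)
    fix m n :: nat assume "m \<noteq> n"
    then show "E (int m) \<inter> E (int n) = {}" using disj[of "int m" "int n"] disj[of "int n" "int m"] by (cases "m < n") auto
  qed
  then have "(\<lambda>n::nat. measure \<mu> (E (int n))) sums measure \<mu> (\<Union>n::nat. E (int n))"
    using Em by (intro finite_measure_UNION) auto
  then have "summable (\<lambda>n::nat. measure \<mu> (E 0))" unfolding eq[of "int _"] by (rule sums_summable)
  then have "measure \<mu> (E 0) = 0" by (simp only: summable_const_iff)
  then have "measure \<mu> (E k) = 0" for k using eq[of k] by simp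
  then have "E k \<in> null_sets \<mu>" for k using Em by (intro null_setsI) (simp_all add: emeasure_eq_measure)
  then have "(\<Union>k. E k) \<in> null_sets \<mu>" by (rule null_sets_UN)
  moreover have "(\<Union>k. E k) = ?L"
  proof -
    have "c \<in> E \<lfloor>u c / t\<rfloor>" if "c \<in> ?L" for c
    proof -
      have "of_int \<lfloor>u c / t\<rfloor> \<le> u c / t" "u c / t < of_int (\<lfloor>u c / t\<rfloor> + 1)" by linarith+
      then have "of_int \<lfloor>u c / t\<rfloor> * t \<le> u c" "u c < of_int (\<lfloor>u c / t\<rfloor> + 1) * t"
        using t by (simp_all only: pos_le_divide_eq pos_divide_less_eq)
      then show ?thesis using that by (simp only: Ek)
    qed
    then show ?thesis using Ek by blast
  qed
  ultimately show False using nz by (auto simp: sp null_sets_def)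
qed

end

locale lattice_in_adjoint_group = adjoint_group G \<Phi> Z
  for G :: "('a::{t2_space,second_countable_topology}, 'm) monoid_scheme" (structure)
    and \<Phi> :: "'a \<Rightarrow> 'w::euclidean_space" and Z :: "'a set" +
  fixes \<Gamma> S :: "'a set"
  assumes lattice: "lattice_subgroup G \<Gamma>" and finite_S: "finite S" and S_\<Gamma>: "S \<subseteq> \<Gamma>"
    and S_inverse: "\<And>s. s \<in> S \<Longrightarrow> inv s \<in> S" and generated: "generate G S = \<Gamma>"
begin

lemma subgroup_\<Gamma>: "subgroup \<Gamma> G" and discrete_\<Gamma>: "discrete \<Gamma>"
  using lattice by (simp_all add: lattice_subgroup_def)

sublocale \<Gamma>: subgroup \<Gamma> G by (rule subgroup_\<Gamma>)

lemma hom_zero: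
  fixes h :: "'a \<Rightarrow> real"
  assumes cont: "continuous_on UNIV h" and add: "\<And>x y. h (x \<otimes> y) = h x + h y" and S: "\<And>s. s \<in> S \<Longrightarrow> h s = 0"
  shows "h g = 0"
proof (rule lattice_hom_zero[OF lattice cont add])
  fix x assume "x \<in> \<Gamma>"
  then have "x \<in> generate G S" by (simp add: generated)
  then show "h x = 0"
    by induction (simp_all add: add S additive_one[of h, OF add] additive_inv[of h, OF add])
qed

definition B :: "'w \<Rightarrow> 'w \<Rightarrow> 'w" where
  "B = (SOME B. bounded_bilinear B \<and> (\<forall>v. B v v = 0) \<and> (\<forall>x y. B (\<Phi> x) (\<Phi> y) = \<kappa> (comm G x y)) \<and> (\<forall>v w. B v w \<in> Zs))"

lemma B: "bounded_bilinear B" "B v v = 0" "B (\<Phi> x) (\<Phi> y) = \<kappa> (comm G x y)" "B v w \<in> Zs"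
proof -
  note * = someI_ex[OF bilinear_form, folded B_def]
  show "bounded_bilinear B" using * by (rule conjunct1)
  show "B v v = 0" by (rule *[THEN conjunct2, THEN conjunct1, rule_format])
  show "B (\<Phi> x) (\<Phi> y) = \<kappa> (comm G x y)" by (rule *[THEN conjunct2, THEN conjunct2, THEN conjunct1, rule_format])
  show "B v w \<in> Zs" by (rule *[THEN conjunct2, THEN conjunct2, THEN conjunct2, rule_format])
qed

text \<open>For \<open>v = \<Phi> x\<close>, the pairing of \<open>\<kappa> (comm G x y)\<close>
  with \<open>z\<close> is a continuous homomorphism in \<open>y\<close>. If it vanished on
  \<open>S\<close>, it would vanish everywhere by \<open>hom_zero\<close>; but non-singularity
  provides \<open>y\<close> with \<open>\<kappa> (comm G x y) = z\<close>.\<close>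

lemma nondegenerate:
  assumes v: "v \<in> W" "v \<noteq> 0" and z: "z \<in> Zs" "z \<noteq> 0"
  shows "\<exists>s\<in>S. B v (\<Phi> s) \<bullet> z \<noteq> 0"
proof (rule ccontr)
  assume neg: "\<not> ?thesis"
  obtain x where x: "v = \<Phi> x" using v by blast
  obtain z' where z': "z' \<in> Z" "\<kappa> z' = z" using \<kappa>_surj[OF z(1)] by blast
  have "x \<notin> Z" using v(2) unfolding x \<Phi>_zero .
  then obtain y where y: "comm G x y = z'" using comm_surj z'(1) by blast
  have "\<kappa> (comm G x y) \<bullet> z = 0"
  proof (rule hom_zero[of "\<lambda>y. \<kappa> (comm G x y) \<bullet> z"])
    show "continuous_on UNIV (\<lambda>y. \<kappa> (comm G x y) \<bullet> z)" by (intro continuous_intros \<kappa>_comm_continuous)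
    show "\<kappa> (comm G x s) \<bullet> z = 0" if "s \<in> S" for s using neg that by (simp add: x B(3))
  qed (simp add: \<kappa>_comm_mult inner_add_left)
  then show False using y z' z(2) by simp
qed

text \<open>If \<open>z\<close> in \<open>W\<close> is orthogonal to the images of all generators,
  then \<open>\<Phi> x \<bullet> z\<close> is a homomorphism vanishing on \<open>S\<close>, hence
  zero; as \<open>z\<close> itself is a value of \<open>\<Phi>\<close>, it is 0.\<close>

lemma span_\<Phi>_S: "span (\<Phi> ` S) = W"
proof
  show "span (\<Phi> ` S) \<subseteq> W" by (rule span_minimal[OF _ subspace_W]) blast
  show "W \<subseteq> span (\<Phi> ` S)"
  proof
    fix w assume w: "w \<in> W"
    obtain y z where yz: "y \<in> span (\<Phi> ` S)" "\<And>t. t \<in> span (\<Phi> ` S) \<Longrightarrow> orthogonal z t" "w = y + z"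
      using orthogonal_subspace_decomp_exists[of "\<Phi> ` S" w] by blast
    have "y \<in> W" using yz(1) \<open>span (\<Phi> ` S) \<subseteq> W\<close> by blast
    then have "w - y \<in> W" by (rule subspace_diff[OF subspace_W w])
    then obtain x where x: "\<Phi> x = z" using yz(3) by auto
    have "\<Phi> x \<bullet> z = 0"
    proof (rule hom_zero[of "\<lambda>x. \<Phi> x \<bullet> z"])
      show "continuous_on UNIV (\<lambda>x. \<Phi> x \<bullet> z)" by (intro continuous_intros \<Phi>_cont)
      show "\<Phi> s \<bullet> z = 0" if "s \<in> S" for s
        using yz(2)[OF span_base[OF imageI[OF that]]] by (simp add: orthogonal_def inner_commute)
    qed (simp add: \<Phi>_mult inner_add_left)
    then have "z = 0" using x by simp
    then show "w \<in> span (\<Phi> ` S)" using yz by simp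
  qed
qed

text \<open>\<open>\<kappa>_proper\<close> puts these elements into a compact set, which the
  discrete \<open>\<Gamma>\<close> meets in a finite set.\<close>

lemma finite_central: "finite {c \<in> \<Gamma> \<inter> Z. norm (\<kappa> c) \<le> R}"
proof -
  obtain b where b: "\<And>z. z \<in> Z \<Longrightarrow> \<exists>w\<in>W. f w = z \<and> norm w \<le> norm (\<kappa> z) + b" using \<kappa>_proper by blast
  have "{c \<in> \<Gamma> \<inter> Z. norm (\<kappa> c) \<le> R} \<subseteq> f ` (W \<inter> cball 0 (R + b)) \<inter> \<Gamma>"
  proof
    fix c assume c: "c \<in> {c \<in> \<Gamma> \<inter> Z. norm (\<kappa> c) \<le> R}"
    then obtain w where w: "w \<in> W" "f w = c" "norm w \<le> norm (\<kappa> c) + b" using b by blast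
    then have "w \<in> W \<inter> cball 0 (R + b)" using c by (intro IntI) simp_all
    then have "c \<in> f ` (W \<inter> cball 0 (R + b))" by (rule image_eqI[where f = f and x = w, OF w(2)[symmetric]])
    then show "c \<in> f ` (W \<inter> cball 0 (R + b)) \<inter> \<Gamma>" using c by blast
  qed
  then show ?thesis using finite_compact_discrete[OF f_compact subgroup_\<Gamma> discrete_\<Gamma>] by (rule finite_subset)
qed

lemma finite_image_determined:
  assumes "finite (g ` A)" and "\<And>x y. x \<in> A \<Longrightarrow> y \<in> A \<Longrightarrow> g x = g y \<Longrightarrow> h x = h y"
  shows "finite (h ` A)"
proof -
  have "h x = h (inv_into A g (g x))" if "x \<in> A" for x
    using that by (intro assms(2)) (auto intro: inv_into_into simp: f_inv_into_f)
  then have "h ` A \<subseteq> (\<lambda>y. h (inv_into A g y)) ` g ` A" by blast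
  then show ?thesis using assms(1) finite_surj by blast
qed

text \<open>If \<open>Zs\<close> is trivial, the centre lies in a compact set, so elements of
  \<open>\<Gamma>\<close> with bounded \<open>\<Phi>\<close> lie in a compact set too. Otherwise
  \<open>\<Phi> x\<close> is determined by the commutators of \<open>x\<close> with the generators,
  by nondegeneracy against one \<open>z\<close>, and these are central elements of
  \<open>\<Gamma>\<close> with bounded \<open>\<kappa>\<close>.\<close>

lemma finite_\<Phi>: "finite (\<Phi> ` {x \<in> \<Gamma>. norm (\<Phi> x) \<le> R})" (is "finite (\<Phi> ` ?A)")
proof (cases "Zs = {0}")
  case True
  then have \<kappa>0: "\<kappa> z = 0" for z using \<kappa>_Zs[of z] by simp
  obtain b where b: "\<And>z. z \<in> Z \<Longrightarrow> \<exists>w\<in>W. f w = z \<and> norm w \<le> norm (\<kappa> z) + b" using \<kappa>_proper by blast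
  obtain Q where Q: "compact Q" "W \<inter> cball 0 R \<subseteq> \<Phi> ` Q" using lift by blast
  let ?C = "f ` (W \<inter> cball 0 b)"
  have "compact ((\<lambda>(x, y). x \<otimes> y) ` (Q \<times> ?C))"
    by (intro compact_continuous_image compact_Times Q f_compact continuous_on_subset[OF mult_cont]) simp
  then have "finite ((\<lambda>(x, y). x \<otimes> y) ` (Q \<times> ?C) \<inter> \<Gamma>)"
    by (rule finite_compact_discrete[OF _ subgroup_\<Gamma> discrete_\<Gamma>])
  moreover have "?A \<subseteq> (\<lambda>(x, y). x \<otimes> y) ` (Q \<times> ?C) \<inter> \<Gamma>"
  proof
    fix x assume x: "x \<in> ?A"
    then have "\<Phi> x \<in> W \<inter> cball 0 R" by simp
    then have "\<Phi> x \<in> \<Phi> ` Q" by (rule subsetD[OF Q(2)])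
    then obtain q where q: "q \<in> Q" "\<Phi> q = \<Phi> x" by auto
    then have "inv q \<otimes> x \<in> Z" using \<Phi>_eq by blast
    then obtain w where w: "w \<in> W" "f w = inv q \<otimes> x" "norm w \<le> b" using b[of "inv q \<otimes> x"] \<kappa>0 by auto
    have "w \<in> W \<inter> cball 0 b" using w by (intro IntI) simp_all
    then have c: "inv q \<otimes> x \<in> ?C" by (rule image_eqI[where f = f and x = w, OF w(2)[symmetric]])
    have "x = q \<otimes> (inv q \<otimes> x)" by (simp add: m_assoc[symmetric])
    then have "x \<in> (\<lambda>(x, y). x \<otimes> y) ` (Q \<times> ?C)" using q(1) c by (intro image_eqI[of _ _ "(q, inv q \<otimes> x)"]) simp_all
    then show "x \<in> (\<lambda>(x, y). x \<otimes> y) ` (Q \<times> ?C) \<inter> \<Gamma>" using x by blast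
  qed
  ultimately show ?thesis using finite_subset by blast
next
  case False
  then obtain z where z: "z \<in> Zs" "z \<noteq> 0" using subspace_0[OF subspace_Zs] by blast
  obtain M where M: "0 \<le> M" "\<And>v w. norm (B v w) \<le> norm v * norm w * M" using bounded_bilinear.nonneg_bounded[OF B(1)] by blast
  let ?g = "\<lambda>x. \<lambda>s\<in>S. comm G x s"
  let ?F = "\<lambda>s. {c \<in> \<Gamma> \<inter> Z. norm (\<kappa> c) \<le> R * norm (\<Phi> s) * M}"
  have "?g ` ?A \<subseteq> PiE S ?F"
  proof
    fix t assume "t \<in> ?g ` ?A"
    then obtain x where x: "x \<in> ?A" "t = ?g x" by blast
    have "comm G x s \<in> ?F s" if s: "s \<in> S" for s
    proof -
      have "norm (\<kappa> (comm G x s)) \<le> norm (\<Phi> x) * norm (\<Phi> s) * M" using M(2)[of "\<Phi> x" "\<Phi> s"] by (simp add: B(3))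
      also have "\<dots> \<le> R * norm (\<Phi> s) * M" using x M(1) by (intro mult_right_mono) auto
      finally show ?thesis using x(1) s S_\<Gamma> comm_Z by (auto simp: comm_def)
    qed
    then show "t \<in> PiE S ?F" by (simp add: x(2) restrict_PiE_iff)
  qed
  then have "finite (?g ` ?A)" by (rule finite_subset) (intro finite_PiE finite_S finite_central)
  then show ?thesis
  proof (rule finite_image_determined)
    fix x y assume "?g x = ?g y"
    then have eq: "comm G x s = comm G y s" if "s \<in> S" for s using that by (metis restrict_apply')
    have "B (\<Phi> x - \<Phi> y) (\<Phi> s) \<bullet> z = 0" if "s \<in> S" for s
      using eq[OF that] by (simp add: bounded_bilinear.diff_left[OF B(1)] B(3))
    moreover have "\<Phi> x - \<Phi> y \<in> W" by (intro subspace_diff[OF subspace_W]) auto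
    ultimately show "\<Phi> x = \<Phi> y" using nondegenerate[OF _ _ z, of "\<Phi> x - \<Phi> y"] by auto
  qed
qed

text \<open>Only finitely many values of \<open>\<Phi>\<close> occur, and two elements with the same
  value differ by a central element of \<open>\<Gamma>\<close> with bounded
  \<open>\<kappa>\<close>.\<close>

lemma finite_coordinates:
  assumes \<zeta>C: "\<And>c. c \<in> \<Gamma> \<inter> Z \<Longrightarrow> \<zeta> c = \<kappa> c"
    and \<zeta>m: "\<And>x y. x \<in> \<Gamma> \<Longrightarrow> y \<in> \<Gamma> \<Longrightarrow> \<zeta> (x \<otimes> y) = \<zeta> x + \<zeta> y + (1/2) *\<^sub>R B (\<Phi> x) (\<Phi> y)"
  shows "finite {x \<in> \<Gamma>. norm (\<Phi> x) \<le> R \<and> norm (\<zeta> x) \<le> R}" (is "finite ?A")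
proof -
  have "finite {x \<in> ?A. \<Phi> x = w}" if w: "w \<in> \<Phi> ` ?A" for w
  proof -
    obtain x0 where "w = \<Phi> x0" and x0': "x0 \<in> ?A" using w by (rule imageE)
    then have x0: "x0 \<in> ?A" "\<Phi> x0 = w" by simp_all
    have "{x \<in> ?A. \<Phi> x = w} \<subseteq> (\<lambda>c. x0 \<otimes> c) ` {c \<in> \<Gamma> \<inter> Z. norm (\<kappa> c) \<le> 2 * R}"
    proof
      fix x assume x: "x \<in> {x \<in> ?A. \<Phi> x = w}"
      let ?c = "inv x0 \<otimes> x"
      have c: "?c \<in> \<Gamma> \<inter> Z" using x x0 \<Phi>_eq[of x0 x] by auto
      have xc: "x = x0 \<otimes> ?c" by (simp add: m_assoc[symmetric])
      have "\<Phi> ?c = 0" using c \<Phi>_zero by blast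
      then have "\<zeta> (x0 \<otimes> ?c) = \<zeta> x0 + \<kappa> ?c"
        using \<zeta>m[of x0 ?c] c x0 \<zeta>C[OF c] by (simp add: bounded_bilinear.zero_right[OF B(1)])
      then have "\<kappa> ?c = \<zeta> x - \<zeta> x0" using xc by simp
      then have "norm (\<kappa> ?c) \<le> 2 * R" using x x0 norm_triangle_ineq4[of "\<zeta> x" "\<zeta> x0"] by simp
      then show "x \<in> (\<lambda>c. x0 \<otimes> c) ` {c \<in> \<Gamma> \<inter> Z. norm (\<kappa> c) \<le> 2 * R}" using c xc by (intro image_eqI[of _ _ ?c]) auto
    qed
    then show ?thesis using finite_central finite_surj by blast
  qed
  moreover have "finite (\<Phi> ` ?A)" by (rule finite_subset[OF _ finite_\<Phi>[of R]]) blast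
  moreover have "?A = (\<Union>w\<in>\<Phi> ` ?A. {x \<in> ?A. \<Phi> x = w})" by auto
  ultimately show ?thesis by (metis (no_types, lifting) finite_UN_I)
qed

abbreviation G\<Gamma> where "G\<Gamma> \<equiv> G\<lparr>carrier := \<Gamma>\<rparr>"

lemma coordinates: "\<exists>\<zeta>. nilpotent_coords G\<Gamma> S \<Phi> \<zeta> B W Zs"
proof -
  interpret H: group G\<Gamma> by (rule subgroup_imp_group[OF subgroup_\<Gamma>])
  have inv\<Gamma>: "inv\<^bsub>G\<Gamma>\<^esub> x = inv x" if "x \<in> \<Gamma>" for x using that by (rule m_inv_consistent[OF subgroup_\<Gamma>])
  have comm\<Gamma>: "comm G\<Gamma> x y = comm G x y" if "x \<in> \<Gamma>" "y \<in> \<Gamma>" for x y using that by (simp add: comm_def inv\<Gamma>)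
  have gen: "generate G\<Gamma> S = \<Gamma>" using generate_consistent[OF S_\<Gamma> subgroup_\<Gamma>] generated by simp
  have "central_ext G\<Gamma> (\<Gamma> \<inter> Z) \<Phi> \<kappa> B Zs"
  proof (rule central_ext.intro[OF H.group_axioms central_ext_axioms.intro])
    show "subgroup (\<Gamma> \<inter> Z) G\<Gamma>"
      by (rule subgroup.intro) (auto simp: Z_mult Z_one inv\<Gamma> Z_inv)
    show "c \<otimes>\<^bsub>G\<Gamma>\<^esub> g = g \<otimes>\<^bsub>G\<Gamma>\<^esub> c" if "c \<in> \<Gamma> \<inter> Z" "g \<in> carrier G\<Gamma>" for c g
    proof -
      \<comment> \<open>By non-singularity every element of \<open>Z\<close> is a commutator with
        \<open>x0\<close>, so \<open>comm_central\<close> applies to it.\<close>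
      have "\<exists>y. comm G x0 y = c" using that(1) by (intro comm_surj[OF x0]) blast
      then obtain y where "comm G x0 y = c" by blast
      then show ?thesis using comm_central[of x0 y g] by simp
    qed
    show "comm G\<Gamma> x y \<in> \<Gamma> \<inter> Z" if "x \<in> carrier G\<Gamma>" "y \<in> carrier G\<Gamma>" for x y
      using that comm\<Gamma>[of x y] comm_Z[of x y] by (simp add: comm_def)
    show "\<kappa> (comm G\<Gamma> x y) = B (\<Phi> x) (\<Phi> y)" if "x \<in> carrier G\<Gamma>" "y \<in> carrier G\<Gamma>" for x y
      using that comm\<Gamma>[of x y] by (simp add: B(3))
    show "\<Phi> c = 0" if "c \<in> \<Gamma> \<inter> Z" for c using that \<Phi>_zero by blast
  qed (simp_all add: B subspace_Zs \<Phi>_mult \<kappa>_mult \<kappa>_Zs)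
  then have "\<exists>\<zeta>. (\<forall>c\<in>\<Gamma> \<inter> Z. \<zeta> c = \<kappa> c) \<and> (\<forall>x\<in>carrier G\<Gamma>. \<zeta> x \<in> Zs) \<and>
     (\<forall>x\<in>carrier G\<Gamma>. \<forall>y\<in>carrier G\<Gamma>. \<zeta> (x \<otimes>\<^bsub>G\<Gamma>\<^esub> y) = \<zeta> x + \<zeta> y + (1/2) *\<^sub>R B (\<Phi> x) (\<Phi> y))"
    by (rule central_ext.extension) (use finite_S S_\<Gamma> gen in auto)
  then obtain \<zeta> where *: "\<forall>c\<in>\<Gamma> \<inter> Z. \<zeta> c = \<kappa> c" "\<forall>x\<in>carrier G\<Gamma>. \<zeta> x \<in> Zs"
    "\<forall>x\<in>carrier G\<Gamma>. \<forall>y\<in>carrier G\<Gamma>. \<zeta> (x \<otimes>\<^bsub>G\<Gamma>\<^esub> y) = \<zeta> x + \<zeta> y + (1/2) *\<^sub>R B (\<Phi> x) (\<Phi> y)"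
    by (elim exE conjE) (rule that)
  have \<zeta>: "\<And>c. c \<in> \<Gamma> \<inter> Z \<Longrightarrow> \<zeta> c = \<kappa> c" "\<And>x. x \<in> \<Gamma> \<Longrightarrow> \<zeta> x \<in> Zs"
    "\<And>x y. x \<in> \<Gamma> \<Longrightarrow> y \<in> \<Gamma> \<Longrightarrow> \<zeta> (x \<otimes> y) = \<zeta> x + \<zeta> y + (1/2) *\<^sub>R B (\<Phi> x) (\<Phi> y)"
    using * by simp_all
  have "nilpotent_coords G\<Gamma> S \<Phi> \<zeta> B W Zs"
  proof (intro nilpotent_coords.intro gen_group.intro gen_group_axioms.intro nilpotent_coords_axioms.intro)
    show "inv\<^bsub>G\<Gamma>\<^esub> s \<in> S" if "s \<in> S" for s using that S_inverse inv\<Gamma> S_\<Gamma> by auto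
    show "\<exists>v\<in>W. v \<noteq> 0" using x0 \<Phi>_zero by blast
    show "finite {g \<in> carrier G\<Gamma>. norm (\<Phi> g) \<le> R \<and> norm (\<zeta> g) \<le> R}" for R
      using finite_coordinates[OF \<zeta>(1,3)] by simp
  qed (simp_all add: H.group_axioms finite_S S_\<Gamma> gen B subspace_W subspace_Zs \<Phi>_mult \<zeta> span_\<Phi>_S nondegenerate)
  then show ?thesis by blast
qed

lemma cone:
  assumes "inj_on j (W \<times> Zs)"
  shows "\<exists>d q a c. cone_approx \<Gamma> (word_metric G S) \<one> (j ` (W \<times> Zs)) d q a c"
proof -
  obtain \<zeta> where "nilpotent_coords G\<Gamma> S \<Phi> \<zeta> B W Zs" using coordinates by blast
  then interpret N: nilpotent_coords G\<Gamma> S \<Phi> \<zeta> B W Zs .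
  have inv\<Gamma>: "inv\<^bsub>G\<Gamma>\<^esub> x = inv x" if "x \<in> \<Gamma>" for x using that by (rule m_inv_consistent[OF subgroup_\<Gamma>])
  have wl: "N.wl g = word_length G S g" for g by (simp add: word_length_def)
  have \<rho>: "word_metric G S x y = N.wl (inv\<^bsub>G\<Gamma>\<^esub> x \<otimes>\<^bsub>G\<Gamma>\<^esub> y)" if "x \<in> \<Gamma>" for x y
    using that by (simp add: word_metric_def wl inv\<Gamma>)
  \<comment> \<open>\<open>Metric_space\<close> requires symmetry on the whole type; off \<open>\<Gamma>\<close> no word exists and all
    word lengths are the same junk value.\<close>
  have inv_wl: "word_length G S (inv g) = word_length G S g" for g
  proof (cases "g \<in> \<Gamma>")
    case True then show ?thesis using N.wl_inv[of g] by (simp add: wl inv\<Gamma>)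
  next
    case False
    have none: "\<not> (\<exists>w. length w = n \<and> set w \<subseteq> S \<and> foldr (\<lambda>s h. s \<otimes> h) w \<one> = g)" if "g \<notin> \<Gamma>" for g n
    proof
      assume "\<exists>w. length w = n \<and> set w \<subseteq> S \<and> foldr (\<lambda>s h. s \<otimes> h) w \<one> = g"
      then obtain w where "set w \<subseteq> S" "N.ev w = g" by (auto simp: N.ev_def)
      then show False using N.ev_closed[of w] that by simp
    qed
    have "inv g \<notin> \<Gamma>" using False \<Gamma>.m_inv_closed[of "inv g"] by auto
    show ?thesis unfolding word_length_def
      by (rule arg_cong[where f = Least], rule ext) (use none[OF False] none[OF \<open>inv g \<notin> \<Gamma>\<close>] in blast)
  qed
  have M: "Metric_space \<Gamma> (word_metric G S)"
  proof
    show "0 \<le> word_metric G S x y" for x y by (simp add: word_metric_def)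
    show "word_metric G S x y = word_metric G S y x" for x y
      using inv_wl[of "inv x \<otimes> y"] by (simp add: word_metric_def inv_mult_group)
    fix x y assume xy: "x \<in> \<Gamma>" "y \<in> \<Gamma>"
    have "inv x \<otimes> y = \<one> \<longleftrightarrow> x = y" by (metis in_carrier inv_closed inv_inv inv_solve_left r_one l_inv)
    then show "word_metric G S x y = 0 \<longleftrightarrow> x = y"
      using N.wl_eq_0[of "inv x \<otimes> y"] xy by (simp add: word_metric_def wl)
    fix z assume z: "z \<in> \<Gamma>"
    have "(inv x \<otimes> y) \<otimes> (inv y \<otimes> z) = inv x \<otimes> z" by (simp add: m_assoc) (simp add: m_assoc[symmetric])
    then show "word_metric G S x z \<le> word_metric G S x y + word_metric G S y z"
      using N.wl_mult[of "inv x \<otimes> y" "inv y \<otimes> z"] xy z by (simp add: word_metric_def wl)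
  qed
  show ?thesis using N.cone_approx[of "word_metric G S" j] M \<rho> assms by simp
qed

end

section \<open>Non-singular Lie groups\<close>

text \<open>A point is determined by the rational half-spaces in the coordinate directions that contain it.\<close>

lemma inj_euclidean_real: "\<exists>j :: 'w::euclidean_space \<Rightarrow> real. inj j"
proof -
  define A where "A = (Basis :: 'w set) \<times> (\<rat> :: real set)"
  have cA: "countable A" unfolding A_def by (intro countable_SIGMA) (auto simp: countable_finite countable_rat)
  define h where "h x = {(b, r). (b, r) \<in> A \<and> x \<bullet> b < r}" for x
  have le: "x \<bullet> b \<le> y \<bullet> b" if h: "h x = h y" and b: "b \<in> Basis" for x y b
  proof (rule ccontr)
    assume "\<not> ?thesis"
    then obtain r where "r \<in> \<rat>" "y \<bullet> b < r" "r < x \<bullet> b" using Rats_dense_in_real[of "y \<bullet> b" "x \<bullet> b"] by auto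
    then have "(b, r) \<in> h y" "(b, r) \<notin> h x" using b by (auto simp: h_def A_def)
    then show False using h by simp
  qed
  have "inj h"
  proof (rule injI, rule euclidean_eqI)
    fix x y b assume "h x = h y" "b \<in> (Basis :: 'w set)"
    then show "x \<bullet> b = y \<bullet> b" using le[of x y b] le[of y x b] by simp
  qed
  moreover have "inj_on ((`) (to_nat_on A)) (Pow A)"
    using inj_on_to_nat_on[OF cA] by (simp add: inj_on_image_Pow)
  moreover have "h x \<in> Pow A" for x by (auto simp: h_def)
  ultimately have "inj (\<lambda>x. to_nat_on A ` h x)" by (meson inj_def inj_onD)
  moreover obtain e :: "nat set \<Rightarrow> real" where "bij e"
    using nat_sets_eqpoll_reals unfolding eqpoll_def by blast
  ultimately have "inj (\<lambda>x. e (to_nat_on A ` h x))" by (auto simp: inj_def bij_def)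
  then show ?thesis by blast
qed

text \<open>A homotopy between two constant loops contains a path between their base points.\<close>

lemma simply_connected_UNIV_path_connected:
  assumes "simply_connected (UNIV :: 'x::topological_space set)" shows "path_connected (UNIV :: 'x set)"
proof -
  have "path_component UNIV a b" for a b :: 'x
  proof -
    have "path (\<lambda>_::real. x)" for x :: 'x by (simp add: path_def)
    then have "homotopic_loops UNIV (\<lambda>_. a) (\<lambda>_. b)"
      using assms unfolding simply_connected_def by (simp add: pathfinish_def pathstart_def)
    from homotopic_loops_imp_path_component_value[OF this, of 0] show ?thesis by simp
  qed
  then show ?thesis by (simp add: path_connected_component)
qed

context chart_at_one
begin

text \<open>The chart contains a ball, and \<open>arctan\<close> squeezes the whole line into it:
  its values are below 2 in absolute value, hence the factor \<open>e / 2\<close>. This provides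
  room for the cone inside the type \<open>'a\<close>.\<close>

lemma inj_real: "\<exists>j :: real \<Rightarrow> 'a. inj j"
proof -
  obtain e where e: "0 < e" "ball p e \<subseteq> W0" using open_contains_ball[of W0] chart(2) p(1) by blast
  obtain b :: 'e where b: "b \<in> Basis" using nonempty_Basis by blast
  define h where "h t = p + (e / 2 * arctan t) *\<^sub>R b" for t
  have "\<bar>arctan t\<bar> < 2" for t using arctan_bounded[of t] pi_less_4 by linarith
  then have "h t \<in> W0" for t
    using e b by (intro subsetD[OF e(2)]) (simp add: h_def dist_norm abs_mult)
  moreover have "inj h" using b e by (intro injI) (auto simp: h_def arctan_eq_iff)
  ultimately have "inj (\<lambda>t. \<psi> (h t))" by (intro injI) (metis \<phi>_\<psi> injD)
  then show ?thesis by blast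
qed

lemma loc_compact: "\<exists>V K. open V \<and> \<one> \<in> V \<and> V \<subseteq> K \<and> compact (K :: 'a set)"
proof -
  obtain e where e: "0 < e" "cball p e \<subseteq> W0" using open_contains_cball[of W0] chart(2) p(1) by blast
  have "open (U \<inter> \<phi> -` ball p e)" using cont_\<phi> chart(1) by (intro continuous_open_preimage) auto
  moreover have "\<one> \<in> U \<inter> \<phi> -` ball p e" using U(2) e(1) by (simp add: p_def)
  moreover have "U \<inter> \<phi> -` ball p e \<subseteq> \<psi> ` cball p e"
  proof
    fix x assume "x \<in> U \<inter> \<phi> -` ball p e"
    then show "x \<in> \<psi> ` cball p e" by (intro image_eqI[of _ _ "\<phi> x"]) auto
  qed
  moreover have "compact (\<psi> ` cball p e)"
    using cont_\<psi> e(2) by (intro compact_continuous_image) (auto intro: continuous_on_subset)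
  ultimately show ?thesis by blast
qed

end

section \<open>Centre and commutator subgroup\<close>

context group
begin

lemma comm_in_derived: "x \<in> carrier G \<Longrightarrow> y \<in> carrier G \<Longrightarrow> comm G x y \<in> commutator_subgroup G"
proof -
  assume xy: "x \<in> carrier G" "y \<in> carrier G"
  then have "comm G x y = inv x \<otimes> inv y \<otimes> inv (inv x) \<otimes> inv (inv y)" by (simp add: comm_def)
  moreover have "inv x \<in> carrier G" "inv y \<in> carrier G" using xy by simp_all
  ultimately show ?thesis unfolding derived_def by (intro generate.incl) blast
qed

lemma derived_trivial:
  assumes "\<And>x y. x \<in> carrier G \<Longrightarrow> y \<in> carrier G \<Longrightarrow> comm G x y = \<one>"
  shows "commutator_subgroup G = {\<one>}"
proof -
  have "x \<otimes> y \<otimes> inv x \<otimes> inv y = \<one>" if "x \<in> carrier G" "y \<in> carrier G" for x y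
    using assms[of "inv x" "inv y"] that by (simp add: comm_def)
  then have "commutator_subgroup G \<subseteq> {\<one>}"
    unfolding derived_def by (intro generate_subgroup_incl triv_subgroup) auto
  then show ?thesis using generate.one unfolding derived_def by blast
qed

lemma commute_if_comm_one:
  assumes "x \<in> carrier G" "y \<in> carrier G" "comm G x y = \<one>" shows "x \<otimes> y = y \<otimes> x"
proof -
  have "inv (y \<otimes> x) \<otimes> (x \<otimes> y) = \<one>" using assms by (simp add: comm_def inv_mult_group m_assoc)
  then have "inv (x \<otimes> y) = inv (y \<otimes> x)" using assms by (intro inv_equality) simp_all
  then have "inv (inv (x \<otimes> y)) = inv (inv (y \<otimes> x))" by (rule arg_cong)
  then show ?thesis using assms by simp
qed

text \<open>If a central element lay outside the commutator subgroup, non-singularity would make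
  every element of that subgroup a commutator with it, hence trivial. This contradicts nilpotency
  class exactly 2.\<close>

lemma center_eq_derived:
  assumes two: "two_step_nilpotent G" and ns: "non_singular G" and g: "g \<in> carrier G"
  shows "g \<in> commutator_subgroup G \<longleftrightarrow> (\<forall>x\<in>carrier G. comm G x g = \<one>)"
proof
  assume "g \<in> commutator_subgroup G"
  then show "\<forall>x\<in>carrier G. comm G x g = \<one>" using two by (simp add: two_step_nilpotent_def)
next
  assume *: "\<forall>x\<in>carrier G. comm G x g = \<one>"
  show "g \<in> commutator_subgroup G"
  proof (rule ccontr)
    assume n: "g \<notin> commutator_subgroup G"
    have "z = \<one>" if z: "z \<in> commutator_subgroup G" for z
    proof -
      obtain y where y: "y \<in> carrier G" "comm G g y = z" using ns z g n unfolding non_singular_def by blast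
      have "comm G g y = inv (comm G y g)" using y(1) g by (simp add: comm_def inv_mult_group m_assoc)
      then show ?thesis using * y by simp
    qed
    then have "commutator_subgroup G = {\<one>}" using generate.one unfolding derived_def by blast
    then show False using two by (simp add: two_step_nilpotent_def)
  qed
qed

end

theorem theorem1p1:
  fixes N :: "('a::{t2_space,second_countable_topology}, 'm) monoid_scheme"
    and atlas :: "('a set \<times> ('a \<Rightarrow> 'e::euclidean_space)) set"
    and \<Gamma> S :: "'a set"
  assumes "lie_group N atlas"
    and "simply_connected (carrier N)"
    and "two_step_nilpotent N"
    and "non_singular N"
    and "lattice_subgroup N \<Gamma>"
    and "finite S" and "S \<subseteq> \<Gamma>" and "\<forall>s\<in>S. inv\<^bsub>N\<^esub> s \<in> S" and "generate N S = \<Gamma>"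
  shows "(\<exists>(X :: 'a set) d p. asymptotic_cone \<Gamma> (word_metric N S) \<one>\<^bsub>N\<^esub> X d p) \<and>
         (\<forall>(X :: 'c set) d p. asymptotic_cone \<Gamma> (word_metric N S) \<one>\<^bsub>N\<^esub> X d p \<longrightarrow>
            (\<exists>C>0. one_quasi_isometric C \<Gamma> (word_metric N S) X d))"
proof -
  interpret lie_group N atlas by (rule assms(1))
  have UNIV: "x \<in> carrier N" for x by (simp add: carrier_UNIV)
  let ?Z = "commutator_subgroup N"
  have path: "path_connected (UNIV :: 'a set)"
    using simply_connected_UNIV_path_connected assms(2) by (simp add: carrier_UNIV)
  have central: "g \<in> ?Z \<longleftrightarrow> (\<forall>x. comm N x g = \<one>\<^bsub>N\<^esub>)" for g
    using center_eq_derived[OF assms(3,4) UNIV] UNIV by blast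
  have comm_Z: "comm N x y \<in> ?Z" for x y by (rule comm_in_derived[OF UNIV UNIV])
  have comm_swap: "g \<otimes>\<^bsub>N\<^esub> x = x \<otimes>\<^bsub>N\<^esub> g" if "comm N x g = \<one>\<^bsub>N\<^esub>" for x g
    using commute_if_comm_one[OF UNIV UNIV that] by simp
  obtain U \<phi> where U: "(U, \<phi>) \<in> atlas" "\<one>\<^bsub>N\<^esub> \<in> U"
  proof -
    have "\<one>\<^bsub>N\<^esub> \<in> (\<Union>(U, \<phi>)\<in>atlas. U)" unfolding charts_cover by simp
    then show thesis using that by (elim UN_E) (simp only: split_paired_all case_prod_conv)
  qed
  interpret N: chart_at_one N atlas U \<phi>
  proof
    show "connected (UNIV :: 'a set)" using path by (rule path_connected_imp_connected)
    show "comm N x y \<otimes>\<^bsub>N\<^esub> z = z \<otimes>\<^bsub>N\<^esub> comm N x y" for x y z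
      using comm_Z[of x y] central comm_swap by blast
  qed (rule U)+
  interpret N: lattice_in_adjoint_group N N.\<Phi> ?Z \<Gamma> S
  proof
    show "N.\<Phi> g = 0 \<longleftrightarrow> g \<in> ?Z" for g unfolding N.\<Phi>_zero central ..
    show "\<exists>y. comm N x y = z" if "x \<notin> ?Z" "z \<in> ?Z" for x z
      using assms(4) that UNIV[of x] unfolding non_singular_def by blast
    show "\<exists>x. x \<notin> ?Z"
    proof (rule ccontr)
      assume "\<not> ?thesis"
      then have "?Z = {\<one>\<^bsub>N\<^esub>}" using central by (intro derived_trivial) blast
      then show False using assms(3) by (simp add: two_step_nilpotent_def)
    qed
  qed (fact path N.loc_compact N.\<Phi>_mult N.\<Phi>_continuous central comm_Z assms(5-7,9) bspec[OF assms(8)])+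
  \<comment> \<open>The cone is modelled on \<open>N.W \<times> N.Zs\<close>; passing through the
    reals embeds this set into the group.\<close>
  obtain j1 :: "('e ^ 'e basis_index) \<times> ('e ^ 'e basis_index) \<Rightarrow> real" where j1: "inj j1" using inj_euclidean_real by blast
  obtain j2 :: "real \<Rightarrow> 'a" where j2: "inj j2" using N.inj_real by blast
  have "inj_on (\<lambda>x. j2 (j1 x)) (N.W \<times> N.Zs)" using inj_compose[OF j2 j1] by (auto simp: comp_def intro: inj_on_subset)
  from N.cone[OF this] obtain X d q a c where
    cone: "cone_approx \<Gamma> (word_metric N S) \<one>\<^bsub>N\<^esub> (X :: 'a set) d q a c" by blast
  show ?thesis
  proof (intro conjI allI impI)
    show "\<exists>(X :: 'a set) d p. asymptotic_cone \<Gamma> (word_metric N S) \<one>\<^bsub>N\<^esub> X d p"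
      using cone_approx.cone[OF cone] by blast
    show "\<exists>C>0. one_quasi_isometric C \<Gamma> (word_metric N S) X d"
      if "asymptotic_cone \<Gamma> (word_metric N S) \<one>\<^bsub>N\<^esub> X d p" for X :: "'c set" and d p
      using that by (rule cone_approx.cone_quasi_isometric[OF cone])
  qed
qed

end
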